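(* Let $\mathbf{k}$ be a field of characteristic zero. There is no functor $\mathcal{C}: \mathrm{Top}_* \to \mathrm{CDGC}_{\mathbf{k}}$ such that for every $(X,b) \in \mathrm{Top}_*$, $\mathcal{C}(X,b)$ is $\Omega$-quasi-isomorphic to $C_*(X,b;\mathbf{k})$ as dg coassociative coalgebras, i.e. such that $\mathcal{C}(X,b)$ can be connected to $C_*(X,b;\mathbf{k})$ by a zig-zag of $\Omega$-quasi-isomorphisms of coaugmented conilpotent dg coassociative $\mathbf{k}$-coalgebras.
   Context: **Categories.** $\mathrm{Top}_*$ is the category of pointed path-connected topological spaces (assumed semi-locally simply connected and locally path-connected) and pointed continuous maps. "dg coalgebra" means counital coaugmented conilpotent differential graded coassociative $\mathbf{k}$-coalgebra; "dg algebra" means unital augmented differential graded associative $\mathbf{k}$-algebra. $\mathrm{CDGC}_{\mathbf{k}}$ is the category of (strictly, in the graded sense) cocommutative dg coalgebras. **Pointed normalized singular chains.** For $(X,b)\in\mathrm{Top}_*$, $C_*(X,b;\mathbf{k})$ is the graded $\mathbf{k}$-module obtained from the submodule of the ordinary singular chains generated by those continuous maps $\sigma:\Delta^n\to X$ that send all vertices of $\Delta^n$ to $b$, by modding out degenerate simplices. The differential $\partial$ is induced by the usual boundary operator of singular chains, and the coproduct $\Delta$ is induced by the Alexander-Whitney map, $\Delta(\sigma)=\sum_{p=0}^n \sigma|_{[0,\dots,p]}\otimes\sigma|_{[p,\dots,n]}$. Since $C_0(X,b;\mathbf{k})\cong\mathbf{k}$, there are canonical counit and coaugmentation. This makes $C_*(X,b;\mathbf{k})$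 a dg coalgebra, functorial in $(X,b)$. **Cobar construction.** For a dg coalgebra $C$ with differential $\partial$ (of degree $-1$) and coproduct $\Delta$, let $\bar C$ be the cokernel of the coaugmentation $\mathbf{k}\to C$, with induced differential $\partial$ and induced (reduced) coproduct $\bar C\to \bar C\otimes\bar C$, again denoted $\Delta$. Let $s^{-1}$ be the shift lowering degree by $1$ and $s^{+1}$ its inverse. Then $\Omega C:=(T(s^{-1}\bar C),D)$, where $T(s^{-1}\bar C)=\mathbf{k}\oplus\bigoplus_{i\ge1}(s^{-1}\bar C)^{\otimes i}$ is the unital tensor algebra and $D$ is the derivation extending the linear map $-s^{-1}\circ\partial\circ s^{+1}+(s^{-1}\otimes s^{-1})\circ\Delta\circ s^{+1}: s^{-1}\bar C\to T(s^{-1}\bar C)$ (with the Koszul sign rule). This defines a functor $\Omega$ from dg coalgebras to dg algebras. A quasi-isomorphism is a chain map inducing an isomorphism in homology. A map $g:C\to C'$ of dg coalgebras is an $\Omega$-quasi-isomorphism if $\Omega g:\Omega C\to\Omega C'$ is a quasi-isomorphism. *)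

theory Defs
  imports "HOL-Homology.Homology" "HOL-Algebra.Algebraic_Closure_Type"
begin

text \<open>
  The ground field is a type \<open>'k\<close> of class \<^class>\<open>field\<close>; vector spaces over it are
  \<^locale>\<open>module\<close>s over \<^term>\<open>ring_of_type_algebra\<close>, with arbitrary carrier and operations.
  A graded vector space is a family of such modules indexed by \<^typ>\<open>int\<close>, so that all
  elements that occur are homogeneous.  The ring components \<open>mult\<close> and \<open>one\<close>, which the
  record type of modules inherits, play no role for a module and are left undefined.
\<close>


section \<open>Linear algebra\<close>

definition lin_map :: "('k, 'v) module \<Rightarrow> ('k, 'w) module \<Rightarrow> ('v \<Rightarrow> 'w) \<Rightarrow> bool" where
  "lin_map M N f \<longleftrightarrow>
     f \<in> carrier M \<rightarrow> carrier N \<and>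
     (\<forall>x\<in>carrier M. \<forall>y\<in>carrier M. f (x \<oplus>\<^bsub>M\<^esub> y) = f x \<oplus>\<^bsub>N\<^esub> f y) \<and>
     (\<forall>c. \<forall>x\<in>carrier M. f (c \<odot>\<^bsub>M\<^esub> x) = c \<odot>\<^bsub>N\<^esub> f x)"

definition quotient_module :: "('k, 'v) module \<Rightarrow> 'v set \<Rightarrow> ('k, 'v set) module" where
  "quotient_module M N =
     \<lparr>carrier = a_rcosets\<^bsub>M\<^esub> N, monoid.mult = undefined, one = undefined,
      ring.zero = N, add = (<+>\<^bsub>M\<^esub>),
      module.smult = (\<lambda>c S. \<Union>x\<in>S. N +>\<^bsub>M\<^esub> (c \<odot>\<^bsub>M\<^esub> x))\<rparr>"

text \<open>
  The map of quotients induced by \<open>f\<close>; here \<open>N\<close> is the submodule of the target \<open>M\<close>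
  that is divided out.
\<close>
definition quotient_map :: "('k, 'w) module \<Rightarrow> 'w set \<Rightarrow> ('v \<Rightarrow> 'w) \<Rightarrow> 'v set \<Rightarrow> 'w set" where
  "quotient_map M N f S = N <+>\<^bsub>M\<^esub> f ` S"

definition free_module :: "'s set \<Rightarrow> ('k::field, 's \<Rightarrow>\<^sub>0 'k) module" where
  "free_module S =
     \<lparr>carrier = {p. Poly_Mapping.keys p \<subseteq> S}, monoid.mult = undefined, one = undefined,
      ring.zero = 0, add = (+), module.smult = (\<lambda>c. Poly_Mapping.map ((*) c))\<rparr>"

text \<open>
  The linear map with values in \<open>M\<close> that is given on basis elements by \<open>\<phi>\<close>, and the map it
  induces on a quotient of a free module: the latter is evaluated on a coset by applying the
  former to the representatives, which all have the same value.
\<close>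
definition lin_extend :: "('k::field, 'w) module \<Rightarrow> ('s \<Rightarrow> 'w) \<Rightarrow> ('s \<Rightarrow>\<^sub>0 'k) \<Rightarrow> 'w" where
  "lin_extend M \<phi> p =
     (\<Oplus>\<^bsub>M\<^esub>s\<in>Poly_Mapping.keys p. Poly_Mapping.lookup p s \<odot>\<^bsub>M\<^esub> \<phi> s)"

definition coset_extend :: "('k::field, 'w) module \<Rightarrow> ('s \<Rightarrow> 'w) \<Rightarrow> ('s \<Rightarrow>\<^sub>0 'k) set \<Rightarrow> 'w" where
  "coset_extend M \<phi> P = the_elem (lin_extend M \<phi> ` P)"

definition koszul_sign :: "int \<Rightarrow> 'k::field" where
  "koszul_sign i = (if even i then 1 else - 1)"


section \<open>Chain complexes\<close>

definition homology ::
  "(int \<Rightarrow> ('k, 'v) module) \<Rightarrow> (int \<Rightarrow> 'v \<Rightarrow> 'v) \<Rightarrow> int \<Rightarrow> ('k, 'v set) module" where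
  "homology M d n =
     quotient_module ((M n)\<lparr>carrier := {z \<in> carrier (M n). d n z = \<zero>\<^bsub>M (n - 1)\<^esub>}\<rparr>)
       (d (n + 1) ` carrier (M (n + 1)))"

definition quasi_iso ::
  "(int \<Rightarrow> ('k, 'v) module) \<Rightarrow> (int \<Rightarrow> 'v \<Rightarrow> 'v) \<Rightarrow>
   (int \<Rightarrow> ('k, 'w) module) \<Rightarrow> (int \<Rightarrow> 'w \<Rightarrow> 'w) \<Rightarrow> (int \<Rightarrow> 'v \<Rightarrow> 'w) \<Rightarrow> bool" where
  "quasi_iso M d M' d' f \<longleftrightarrow>
     (\<forall>n. lin_map (M n) (M' n) (f n)) \<and>
     (\<forall>n. \<forall>x\<in>carrier (M n). d' n (f n x) = f (n - 1) (d n x)) \<and>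
     (\<forall>n. let h = quotient_map (M' n) (d' (n + 1) ` carrier (M' (n + 1))) (f n) in
        lin_map (homology M d n) (homology M' d' n) h \<and>
        bij_betw h (carrier (homology M d n)) (carrier (homology M' d' n)))"


section \<open>Tensor algebras\<close>

definition free_algebra :: "'l set \<Rightarrow> ('l list \<Rightarrow>\<^sub>0 'k::field) ring" where
  "free_algebra L =
     \<lparr>carrier = {p. Poly_Mapping.keys p \<subseteq> lists L},
      monoid.mult = (\<lambda>p q. \<Sum>u\<in>Poly_Mapping.keys p. \<Sum>v\<in>Poly_Mapping.keys q.
        Poly_Mapping.single (u @ v) (Poly_Mapping.lookup p u * Poly_Mapping.lookup q v)),
      one = Poly_Mapping.single [] 1, ring.zero = 0, add = (+)\<rparr>"

text \<open>
  The tensor algebra of a graded vector space \<open>V\<close> is the free associative algebra on the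
  homogeneous elements \<open>(n, x)\<close>, \<open>x \<in> V\<^sub>n\<close>, modulo the linear relations among them.  It is
  equipped with the scalar multiplication coming from the empty word.  The word
  \<open>[(n\<^sub>1, x\<^sub>1), \<dots>, (n\<^sub>r, x\<^sub>r)]\<close> represents \<open>x\<^sub>1 \<otimes> \<dots> \<otimes> x\<^sub>r\<close>, so that the words of length \<open>r\<close>
  span the \<open>r\<close>-th tensor power of \<open>V\<close>.
\<close>
definition letters :: "(int \<Rightarrow> ('k, 'v) module) \<Rightarrow> (int \<times> 'v) set" where
  "letters V = (SIGMA n:UNIV. carrier (V n))"

definition tensor_relations ::
  "(int \<Rightarrow> ('k::field, 'v) module) \<Rightarrow> ((int \<times> 'v) list \<Rightarrow>\<^sub>0 'k) set" where
  "tensor_relations V =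
     {Poly_Mapping.single [(n, x \<oplus>\<^bsub>V n\<^esub> y)] 1
        - Poly_Mapping.single [(n, x)] 1 - Poly_Mapping.single [(n, y)] 1
      | n x y. x \<in> carrier (V n) \<and> y \<in> carrier (V n)} \<union>
     {Poly_Mapping.single [(n, c \<odot>\<^bsub>V n\<^esub> x)] 1 - Poly_Mapping.single [(n, x)] c
      | n c x. x \<in> carrier (V n)}"

definition tensor_ideal ::
  "(int \<Rightarrow> ('k::field, 'v) module) \<Rightarrow> ((int \<times> 'v) list \<Rightarrow>\<^sub>0 'k) set" where
  "tensor_ideal V = Idl\<^bsub>free_algebra (letters V)\<^esub> (tensor_relations V)"

definition tensor_class ::
  "(int \<Rightarrow> ('k::field, 'v) module) \<Rightarrow> ((int \<times> 'v) list \<Rightarrow>\<^sub>0 'k) \<Rightarrow>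
   ((int \<times> 'v) list \<Rightarrow>\<^sub>0 'k) set" where
  "tensor_class V p = tensor_ideal V +>\<^bsub>free_algebra (letters V)\<^esub> p"

definition tensor_algebra ::
  "(int \<Rightarrow> ('k::field, 'v) module) \<Rightarrow> ('k, ((int \<times> 'v) list \<Rightarrow>\<^sub>0 'k) set) module" where
  "tensor_algebra V =
     (let T = free_algebra (letters V) Quot tensor_ideal V in
      \<lparr>carrier = carrier T, monoid.mult = monoid.mult T, one = one T,
       ring.zero = ring.zero T, add = add T,
       module.smult = (\<lambda>c P. tensor_class V (Poly_Mapping.single [] c) \<otimes>\<^bsub>T\<^esub> P)\<rparr>)"

definition tensor_word ::
  "(int \<Rightarrow> ('k::field, 'v) module) \<Rightarrow> (int \<times> 'v) list \<Rightarrow> ((int \<times> 'v) list \<Rightarrow>\<^sub>0 'k) set" where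
  "tensor_word V w = tensor_class V (Poly_Mapping.single w 1)"

definition word_degree :: "(int \<times> 'v) list \<Rightarrow> int" where
  "word_degree w = sum_list (map fst w)"

definition tensor_degree_part ::
  "(int \<Rightarrow> ('k::field, 'v) module) \<Rightarrow> int \<Rightarrow> ('k, ((int \<times> 'v) list \<Rightarrow>\<^sub>0 'k) set) module" where
  "tensor_degree_part V n = (tensor_algebra V)\<lparr>carrier :=
     tensor_class V ` {p. Poly_Mapping.keys p \<subseteq> {w \<in> lists (letters V). word_degree w = n}}\<rparr>"

definition tensor_square ::
  "(int \<Rightarrow> ('k::field, 'v) module) \<Rightarrow> int \<Rightarrow> ('k, ((int \<times> 'v) list \<Rightarrow>\<^sub>0 'k) set) module" where
  "tensor_square V n = (tensor_algebra V)\<lparr>carrier :=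
     tensor_class V ` {p. Poly_Mapping.keys p \<subseteq>
       {w \<in> lists (letters V). length w = 2 \<and> word_degree w = n}}\<rparr>"

definition tensor_map ::
  "(int \<Rightarrow> ('k::field, 'w) module) \<Rightarrow> (int \<Rightarrow> 'v \<Rightarrow> 'w) \<Rightarrow>
   ((int \<times> 'v) list \<Rightarrow>\<^sub>0 'k) set \<Rightarrow> ((int \<times> 'w) list \<Rightarrow>\<^sub>0 'k) set" where
  "tensor_map W f =
     coset_extend (tensor_algebra W) (\<lambda>w. tensor_word W (map (\<lambda>(n, x). (n, f n x)) w))"

text \<open>
  A map on tensors of weight two, given by its values on \<open>x \<otimes> y\<close> with \<open>x\<close>, \<open>y\<close> of
  degrees \<open>i\<close>, \<open>j\<close>; it is extended by zero to the other tensor powers.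
\<close>
definition on_tensor_square ::
  "(int \<Rightarrow> ('k::field, 'w) module) \<Rightarrow>
   (int \<Rightarrow> 'v \<Rightarrow> int \<Rightarrow> 'v \<Rightarrow> ((int \<times> 'w) list \<Rightarrow>\<^sub>0 'k) set) \<Rightarrow>
   ((int \<times> 'v) list \<Rightarrow>\<^sub>0 'k) set \<Rightarrow> ((int \<times> 'w) list \<Rightarrow>\<^sub>0 'k) set" where
  "on_tensor_square W \<phi> =
     coset_extend (tensor_algebra W)
       (\<lambda>w. case w of [(i, x), (j, y)] \<Rightarrow> \<phi> i x j y | _ \<Rightarrow> \<zero>\<^bsub>tensor_algebra W\<^esub>)"


section \<open>Differential graded coalgebras\<close>

text \<open>
  The coproduct takes values in the second tensor power inside the tensor algebra; the counit is
  given in degree \<open>0\<close> (it vanishes in all other degrees); the coaugmentation is given by the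
  image of \<open>1\<close>.
\<close>
record (overloaded) ('k, 'v) dgc =
  space :: "int \<Rightarrow> ('k, 'v) module"
  bd :: "int \<Rightarrow> 'v \<Rightarrow> 'v"
  coprod :: "int \<Rightarrow> 'v \<Rightarrow> ((int \<times> 'v) list \<Rightarrow>\<^sub>0 'k) set"
  counit :: "'v \<Rightarrow> 'k"
  coaug :: 'v

definition counital_dg_coalgebra :: "('k::field, 'v) dgc \<Rightarrow> bool" where
  "counital_dg_coalgebra C \<longleftrightarrow>
     (let V = space C; T = tensor_algebra V; \<iota> = tensor_word V;
          \<Delta> = coprod C; d = bd C; \<epsilon> = counit C in
     (\<forall>n. module ring_of_type_algebra (V n)) \<and>
     (\<forall>n. lin_map (V n) (V (n - 1)) (d n)) \<and>
     (\<forall>n. \<forall>x\<in>carrier (V n). d (n - 1) (d n x) = \<zero>\<^bsub>V (n - 1 - 1)\<^esub>) \<and>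
     (\<forall>n. lin_map (V n) (tensor_square V n) (\<Delta> n)) \<and>
     (\<forall>n. \<forall>x\<in>carrier (V n).
        \<Delta> (n - 1) (d n x) =
          on_tensor_square V (\<lambda>i x j y.
            \<iota> [(i - 1, d i x), (j, y)]
            \<oplus>\<^bsub>T\<^esub> koszul_sign i \<odot>\<^bsub>T\<^esub> \<iota> [(i, x), (j - 1, d j y)]) (\<Delta> n x)) \<and>
     (\<forall>n. \<forall>x\<in>carrier (V n).
        on_tensor_square V (\<lambda>i x j y. \<Delta> i x \<otimes>\<^bsub>T\<^esub> \<iota> [(j, y)]) (\<Delta> n x) =
        on_tensor_square V (\<lambda>i x j y. \<iota> [(i, x)] \<otimes>\<^bsub>T\<^esub> \<Delta> j y) (\<Delta> n x)) \<and>
     (\<forall>x\<in>carrier (V 0). \<forall>y\<in>carrier (V 0). \<epsilon> (x \<oplus>\<^bsub>V 0\<^esub> y) = \<epsilon> x + \<epsilon> y) \<and>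
     (\<forall>c. \<forall>x\<in>carrier (V 0). \<epsilon> (c \<odot>\<^bsub>V 0\<^esub> x) = c * \<epsilon> x) \<and>
     (\<forall>x\<in>carrier (V 1). \<epsilon> (d 1 x) = 0) \<and>
     (\<forall>n. \<forall>x\<in>carrier (V n).
        on_tensor_square V (\<lambda>i x j y. (if i = 0 then \<epsilon> x else 0) \<odot>\<^bsub>T\<^esub> \<iota> [(j, y)]) (\<Delta> n x)
          = \<iota> [(n, x)] \<and>
        on_tensor_square V (\<lambda>i x j y. (if j = 0 then \<epsilon> y else 0) \<odot>\<^bsub>T\<^esub> \<iota> [(i, x)]) (\<Delta> n x)
          = \<iota> [(n, x)]))"

definition coaugmented :: "('k::field, 'v) dgc \<Rightarrow> bool" where
  "coaugmented C \<longleftrightarrow>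
     coaug C \<in> carrier (space C 0) \<and>
     bd C 0 (coaug C) = \<zero>\<^bsub>space C (- 1)\<^esub> \<and>
     counit C (coaug C) = 1 \<and>
     coprod C 0 (coaug C) = tensor_word (space C) [(0, coaug C), (0, coaug C)]"

text \<open>
  The prefix \<open>bar\<close> refers to the cokernel of the coaugmentation: its elements are cosets, on
  which the induced coproduct is evaluated through representatives.
\<close>

definition coaug_image :: "('k::field, 'v) dgc \<Rightarrow> int \<Rightarrow> 'v set" where
  "coaug_image C n =
     (if n = 0 then range (\<lambda>c. c \<odot>\<^bsub>space C 0\<^esub> coaug C) else {\<zero>\<^bsub>space C n\<^esub>})"

definition bar_space :: "('k::field, 'v) dgc \<Rightarrow> int \<Rightarrow> ('k, 'v set) module" where
  "bar_space C n = quotient_module (space C n) (coaug_image C n)"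

definition bar_proj :: "('k::field, 'v) dgc \<Rightarrow> int \<Rightarrow> 'v \<Rightarrow> 'v set" where
  "bar_proj C n x = coaug_image C n +>\<^bsub>space C n\<^esub> x"

definition bar_bd :: "('k::field, 'v) dgc \<Rightarrow> int \<Rightarrow> 'v set \<Rightarrow> 'v set" where
  "bar_bd C n = quotient_map (space C (n - 1)) (coaug_image C (n - 1)) (bd C n)"

definition bar_coprod ::
  "('k::field, 'v) dgc \<Rightarrow> int \<Rightarrow> 'v set \<Rightarrow> ((int \<times> 'v set) list \<Rightarrow>\<^sub>0 'k) set" where
  "bar_coprod C n S =
     the_elem ((\<lambda>x. tensor_map (bar_space C) (bar_proj C) (coprod C n x)) ` S)"

definition bar_map ::
  "('k::field, 'w) dgc \<Rightarrow> (int \<Rightarrow> 'v \<Rightarrow> 'w) \<Rightarrow> int \<Rightarrow> 'v set \<Rightarrow> 'w set" where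
  "bar_map C' g n = quotient_map (space C' n) (coaug_image C' n) (g n)"

text \<open>
  The \<open>N\<close>-th iterate of \<open>bar_coprod_first\<close> on a tensor of weight one is the iterated reduced
  coproduct with values in the tensor power of weight \<open>N + 1\<close>.
\<close>
definition bar_coprod_first ::
  "('k::field, 'v) dgc \<Rightarrow> ((int \<times> 'v set) list \<Rightarrow>\<^sub>0 'k) set \<Rightarrow>
   ((int \<times> 'v set) list \<Rightarrow>\<^sub>0 'k) set" where
  "bar_coprod_first C =
     coset_extend (tensor_algebra (bar_space C))
       (\<lambda>w. case w of
          [] \<Rightarrow> \<zero>\<^bsub>tensor_algebra (bar_space C)\<^esub>
        | (n, S) # u \<Rightarrow>
            bar_coprod C n S \<otimes>\<^bsub>tensor_algebra (bar_space C)\<^esub> tensor_word (bar_space C) u)"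

definition conilpotent :: "('k::field, 'v) dgc \<Rightarrow> bool" where
  "conilpotent C \<longleftrightarrow>
     (\<forall>n. \<forall>S\<in>carrier (bar_space C n). \<exists>N.
        (bar_coprod_first C ^^ N) (tensor_word (bar_space C) [(n, S)])
          = \<zero>\<^bsub>tensor_algebra (bar_space C)\<^esub>)"

definition dg_coalgebra :: "('k::field, 'v) dgc \<Rightarrow> bool" where
  "dg_coalgebra C \<longleftrightarrow> counital_dg_coalgebra C \<and> coaugmented C \<and> conilpotent C"

definition cocommutative :: "('k::field, 'v) dgc \<Rightarrow> bool" where
  "cocommutative C \<longleftrightarrow>
     (\<forall>n. \<forall>x\<in>carrier (space C n).
        on_tensor_square (space C)
          (\<lambda>i x j y. koszul_sign (i * j)
             \<odot>\<^bsub>tensor_algebra (space C)\<^esub> tensor_word (space C) [(j, y), (i, x)])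
          (coprod C n x) = coprod C n x)"

definition dgc_hom :: "('k::field, 'v) dgc \<Rightarrow> ('k, 'w) dgc \<Rightarrow> (int \<Rightarrow> 'v \<Rightarrow> 'w) \<Rightarrow> bool" where
  "dgc_hom C C' g \<longleftrightarrow>
     (\<forall>n. lin_map (space C n) (space C' n) (g n)) \<and>
     (\<forall>n. \<forall>x\<in>carrier (space C n). bd C' n (g n x) = g (n - 1) (bd C n x)) \<and>
     (\<forall>n. \<forall>x\<in>carrier (space C n).
        coprod C' n (g n x) = tensor_map (space C') g (coprod C n x)) \<and>
     (\<forall>x\<in>carrier (space C 0). counit C' (g 0 x) = counit C x) \<and>
     g 0 (coaug C) = coaug C'"


section \<open>The cobar construction\<close>

definition cobar_gens :: "('k::field, 'v) dgc \<Rightarrow> int \<Rightarrow> ('k, 'v set) module" where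
  "cobar_gens C n = bar_space C (n + 1)"

definition cobar_algebra ::
  "('k::field, 'v) dgc \<Rightarrow> ('k, ((int \<times> 'v set) list \<Rightarrow>\<^sub>0 'k) set) module" where
  "cobar_algebra C = tensor_algebra (cobar_gens C)"

text \<open>
  The differential on the generator \<open>s\<inverse>S\<close> of degree \<open>n\<close>, that is, \<open>S\<close> has degree \<open>n + 1\<close>.
  The sign in the quadratic part comes from moving \<open>s\<inverse>\<close> past the first tensor factor.
\<close>
definition cobar_bd_gen ::
  "('k::field, 'v) dgc \<Rightarrow> int \<Rightarrow> 'v set \<Rightarrow> ((int \<times> 'v set) list \<Rightarrow>\<^sub>0 'k) set" where
  "cobar_bd_gen C n S =
     (\<ominus>\<^bsub>cobar_algebra C\<^esub> tensor_word (cobar_gens C) [(n - 1, bar_bd C (n + 1) S)])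
     \<oplus>\<^bsub>cobar_algebra C\<^esub>
     on_tensor_square (cobar_gens C)
       (\<lambda>i x j y. koszul_sign i \<odot>\<^bsub>cobar_algebra C\<^esub>
          tensor_word (cobar_gens C) [(i - 1, x), (j - 1, y)])
       (bar_coprod C (n + 1) S)"

primrec cobar_bd_word ::
  "('k::field, 'v) dgc \<Rightarrow> (int \<times> 'v set) list \<Rightarrow> ((int \<times> 'v set) list \<Rightarrow>\<^sub>0 'k) set" where
  "cobar_bd_word C [] = \<zero>\<^bsub>cobar_algebra C\<^esub>"
| "cobar_bd_word C (l # w) =
     cobar_bd_gen C (fst l) (snd l) \<otimes>\<^bsub>cobar_algebra C\<^esub> tensor_word (cobar_gens C) w
     \<oplus>\<^bsub>cobar_algebra C\<^esub>
     koszul_sign (fst l) \<odot>\<^bsub>cobar_algebra C\<^esub>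
       (tensor_word (cobar_gens C) [l] \<otimes>\<^bsub>cobar_algebra C\<^esub> cobar_bd_word C w)"

definition cobar_space ::
  "('k::field, 'v) dgc \<Rightarrow> int \<Rightarrow> ('k, ((int \<times> 'v set) list \<Rightarrow>\<^sub>0 'k) set) module" where
  "cobar_space C = tensor_degree_part (cobar_gens C)"

definition cobar_bd ::
  "('k::field, 'v) dgc \<Rightarrow> int \<Rightarrow> ((int \<times> 'v set) list \<Rightarrow>\<^sub>0 'k) set \<Rightarrow>
   ((int \<times> 'v set) list \<Rightarrow>\<^sub>0 'k) set" where
  "cobar_bd C n = coset_extend (cobar_algebra C) (cobar_bd_word C)"

definition cobar_map ::
  "('k::field, 'w) dgc \<Rightarrow> (int \<Rightarrow> 'v \<Rightarrow> 'w) \<Rightarrow> int \<Rightarrow>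
   ((int \<times> 'v set) list \<Rightarrow>\<^sub>0 'k) set \<Rightarrow> ((int \<times> 'w set) list \<Rightarrow>\<^sub>0 'k) set" where
  "cobar_map C' g n = tensor_map (cobar_gens C') (\<lambda>m. bar_map C' g (m + 1))"

definition omega_quasi_iso ::
  "('k::field, 'v) dgc \<Rightarrow> ('k, 'w) dgc \<Rightarrow> (int \<Rightarrow> 'v \<Rightarrow> 'w) \<Rightarrow> bool" where
  "omega_quasi_iso C C' g \<longleftrightarrow>
     dg_coalgebra C \<and> dg_coalgebra C' \<and> dgc_hom C C' g \<and>
     quasi_iso (cobar_space C) (cobar_bd C) (cobar_space C') (cobar_bd C') (cobar_map C' g)"

definition omega_leg :: "('k::field, 'v) dgc \<Rightarrow> ('k, 'w) dgc \<Rightarrow> bool" where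
  "omega_leg C C' \<longleftrightarrow> (\<exists>g. omega_quasi_iso C C' g) \<or> (\<exists>g. omega_quasi_iso C' C g)"

text \<open>
  A zig-zag from \<open>A\<close> to \<open>B\<close> through the coalgebras in the list \<open>Ds\<close>.  A single
  \<open>\<Omega>\<close>-quasi-isomorphism between \<open>A\<close> and \<open>B\<close> is covered by repeating \<open>A\<close> (or a copy of it).
\<close>
definition omega_zigzag ::
  "('k::field, 'u) dgc \<Rightarrow> ('k, 'v) dgc list \<Rightarrow> ('k, 'w) dgc \<Rightarrow> bool" where
  "omega_zigzag A Ds B \<longleftrightarrow>
     Ds \<noteq> [] \<and> omega_leg A (hd Ds) \<and> successively omega_leg Ds \<and> omega_leg (last Ds) B"


section \<open>Pointed normalized singular chains\<close>

definition based_simplices :: "'a topology \<Rightarrow> 'a \<Rightarrow> int \<Rightarrow> ((nat \<Rightarrow> real) \<Rightarrow> 'a) set" where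
  "based_simplices S b n =
     {\<sigma>. 0 \<le> n \<and> singular_simplex (nat n) S \<sigma> \<and>
         (\<forall>i\<le>nat n. \<sigma> (\<lambda>j. if j = i then 1 else 0) = b)}"

text \<open>The \<open>i\<close>-th degeneracy map of standard simplices, which identifies the vertices \<open>i\<close> and \<open>i + 1\<close>.\<close>
definition simplex_collapse :: "nat \<Rightarrow> (nat \<Rightarrow> real) \<Rightarrow> nat \<Rightarrow> real" where
  "simplex_collapse i x = (\<lambda>j. if j < i then x j else if j = i then x i + x (Suc i) else x (Suc j))"

definition degenerate_simplices :: "'a topology \<Rightarrow> 'a \<Rightarrow> int \<Rightarrow> ((nat \<Rightarrow> real) \<Rightarrow> 'a) set" where
  "degenerate_simplices S b n =
     {\<sigma> \<in> based_simplices S b n. \<exists>i<nat n. \<exists>\<tau>. singular_simplex (nat n - 1) S \<tau> \<and>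
        \<sigma> = restrict (\<tau> \<circ> simplex_collapse i) (standard_simplex (nat n))}"

definition degenerate_chains ::
  "'a topology \<Rightarrow> 'a \<Rightarrow> int \<Rightarrow> (((nat \<Rightarrow> real) \<Rightarrow> 'a) \<Rightarrow>\<^sub>0 'k::field) set" where
  "degenerate_chains S b n = carrier (free_module (degenerate_simplices S b n))"

definition chain_space ::
  "'a topology \<Rightarrow> 'a \<Rightarrow> int \<Rightarrow> ('k::field, (((nat \<Rightarrow> real) \<Rightarrow> 'a) \<Rightarrow>\<^sub>0 'k) set) module" where
  "chain_space S b n =
     quotient_module (free_module (based_simplices S b n)) (degenerate_chains S b n)"

definition simplex_class ::
  "'a topology \<Rightarrow> 'a \<Rightarrow> int \<Rightarrow> ((nat \<Rightarrow> real) \<Rightarrow> 'a) \<Rightarrow>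
   (((nat \<Rightarrow> real) \<Rightarrow> 'a) \<Rightarrow>\<^sub>0 'k::field) set" where
  "simplex_class S b n \<sigma> =
     degenerate_chains S b n +>\<^bsub>free_module (based_simplices S b n)\<^esub> Poly_Mapping.single \<sigma> 1"

definition chain_bd ::
  "'a topology \<Rightarrow> 'a \<Rightarrow> int \<Rightarrow> (((nat \<Rightarrow> real) \<Rightarrow> 'a) \<Rightarrow>\<^sub>0 'k::field) set \<Rightarrow>
   (((nat \<Rightarrow> real) \<Rightarrow> 'a) \<Rightarrow>\<^sub>0 'k) set" where
  "chain_bd S b n =
     coset_extend (chain_space S b (n - 1))
       (\<lambda>\<sigma>. if n \<le> 0 then \<zero>\<^bsub>chain_space S b (n - 1)\<^esub> else
          (\<Oplus>\<^bsub>chain_space S b (n - 1)\<^esub>k\<in>{..nat n}.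
             koszul_sign (int k) \<odot>\<^bsub>chain_space S b (n - 1)\<^esub>
               simplex_class S b (n - 1) (singular_face (nat n) k \<sigma>)))"

text \<open>
  The front face \<open>[0, \<dots>, p]\<close> is a plain restriction, as \<^term>\<open>standard_simplex p\<close> is contained in
  \<^term>\<open>standard_simplex n\<close> for \<open>p \<le> n\<close>.
\<close>
definition front_face :: "nat \<Rightarrow> ((nat \<Rightarrow> real) \<Rightarrow> 'a) \<Rightarrow> (nat \<Rightarrow> real) \<Rightarrow> 'a" where
  "front_face p \<sigma> = restrict \<sigma> (standard_simplex p)"

definition back_face :: "nat \<Rightarrow> nat \<Rightarrow> ((nat \<Rightarrow> real) \<Rightarrow> 'a) \<Rightarrow> (nat \<Rightarrow> real) \<Rightarrow> 'a" where
  "back_face n p \<sigma> =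
     restrict (\<lambda>x. \<sigma> (\<lambda>j. if j < p then 0 else x (j - p))) (standard_simplex (n - p))"

definition chain_coprod ::
  "'a topology \<Rightarrow> 'a \<Rightarrow> int \<Rightarrow> (((nat \<Rightarrow> real) \<Rightarrow> 'a) \<Rightarrow>\<^sub>0 'k::field) set \<Rightarrow>
   ((int \<times> (((nat \<Rightarrow> real) \<Rightarrow> 'a) \<Rightarrow>\<^sub>0 'k) set) list \<Rightarrow>\<^sub>0 'k) set" where
  "chain_coprod S b n =
     coset_extend (tensor_algebra (chain_space S b))
       (\<lambda>\<sigma>. \<Oplus>\<^bsub>tensor_algebra (chain_space S b)\<^esub>p\<in>{..nat n}.
          tensor_word (chain_space S b)
            [(int p, simplex_class S b (int p) (front_face p \<sigma>)),
             (n - int p, simplex_class S b (n - int p) (back_face (nat n) p \<sigma>))])"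

definition base_simplex :: "'a \<Rightarrow> (nat \<Rightarrow> real) \<Rightarrow> 'a" where
  "base_simplex b = restrict (\<lambda>_. b) (standard_simplex 0)"

definition singular_chains ::
  "'a topology \<Rightarrow> 'a \<Rightarrow> ('k::field, (((nat \<Rightarrow> real) \<Rightarrow> 'a) \<Rightarrow>\<^sub>0 'k) set) dgc" where
  "singular_chains S b =
     \<lparr>space = chain_space S b, bd = chain_bd S b, coprod = chain_coprod S b,
      counit = (\<lambda>P. the_elem ((\<lambda>p. Poly_Mapping.lookup p (base_simplex b)) ` P)),
      coaug = simplex_class S b 0 (base_simplex b)\<rparr>"


section \<open>Pointed spaces and functors to cocommutative coalgebras\<close>

definition semilocally_simply_connected_space :: "'a topology \<Rightarrow> bool" where
  "semilocally_simply_connected_space S \<longleftrightarrow>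
     (\<forall>x\<in>topspace S. \<exists>U. openin S U \<and> x \<in> U \<and>
        (\<forall>g. pathin (subtopology S U) g \<and> g 0 = x \<and> g 1 = x \<longrightarrow>
           homotopic_with (\<lambda>h. h 0 = x \<and> h 1 = x)
             (subtopology euclideanreal {0..1}) S g (\<lambda>_. x)))"

definition top_obj :: "'a topology \<Rightarrow> 'a \<Rightarrow> bool" where
  "top_obj S b \<longleftrightarrow>
     b \<in> topspace S \<and> path_connected_space S \<and>
     locally_path_connected_space S \<and> semilocally_simply_connected_space S"

text \<open>Morphisms are required to be extensional, so that a map of spaces is a single HOL function.\<close>
definition top_hom :: "'a topology \<Rightarrow> 'a \<Rightarrow> 'a topology \<Rightarrow> 'a \<Rightarrow> ('a \<Rightarrow> 'a) \<Rightarrow> bool" where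
  "top_hom S b S' c f \<longleftrightarrow> continuous_map S S' f \<and> f \<in> extensional (topspace S) \<and> f b = c"

text \<open>
  The types \<open>'a\<close> and \<open>'v\<close> serve as universes: they contain the points of the spaces and the
  elements of the coalgebras.  Values of a functor matter only on objects, morphisms and
  carriers.
\<close>
definition top_cdgc_functor ::
  "('a topology \<Rightarrow> 'a \<Rightarrow> ('k::field, 'v) dgc) \<Rightarrow>
   ('a topology \<Rightarrow> 'a \<Rightarrow> 'a topology \<Rightarrow> 'a \<Rightarrow> ('a \<Rightarrow> 'a) \<Rightarrow> int \<Rightarrow> 'v \<Rightarrow> 'v) \<Rightarrow> bool" where
  "top_cdgc_functor F Fm \<longleftrightarrow>
     (\<forall>S b. top_obj S b \<longrightarrow> dg_coalgebra (F S b) \<and> cocommutative (F S b)) \<and>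
     (\<forall>S b S' c f. top_obj S b \<and> top_obj S' c \<and> top_hom S b S' c f \<longrightarrow>
        dgc_hom (F S b) (F S' c) (Fm S b S' c f)) \<and>
     (\<forall>S b n. \<forall>x\<in>carrier (space (F S b) n). top_obj S b \<longrightarrow>
        Fm S b S b (restrict id (topspace S)) n x = x) \<and>
     (\<forall>S b S' c S'' d f g n. \<forall>x\<in>carrier (space (F S b) n).
        top_obj S b \<and> top_obj S' c \<and> top_obj S'' d \<and> top_hom S b S' c f \<and> top_hom S' c S'' d g \<longrightarrow>
        Fm S b S'' d (compose (topspace S) g f) n x = Fm S' c S'' d g n (Fm S b S' c f n x))"

end

theory Submission
  imports "HOL-Analysis.Further_Topology" Defs
begin

text \<open>
  It suffices to look at one space, the circle. Say that a coalgebra has property \<open>P\<close> if the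
  homology algebra of its cobar construction contains a right invertible class of degree \<open>0\<close> on which
  two characters differ. An \<open>\<Omega>\<close>-quasi-isomorphism preserves \<open>P\<close>. The chains of the circle satisfy
  it, since a character of the fundamental group defines a character of the homology: the generator
  is a unit, and the trivial character and the sign \<open>(-1)\<^sup>n\<close> of the winding number differ on it.

  A cocommutative coalgebra does not satisfy \<open>P\<close> in characteristic \<open>0\<close>. There the shuffle coproduct,
  for which the generators are primitive, makes the cobar construction a dg Hopf algebra, and by the
  Kuenneth formula its homology is one as well, so the characters of the homology can be convolved.
  The shuffle coproduct is conilpotent, hence the value of the \<open>n\<close>-th convolution power
  \<open>\<phi>\<^sup>n\<close> of a character on a fixed element is a polynomial in \<open>n\<close>. If \<open>u\<close> is right invertible with inverse
  \<open>v\<close>, then \<open>\<phi>\<^sup>n(u) \<phi>\<^sup>n(v) = 1\<close> for all \<open>n\<close>, so both polynomials are constant and \<open>\<phi>(u) = \<phi>\<^sup>0(u)\<close> is the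
  augmentation of \<open>u\<close>, whatever \<open>\<phi>\<close> is.
\<close>


section \<open>Linear extension and free algebras\<close>

text \<open>Tensor algebras are given as quotients whose elements are cosets, on which recursion
  over words is not directly available. Over a field the linear relations have a complement, so each
  coset gets a normal form that is linear and multiplicative; all computations then take place among
  polynomials in words.

  Cocommutativity enters at a single point: it makes the quadratic part of the cobar differential a
  combination of graded commutators of generators, hence primitive, so that the differential is
  compatible with the shuffle coproduct.

  Characters of the homology are multiplicative on cycles only. The shuffle coproduct of a cycle is
  a cycle of the tensor square, but in general not a sum of tensors of cycles; this is the gap that
  the Kuenneth argument closes.

  The invariant compares two characters with each other, so that it speaks of the homology algebra
  alone. On the circle the sign of the winding number is chosen because it needs continuous square
  roots only and differs from 1 in characteristic zero.\<close>

text \<open>With this instance, \<^typ>\<open>'l list \<Rightarrow>\<^sub>0 'k\<close> is the free algebra on \<^typ>\<open>'l\<close> as a \<^class>\<open>ring_1\<close>.\<close>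

instantiation list :: (type) monoid_add
begin

definition zero_list :: "'a list" where "zero_list = []"
definition plus_list :: "'a list \<Rightarrow> 'a list \<Rightarrow> 'a list" where "plus_list xs ys = xs @ ys"

instance by standard (simp_all add: zero_list_def plus_list_def)

end

definition scl :: "'k::field \<Rightarrow> ('a \<Rightarrow>\<^sub>0 'k) \<Rightarrow> ('a \<Rightarrow>\<^sub>0 'k)" where
  "scl c = Poly_Mapping.map ((*) c)"

abbreviation single1 :: "'a \<Rightarrow> ('a \<Rightarrow>\<^sub>0 'k::field)" where
  "single1 w \<equiv> Poly_Mapping.single w 1"

abbreviation coeff_of :: "('a \<Rightarrow>\<^sub>0 'k::field) \<Rightarrow> 'a \<Rightarrow> 'k" where
  "coeff_of \<equiv> Poly_Mapping.lookup"

abbreviation supp :: "('a \<Rightarrow>\<^sub>0 'k::field) \<Rightarrow> 'a set" where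
  "supp \<equiv> Poly_Mapping.keys"

lemma lookup_scl [simp]: "coeff_of (scl c p) x = c * coeff_of p x"
  by (simp add: scl_def Poly_Mapping.map.rep_eq when_def)

lemma scl_single [simp]: "scl c (Poly_Mapping.single w d) = Poly_Mapping.single w (c * d)"
  by (rule poly_mapping_eqI) (simp add: lookup_single when_def)

global_interpretation poly: vector_space "scl :: 'k::field \<Rightarrow> ('a \<Rightarrow>\<^sub>0 'k) \<Rightarrow> _"
  by unfold_locales (auto intro!: poly_mapping_eqI simp: lookup_add algebra_simps)

lemma supp_scl: "supp (scl c p) \<subseteq> supp p"
  by (auto simp: in_keys_iff)

lemma poly_expand: "p = (\<Sum>w\<in>supp p. scl (coeff_of p w) (single1 w))"
proof (rule poly_mapping_eqI)
  fix x
  have "coeff_of (\<Sum>w\<in>supp p. scl (coeff_of p w) (single1 w)) x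
      = (\<Sum>w\<in>supp p. if w = x then coeff_of p x else 0)"
    unfolding lookup_sum by (rule sum.cong) (auto simp: lookup_single when_def)
  also have "\<dots> = coeff_of p x"
    by (auto simp: in_keys_iff)
  finally show "coeff_of p x = coeff_of (\<Sum>w\<in>supp p. scl (coeff_of p w) (single1 w)) x" ..
qed

lemma poly_induct_on [consumes 1, case_names zero single add scl]:
  assumes "supp p \<subseteq> S" "P 0" "\<And>w. w \<in> S \<Longrightarrow> P (single1 w)"
    "\<And>p q. supp p \<subseteq> S \<Longrightarrow> supp q \<subseteq> S \<Longrightarrow> P p \<Longrightarrow> P q \<Longrightarrow> P (p + q)"
    "\<And>c p. supp p \<subseteq> S \<Longrightarrow> P p \<Longrightarrow> P (scl c p)"
  shows "P p"
proof -
  have "supp (\<Sum>w\<in>F. scl (coeff_of p w) (single1 w)) \<subseteq> S \<and> P (\<Sum>w\<in>F. scl (coeff_of p w) (single1 w))"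
    if "finite F" "F \<subseteq> supp p" for F
    using that
  proof (induction F)
    case (insert w F)
    have *: "supp (scl (coeff_of p w) (single1 w)) \<subseteq> S" "supp (single1 w :: _ \<Rightarrow>\<^sub>0 'b) \<subseteq> S" "P (single1 w)"
      using insert.prems assms(1) assms(3)[of w] supp_scl[of "coeff_of p w" "single1 w"] by auto
    have "P (scl (coeff_of p w) (single1 w))"
      using assms(5)[OF *(2,3)] .
    then have "P (scl (coeff_of p w) (single1 w) + (\<Sum>w\<in>F. scl (coeff_of p w) (single1 w)))"
      using insert * by (intro assms(4)) auto
    moreover have "supp (scl (coeff_of p w) (single1 w) + (\<Sum>w\<in>F. scl (coeff_of p w) (single1 w))) \<subseteq> S"
      using insert * by (intro order.trans[OF Poly_Mapping.keys_add] Un_least) auto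
    ultimately show ?case using insert.hyps by simp
  qed (use assms(2) in auto)
  from this[of "supp p"] show ?thesis using poly_expand[of p] by simp
qed

lemma poly_induct [case_names zero single add scl]:
  assumes "P 0" "\<And>w. P (single1 w)" "\<And>p q. P p \<Longrightarrow> P q \<Longrightarrow> P (p + q)" "\<And>c p. P p \<Longrightarrow> P (scl c p)"
  shows "P p"
  by (rule poly_induct_on[of p UNIV]) (use assms in auto)

text \<open>A light form of \<open>Vector_Spaces.linear\<close> for maps out of free spaces: the
  target is described by its scaling alone, so the same facts serve words, pairs of words and the
  field.\<close>

definition k_linear :: "('k::field \<Rightarrow> 'b::ab_group_add \<Rightarrow> 'b) \<Rightarrow> (('a \<Rightarrow>\<^sub>0 'k) \<Rightarrow> 'b) \<Rightarrow> bool" where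
  "k_linear s f \<longleftrightarrow> (\<forall>p q. f (p + q) = f p + f q) \<and> (\<forall>c p. f (scl c p) = s c (f p))"

lemma k_linearI:
  "(\<And>p q. f (p + q) = f p + f q) \<Longrightarrow> (\<And>c p. f (scl c p) = s c (f p)) \<Longrightarrow> k_linear s f"
  by (simp add: k_linear_def)

lemma
  assumes "k_linear s f"
  shows k_linear_add: "f (p + q) = f p + f q"
    and k_linear_scl: "f (scl c p) = s c (f p)"
    and k_linear_zero: "f 0 = 0"
    and k_linear_uminus: "f (- p) = - f p"
    and k_linear_diff: "f (p - q) = f p - f q"
    and k_linear_sum: "f (\<Sum>i\<in>I. g i) = (\<Sum>i\<in>I. f (g i))"
proof -
  show 1: "f (p + q) = f p + f q" "f (scl c p) = s c (f p)" for p q c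
    using assms by (simp_all add: k_linear_def)
  show 2: "f 0 = 0" using 1(1)[of 0 0] by simp
  show 3: "f (- p) = - f p" for p
    using 1(1)[of p "- p"] 2 by (simp add: minus_unique)
  show "f (p - q) = f p - f q" using 1(1)[of p "- q"] 3 by simp
  show "f (\<Sum>i\<in>I. g i) = (\<Sum>i\<in>I. f (g i))"
    by (induction I rule: infinite_finite_induct) (simp_all add: 1 2)
qed

lemma k_linear_eq_on:
  assumes "k_linear s f" "k_linear s g" "supp p \<subseteq> S" "\<And>w. w \<in> S \<Longrightarrow> f (single1 w) = g (single1 w)"
  shows "f p = g p"
  using assms(3)
  by (induction rule: poly_induct_on)
    (simp_all add: assms(4) k_linear_add[OF assms(1)] k_linear_add[OF assms(2)] k_linear_zero[OF assms(1)]
      k_linear_zero[OF assms(2)] k_linear_scl[OF assms(1)] k_linear_scl[OF assms(2)])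

definition lin_ext :: "('k::field \<Rightarrow> 'b::ab_group_add \<Rightarrow> 'b) \<Rightarrow> ('a \<Rightarrow> 'b) \<Rightarrow> ('a \<Rightarrow>\<^sub>0 'k) \<Rightarrow> 'b" where
  "lin_ext s \<phi> p = (\<Sum>w\<in>supp p. s (coeff_of p w) (\<phi> w))"

context vector_space
begin

lemma lin_ext_superset:
  "finite F \<Longrightarrow> supp p \<subseteq> F \<Longrightarrow> lin_ext scale \<phi> p = (\<Sum>w\<in>F. scale (coeff_of p w) (\<phi> w))"
  unfolding lin_ext_def by (rule sum.mono_neutral_left) (auto simp: in_keys_iff)

lemma lin_ext_k_linear: "k_linear scale (lin_ext scale \<phi>)"
proof (rule k_linearI)
  fix p q :: "'c \<Rightarrow>\<^sub>0 'a"
  let ?F = "supp p \<union> supp q"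
  have "lin_ext scale \<phi> r = (\<Sum>w\<in>?F. scale (coeff_of r w) (\<phi> w))" if "supp r \<subseteq> ?F" for r
    using that by (intro lin_ext_superset) auto
  from this[of p] this[of q] this[of "p + q"]
  show "lin_ext scale \<phi> (p + q) = lin_ext scale \<phi> p + lin_ext scale \<phi> q"
    using Poly_Mapping.keys_add[of p q] by (simp add: lookup_add scale_left_distrib sum.distrib)
next
  fix c and p :: "'c \<Rightarrow>\<^sub>0 'a"
  show "lin_ext scale \<phi> (scl c p) = scale c (lin_ext scale \<phi> p)"
    using lin_ext_superset[of "supp p" "scl c p" \<phi>] supp_scl[of c p]
    by (simp add: lin_ext_def scale_sum_right)
qed

lemmas lin_ext_add = k_linear_add[OF lin_ext_k_linear]
  and lin_ext_scl = k_linear_scl[OF lin_ext_k_linear]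
  and lin_ext_zero = k_linear_zero[OF lin_ext_k_linear]
  and lin_ext_uminus = k_linear_uminus[OF lin_ext_k_linear]
  and lin_ext_diff = k_linear_diff[OF lin_ext_k_linear]
  and lin_ext_sum = k_linear_sum[OF lin_ext_k_linear]

lemma lin_ext_single: "lin_ext scale \<phi> (Poly_Mapping.single w c) = scale c (\<phi> w)"
  by (cases "c = 0") (auto simp: lin_ext_def)

lemma lin_ext_cong_on: "(\<And>w. w \<in> supp p \<Longrightarrow> \<phi> w = \<psi> w) \<Longrightarrow> lin_ext scale \<phi> p = lin_ext scale \<psi> p"
  by (simp add: lin_ext_def)

lemma k_linear_lin_ext:
  assumes "k_linear scale f"
  shows "f p = lin_ext scale (\<lambda>w. f (single1 w)) p"
  by (rule k_linear_eq_on[OF assms lin_ext_k_linear, of p UNIV]) (auto simp: lin_ext_single)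

lemma lin_ext_comp:
  assumes "k_linear scale f"
  shows "f (lin_ext scl \<phi> p) = lin_ext scale (\<lambda>w. f (\<phi> w)) p"
  unfolding lin_ext_def by (simp add: k_linear_sum[OF assms] k_linear_scl[OF assms])

lemma k_linear_fun_comp:
  "k_linear scale f \<Longrightarrow> k_linear scl g \<Longrightarrow> k_linear scale (\<lambda>x. f (g x))"
  unfolding k_linear_def by simp

lemma k_linear_fun_scale:
  "k_linear scale f \<Longrightarrow> k_linear scale (\<lambda>x. scale c (f x))"
  unfolding k_linear_def by (simp add: scale_right_distrib scale_left_commute)

end

lemma lin_ext_single1_id: "lin_ext scl single1 p = p"
  using poly.k_linear_lin_ext[of "\<lambda>x. x" p] by (simp add: k_linear_def)

lemma supp_lin_ext: "supp (lin_ext scl \<phi> p) \<subseteq> (\<Union>w\<in>supp p. supp (\<phi> w))"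
proof -
  have "supp (lin_ext scl \<phi> p) \<subseteq> (\<Union>w\<in>supp p. supp (scl (coeff_of p w) (\<phi> w)))"
    unfolding lin_ext_def by (rule Poly_Mapping.keys_sum)
  then show ?thesis using supp_scl by fastforce
qed

text \<open>Unital associative algebras over the field, possibly noncommutative. The interpretations
  below are the free algebra and the field itself, the two kinds of targets of algebra maps in this
  proof.\<close>

locale scalar_algebra = vector_space s for s :: "'k::field \<Rightarrow> 'b::ring_1 \<Rightarrow> 'b" +
  assumes scale_mult_left: "s c x * y = s c (x * y)"
    and scale_mult_right: "x * s c y = s c (x * y)"

lemma scl_eq_mult: "scl c (p :: 'l list \<Rightarrow>\<^sub>0 'k::field) = Poly_Mapping.single [] c * p"
  using mult_map_scale_conv_mult[of c p] by (simp add: zero_list_def scl_def)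

lemma single1_mult: "single1 u * single1 v = (single1 (u @ v) :: 'l list \<Rightarrow>\<^sub>0 'k::field)"
  by (simp add: mult_single plus_list_def)

lemma single1_Nil: "single1 [] = (1 :: 'l list \<Rightarrow>\<^sub>0 'k::field)"
  by (metis single_one zero_list_def)

lemma single1_Cons: "single1 (l # w) = single1 [l] * (single1 w :: 'l list \<Rightarrow>\<^sub>0 'k::field)"
  by (simp add: single1_mult)

text \<open>Scalars sit in the free algebra as multiples of the empty word. The multiplication is
  not commutative, so that they may be moved past a factor has to be proved.\<close>

lemma single_Nil_central: "p * Poly_Mapping.single [] c = Poly_Mapping.single [] c * (p :: 'l list \<Rightarrow>\<^sub>0 'k::field)"
proof (induction p rule: poly_induct)
  case (scl d p)
  have "Poly_Mapping.single [] d * Poly_Mapping.single [] c =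
      Poly_Mapping.single [] c * (Poly_Mapping.single [] d :: 'l list \<Rightarrow>\<^sub>0 'k)"
    by (simp add: mult_single mult.commute)
  then show ?case
    unfolding scl_eq_mult mult.assoc[of _ p] scl by (simp only: mult.assoc[symmetric])
qed (simp_all add: distrib_left distrib_right mult_single plus_list_def)

global_interpretation poly: scalar_algebra "scl :: 'k::field \<Rightarrow> ('l list \<Rightarrow>\<^sub>0 'k) \<Rightarrow> _"
proof unfold_locales
  fix c and x y :: "'l list \<Rightarrow>\<^sub>0 'k"
  show "scl c x * y = scl c (x * y)" by (simp add: scl_eq_mult mult.assoc)
  show "x * scl c y = scl c (x * y)"
    unfolding scl_eq_mult by (metis mult.assoc single_Nil_central)
qed

global_interpretation field_scale: scalar_algebra "(*) :: 'k::field \<Rightarrow> 'k \<Rightarrow> 'k"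
  by unfold_locales (auto simp: algebra_simps)

definition alg_ext :: "('k::field \<Rightarrow> 'b::ring_1 \<Rightarrow> 'b) \<Rightarrow> ('l \<Rightarrow> 'b) \<Rightarrow> ('l list \<Rightarrow>\<^sub>0 'k) \<Rightarrow> 'b" where
  "alg_ext s a = lin_ext s (\<lambda>w. prod_list (map a w))"

context scalar_algebra
begin

lemma alg_ext_k_linear: "k_linear s (alg_ext s a)"
  unfolding alg_ext_def by (rule lin_ext_k_linear)

lemmas alg_ext_add = k_linear_add[OF alg_ext_k_linear]
  and alg_ext_scl = k_linear_scl[OF alg_ext_k_linear]
  and alg_ext_zero = k_linear_zero[OF alg_ext_k_linear]
  and alg_ext_uminus = k_linear_uminus[OF alg_ext_k_linear]
  and alg_ext_diff = k_linear_diff[OF alg_ext_k_linear]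
  and alg_ext_sum = k_linear_sum[OF alg_ext_k_linear]

lemma alg_ext_single: "alg_ext s a (Poly_Mapping.single w c) = s c (prod_list (map a w))"
  by (simp add: alg_ext_def lin_ext_single)

lemma alg_ext_one: "alg_ext s a 1 = 1"
  by (simp add: alg_ext_single flip: single1_Nil)

lemma alg_ext_mult: "alg_ext s a (p * q) = alg_ext s a p * alg_ext s a q"
proof (induction p rule: poly_induct)
  case (single w)
  show ?case
  proof (induction q rule: poly_induct)
    case (scl c q) then show ?case
      by (simp add: poly.scale_mult_right alg_ext_scl scale_mult_right)
  qed (simp_all add: alg_ext_zero alg_ext_add ring_distribs single1_mult alg_ext_single)
qed (simp_all add: alg_ext_zero alg_ext_add ring_distribs poly.scale_mult_left alg_ext_scl scale_mult_left)

text \<open>Both sides are algebra maps with the same values on letters. Applied to a map with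
  itself this gives the idempotence of normal forms.\<close>

lemma alg_ext_comp: "alg_ext s a (alg_ext scl b p) = alg_ext s (\<lambda>l. alg_ext s a (b l)) p"
proof -
  have "k_linear s (\<lambda>p. alg_ext s a (alg_ext scl b p))"
    by (rule k_linear_fun_comp[OF alg_ext_k_linear poly.alg_ext_k_linear])
  moreover have "alg_ext s a (alg_ext scl b (single1 w)) = alg_ext s (\<lambda>l. alg_ext s a (b l)) (single1 w)" for w
    by (induction w) (simp_all add: alg_ext_single poly.alg_ext_single alg_ext_one alg_ext_mult)
  ultimately show ?thesis
    by (rule k_linear_eq_on[where S = UNIV, OF _ alg_ext_k_linear subset_UNIV])
qed

end


section \<open>Graded derivations of free algebras\<close>

lemma koszul_sign_simps [simp]:
  "koszul_sign 0 = 1" "koszul_sign 1 = - 1" "koszul_sign i * koszul_sign i = 1"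
  "koszul_sign i * (koszul_sign i * c) = c"
  by (simp_all add: koszul_sign_def)

lemma koszul_sign_add: "koszul_sign (i + j) = koszul_sign i * koszul_sign j"
  by (simp add: koszul_sign_def)

lemma koszul_sign_diff: "koszul_sign (i - j) = koszul_sign i * koszul_sign j"
  by (simp add: koszul_sign_def)

lemma word_degree_simps [simp]:
  "word_degree [] = 0" "word_degree (l # w) = fst l + word_degree w"
  "word_degree (u @ v) = word_degree u + word_degree v"
  by (simp_all add: word_degree_def)

text \<open>Zero is homogeneous of every degree, so a degree is not a function of the element;
  arguments that compare two degrees have to treat zero separately.\<close>

definition homogeneous :: "int \<Rightarrow> ((int \<times> 'x) list \<Rightarrow>\<^sub>0 'k::field) \<Rightarrow> bool" where
  "homogeneous n p \<longleftrightarrow> supp p \<subseteq> {w. word_degree w = n}"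

lemma homogeneous_zero [simp]: "homogeneous n 0"
  by (simp add: homogeneous_def)

lemma homogeneous_add: "homogeneous n p \<Longrightarrow> homogeneous n q \<Longrightarrow> homogeneous n (p + q)"
  unfolding homogeneous_def using Poly_Mapping.keys_add[of p q] by auto

lemma homogeneous_scl: "homogeneous n p \<Longrightarrow> homogeneous n (scl c p)"
  unfolding homogeneous_def using supp_scl[of c p] by auto

lemma homogeneous_uminus: "homogeneous n p \<Longrightarrow> homogeneous n (- p)"
  unfolding homogeneous_def by (simp add: in_keys_iff subset_iff)

lemma homogeneous_diff: "homogeneous n p \<Longrightarrow> homogeneous n q \<Longrightarrow> homogeneous n (p - q)"
  using homogeneous_add[of n p "- q"] by (simp add: homogeneous_uminus)

lemma homogeneous_mult: "homogeneous n p \<Longrightarrow> homogeneous m q \<Longrightarrow> homogeneous (n + m) (p * q)"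
  unfolding homogeneous_def using Poly_Mapping.keys_mult[of p q] by (fastforce simp: plus_list_def)

lemma homogeneous_single: "word_degree w = n \<Longrightarrow> homogeneous n (Poly_Mapping.single w c)"
  by (simp add: homogeneous_def)

lemma homogeneous_one: "homogeneous 0 1"
  by (simp add: homogeneous_single flip: single1_Nil)

lemma homogeneous_lin_ext:
  "(\<And>w. w \<in> supp p \<Longrightarrow> homogeneous n (\<phi> w)) \<Longrightarrow> homogeneous n (lin_ext scl \<phi> p)"
  unfolding homogeneous_def using supp_lin_ext[of \<phi> p] by fast

lemma homogeneous_alg_ext:
  assumes "homogeneous n p" "\<And>l. homogeneous (fst l) (a l)"
  shows "homogeneous n (alg_ext scl a p)"
  unfolding alg_ext_def
proof (rule homogeneous_lin_ext)
  fix w assume "w \<in> supp p"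
  then have "word_degree w = n" using assms(1) by (auto simp: homogeneous_def)
  moreover have "homogeneous (word_degree w) (prod_list (map a w))"
    by (induction w) (simp_all add: homogeneous_one homogeneous_mult assms(2))
  ultimately show "homogeneous n (prod_list (map a w))" by simp
qed

text \<open>The grading involution. It allows a Leibniz rule without a homogeneity hypothesis on the
  first factor.\<close>

definition sign_twist :: "((int \<times> 'x) list \<Rightarrow>\<^sub>0 'k::field) \<Rightarrow> ((int \<times> 'x) list \<Rightarrow>\<^sub>0 'k)" where
  "sign_twist = lin_ext scl (\<lambda>w. scl (koszul_sign (word_degree w)) (single1 w))"

lemma sign_twist_homogeneous:
  assumes "homogeneous n p" shows "sign_twist p = scl (koszul_sign n) p"
proof -
  have "sign_twist p = lin_ext scl (\<lambda>w. scl (koszul_sign n) (single1 w)) p"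
    unfolding sign_twist_def using assms by (intro poly.lin_ext_cong_on) (auto simp: homogeneous_def)
  also have "\<dots> = scl (koszul_sign n) p"
    using poly.lin_ext_comp[OF poly.k_linear_fun_scale, of "\<lambda>x. x" "koszul_sign n" single1 p]
    by (simp add: lin_ext_single1_id k_linear_def)
  finally show ?thesis .
qed

lemma sign_twist_k_linear: "k_linear scl sign_twist"
  unfolding sign_twist_def by (rule poly.lin_ext_k_linear)

lemmas sign_twist_linear_simps = k_linear_add[OF sign_twist_k_linear] k_linear_scl[OF sign_twist_k_linear]
  k_linear_zero[OF sign_twist_k_linear] k_linear_uminus[OF sign_twist_k_linear]
  k_linear_diff[OF sign_twist_k_linear]

text \<open>The same recursion as \<open>cobar_bd_word\<close>, with polynomials in place of cosets
  and arbitrary values on letters.\<close>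

primrec der_word ::
  "(int \<times> 'x \<Rightarrow> ((int \<times> 'x) list \<Rightarrow>\<^sub>0 'k::field)) \<Rightarrow> (int \<times> 'x) list \<Rightarrow> ((int \<times> 'x) list \<Rightarrow>\<^sub>0 'k)" where
  "der_word \<delta> [] = 0"
| "der_word \<delta> (l # w) = \<delta> l * single1 w + scl (koszul_sign (fst l)) (single1 [l] * der_word \<delta> w)"

definition der ::
  "(int \<times> 'x \<Rightarrow> ((int \<times> 'x) list \<Rightarrow>\<^sub>0 'k::field)) \<Rightarrow>
   ((int \<times> 'x) list \<Rightarrow>\<^sub>0 'k) \<Rightarrow> ((int \<times> 'x) list \<Rightarrow>\<^sub>0 'k)" where
  "der \<delta> = lin_ext scl (der_word \<delta>)"

lemma der_k_linear: "k_linear scl (der \<delta>)"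
  unfolding der_def by (rule poly.lin_ext_k_linear)

lemmas der_add = k_linear_add[OF der_k_linear]
  and der_scl = k_linear_scl[OF der_k_linear]
  and der_zero = k_linear_zero[OF der_k_linear]
  and der_uminus = k_linear_uminus[OF der_k_linear]
  and der_diff = k_linear_diff[OF der_k_linear]
  and der_sum = k_linear_sum[OF der_k_linear]

lemma der_single: "der \<delta> (Poly_Mapping.single w c) = scl c (der_word \<delta> w)"
  by (simp add: der_def poly.lin_ext_single)

lemma der_letter [simp]: "der \<delta> (single1 [l]) = \<delta> l"
  by (simp add: der_single single1_Nil)

lemma der_one [simp]: "der \<delta> 1 = 0"
  by (simp add: der_single flip: single1_Nil)

lemma der_word_append:
  "der_word \<delta> (u @ v) = der_word \<delta> u * single1 v + scl (koszul_sign (word_degree u)) (single1 u * der_word \<delta> v)"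
proof (induction u)
  case (Cons l u)
  show ?case
    by (simp only: append_Cons der_word.simps Cons single1_mult[symmetric] single1_Cons[of l u]
        word_degree_simps koszul_sign_add poly.scale_mult_left poly.scale_mult_right distrib_left
        distrib_right poly.scale_right_distrib poly.scale_scale mult.assoc add.assoc)
qed (simp add: single1_Nil)

lemma der_mult: "der \<delta> (p * q) = der \<delta> p * q + sign_twist p * der \<delta> q"
proof (induction p rule: poly_induct)
  case (single u)
  have sgn: "sign_twist (single1 u :: _ \<Rightarrow>\<^sub>0 'b) = scl (koszul_sign (word_degree u)) (single1 u)"
    by (simp add: sign_twist_def poly.lin_ext_single)
  show ?case
  proof (induction q rule: poly_induct)
    case (single v)
    have "scl (koszul_sign (word_degree u)) (single1 u * der_word \<delta> v)
      = scl (koszul_sign (word_degree u)) (single1 u) * der_word \<delta> v"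
      by (rule poly.scale_mult_left[symmetric])
    then show ?case by (simp add: single1_mult der_single der_word_append sgn)
  next
    case (scl c q)
    then show ?case
      by (simp only: poly.scale_mult_right der_scl poly.scale_right_distrib)
  qed (simp_all add: der_zero der_add ring_distribs)
qed (simp_all add: der_zero der_add der_scl sign_twist_linear_simps ring_distribs poly.scale_mult_left
    poly.scale_right_distrib)

lemma der_mult_homogeneous:
  "homogeneous n p \<Longrightarrow> der \<delta> (p * q) = der \<delta> p * q + scl (koszul_sign n) (p * der \<delta> q)"
  by (simp add: der_mult sign_twist_homogeneous poly.scale_mult_left)

lemma homogeneous_der:
  assumes "\<And>l. l \<in> L \<Longrightarrow> homogeneous (fst l - 1) (\<delta> l)" "homogeneous n p" "supp p \<subseteq> lists L"
  shows "homogeneous (n - 1) (der \<delta> p)"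
  unfolding der_def
proof (rule homogeneous_lin_ext)
  fix w assume "w \<in> supp p"
  then have "word_degree w = n" "w \<in> lists L" using assms(2,3) by (auto simp: homogeneous_def)
  moreover have "w \<in> lists L \<Longrightarrow> homogeneous (word_degree w - 1) (der_word \<delta> w)"
  proof (induction w)
    case (Cons l w)
    then have l: "l \<in> L" and w: "w \<in> lists L" by auto
    have "homogeneous (fst l - 1 + word_degree w) (\<delta> l * single1 w)"
      by (intro homogeneous_mult homogeneous_single assms(1) l) simp
    moreover have "homogeneous (fst l + (word_degree w - 1)) (single1 [l] * der_word \<delta> w)"
      using w by (intro homogeneous_mult homogeneous_single Cons.IH) simp_all
    ultimately show ?case by (simp add: homogeneous_add homogeneous_scl algebra_simps)
  qed simp
  ultimately show "homogeneous (n - 1) (der_word \<delta> w)" by simp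
qed

text \<open>Algebra maps and derivations are determined on letters. Preservation of degrees by
  \<open>a\<close> is what makes the Koszul signs on the two sides agree in the induction over
  words.\<close>

lemma alg_ext_der:
  assumes "supp p \<subseteq> lists L" "\<And>l. l \<in> L \<Longrightarrow> homogeneous (fst l) (a l)"
    "\<And>l. l \<in> L \<Longrightarrow> alg_ext scl a (\<delta> l) = der \<delta>' (a l)"
  shows "alg_ext scl a (der \<delta> p) = der \<delta>' (alg_ext scl a p)"
proof (rule k_linear_eq_on[OF _ _ assms(1)])
  show "k_linear scl (\<lambda>x. alg_ext scl a (der \<delta> x))" "k_linear scl (\<lambda>x. der \<delta>' (alg_ext scl a x))"
    by (rule poly.k_linear_fun_comp[OF poly.alg_ext_k_linear der_k_linear]
        poly.k_linear_fun_comp[OF der_k_linear poly.alg_ext_k_linear])+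
  fix w assume "w \<in> lists L"
  then show "alg_ext scl a (der \<delta> (single1 w)) = der \<delta>' (alg_ext scl a (single1 w))"
  proof (induction w)
    case (Cons l w)
    then have l: "l \<in> L" by auto
    have IH: "alg_ext scl a (der_word \<delta> w) = der \<delta>' (prod_list (map a w))"
      using Cons by (simp add: der_single poly.alg_ext_single)
    show ?case
      by (simp add: der_single poly.alg_ext_single poly.alg_ext_add poly.alg_ext_mult poly.alg_ext_scl
          der_mult_homogeneous[OF assms(2)[OF l]] IH assms(3)[OF l])
  qed (simp add: single1_Nil poly.alg_ext_one poly.alg_ext_zero)
qed


section \<open>Normal forms in tensor algebras\<close>

text \<open>Closure under the operations is what keeps the relations in \<open>linear_rels\<close>
  supported on the carrier.\<close>

definition closed_ops :: "('k, 'v) module \<Rightarrow> bool" where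
  "closed_ops M \<longleftrightarrow>
     (\<forall>x\<in>carrier M. \<forall>y\<in>carrier M. x \<oplus>\<^bsub>M\<^esub> y \<in> carrier M) \<and> (\<forall>c. \<forall>x\<in>carrier M. c \<odot>\<^bsub>M\<^esub> x \<in> carrier M)"

definition linear_on :: "('k, 'v) module \<Rightarrow> ('k \<Rightarrow> 'b::ab_group_add \<Rightarrow> 'b) \<Rightarrow> ('v \<Rightarrow> 'b) \<Rightarrow> bool" where
  "linear_on M s f \<longleftrightarrow>
     (\<forall>x\<in>carrier M. \<forall>y\<in>carrier M. f (x \<oplus>\<^bsub>M\<^esub> y) = f x + f y) \<and>
     (\<forall>c. \<forall>x\<in>carrier M. f (c \<odot>\<^bsub>M\<^esub> x) = s c (f x))"

lemma closed_opsD: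
  "closed_ops M \<Longrightarrow> x \<in> carrier M \<Longrightarrow> y \<in> carrier M \<Longrightarrow> x \<oplus>\<^bsub>M\<^esub> y \<in> carrier M"
  "closed_ops M \<Longrightarrow> x \<in> carrier M \<Longrightarrow> c \<odot>\<^bsub>M\<^esub> x \<in> carrier M"
  by (auto simp: closed_ops_def)

lemma linear_onI:
  assumes "\<And>x y. x \<in> carrier M \<Longrightarrow> y \<in> carrier M \<Longrightarrow> f (x \<oplus>\<^bsub>M\<^esub> y) = f x + f y"
    "\<And>c x. x \<in> carrier M \<Longrightarrow> f (c \<odot>\<^bsub>M\<^esub> x) = s c (f x)"
  shows "linear_on M s f"
  using assms by (simp add: linear_on_def)

lemma linear_onD:
  "linear_on M s f \<Longrightarrow> x \<in> carrier M \<Longrightarrow> y \<in> carrier M \<Longrightarrow> f (x \<oplus>\<^bsub>M\<^esub> y) = f x + f y"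
  "linear_on M s f \<Longrightarrow> x \<in> carrier M \<Longrightarrow> f (c \<odot>\<^bsub>M\<^esub> x) = s c (f x)"
  by (auto simp: linear_on_def)

text \<open>For a vector space \<open>M\<close> these relations present it as a quotient of the free
  space on its own elements.\<close>

definition linear_rels :: "('k::field, 'v) module \<Rightarrow> ('v \<Rightarrow>\<^sub>0 'k) set" where
  "linear_rels M =
     {single1 (x \<oplus>\<^bsub>M\<^esub> y) - single1 x - single1 y | x y. x \<in> carrier M \<and> y \<in> carrier M} \<union>
     {single1 (c \<odot>\<^bsub>M\<^esub> x) - scl c (single1 x) | c x. x \<in> carrier M}"

lemma (in vector_space) lin_ext_rels:
  assumes "linear_on M scale f" "p \<in> poly.span (linear_rels M)"
  shows "lin_ext scale f p = 0"
proof -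
  have *: "lin_ext scale f r = 0" if "r \<in> linear_rels M" for r
    using that assms(1)
    by (auto simp: linear_rels_def linear_onD lin_ext_diff lin_ext_single lin_ext_scl simp del: scl_single)
  from assms(2) show ?thesis
    by (induction rule: poly.span_induct_alt) (simp_all add: lin_ext_zero lin_ext_add lin_ext_scl *)
qed

lemma supp_diff: "supp (p - q) \<subseteq> supp p \<union> supp q"
  by (auto simp: in_keys_iff lookup_minus)

text \<open>A basis of the span of the relations is completed by letters to a basis of everything
  supported on the carrier; \<open>r\<close> is the projection that kills the first part and fixes
  the second. It therefore has values supported on the carrier and changes its argument by relations
  only.\<close>

lemma exists_normal_form:
  fixes M :: "('k::field, 'v) module"
  assumes "closed_ops M"
  shows "\<exists>r :: ('v \<Rightarrow>\<^sub>0 'k) \<Rightarrow> ('v \<Rightarrow>\<^sub>0 'k). k_linear scl r \<and> (\<forall>p\<in>poly.span (linear_rels M). r p = 0) \<and>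
    (\<forall>p. supp p \<subseteq> carrier M \<longrightarrow> supp (r p) \<subseteq> carrier M \<and> p - r p \<in> poly.span (linear_rels M))"
proof -
  define K where "K = poly.span (linear_rels M)"
  define S :: "('v \<Rightarrow>\<^sub>0 'k) set" where "S = single1 ` carrier M"
  obtain B0 where B0: "B0 \<subseteq> K" "poly.independent B0" "K \<subseteq> poly.span B0"
    by (rule poly.maximal_independent_subset_extend[of "{}" K]) (auto simp: poly.independent_empty)
  have B0K: "poly.span B0 \<subseteq> K"
    using B0(1) unfolding K_def by (simp add: poly.span_minimal)
  \<comment> \<open>Extending inside \<open>B0 \<union> S\<close>, and not in the whole space,
    forces every new basis vector to be a single element of the carrier.\<close>
  obtain B where B: "B0 \<subseteq> B" "B \<subseteq> B0 \<union> S" "poly.independent B" "B0 \<union> S \<subseteq> poly.span B"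
    by (rule poly.maximal_independent_subset_extend[OF Un_upper1 B0(2)])
  interpret vector_space_pair "scl :: 'k \<Rightarrow> ('v \<Rightarrow>\<^sub>0 'k) \<Rightarrow> _" "scl :: 'k \<Rightarrow> ('v \<Rightarrow>\<^sub>0 'k) \<Rightarrow> _" ..
  obtain r where lin: "Vector_Spaces.linear scl scl r" and r: "\<And>b. b \<in> B \<Longrightarrow> r b = (if b \<in> B0 then 0 else b)"
    using linear_independent_extend[OF B(3), of "\<lambda>b. if b \<in> B0 then 0 else b"] by blast
  have kl: "k_linear scl r"
    using lin unfolding Vector_Spaces.linear_iff by (intro k_linearI) auto
  have z: "r p = 0" if "p \<in> K" for p
  proof -
    have "p \<in> poly.span B0" using that B0 by blast
    then show ?thesis
    proof (induction rule: poly.span_induct_alt)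
      case (step c x y)
      moreover have "r x = 0" using step(1) B(1) r by auto
      ultimately show ?case by (simp add: k_linear_add[OF kl] k_linear_scl[OF kl])
    qed (simp add: k_linear_zero[OF kl])
  qed
  have P: "supp (r p) \<subseteq> carrier M \<and> p - r p \<in> K" if "p \<in> poly.span B" for p
    using that
  proof (induction rule: poly.span_induct_alt)
    case (step c x y)
    have x: "supp (r x) \<subseteq> carrier M \<and> x - r x \<in> K"
    proof (cases "x \<in> B0")
      case True
      then show ?thesis using step(1) B0(1) r[of x] by auto
    next
      case False
      then have "x \<in> S" "r x = x" using step(1) B(2) r[of x] by auto
      then show ?thesis by (auto simp: S_def K_def poly.span_zero)
    qed
    have "supp (scl c (r x) + r y) \<subseteq> carrier M"
      using step x Poly_Mapping.keys_add[of "scl c (r x)" "r y"] supp_scl[of c "r x"] by blast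
    moreover have "scl c (x - r x) + (y - r y) \<in> K"
      using x step unfolding K_def by (intro poly.span_add poly.span_scale) auto
    ultimately show ?case
      by (simp add: k_linear_add[OF kl] k_linear_scl[OF kl] poly.scale_right_diff_distrib algebra_simps)
  qed (simp add: k_linear_zero[OF kl] K_def poly.span_zero)
  have "p \<in> poly.span B" if "supp p \<subseteq> carrier M" for p
    using that
  proof (induction rule: poly_induct_on)
    case (single w)
    then show ?case using B(4) by (auto simp: S_def)
  qed (auto intro: poly.span_add poly.span_scale poly.span_zero)
  then show ?thesis using kl z P unfolding K_def by blast
qed

definition normal_form :: "('k::field, 'v) module \<Rightarrow> ('v \<Rightarrow>\<^sub>0 'k) \<Rightarrow> ('v \<Rightarrow>\<^sub>0 'k)" where
  "normal_form M = (SOME r. k_linear scl r \<and> (\<forall>p\<in>poly.span (linear_rels M). r p = 0) \<and>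
    (\<forall>p. supp p \<subseteq> carrier M \<longrightarrow> supp (r p) \<subseteq> carrier M \<and> p - r p \<in> poly.span (linear_rels M)))"

context
  fixes M :: "('k::field, 'v) module"
  assumes closed: "closed_ops M"
begin

lemma normal_form_k_linear: "k_linear scl (normal_form M)"
  and normal_form_rels: "p \<in> poly.span (linear_rels M) \<Longrightarrow> normal_form M p = 0"
  and supp_normal_form: "supp p \<subseteq> carrier M \<Longrightarrow> supp (normal_form M p) \<subseteq> carrier M"
  and normal_form_congruent: "supp p \<subseteq> carrier M \<Longrightarrow> p - normal_form M p \<in> poly.span (linear_rels M)"
  using someI_ex[OF exists_normal_form[OF closed]] unfolding normal_form_def[symmetric] by auto

lemma normal_form_idem: "supp p \<subseteq> carrier M \<Longrightarrow> normal_form M (normal_form M p) = normal_form M p"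
  using normal_form_rels[OF normal_form_congruent, of p] by (simp add: k_linear_diff[OF normal_form_k_linear])

lemma normal_form_linear_on: "linear_on M scl (\<lambda>x. normal_form M (single1 x))"
proof (rule linear_onI)
  fix x y assume "x \<in> carrier M" "y \<in> carrier M"
  then have "single1 (x \<oplus>\<^bsub>M\<^esub> y) - single1 x - single1 y \<in> poly.span (linear_rels M)"
    by (intro poly.span_base) (auto simp: linear_rels_def)
  from normal_form_rels[OF this]
  show "normal_form M (single1 (x \<oplus>\<^bsub>M\<^esub> y)) = normal_form M (single1 x) + normal_form M (single1 y)"
    by (simp add: k_linear_diff[OF normal_form_k_linear] k_linear_add[OF normal_form_k_linear] algebra_simps)
next
  fix c x assume "x \<in> carrier M"
  then have "single1 (c \<odot>\<^bsub>M\<^esub> x) - scl c (single1 x) \<in> poly.span (linear_rels M)"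
    by (intro poly.span_base) (auto simp: linear_rels_def)
  from normal_form_rels[OF this]
  show "normal_form M (single1 (c \<odot>\<^bsub>M\<^esub> x)) = scl c (normal_form M (single1 x))"
    by (simp add: k_linear_diff[OF normal_form_k_linear] k_linear_scl[OF normal_form_k_linear] del: scl_single)
qed

end

lemma (in vector_space) lin_ext_normal_form:
  assumes "closed_ops M'" "linear_on M' scale f" "supp p \<subseteq> carrier M'"
  shows "lin_ext scale f (normal_form M' p) = lin_ext scale f p"
  using lin_ext_rels[OF assms(2) normal_form_congruent[OF assms(1,3)]] by (simp add: lin_ext_diff)

text \<open>Letters outside the graded space are sent to zero, so that normal forms of arbitrary
  polynomials use admissible letters only.\<close>

definition letter_nform :: "(int \<Rightarrow> ('k::field, 'v) module) \<Rightarrow> int \<times> 'v \<Rightarrow> ((int \<times> 'v) list \<Rightarrow>\<^sub>0 'k)" where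
  "letter_nform V l = (if l \<in> letters V
     then lin_ext scl (\<lambda>t. single1 [(fst l, t)]) (normal_form (V (fst l)) (single1 (snd l))) else 0)"

text \<open>Being an algebra endomorphism of the free algebra, it has a subalgebra of fixed points,
  and for a graded space this subalgebra is a copy of the tensor algebra inside the free
  algebra.\<close>

definition nform :: "(int \<Rightarrow> ('k::field, 'v) module) \<Rightarrow> ((int \<times> 'v) list \<Rightarrow>\<^sub>0 'k) \<Rightarrow> ((int \<times> 'v) list \<Rightarrow>\<^sub>0 'k)" where
  "nform V = alg_ext scl (letter_nform V)"

text \<open>Linearity in each letter while the other letters are fixed: the condition under which a
  function of words depends only on the tensor that the word represents.\<close>

definition multilinear ::
  "(int \<Rightarrow> ('k::field, 'v) module) \<Rightarrow> ('k \<Rightarrow> 'b::ab_group_add \<Rightarrow> 'b) \<Rightarrow> ((int \<times> 'v) list \<Rightarrow> 'b) \<Rightarrow> bool" where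
  "multilinear V s \<phi> \<longleftrightarrow> (\<forall>u\<in>lists (letters V). \<forall>w\<in>lists (letters V). \<forall>n.
     linear_on (V n) s (\<lambda>x. \<phi> (u @ (n, x) # w)))"

lemma letters_iff [simp]: "(n, x) \<in> letters V \<longleftrightarrow> x \<in> carrier (V n)"
  by (auto simp: letters_def)

lemma homogeneous_letter_nform: "homogeneous (fst l) (letter_nform V l)"
  unfolding letter_nform_def by (auto intro!: homogeneous_lin_ext homogeneous_single)

lemma homogeneous_nform: "homogeneous n p \<Longrightarrow> homogeneous n (nform V p)"
  unfolding nform_def by (rule homogeneous_alg_ext[OF _ homogeneous_letter_nform])

lemma nform_k_linear: "k_linear scl (nform V)"
  unfolding nform_def by (rule poly.alg_ext_k_linear)

lemmas nform_add = k_linear_add[OF nform_k_linear]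
  and nform_scl = k_linear_scl[OF nform_k_linear]
  and nform_zero [simp] = k_linear_zero[OF nform_k_linear]
  and nform_uminus = k_linear_uminus[OF nform_k_linear]
  and nform_diff = k_linear_diff[OF nform_k_linear]
  and nform_sum = k_linear_sum[OF nform_k_linear]

lemma nform_one [simp]: "nform V 1 = 1"
  by (simp add: nform_def poly.alg_ext_one)

lemma nform_mult: "nform V (p * q) = nform V p * nform V q"
  by (simp add: nform_def poly.alg_ext_mult)

lemma nform_word: "nform V (single1 w) = prod_list (map (letter_nform V) w)"
  by (simp add: nform_def poly.alg_ext_single)

lemma nform_letter: "nform V (single1 [l]) = letter_nform V l"
  by (simp add: nform_word)

lemma supp_mult_lists:
  fixes p q :: "'l list \<Rightarrow>\<^sub>0 'k::field"
  shows "supp p \<subseteq> lists L \<Longrightarrow> supp q \<subseteq> lists L \<Longrightarrow> supp (p * q) \<subseteq> lists L"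
  using Poly_Mapping.keys_mult[of p q] by (fastforce simp: plus_list_def)

lemma supp_alg_ext_lists:
  assumes "supp p \<subseteq> lists L" "\<And>l. l \<in> L \<Longrightarrow> supp (a l) \<subseteq> lists L'"
  shows "supp (alg_ext scl a p) \<subseteq> lists L'"
proof -
  have "supp (prod_list (map a w)) \<subseteq> lists L'" if "w \<in> lists L" for w
    using that
  proof (induction w)
    case (Cons l w)
    then have "l \<in> L" "w \<in> lists L" by auto
    then show ?case by (simp only: list.map prod_list.Cons) (rule supp_mult_lists[OF assms(2) Cons.IH])
  qed (auto simp: zero_list_def)
  then show ?thesis
    using assms(1) supp_lin_ext[of "\<lambda>w. prod_list (map a w)" p] unfolding alg_ext_def by blast
qed

locale graded_space =
  fixes V :: "int \<Rightarrow> ('k::field, 'v) module"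
  assumes closed: "closed_ops (V n)"
begin

lemma letter_nform_linear_on: "linear_on (V n) scl (\<lambda>x. letter_nform V (n, x))"
proof (rule linear_onI)
  fix x y assume "x \<in> carrier (V n)" "y \<in> carrier (V n)"
  then show "letter_nform V (n, x \<oplus>\<^bsub>V n\<^esub> y) = letter_nform V (n, x) + letter_nform V (n, y)"
    by (simp add: letter_nform_def closed_opsD[OF closed] linear_onD[OF normal_form_linear_on[OF closed]]
        poly.lin_ext_add)
next
  fix c x assume "x \<in> carrier (V n)"
  then show "letter_nform V (n, c \<odot>\<^bsub>V n\<^esub> x) = scl c (letter_nform V (n, x))"
    by (simp add: letter_nform_def closed_opsD[OF closed] linear_onD[OF normal_form_linear_on[OF closed]]
        poly.lin_ext_scl)
qed

lemma supp_letter_nform: "supp (letter_nform V l) \<subseteq> lists (letters V)"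
proof (cases "l \<in> letters V")
  case True
  then have "supp (normal_form (V (fst l)) (single1 (snd l))) \<subseteq> carrier (V (fst l))"
    by (intro supp_normal_form[OF closed]) (cases l, auto)
  then show ?thesis
    using True supp_lin_ext[of "\<lambda>t. single1 [(fst l, t)]" "normal_form (V (fst l)) (single1 (snd l))"]
    unfolding letter_nform_def by fastforce
qed (simp add: letter_nform_def)

lemma supp_nform: "supp (nform V p) \<subseteq> lists (letters V)"
  unfolding nform_def by (rule supp_alg_ext_lists[of p UNIV, OF _ supp_letter_nform]) simp

text \<open>The normal form of a letter is a combination of letters from the same carrier. By
  linearity their normal forms recombine to the normal form of a normal form, which is the
  projection applied twice.\<close>

lemma nform_letter_nform: "nform V (letter_nform V l) = letter_nform V l"
proof (cases "l \<in> letters V")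
  case True
  obtain n x where l: "l = (n, x)" by (cases l)
  define r where "r = normal_form (V n) (single1 x)"
  have x: "x \<in> carrier (V n)" using True l by simp
  then have r: "supp r \<subseteq> carrier (V n)" "normal_form (V n) r = r"
    using supp_normal_form[OF closed, of "single1 x" n] normal_form_idem[OF closed, of "single1 x" n]
    by (auto simp: r_def)
  have "nform V (letter_nform V l) = lin_ext scl (\<lambda>t. letter_nform V (n, t)) r"
    using x l by (simp add: letter_nform_def[of V "(n, x)"] poly.lin_ext_comp[OF nform_k_linear]
        nform_letter flip: r_def)
  also have "\<dots> = lin_ext scl (\<lambda>t. lin_ext scl (\<lambda>t. single1 [(n, t)]) (normal_form (V n) (single1 t))) r"
    using r(1) by (intro poly.lin_ext_cong_on) (auto simp: letter_nform_def)
  also have "\<dots> = lin_ext scl (\<lambda>t. single1 [(n, t)]) (lin_ext scl (\<lambda>t. normal_form (V n) (single1 t)) r)"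
    by (rule poly.lin_ext_comp[OF poly.lin_ext_k_linear, symmetric])
  also have "lin_ext scl (\<lambda>t. normal_form (V n) (single1 t)) r = normal_form (V n) r"
    by (rule poly.k_linear_lin_ext[OF normal_form_k_linear[OF closed], symmetric])
  finally show ?thesis
    unfolding r(2) using x by (simp add: l letter_nform_def r_def)
qed (simp add: letter_nform_def)

lemma nform_idem [simp]: "nform V (nform V p) = nform V p"
  by (simp add: nform_def poly.alg_ext_comp) (simp add: nform_letter_nform flip: nform_def)

end

text \<open>Letters are normalised one at a time. The prefix \<open>u\<close> is generalised in the
  induction and collects the letters already chosen; linearity in the current slot then turns the
  combination of letters \<open>t\<close> back into the original letter.\<close>

lemma (in vector_space) multilinear_nform:
  assumes V: "graded_space V" and m: "multilinear V scale \<phi>" and p: "supp p \<subseteq> lists (letters V)"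
  shows "lin_ext scale \<phi> (nform V p) = lin_ext scale \<phi> p"
proof -
  interpret V: graded_space V by fact
  have *: "lin_ext scale \<phi> (single1 u * nform V (single1 w)) = \<phi> (u @ w)"
    if "w \<in> lists (letters V)" "u \<in> lists (letters V)" for u w
    using that
  proof (induction w arbitrary: u rule: list.induct)
    case Nil
    then show ?case by (simp add: single1_Nil lin_ext_single)
  next
    case (Cons l w)
    obtain n x where l: "l = (n, x)" by (cases l)
    have x: "x \<in> carrier (V n)" and w: "w \<in> lists (letters V)" using Cons.prems l by auto
    define r where "r = normal_form (V n) (single1 x)"
    have r: "supp r \<subseteq> carrier (V n)"
      using supp_normal_form[OF V.closed, of "single1 x" n] x by (simp add: r_def)
    have lin: "linear_on (V n) scale (\<lambda>x. \<phi> (u @ (n, x) # w))"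
      using m Cons.prems w by (simp add: multilinear_def)
    have kl: "k_linear scale (\<lambda>z. lin_ext scale \<phi> (single1 u * z * nform V (single1 w)))"
      by (intro k_linearI) (simp_all add: distrib_left distrib_right poly.scale_mult_left
          poly.scale_mult_right lin_ext_add lin_ext_scl)
    have "lin_ext scale \<phi> (single1 u * nform V (single1 (l # w)))
        = lin_ext scale \<phi> (single1 u * lin_ext scl (\<lambda>t. single1 [(n, t)]) r * nform V (single1 w))"
      using x by (simp add: nform_word letter_nform_def l r_def mult.assoc)
    also have "\<dots> = lin_ext scale (\<lambda>t. lin_ext scale \<phi> (single1 (u @ [(n, t)]) * nform V (single1 w))) r"
      using lin_ext_comp[OF kl, of "\<lambda>t. single1 [(n, t)]" r] by (simp add: single1_mult)
    also have "\<dots> = lin_ext scale (\<lambda>t. \<phi> (u @ (n, t) # w)) r"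
    proof (rule lin_ext_cong_on)
      fix t assume "t \<in> supp r"
      then have "u @ [(n, t)] \<in> lists (letters V)" using r Cons.prems by auto
      from Cons.IH[OF w this]
      show "lin_ext scale \<phi> (single1 (u @ [(n, t)]) * nform V (single1 w)) = \<phi> (u @ (n, t) # w)"
        by simp
    qed
    also have "\<dots> = \<phi> (u @ l # w)"
      using lin_ext_normal_form[OF V.closed lin, of "single1 x"] x by (simp add: r_def lin_ext_single l)
    finally show ?case .
  qed
  show ?thesis
  proof (rule k_linear_eq_on[OF k_linear_fun_comp[OF lin_ext_k_linear nform_k_linear] lin_ext_k_linear p])
    fix w assume "w \<in> lists (letters V)"
    then show "lin_ext scale \<phi> (nform V (single1 w)) = lin_ext scale \<phi> (single1 w)"
      using *[of w "[]"] by (simp add: single1_Nil lin_ext_single)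
  qed
qed

lemma (in scalar_algebra) multilinear_prod_list:
  assumes "\<And>n. linear_on (V n) s (\<lambda>x. f (n, x))"
  shows "multilinear V s (\<lambda>w. prod_list (map f w))"
  unfolding multilinear_def
  by (auto intro!: linear_onI simp: linear_onD[OF assms] distrib_left distrib_right scale_mult_left scale_mult_right)

lemma (in scalar_algebra) alg_ext_nform:
  assumes "graded_space V" "\<And>n. linear_on (V n) s (\<lambda>x. f (n, x))" "supp p \<subseteq> lists (letters V)"
  shows "alg_ext s f (nform V p) = alg_ext s f p"
  unfolding alg_ext_def by (rule multilinear_nform[OF assms(1) multilinear_prod_list[OF assms(2)] assms(3)])

text \<open>The counterpart of the case distinction in \<open>on_tensor_square\<close>, with values
  in a type that has a zero.\<close>

definition on_pair ::
  "(int \<Rightarrow> 'v \<Rightarrow> int \<Rightarrow> 'v \<Rightarrow> 'b) \<Rightarrow> (int \<times> 'v) list \<Rightarrow> 'b::zero" where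
  "on_pair \<psi> w = (case w of [(i, x), (j, y)] \<Rightarrow> \<psi> i x j y | _ \<Rightarrow> 0)"

lemma on_pair_simps [simp]: "on_pair \<psi> [(i, x), (j, y)] = \<psi> i x j y" "on_pair \<psi> [l, m] = \<psi> (fst l) (snd l) (fst m) (snd m)"
  by (simp_all add: on_pair_def split: prod.split)

lemma on_pair_other: "length w \<noteq> 2 \<Longrightarrow> on_pair \<psi> w = 0"
  by (auto simp: on_pair_def split: list.splits)

lemma (in vector_space) multilinear_on_pair:
  assumes "\<And>i j y. y \<in> carrier (V j) \<Longrightarrow> linear_on (V i) scale (\<lambda>x. \<psi> i x j y)"
    "\<And>i j x. x \<in> carrier (V i) \<Longrightarrow> linear_on (V j) scale (\<lambda>y. \<psi> i x j y)"
  shows "multilinear V scale (on_pair \<psi>)"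
  unfolding multilinear_def
proof (intro ballI allI)
  fix u w n assume uw: "u \<in> lists (letters V)" "w \<in> lists (letters V)"
  show "linear_on (V n) scale (\<lambda>x. on_pair \<psi> (u @ (n, x) # w))"
  proof (cases "length u + length w = 1")
    case True
    then consider l where "u = [l]" "w = []" | l where "u = []" "w = [l]"
      by (cases u; cases w) auto
    then show ?thesis
    proof cases
      case 1
      then show ?thesis using uw assms(2)[of "snd l" "fst l" n] by (cases l) (auto simp: linear_on_def)
    next
      case 2
      then show ?thesis using uw assms(1)[of "snd l" "fst l" n] by (cases l) (auto simp: linear_on_def)
    qed
  next
    case False
    then have "on_pair \<psi> (u @ (n, x) # w) = 0" for x by (intro on_pair_other) simp
    then show ?thesis by (intro linear_onI) simp_all
  qed
qed


section \<open>Computing in tensor algebras by representatives\<close>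

lemma free_algebra_simps [simp]:
  "carrier (free_algebra L) = {p. supp p \<subseteq> lists L}" "\<zero>\<^bsub>free_algebra L\<^esub> = 0"
  "\<one>\<^bsub>free_algebra L\<^esub> = 1" "p \<oplus>\<^bsub>free_algebra L\<^esub> q = p + q"
  by (simp_all add: free_algebra_def single1_Nil)

lemma free_algebra_mult [simp]: "p \<otimes>\<^bsub>free_algebra L\<^esub> q = p * q"
proof -
  have "(\<Sum>u\<in>supp p. scl (coeff_of p u) (single1 u)) * (\<Sum>v\<in>supp q. scl (coeff_of q v) (single1 v))
      = (\<Sum>u\<in>supp p. \<Sum>v\<in>supp q. Poly_Mapping.single (u @ v) (coeff_of p u * coeff_of q v))"
    by (simp add: sum_product mult_single plus_list_def)
  moreover have "p * q = (\<Sum>u\<in>supp p. scl (coeff_of p u) (single1 u)) * (\<Sum>v\<in>supp q. scl (coeff_of q v) (single1 v))"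
    by (simp only: poly_expand[symmetric])
  ultimately have "p * q = (\<Sum>u\<in>supp p. \<Sum>v\<in>supp q. Poly_Mapping.single (u @ v) (coeff_of p u * coeff_of q v))"
    by (rule trans[rotated])
  then show ?thesis
    by (simp add: free_algebra_def)
qed

lemma ring_free_algebra: "ring (free_algebra L)"
proof (rule ringI)
  show "abelian_group (free_algebra L)"
  proof (rule abelian_groupI)
    fix p assume "p \<in> carrier (free_algebra L)"
    then show "\<exists>q\<in>carrier (free_algebra L). q \<oplus>\<^bsub>free_algebra L\<^esub> p = \<zero>\<^bsub>free_algebra L\<^esub>"
      by (intro bexI[of _ "- p"]) auto
  qed (auto simp: algebra_simps dest: subsetD[OF Poly_Mapping.keys_add])
  show "monoid (free_algebra L)"
    by (rule monoidI) (simp_all add: supp_mult_lists zero_list_def mult.assoc)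
qed (simp_all add: distrib_left distrib_right)

context graded_space
begin

abbreviation "FV \<equiv> free_algebra (letters V)"
abbreviation "TV \<equiv> tensor_algebra V"
abbreviation "cl \<equiv> tensor_class V"

lemma supp_letter: "l \<in> letters V \<Longrightarrow> supp (single1 [l]) \<subseteq> lists (letters V)"
  by simp

lemma supp_add_lists: "supp p \<subseteq> S \<Longrightarrow> supp q \<subseteq> S \<Longrightarrow> supp (p + q) \<subseteq> S"
  using Poly_Mapping.keys_add[of p q] by blast

lemma supp_diff_lists: "supp p \<subseteq> S \<Longrightarrow> supp q \<subseteq> S \<Longrightarrow> supp (p - q) \<subseteq> S"
  using supp_diff[of p q] by blast

lemma tensor_relations_subset:
  "tensor_relations V \<subseteq> {p. supp p \<subseteq> lists (letters V) \<and> nform V p = 0}"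
proof
  fix p assume "p \<in> tensor_relations V"
  then consider n x y where "x \<in> carrier (V n)" "y \<in> carrier (V n)"
      "p = single1 [(n, x \<oplus>\<^bsub>V n\<^esub> y)] - single1 [(n, x)] - single1 [(n, y)]"
    | n c x where "x \<in> carrier (V n)" "p = single1 [(n, c \<odot>\<^bsub>V n\<^esub> x)] - scl c (single1 [(n, x)])"
    unfolding tensor_relations_def by auto
  then show "p \<in> {p. supp p \<subseteq> lists (letters V) \<and> nform V p = 0}"
  proof cases
    case 1
    have "supp p \<subseteq> lists (letters V)"
      unfolding 1(3) using 1 by (intro supp_diff_lists supp_letter) (simp_all add: closed_opsD[OF closed])
    then show ?thesis
      using 1 by (simp add: nform_diff nform_letter linear_onD[OF letter_nform_linear_on])
  next
    case 2
    have "supp p \<subseteq> lists (letters V)"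
      unfolding 2(2) using 2 supp_scl[of c "single1 [(n, x)]"]
      by (intro supp_diff_lists supp_letter) (auto simp: closed_opsD[OF closed])
    then show ?thesis
      using 2 by (simp add: nform_diff nform_letter nform_scl linear_onD[OF letter_nform_linear_on]
          del: scl_single)
  qed
qed

lemma ideal_tensor_ideal: "ideal (tensor_ideal V) FV"
  unfolding tensor_ideal_def using tensor_relations_subset
  by (intro ring.genideal_ideal ring_free_algebra) auto

lemma tensor_ideal_closed:
  assumes "p \<in> tensor_ideal V"
  shows "q \<in> tensor_ideal V \<Longrightarrow> p + q \<in> tensor_ideal V"
    and "supp r \<subseteq> lists (letters V) \<Longrightarrow> r * p \<in> tensor_ideal V"
    and "supp r \<subseteq> lists (letters V) \<Longrightarrow> p * r \<in> tensor_ideal V"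
    and "scl c p \<in> tensor_ideal V"
proof -
  interpret ideal "tensor_ideal V" FV by (rule ideal_tensor_ideal)
  show "q \<in> tensor_ideal V \<Longrightarrow> p + q \<in> tensor_ideal V" using additive_subgroup.a_closed[OF additive_subgroup_axioms assms, of q] by simp
  show 1: "supp r \<subseteq> lists (letters V) \<Longrightarrow> r * p \<in> tensor_ideal V" for r using I_l_closed[OF assms, of r] by simp
  show "supp r \<subseteq> lists (letters V) \<Longrightarrow> p * r \<in> tensor_ideal V" using I_r_closed[OF assms, of r] by simp
  show "scl c p \<in> tensor_ideal V" unfolding scl_eq_mult by (rule 1) auto
qed

lemma zero_in_tensor_ideal: "0 \<in> tensor_ideal V"
proof -
  interpret ideal "tensor_ideal V" FV by (rule ideal_tensor_ideal)
  show ?thesis using additive_subgroup.zero_closed[OF additive_subgroup_axioms] by simp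
qed

text \<open>Reading an element \<open>t\<close> of degree \<open>n\<close> as the one-letter word
  \<open>[(n, t)]\<close> turns the linear relations of the module into the relations that generate
  the ideal.\<close>

lemma letter_congruent:
  assumes "x \<in> carrier (V n)"
  shows "single1 [(n, x)] - letter_nform V (n, x) \<in> tensor_ideal V"
proof -
  let ?f = "lin_ext scl (\<lambda>t. single1 [(n, t)]) :: ('v \<Rightarrow>\<^sub>0 'k) \<Rightarrow> _"
  have rel: "?f r \<in> tensor_ideal V" if "r \<in> linear_rels (V n)" for r
  proof -
    have "?f r \<in> tensor_relations V"
      using that unfolding linear_rels_def tensor_relations_def
      by (auto simp: poly.lin_ext_diff poly.lin_ext_single poly.lin_ext_scl)
    then show ?thesis
      using ring.genideal_self[OF ring_free_algebra, of "tensor_relations V" "letters V"]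
        tensor_relations_subset unfolding tensor_ideal_def by auto
  qed
  have "?f r \<in> tensor_ideal V" if "r \<in> poly.span (linear_rels (V n))" for r
    using that
    by (induction rule: poly.span_induct_alt)
      (simp_all add: poly.lin_ext_zero poly.lin_ext_add poly.lin_ext_scl zero_in_tensor_ideal
        tensor_ideal_closed rel)
  from this[OF normal_form_congruent[OF closed, of "single1 x" n]] show ?thesis
    using assms by (simp add: letter_nform_def poly.lin_ext_diff poly.lin_ext_single)
qed

lemma nform_congruent:
  assumes "supp p \<subseteq> lists (letters V)"
  shows "p - nform V p \<in> tensor_ideal V"
  using assms
proof (induction rule: poly_induct_on)
  case (single w)
  then show ?case
  proof (induction w rule: list.induct)
    case (Cons l w)
    obtain n x where l: "l = (n, x)" by (cases l)
    have x: "x \<in> carrier (V n)" and w: "w \<in> lists (letters V)" using Cons.prems l by auto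
    have "(single1 [l] - letter_nform V l) * single1 w + letter_nform V l * (single1 w - nform V (single1 w))
        \<in> tensor_ideal V"
      using Cons.IH[OF w] letter_congruent[OF x] w
      by (intro tensor_ideal_closed(1) tensor_ideal_closed(2) tensor_ideal_closed(3) supp_letter_nform)
        (auto simp: l)
    moreover have "nform V (single1 (l # w)) = letter_nform V l * nform V (single1 w)"
      by (simp add: nform_word)
    then have "single1 (l # w) - nform V (single1 (l # w)) =
        (single1 [l] - letter_nform V l) * single1 w + letter_nform V l * (single1 w - nform V (single1 w))"
      by (simp add: left_diff_distrib right_diff_distrib single1_mult)
    ultimately show ?case by simp
  qed (simp add: single1_Nil zero_in_tensor_ideal)
next
  case (add p q)
  then show ?case using tensor_ideal_closed(1)[OF add(3,4)] by (simp add: nform_add algebra_simps)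
next
  case (scl c p)
  then show ?case using tensor_ideal_closed(4)[OF scl(2), of c]
    by (simp add: nform_scl poly.scale_right_diff_distrib)
qed (simp add: zero_in_tensor_ideal)

text \<open>The ideal is the kernel of \<open>nform\<close>. The kernel is an ideal because
  \<open>nform\<close> is multiplicative, and it contains the generators; conversely every
  polynomial is congruent to its normal form. Hence equality of cosets becomes equality of normal
  forms.\<close>

lemma tensor_ideal_eq: "tensor_ideal V = {p. supp p \<subseteq> lists (letters V) \<and> nform V p = 0}"
proof
  show "{p. supp p \<subseteq> lists (letters V) \<and> nform V p = 0} \<subseteq> tensor_ideal V"
    using nform_congruent by force
  show "tensor_ideal V \<subseteq> {p. supp p \<subseteq> lists (letters V) \<and> nform V p = 0}"
    unfolding tensor_ideal_def
  proof (rule ring.genideal_minimal[OF ring_free_algebra _ tensor_relations_subset],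
      rule idealI[OF ring_free_algebra])
    interpret ring FV by (rule ring_free_algebra)
    show "subgroup {p. supp p \<subseteq> lists (letters V) \<and> nform V p = 0} (add_monoid FV)"
    proof (rule add.subgroupI)
      fix p assume p: "p \<in> {p. supp p \<subseteq> lists (letters V) \<and> nform V p = 0}"
      then have "\<ominus>\<^bsub>FV\<^esub> p = - p" by (intro minus_equality) auto
      then show "\<ominus>\<^bsub>FV\<^esub> p \<in> {p. supp p \<subseteq> lists (letters V) \<and> nform V p = 0}"
        using p by (simp add: nform_uminus)
    next
      show "{p. supp p \<subseteq> lists (letters V) \<and> nform V p = 0} \<noteq> {}" by (auto intro!: exI[of _ 0])
    next
      fix p q assume "p \<in> {p. supp p \<subseteq> lists (letters V) \<and> nform V p = 0}"
        "q \<in> {p. supp p \<subseteq> lists (letters V) \<and> nform V p = 0}"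
      then show "p \<oplus>\<^bsub>FV\<^esub> q \<in> {p. supp p \<subseteq> lists (letters V) \<and> nform V p = 0}"
        using supp_add_lists[of p _ q] by (simp add: nform_add)
    qed auto
  qed (simp_all add: supp_mult_lists nform_mult)
qed

lemma tensor_class_eq:
  assumes "supp p \<subseteq> lists (letters V)"
  shows "cl p = {q. supp q \<subseteq> lists (letters V) \<and> nform V q = nform V p}"
proof -
  have "cl p = {j + p | j. supp j \<subseteq> lists (letters V) \<and> nform V j = 0}"
    by (auto simp: tensor_class_def a_r_coset_def' tensor_ideal_eq)
  also have "\<dots> = {q. supp q \<subseteq> lists (letters V) \<and> nform V q = nform V p}" (is "?L = ?R")
  proof
    show "?L \<subseteq> ?R" using supp_add_lists[OF _ assms] by (auto simp: nform_add)
    show "?R \<subseteq> ?L"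
    proof
      fix q assume "q \<in> ?R"
      then have "q = (q - p) + p \<and> supp (q - p) \<subseteq> lists (letters V) \<and> nform V (q - p) = 0"
        using assms supp_diff_lists[of q _ p] by (auto simp: nform_diff)
      then show "q \<in> ?L" by blast
    qed
  qed
  finally show ?thesis .
qed

lemma tensor_class_eq_iff:
  "supp p \<subseteq> lists (letters V) \<Longrightarrow> supp q \<subseteq> lists (letters V) \<Longrightarrow> cl p = cl q \<longleftrightarrow> nform V p = nform V q"
  by (auto simp: tensor_class_eq)

lemma tensor_class_nform: "supp p \<subseteq> lists (letters V) \<Longrightarrow> cl (nform V p) = cl p"
  by (simp add: tensor_class_eq_iff supp_nform)

lemma in_tensor_class: "supp p \<subseteq> lists (letters V) \<Longrightarrow> p \<in> cl p"
  by (simp add: tensor_class_eq)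

lemma carrier_tensor_algebra: "carrier TV = cl ` {p. supp p \<subseteq> lists (letters V)}"
  by (auto simp: tensor_algebra_def Let_def FactRing_def A_RCOSETS_def' tensor_class_def)

lemma tensor_zero: "\<zero>\<^bsub>TV\<^esub> = cl 0"
  by (simp add: tensor_algebra_def Let_def FactRing_def tensor_class_eq) (simp add: tensor_ideal_eq)

context
  fixes p q :: "(int \<times> 'v) list \<Rightarrow>\<^sub>0 'k"
  assumes p: "supp p \<subseteq> lists (letters V)" and q: "supp q \<subseteq> lists (letters V)"
begin

lemma tensor_add: "cl p \<oplus>\<^bsub>TV\<^esub> cl q = cl (p + q)"
proof -
  interpret ideal "tensor_ideal V" FV by (rule ideal_tensor_ideal)
  show ?thesis
    using a_rcos_sum[of p q] p q by (simp add: tensor_algebra_def Let_def FactRing_def tensor_class_def)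
qed

lemma tensor_mult: "cl p \<otimes>\<^bsub>TV\<^esub> cl q = cl (p * q)"
proof -
  interpret ideal "tensor_ideal V" FV by (rule ideal_tensor_ideal)
  show ?thesis
    using rcoset_mult_add[of p q] p q by (simp add: tensor_algebra_def Let_def FactRing_def tensor_class_def)
qed

end

lemma tensor_smult:
  assumes p: "supp p \<subseteq> lists (letters V)"
  shows "c \<odot>\<^bsub>TV\<^esub> cl p = cl (scl c p)"
proof -
  interpret ideal "tensor_ideal V" FV by (rule ideal_tensor_ideal)
  show ?thesis
    using rcoset_mult_add[of "Poly_Mapping.single [] c" p] p
    by (simp add: tensor_algebra_def Let_def FactRing_def tensor_class_def scl_eq_mult)
qed

lemma abelian_group_tensor: "abelian_group TV"
proof (rule abelian_groupI)
  fix x assume "x \<in> carrier TV"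
  then obtain p where p: "x = cl p" "supp p \<subseteq> lists (letters V)" by (auto simp: carrier_tensor_algebra)
  then show "\<exists>y\<in>carrier TV. y \<oplus>\<^bsub>TV\<^esub> x = \<zero>\<^bsub>TV\<^esub>"
    by (intro bexI[of _ "cl (- p)"]) (auto simp: carrier_tensor_algebra tensor_add tensor_zero)
qed (auto simp: carrier_tensor_algebra tensor_add tensor_zero supp_add_lists algebra_simps intro!: imageI)

lemma tensor_uminus: "supp p \<subseteq> lists (letters V) \<Longrightarrow> \<ominus>\<^bsub>TV\<^esub> cl p = cl (- p)"
  by (rule abelian_group.minus_equality[OF abelian_group_tensor])
    (auto simp: carrier_tensor_algebra tensor_add tensor_zero)

lemma tensor_finsum:
  assumes "finite I" "\<And>i. i \<in> I \<Longrightarrow> supp (f i) \<subseteq> lists (letters V)"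
  shows "(\<Oplus>\<^bsub>TV\<^esub>i\<in>I. cl (f i)) = cl (\<Sum>i\<in>I. f i) \<and> supp (\<Sum>i\<in>I. f i) \<subseteq> lists (letters V)"
proof -
  interpret abelian_group TV by (rule abelian_group_tensor)
  show ?thesis
    using assms
  proof (induction I)
    case empty
    then show ?case by (simp add: tensor_zero)
  next
    case (insert i I)
    have "(\<Oplus>\<^bsub>TV\<^esub>i\<in>insert i I. cl (f i)) = cl (f i) \<oplus>\<^bsub>TV\<^esub> (\<Oplus>\<^bsub>TV\<^esub>i\<in>I. cl (f i))"
      using insert by (intro finsum_insert) (auto simp: carrier_tensor_algebra)
    then show ?case using insert by (simp add: tensor_add supp_add_lists)
  qed
qed

lemma lin_extend_tensor:
  assumes "\<And>s. s \<in> supp p \<Longrightarrow> \<phi> s = cl (\<phi>' s) \<and> supp (\<phi>' s) \<subseteq> lists (letters V)"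
  shows "lin_extend TV \<phi> p = cl (lin_ext scl \<phi>' p)" "supp (lin_ext scl \<phi>' p) \<subseteq> lists (letters V)"
proof -
  interpret abelian_group TV by (rule abelian_group_tensor)
  have s: "supp (scl (coeff_of p s) (\<phi>' s)) \<subseteq> lists (letters V)" if "s \<in> supp p" for s
    using assms[OF that] supp_scl[of "coeff_of p s" "\<phi>' s"] by (meson order.trans)
  have t: "coeff_of p s \<odot>\<^bsub>TV\<^esub> \<phi> s = cl (scl (coeff_of p s) (\<phi>' s))" if "s \<in> supp p" for s
    using assms[OF that] by (simp add: tensor_smult)
  have "lin_extend TV \<phi> p = (\<Oplus>\<^bsub>TV\<^esub>s\<in>supp p. cl (scl (coeff_of p s) (\<phi>' s)))"
    unfolding lin_extend_def using s t by (intro finsum_cong') (auto simp: carrier_tensor_algebra)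
  with tensor_finsum[of "supp p" "\<lambda>s. scl (coeff_of p s) (\<phi>' s)"] s
  show "lin_extend TV \<phi> p = cl (lin_ext scl \<phi>' p)" "supp (lin_ext scl \<phi>' p) \<subseteq> lists (letters V)"
    by (simp_all add: lin_ext_def)
qed

end

lemma coset_extend_eqI:
  assumes "P \<noteq> {}" "\<And>q. q \<in> P \<Longrightarrow> lin_extend M \<phi> q = m"
  shows "coset_extend M \<phi> P = m"
proof -
  have "lin_extend M \<phi> ` P = {m}" using assms by auto
  then show ?thesis by (simp add: coset_extend_def)
qed

text \<open>A function on words descends to tensors when it is multilinear. This is required of
  \<open>nform W (\<phi>' w)\<close> and not of \<phi>' itself, since \<phi>' picks representatives
  that need not depend linearly on the letters.\<close>

lemma coset_extend_tensor:
  assumes V: "graded_space V" and W: "graded_space W"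
    and \<phi>: "\<And>w. w \<in> lists (letters V) \<Longrightarrow> \<phi> w = tensor_class W (\<phi>' w) \<and> supp (\<phi>' w) \<subseteq> lists (letters W)"
    and m: "multilinear V scl (\<lambda>w. nform W (\<phi>' w))" and p: "supp p \<subseteq> lists (letters V)"
  shows "coset_extend (tensor_algebra W) \<phi> (tensor_class V p) = tensor_class W (lin_ext scl \<phi>' p)"
proof (rule coset_extend_eqI)
  interpret V: graded_space V by fact
  interpret W: graded_space W by fact
  show "tensor_class V p \<noteq> {}" using V.in_tensor_class[OF p] by auto
  have e: "nform W (lin_ext scl \<phi>' q) = lin_ext scl (\<lambda>w. nform W (\<phi>' w)) (nform V q)"
    if "supp q \<subseteq> lists (letters V)" for q
    by (simp add: poly.lin_ext_comp[OF nform_k_linear] poly.multilinear_nform[OF V m that])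
  have L: "lin_extend (tensor_algebra W) \<phi> q = tensor_class W (lin_ext scl \<phi>' q) \<and>
      supp (lin_ext scl \<phi>' q) \<subseteq> lists (letters W)" if "supp q \<subseteq> lists (letters V)" for q
    using \<phi> that W.lin_extend_tensor[of q \<phi> \<phi>'] by blast
  fix q assume "q \<in> tensor_class V p"
  then have q: "supp q \<subseteq> lists (letters V)" "nform V q = nform V p"
    by (auto simp: V.tensor_class_eq[OF p])
  then show "lin_extend (tensor_algebra W) \<phi> q = tensor_class W (lin_ext scl \<phi>' p)"
    using L[OF q(1)] L[OF p] e[OF q(1)] e[OF p] by (simp add: W.tensor_class_eq_iff)
qed

lemma nform_map:
  "nform W (single1 (map f w)) = prod_list (map (\<lambda>l. letter_nform W (f l)) w)"
  by (simp add: nform_word comp_def)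

lemma tensor_map_class:
  assumes V: "graded_space V" and W: "graded_space W"
    and g: "\<And>n. g n \<in> carrier (V n) \<rightarrow> carrier (W n)" "\<And>n. linear_on (V n) scl (\<lambda>x. letter_nform W (n, g n x))"
    and p: "supp p \<subseteq> lists (letters V)"
  shows "tensor_map W g (tensor_class V p) = tensor_class W (lin_ext scl (\<lambda>w. single1 (map (\<lambda>(n, x). (n, g n x)) w)) p)"
    and "supp (lin_ext scl (\<lambda>w. single1 (map (\<lambda>(n, x). (n, g n x)) w)) p :: _ \<Rightarrow>\<^sub>0 'k::field) \<subseteq> lists (letters W)"
proof -
  let ?\<phi> = "\<lambda>w. single1 (map (\<lambda>(n, x). (n, g n x)) w)"
  have *: "map (\<lambda>(n, x). (n, g n x)) w \<in> lists (letters W)" if "w \<in> lists (letters V)" for w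
    using that g(1) by fastforce
  show "tensor_map W g (tensor_class V p) = tensor_class W (lin_ext scl ?\<phi> p)"
    unfolding tensor_map_def
  proof (rule coset_extend_tensor[OF V W _ _ p])
    show "multilinear V scl (\<lambda>w. nform W (?\<phi> w))"
      unfolding nform_map using poly.multilinear_prod_list[of V "\<lambda>l. letter_nform W (case l of (n, x) \<Rightarrow> (n, g n x))"] g(2)
      by simp
  qed (use * in \<open>simp add: tensor_word_def\<close>)
  show "supp (lin_ext scl ?\<phi> p :: _ \<Rightarrow>\<^sub>0 'k) \<subseteq> lists (letters W)"
    using supp_lin_ext[of ?\<phi> p] p * by force
qed

lemma on_tensor_square_class:
  assumes V: "graded_space V" and W: "graded_space W"
    and \<phi>: "\<And>i x j y. x \<in> carrier (V i) \<Longrightarrow> y \<in> carrier (V j) \<Longrightarrow>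
      \<phi> i x j y = tensor_class W (\<psi> i x j y) \<and> supp (\<psi> i x j y) \<subseteq> lists (letters W)"
    and lin: "\<And>i j y. y \<in> carrier (V j) \<Longrightarrow> linear_on (V i) scl (\<lambda>x. nform W (\<psi> i x j y))"
      "\<And>i j x. x \<in> carrier (V i) \<Longrightarrow> linear_on (V j) scl (\<lambda>y. nform W (\<psi> i x j y))"
    and p: "supp p \<subseteq> lists (letters V)"
  shows "on_tensor_square W \<phi> (tensor_class V p) = tensor_class W (lin_ext scl (on_pair \<psi>) p)"
  unfolding on_tensor_square_def
proof (rule coset_extend_tensor[OF V W _ _ p])
  interpret W: graded_space W by fact
  have "(\<lambda>w. nform W (on_pair \<psi> w)) = on_pair (\<lambda>i x j y. nform W (\<psi> i x j y))"
    by (auto simp: fun_eq_iff on_pair_def split: list.split)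
  then show "multilinear V scl (\<lambda>w. nform W (on_pair \<psi> w))"
    using poly.multilinear_on_pair[OF lin] by simp
  fix w assume "w \<in> lists (letters V)"
  then show "(case w of [(i, x), (j, y)] \<Rightarrow> \<phi> i x j y | _ \<Rightarrow> \<zero>\<^bsub>tensor_algebra W\<^esub>) = tensor_class W (on_pair \<psi> w) \<and>
      supp (on_pair \<psi> w) \<subseteq> lists (letters W)"
  proof (cases "\<exists>i x j y. w = [(i, x), (j, y)]")
    case True
    then obtain i x j y where "w = [(i, x), (j, y)]" by blast
    with \<open>w \<in> lists (letters V)\<close> show ?thesis using \<phi>[of x i y j] by simp
  next
    case False
    then show ?thesis by (auto simp: on_pair_def W.tensor_zero split: list.split prod.split)
  qed
qed


section \<open>Quotients by subspaces\<close>

abbreviation k_module :: "('k::field, 'v) module \<Rightarrow> bool" where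
  "k_module M \<equiv> module (ring_of_type_algebra :: 'k ring) M"

lemma k_moduleD:
  fixes M :: "('k::field, 'v) module"
  assumes "k_module M" and x: "x \<in> carrier M"
  shows "c \<odot>\<^bsub>M\<^esub> x \<in> carrier M" "y \<in> carrier M \<Longrightarrow> c \<odot>\<^bsub>M\<^esub> (x \<oplus>\<^bsub>M\<^esub> y) = c \<odot>\<^bsub>M\<^esub> x \<oplus>\<^bsub>M\<^esub> c \<odot>\<^bsub>M\<^esub> y"
    "(c + d) \<odot>\<^bsub>M\<^esub> x = c \<odot>\<^bsub>M\<^esub> x \<oplus>\<^bsub>M\<^esub> d \<odot>\<^bsub>M\<^esub> x" "(c * d) \<odot>\<^bsub>M\<^esub> x = c \<odot>\<^bsub>M\<^esub> (d \<odot>\<^bsub>M\<^esub> x)" "1 \<odot>\<^bsub>M\<^esub> x = x"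
    "0 \<odot>\<^bsub>M\<^esub> x = \<zero>\<^bsub>M\<^esub>" "(- 1) \<odot>\<^bsub>M\<^esub> x = \<ominus>\<^bsub>M\<^esub> x"
proof -
  interpret module "ring_of_type_algebra :: 'k ring" M by fact
  note R = smult_closed smult_r_distr smult_l_distr smult_assoc1 smult_one
  note R' = R[unfolded ring_of_type_algebra_def, simplified]
  show c: "c \<odot>\<^bsub>M\<^esub> x \<in> carrier M" for c using R'(1) x by simp
  show "y \<in> carrier M \<Longrightarrow> c \<odot>\<^bsub>M\<^esub> (x \<oplus>\<^bsub>M\<^esub> y) = c \<odot>\<^bsub>M\<^esub> x \<oplus>\<^bsub>M\<^esub> c \<odot>\<^bsub>M\<^esub> y" using R'(2) x by simp
  show d: "(c + d) \<odot>\<^bsub>M\<^esub> x = c \<odot>\<^bsub>M\<^esub> x \<oplus>\<^bsub>M\<^esub> d \<odot>\<^bsub>M\<^esub> x" for c d using R'(3) x by simp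
  show "(c * d) \<odot>\<^bsub>M\<^esub> x = c \<odot>\<^bsub>M\<^esub> (d \<odot>\<^bsub>M\<^esub> x)" using R'(4) x by simp
  show o: "1 \<odot>\<^bsub>M\<^esub> x = x" using R'(5) x by simp
  show z: "0 \<odot>\<^bsub>M\<^esub> x = \<zero>\<^bsub>M\<^esub>"
    using d[of 0 0] c[of 0] by (metis M.add.l_cancel_one' add.right_neutral)
  show "(- 1) \<odot>\<^bsub>M\<^esub> x = \<ominus>\<^bsub>M\<^esub> x"
    using d[of "- 1" 1] z o c x by (metis M.minus_equality add.left_inverse)
qed

lemma k_module_closed_ops: "k_module M \<Longrightarrow> closed_ops M"
  by (simp add: closed_ops_def k_moduleD abelian_groupE(1) module.axioms(2) abelian_monoid.a_closed
      abelian_group.axioms(1))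

lemma linear_on_zero:
  assumes "k_module M" "linear_on M scl f"
  shows "f \<zero>\<^bsub>M\<^esub> = 0"
proof -
  have "\<zero>\<^bsub>M\<^esub> \<in> carrier M" using assms(1) by (simp add: module_def abelian_group_def abelian_monoid.zero_closed)
  then show ?thesis
    using linear_onD(2)[OF assms(2), of "\<zero>\<^bsub>M\<^esub>" 0] k_moduleD(6)[OF assms(1), of "\<zero>\<^bsub>M\<^esub>"] by simp
qed

locale k_subspace =
  fixes M :: "('k::field, 'v) module" and N :: "'v set"
  assumes module: "k_module M" and subset: "N \<subseteq> carrier M" and zero: "\<zero>\<^bsub>M\<^esub> \<in> N"
    and add_closed: "x \<in> N \<Longrightarrow> y \<in> N \<Longrightarrow> x \<oplus>\<^bsub>M\<^esub> y \<in> N" and smult_closed: "x \<in> N \<Longrightarrow> c \<odot>\<^bsub>M\<^esub> x \<in> N"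
begin

sublocale M: abelian_group M
  using module by (simp add: module_def)

abbreviation "pr x \<equiv> N +>\<^bsub>M\<^esub> x"
abbreviation "MN \<equiv> quotient_module M N"

lemma coset_iff: "y \<in> pr x \<longleftrightarrow> (\<exists>n\<in>N. y = n \<oplus>\<^bsub>M\<^esub> x)"
  by (auto simp: a_r_coset_def')

lemma coset_image: "pr x = (\<lambda>n. n \<oplus>\<^bsub>M\<^esub> x) ` N"
  by (auto simp: a_r_coset_def')

lemma uminus_closed: "x \<in> N \<Longrightarrow> \<ominus>\<^bsub>M\<^esub> x \<in> N"
  using smult_closed[of x "- 1"] k_moduleD(7)[OF module, of x] subset by auto

lemma self_in_coset: "x \<in> carrier M \<Longrightarrow> x \<in> pr x"
  using zero by (auto simp: coset_iff intro!: bexI[of _ "\<zero>\<^bsub>M\<^esub>"])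

lemma coset_absorb:
  assumes n: "n \<in> N" and x: "x \<in> carrier M"
  shows "pr (n \<oplus>\<^bsub>M\<^esub> x) = pr x"
proof -
  have nc: "n \<in> carrier M" using n subset by auto
  have "(\<exists>m\<in>N. y = m \<oplus>\<^bsub>M\<^esub> (n \<oplus>\<^bsub>M\<^esub> x)) \<longleftrightarrow> (\<exists>m\<in>N. y = m \<oplus>\<^bsub>M\<^esub> x)" for y
  proof
    assume "\<exists>m\<in>N. y = m \<oplus>\<^bsub>M\<^esub> (n \<oplus>\<^bsub>M\<^esub> x)"
    then obtain m where "m \<in> N" "y = m \<oplus>\<^bsub>M\<^esub> (n \<oplus>\<^bsub>M\<^esub> x)" by blast
    then show "\<exists>m\<in>N. y = m \<oplus>\<^bsub>M\<^esub> x"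
      using n nc x subset by (intro bexI[of _ "m \<oplus>\<^bsub>M\<^esub> n"]) (auto simp: M.a_assoc add_closed)
  next
    assume "\<exists>m\<in>N. y = m \<oplus>\<^bsub>M\<^esub> x"
    then obtain m where "m \<in> N" "y = m \<oplus>\<^bsub>M\<^esub> x" by blast
    then show "\<exists>m\<in>N. y = m \<oplus>\<^bsub>M\<^esub> (n \<oplus>\<^bsub>M\<^esub> x)"
      using n nc x subset uminus_closed[OF n]
      by (intro bexI[of _ "m \<oplus>\<^bsub>M\<^esub> \<ominus>\<^bsub>M\<^esub> n"]) (auto simp: M.a_assoc M.l_neg add_closed M.r_neg2 M.r_neg1 subsetD)
  qed
  then show ?thesis by (auto simp: set_eq_iff coset_iff)
qed

lemma coset_eqI: "x \<in> carrier M \<Longrightarrow> y \<in> pr x \<Longrightarrow> pr y = pr x"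
  using coset_absorb by (auto simp: coset_iff)

lemma coset_carrier: "x \<in> carrier M \<Longrightarrow> y \<in> pr x \<Longrightarrow> y \<in> carrier M"
  using subset by (auto simp: coset_iff)

lemma coset_of_subspace: "n \<in> N \<Longrightarrow> pr n = N"
  using coset_absorb[of n "\<zero>\<^bsub>M\<^esub>"] subset by (auto simp: coset_iff set_eq_iff subsetD)

lemma coset_zero: "pr \<zero>\<^bsub>M\<^esub> = N"
  using coset_of_subspace zero by auto

lemma coset_add:
  assumes x: "x \<in> carrier M" and y: "y \<in> carrier M"
  shows "pr x <+>\<^bsub>M\<^esub> pr y = pr (x \<oplus>\<^bsub>M\<^esub> y)"
proof -
  have "(\<exists>n\<in>N. \<exists>m\<in>N. z = (n \<oplus>\<^bsub>M\<^esub> x) \<oplus>\<^bsub>M\<^esub> (m \<oplus>\<^bsub>M\<^esub> y)) \<longleftrightarrow> (\<exists>n\<in>N. z = n \<oplus>\<^bsub>M\<^esub> (x \<oplus>\<^bsub>M\<^esub> y))" for z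
  proof
    assume "\<exists>n\<in>N. \<exists>m\<in>N. z = (n \<oplus>\<^bsub>M\<^esub> x) \<oplus>\<^bsub>M\<^esub> (m \<oplus>\<^bsub>M\<^esub> y)"
    then obtain n m where "n \<in> N" "m \<in> N" "z = (n \<oplus>\<^bsub>M\<^esub> x) \<oplus>\<^bsub>M\<^esub> (m \<oplus>\<^bsub>M\<^esub> y)" by blast
    then show "\<exists>n\<in>N. z = n \<oplus>\<^bsub>M\<^esub> (x \<oplus>\<^bsub>M\<^esub> y)"
      using x y subset by (intro bexI[of _ "n \<oplus>\<^bsub>M\<^esub> m"]) (auto simp: M.a_ac add_closed subsetD)
  next
    assume "\<exists>n\<in>N. z = n \<oplus>\<^bsub>M\<^esub> (x \<oplus>\<^bsub>M\<^esub> y)"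
    then obtain n where "n \<in> N" "z = n \<oplus>\<^bsub>M\<^esub> (x \<oplus>\<^bsub>M\<^esub> y)" by blast
    then have "z = (n \<oplus>\<^bsub>M\<^esub> x) \<oplus>\<^bsub>M\<^esub> (\<zero>\<^bsub>M\<^esub> \<oplus>\<^bsub>M\<^esub> y)"
      using x y subset by (auto simp: M.a_ac subsetD)
    then show "\<exists>n\<in>N. \<exists>m\<in>N. z = (n \<oplus>\<^bsub>M\<^esub> x) \<oplus>\<^bsub>M\<^esub> (m \<oplus>\<^bsub>M\<^esub> y)"
      using zero \<open>n \<in> N\<close> by blast
  qed
  moreover have "z \<in> pr x <+>\<^bsub>M\<^esub> pr y \<longleftrightarrow> (\<exists>n\<in>N. \<exists>m\<in>N. z = (n \<oplus>\<^bsub>M\<^esub> x) \<oplus>\<^bsub>M\<^esub> (m \<oplus>\<^bsub>M\<^esub> y))" for z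
    unfolding set_add_def' coset_image by auto
  ultimately show ?thesis by (auto simp: set_eq_iff coset_iff)
qed

lemma quotient_carrier: "carrier MN = pr ` carrier M"
  by (auto simp: quotient_module_def A_RCOSETS_def')

lemma quotient_zero: "\<zero>\<^bsub>MN\<^esub> = pr \<zero>\<^bsub>M\<^esub>"
  by (simp add: quotient_module_def coset_zero)

lemma quotient_add: "x \<in> carrier M \<Longrightarrow> y \<in> carrier M \<Longrightarrow> pr x \<oplus>\<^bsub>MN\<^esub> pr y = pr (x \<oplus>\<^bsub>M\<^esub> y)"
  by (simp add: quotient_module_def coset_add)

lemma quotient_smult:
  assumes x: "x \<in> carrier M"
  shows "c \<odot>\<^bsub>MN\<^esub> pr x = pr (c \<odot>\<^bsub>M\<^esub> x)"
proof -
  have "pr (c \<odot>\<^bsub>M\<^esub> y) = pr (c \<odot>\<^bsub>M\<^esub> x)" if y: "y \<in> pr x" for y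
  proof -
    obtain n where n: "n \<in> N" "y = n \<oplus>\<^bsub>M\<^esub> x" using y unfolding coset_iff by blast
    then have "c \<odot>\<^bsub>M\<^esub> y = c \<odot>\<^bsub>M\<^esub> n \<oplus>\<^bsub>M\<^esub> c \<odot>\<^bsub>M\<^esub> x"
      using k_moduleD(2)[OF module, of n x c] x subset by auto
    then show ?thesis
      using coset_absorb[OF smult_closed[OF n(1)]] k_moduleD(1)[OF module x] by simp
  qed
  moreover have "pr x \<noteq> {}" using self_in_coset[OF x] by blast
  ultimately have "(\<Union>y\<in>pr x. pr (c \<odot>\<^bsub>M\<^esub> y)) = pr (c \<odot>\<^bsub>M\<^esub> x)" by (intro SUP_eq_const)
  then show ?thesis by (simp add: quotient_module_def)
qed

lemma quotient_closed_ops: "closed_ops MN"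
  by (auto simp: closed_ops_def quotient_carrier quotient_add quotient_smult k_moduleD[OF module])

lemma quotient_linear_on:
  assumes "linear_on M s (\<lambda>x. f (pr x))"
  shows "linear_on MN s f"
  using assms by (auto simp: linear_on_def quotient_carrier quotient_add quotient_smult)

lemma quotient_map_coset:
  fixes f :: "'u \<Rightarrow> 'v" and M0 :: "('k, 'u) module"
  assumes M0: "k_subspace M0 N0" and f: "lin_map M0 M f" "f ` N0 \<subseteq> N" and x: "x \<in> carrier M0"
  shows "quotient_map M N f (N0 +>\<^bsub>M0\<^esub> x) = pr (f x)"
proof -
  interpret M0: k_subspace M0 N0 by fact
  have fc: "f x \<in> carrier M" using f x by (auto simp: lin_map_def)
  have fn: "f (n \<oplus>\<^bsub>M0\<^esub> x) = f n \<oplus>\<^bsub>M\<^esub> f x" if "n \<in> N0" for n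
    using f that x M0.subset by (auto simp: lin_map_def)
  have 1: "z \<in> quotient_map M N f (N0 +>\<^bsub>M0\<^esub> x) \<longleftrightarrow> (\<exists>m\<in>N. \<exists>n\<in>N0. z = m \<oplus>\<^bsub>M\<^esub> (f n \<oplus>\<^bsub>M\<^esub> f x))" for z
    unfolding quotient_map_def set_add_def' M0.coset_image using fn by auto
  have "(\<exists>m\<in>N. \<exists>n\<in>N0. z = m \<oplus>\<^bsub>M\<^esub> (f n \<oplus>\<^bsub>M\<^esub> f x)) \<longleftrightarrow> (\<exists>m\<in>N. z = m \<oplus>\<^bsub>M\<^esub> f x)" for z
  proof
    assume "\<exists>m\<in>N. \<exists>n\<in>N0. z = m \<oplus>\<^bsub>M\<^esub> (f n \<oplus>\<^bsub>M\<^esub> f x)"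
    then obtain m n where *: "m \<in> N" "n \<in> N0" "z = m \<oplus>\<^bsub>M\<^esub> (f n \<oplus>\<^bsub>M\<^esub> f x)" by blast
    then have "f n \<in> N" using f by auto
    then show "\<exists>m\<in>N. z = m \<oplus>\<^bsub>M\<^esub> f x"
      using * fc subset by (intro bexI[of _ "m \<oplus>\<^bsub>M\<^esub> f n"]) (auto simp: M.a_assoc add_closed subsetD)
  next
    assume "\<exists>m\<in>N. z = m \<oplus>\<^bsub>M\<^esub> f x"
    then obtain m where *: "m \<in> N" "z = m \<oplus>\<^bsub>M\<^esub> f x" by blast
    \<comment> \<open>The representative \<open>\<zero>\<close> of the source subspace is used for
      the witness; its image is known to lie in \<open>N\<close>, and is subtracted from
      \<open>m\<close> there.\<close>
    have n: "f \<zero>\<^bsub>M0\<^esub> \<in> N" using f M0.zero by auto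
    have "z = (m \<oplus>\<^bsub>M\<^esub> \<ominus>\<^bsub>M\<^esub> f \<zero>\<^bsub>M0\<^esub>) \<oplus>\<^bsub>M\<^esub> (f \<zero>\<^bsub>M0\<^esub> \<oplus>\<^bsub>M\<^esub> f x)"
      using * fc n uminus_closed[OF n] subset by (simp add: M.a_assoc M.r_neg1 subsetD)
    then show "\<exists>m\<in>N. \<exists>n\<in>N0. z = m \<oplus>\<^bsub>M\<^esub> (f n \<oplus>\<^bsub>M\<^esub> f x)"
      using * M0.zero add_closed[OF *(1) uminus_closed[OF n]] by blast
  qed
  then show ?thesis by (auto simp: set_eq_iff 1 coset_iff)
qed

end


section \<open>The cobar differential as a derivation\<close>

text \<open>Any representative of the coset will do, because \<open>nform\<close> is constant on
  cosets; the value zero on inadmissible letters makes every value a normal form.\<close>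

definition dgc_letter_bd :: "('k::field, 'v) dgc \<Rightarrow> int \<times> 'v set \<Rightarrow> ((int \<times> 'v set) list \<Rightarrow>\<^sub>0 'k)" where
  "dgc_letter_bd C l = (if l \<in> letters (cobar_gens C)
     then nform (cobar_gens C) (SOME p. p \<in> cobar_bd_gen C (fst l) (snd l)) else 0)"

definition coprod_rep :: "('k::field, 'v) dgc \<Rightarrow> int \<Rightarrow> 'v \<Rightarrow> ((int \<times> 'v) list \<Rightarrow>\<^sub>0 'k)" where
  "coprod_rep C n x = nform (space C) (SOME p. p \<in> coprod C n x)"

text \<open>The desuspended class of \<open>x\<close> in the cokernel of the coaugmentation, as a
  polynomial: the generator of the cobar construction that \<open>x\<close> defines, in degree one
  less.\<close>

definition bar_letter :: "('k::field, 'v) dgc \<Rightarrow> int \<times> 'v \<Rightarrow> ((int \<times> 'v set) list \<Rightarrow>\<^sub>0 'k)" where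
  "bar_letter C l = letter_nform (cobar_gens C) (fst l - 1, bar_proj C (fst l) (snd l))"

text \<open>The weights \<open>(-1)\<^sup>i\<close> are those of the quadratic part of the cobar differential.\<close>
definition bar_square :: "('k::field, 'v) dgc \<Rightarrow> (int \<times> 'v) list \<Rightarrow> ((int \<times> 'v set) list \<Rightarrow>\<^sub>0 'k)" where
  "bar_square C = on_pair (\<lambda>i x j y. scl (koszul_sign i) (bar_letter C (i, x) * bar_letter C (j, y)))"

lemma multilinear_weighted:
  assumes "multilinear V scl \<phi>"
  shows "multilinear V scl (\<lambda>w. scl (g (map fst w)) (\<phi> w))"
  using assms unfolding multilinear_def linear_on_def
  by (auto simp: poly.scale_right_distrib mult.commute)

locale augmented_dgc =
  fixes C :: "('k::field, 'v) dgc"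
  assumes counital: "counital_dg_coalgebra C" and coaug: "coaugmented C"
begin

abbreviation "Sp \<equiv> space C"
abbreviation "Xb \<equiv> bar_space C"
abbreviation "V \<equiv> cobar_gens C"
abbreviation "N \<equiv> coaug_image C"
abbreviation "pj \<equiv> bar_proj C"
abbreviation "bl \<equiv> bar_letter C"
abbreviation "Q \<equiv> coprod_rep C"
abbreviation "dC \<equiv> der (dgc_letter_bd C)"

lemma module_Sp: "k_module (Sp n)"
  and lin_bd: "lin_map (Sp n) (Sp (n - 1)) (bd C n)"
  and bd_bd: "x \<in> carrier (Sp n) \<Longrightarrow> bd C (n - 1) (bd C n x) = \<zero>\<^bsub>Sp (n - 1 - 1)\<^esub>"
  and lin_coprod: "lin_map (Sp n) (tensor_square Sp n) (coprod C n)"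
  using counital unfolding counital_dg_coalgebra_def Let_def by auto

lemma bd_closed: "x \<in> carrier (Sp n) \<Longrightarrow> bd C n x \<in> carrier (Sp (n - 1))"
  using lin_bd[of n] by (auto simp: lin_map_def)

lemma coaug_closed: "coaug C \<in> carrier (Sp 0)"
  and bd_coaug: "bd C 0 (coaug C) = \<zero>\<^bsub>Sp (- 1)\<^esub>"
  and coprod_coaug: "coprod C 0 (coaug C) = tensor_word Sp [(0, coaug C), (0, coaug C)]"
  using coaug unfolding coaugmented_def by auto

sublocale Sp: graded_space Sp
  by standard (rule k_module_closed_ops[OF module_Sp])

lemma k_subspace_N: "k_subspace (Sp n) (N n)"
proof (rule k_subspace.intro)
  note c = coaug_closed
  show "k_module (Sp n)" by (rule module_Sp)
  interpret module "ring_of_type_algebra :: 'k ring" "Sp n" by (rule module_Sp)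
  show "N n \<subseteq> carrier (Sp n)"
    using c k_moduleD(1)[OF module_Sp c] by (auto simp: coaug_image_def)
  show "\<zero>\<^bsub>Sp n\<^esub> \<in> N n"
    using k_moduleD(6)[OF module_Sp c] by (auto simp: coaug_image_def intro: range_eqI[of _ _ 0])
  show "x \<oplus>\<^bsub>Sp n\<^esub> y \<in> N n" if "x \<in> N n" "y \<in> N n" for x y
    using that k_moduleD(3)[OF module_Sp c] by (auto simp: coaug_image_def simp flip: k_moduleD(3)[OF module_Sp c])
  have "d \<odot>\<^bsub>Sp n\<^esub> \<zero>\<^bsub>Sp n\<^esub> = \<zero>\<^bsub>Sp n\<^esub>" for d
    using k_moduleD(4)[OF module_Sp M.zero_closed, of d 0] k_moduleD(6)[OF module_Sp M.zero_closed] by simp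
  then show "d \<odot>\<^bsub>Sp n\<^esub> x \<in> N n" if "x \<in> N n" for x d
    using that k_moduleD(4)[OF module_Sp c] by (auto simp: coaug_image_def simp flip: k_moduleD(4)[OF module_Sp c])
qed

sublocale N: k_subspace "Sp n" "N n" for n
  by (rule k_subspace_N)

lemma bar_proj_eq: "pj n x = N n +>\<^bsub>Sp n\<^esub> x"
  by (simp add: bar_proj_def)

lemma bar_carrier: "carrier (Xb n) = pj n ` carrier (Sp n)"
  by (simp add: bar_space_def N.quotient_carrier bar_proj_def)

lemma gens_carrier: "carrier (V n) = pj (n + 1) ` carrier (Sp (n + 1))"
  by (simp add: cobar_gens_def bar_carrier)

sublocale Xb: graded_space Xb
  by standard (simp add: bar_space_def N.quotient_closed_ops)

sublocale V: graded_space V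
  by standard (simp add: cobar_gens_def Xb.closed)

lemma bar_linear_on:
  assumes "linear_on (Sp n) s (\<lambda>x. f (pj n x))"
  shows "linear_on (Xb n) s f"
  unfolding bar_space_def by (rule N.quotient_linear_on) (use assms in \<open>simp add: bar_proj_eq\<close>)

lemma pj_add: "x \<in> carrier (Sp n) \<Longrightarrow> y \<in> carrier (Sp n) \<Longrightarrow> pj n (x \<oplus>\<^bsub>Sp n\<^esub> y) = pj n x \<oplus>\<^bsub>Xb n\<^esub> pj n y"
  by (simp add: bar_proj_eq bar_space_def N.quotient_add)

lemma pj_smult: "x \<in> carrier (Sp n) \<Longrightarrow> pj n (c \<odot>\<^bsub>Sp n\<^esub> x) = c \<odot>\<^bsub>Xb n\<^esub> pj n x"
  by (simp add: bar_proj_eq bar_space_def N.quotient_smult)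

lemma linear_on_pj:
  assumes "linear_on (Xb n) s f"
  shows "linear_on (Sp n) s (\<lambda>x. f (pj n x))"
  using assms bar_carrier by (auto simp: linear_on_def pj_add pj_smult)

lemma linear_on_bl: "linear_on (Sp n) scl (\<lambda>x. bl (n, x))"
proof -
  have "linear_on (Xb n) scl (\<lambda>S. letter_nform V (n - 1, S))"
    using V.letter_nform_linear_on[of "n - 1"] by (simp add: cobar_gens_def)
  from linear_on_pj[OF this] show ?thesis by (simp add: bar_letter_def)
qed

lemma bd_N: "bd C n ` N n \<subseteq> N (n - 1)"
proof -
  have z: "bd C n \<zero>\<^bsub>Sp n\<^esub> = \<zero>\<^bsub>Sp (n - 1)\<^esub>"
  proof -
    have "\<zero>\<^bsub>Sp n\<^esub> \<in> carrier (Sp n)" by simp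
    then have "bd C n (0 \<odot>\<^bsub>Sp n\<^esub> \<zero>\<^bsub>Sp n\<^esub>) = 0 \<odot>\<^bsub>Sp (n - 1)\<^esub> bd C n \<zero>\<^bsub>Sp n\<^esub>"
      using lin_bd[of n] by (simp add: lin_map_def)
    then show ?thesis
      using k_moduleD(6)[OF module_Sp, of "\<zero>\<^bsub>Sp n\<^esub>" n] k_moduleD(6)[OF module_Sp, of "bd C n \<zero>\<^bsub>Sp n\<^esub>" "n - 1"]
        bd_closed[of "\<zero>\<^bsub>Sp n\<^esub>" n] by simp
  qed
  show ?thesis
  proof (cases "n = 0")
    case True
    have "bd C 0 (c \<odot>\<^bsub>Sp 0\<^esub> coaug C) \<in> N (- 1)" for c
      using lin_bd[of 0] coaug_closed bd_coaug N.smult_closed[OF N.zero] by (simp add: lin_map_def)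
    then show ?thesis using True by (auto simp: coaug_image_def[of C 0])
  next
    case False
    then show ?thesis using z N.zero by (auto simp: coaug_image_def[of C n])
  qed
qed

lemma bar_bd_pj:
  assumes "x \<in> carrier (Sp n)" shows "bar_bd C n (pj n x) = pj (n - 1) (bd C n x)"
  unfolding bar_bd_def bar_proj_eq by (rule N.quotient_map_coset[OF k_subspace_N lin_bd bd_N assms])

text \<open>\<open>Q\<close> selects one polynomial in the coset of the coproduct. The fourth clause
  characterises it: every representative of that coset has it as normal form.\<close>

lemma coprod_class:
  assumes "x \<in> carrier (Sp n)"
  shows "coprod C n x = Sp.cl (Q n x)" "supp (Q n x) \<subseteq> lists (letters Sp)" "homogeneous n (Q n x)"
    "supp p \<subseteq> lists (letters Sp) \<Longrightarrow> coprod C n x = Sp.cl p \<Longrightarrow> Q n x = nform Sp p"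
    "nform Sp (Q n x) = Q n x"
proof -
  have "coprod C n x \<in> carrier (tensor_square Sp n)" using lin_coprod[of n] assms by (auto simp: lin_map_def)
  then obtain p where p: "supp p \<subseteq> {w \<in> lists (letters Sp). length w = 2 \<and> word_degree w = n}" "coprod C n x = Sp.cl p"
    by (auto simp: tensor_square_def)
  have Qeq: "Q n x = nform Sp p" if "supp p \<subseteq> lists (letters Sp)" "coprod C n x = Sp.cl p" for p
  proof -
    have "\<exists>q. q \<in> coprod C n x" using that(2) Sp.in_tensor_class[OF that(1)] by blast
    then have "(SOME q. q \<in> coprod C n x) \<in> coprod C n x" by (rule someI_ex)
    then have "(SOME q. q \<in> coprod C n x) \<in> Sp.cl p" using that(2) by simp
    then show ?thesis using Sp.tensor_class_eq[OF that(1)] by (simp add: coprod_rep_def)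
  qed
  then show "supp p \<subseteq> lists (letters Sp) \<Longrightarrow> coprod C n x = Sp.cl p \<Longrightarrow> Q n x = nform Sp p" for p .
  have sp: "supp p \<subseteq> lists (letters Sp)" using p by auto
  have q: "Q n x = nform Sp p" by (rule Qeq[OF sp p(2)])
  show "coprod C n x = Sp.cl (Q n x)" "supp (Q n x) \<subseteq> lists (letters Sp)" "nform Sp (Q n x) = Q n x"
    using Sp.tensor_class_nform[OF sp] p(2) Sp.supp_nform by (simp_all add: q)
  have "homogeneous n p" using p by (auto simp: homogeneous_def)
  then show "homogeneous n (Q n x)" by (simp add: q homogeneous_nform)
qed

lemma linear_on_Q: "linear_on (Sp n) scl (Q n)"
proof (rule linear_onI)
  fix x y assume x: "x \<in> carrier (Sp n)" and y: "y \<in> carrier (Sp n)"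
  have "coprod C n (x \<oplus>\<^bsub>Sp n\<^esub> y) = Sp.cl (Q n x + Q n y)"
    using lin_coprod[of n] x y coprod_class(1,2)[OF x] coprod_class(1,2)[OF y]
    by (simp add: lin_map_def tensor_square_def Sp.tensor_add)
  with coprod_class(2)[OF x] coprod_class(2)[OF y]
  show "Q n (x \<oplus>\<^bsub>Sp n\<^esub> y) = Q n x + Q n y"
    using coprod_class(4)[of "x \<oplus>\<^bsub>Sp n\<^esub> y" n "Q n x + Q n y"] x y coprod_class(5)
    by (simp add: Sp.supp_add_lists nform_add)
next
  fix c x assume x: "x \<in> carrier (Sp n)"
  have "coprod C n (c \<odot>\<^bsub>Sp n\<^esub> x) = Sp.cl (scl c (Q n x))"
    using lin_coprod[of n] x coprod_class(1,2)[OF x] by (simp add: lin_map_def tensor_square_def Sp.tensor_smult)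
  moreover have "supp (scl c (Q n x)) \<subseteq> lists (letters Sp)"
    using coprod_class(2)[OF x] supp_scl[of c "Q n x"] by (rule order.trans[rotated])
  ultimately show "Q n (c \<odot>\<^bsub>Sp n\<^esub> x) = scl c (Q n x)"
    using coprod_class(4)[of "c \<odot>\<^bsub>Sp n\<^esub> x" n "scl c (Q n x)"] x coprod_class(5) k_moduleD(1)[OF module_Sp x]
    by (simp add: nform_scl)
qed

end

section \<open>The reduced coproduct and the cobar differential on representatives\<close>

context augmented_dgc
begin

text \<open>The value does not depend on the representative of the coset because the coaugmentation
  is grouplike: its coproduct is the tensor of two copies of itself, and each copy becomes zero in
  the cokernel.\<close>

lemma bar_coprod_pj:
  assumes x: "x \<in> carrier (Sp n)"
  shows "bar_coprod C n (pj n x) =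
    Xb.cl (lin_ext scl (\<lambda>w. single1 (map (\<lambda>(n, x). (n, pj n x)) w)) (Q n x))" (is "_ = Xb.cl (?f (Q n x))")
    and "supp (lin_ext scl (\<lambda>w. single1 (map (\<lambda>(n, x). (n, pj n x)) w)) (Q n x)) \<subseteq> lists (letters Xb)"
proof -
  have pj: "pj n \<in> carrier (Sp n) \<rightarrow> carrier (Xb n)" for n by (auto simp: bar_carrier)
  have lin: "linear_on (Sp n) scl (\<lambda>x. letter_nform Xb (n, pj n x))" for n
    by (rule linear_on_pj[OF Xb.letter_nform_linear_on])
  note tm = tensor_map_class[OF Sp.graded_space_axioms Xb.graded_space_axioms pj lin]
  have tmQ: "tensor_map Xb pj (coprod C n y) = Xb.cl (?f (Q n y))" "supp (?f (Q n y)) \<subseteq> lists (letters Xb)"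
    if "y \<in> carrier (Sp n)" for y
    using tm[OF coprod_class(2)[OF that]] coprod_class(1)[OF that] by simp_all
  define h where "h y = nform Xb (?f (Q n y))" for y
  have h: "linear_on (Sp n) scl h"
    using linear_on_Q[of n] unfolding h_def linear_on_def by (simp add: poly.lin_ext_add poly.lin_ext_scl nform_add nform_scl)
  have hN: "h m = 0" if m: "m \<in> N n" for m
  proof (cases "n = 0")
    case True
    then obtain c where c: "m = c \<odot>\<^bsub>Sp 0\<^esub> coaug C" using m by (auto simp: coaug_image_def)
    have "Q 0 (coaug C) = nform Sp (single1 [(0, coaug C), (0, coaug C)])"
      using coprod_coaug coaug_closed by (intro coprod_class(4)) (auto simp: tensor_word_def)
    then have Qc: "Sp.cl (Q 0 (coaug C)) = Sp.cl (single1 [(0, coaug C), (0, coaug C)])"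
      using coaug_closed by (simp add: Sp.tensor_class_nform)
    let ?w = "single1 [(0, coaug C), (0, coaug C)] :: _ \<Rightarrow>\<^sub>0 'k"
    have w: "supp ?w \<subseteq> lists (letters Sp)" using coaug_closed by simp
    have "Xb.cl (?f (Q 0 (coaug C))) = Xb.cl (?f ?w)"
      using tm(1)[OF coprod_class(2)[OF coaug_closed]] tm(1)[OF w] Qc by simp
    moreover have "supp (?f (Q 0 (coaug C))) \<subseteq> lists (letters Xb)" "supp (?f ?w) \<subseteq> lists (letters Xb)"
      using tm(2)[OF coprod_class(2)[OF coaug_closed]] tm(2)[OF w] by simp_all
    ultimately have "h (coaug C) = nform Xb (?f ?w)" using True by (simp add: h_def Xb.tensor_class_eq_iff)
    also have "\<dots> = letter_nform Xb (0, pj 0 (coaug C)) * letter_nform Xb (0, pj 0 (coaug C))"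
      by (simp add: poly.lin_ext_single nform_word)
    also have "pj 0 (coaug C) = pj 0 \<zero>\<^bsub>Sp 0\<^esub>"
    proof -
      have "coaug C \<in> N 0"
        using k_moduleD(5)[OF module_Sp coaug_closed] by (auto simp: coaug_image_def intro: range_eqI[of _ _ 1])
      then show ?thesis by (simp add: bar_proj_eq N.coset_of_subspace N.zero)
    qed
    also have "letter_nform Xb (0, pj 0 \<zero>\<^bsub>Sp 0\<^esub>) = 0"
      using linear_on_zero[OF module_Sp lin] by simp
    finally show ?thesis using linear_onD(2)[OF h, of "coaug C" c] True coaug_closed by (simp add: c)
  next
    case False
    then show ?thesis using m linear_on_zero[OF module_Sp h] by (simp add: coaug_image_def)
  qed
  have hy: "h y = h x" if y: "y \<in> pj n x" for y
  proof -
    obtain m where "m \<in> N n" "y = m \<oplus>\<^bsub>Sp n\<^esub> x" using y unfolding bar_proj_eq N.coset_iff by blast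
    then show ?thesis using linear_onD(1)[OF h, of m x] hN[of m] x N.subset by auto
  qed
  have "tensor_map Xb pj (coprod C n y) = Xb.cl (?f (Q n x))" if y: "y \<in> pj n x" for y
  proof -
    have "y \<in> carrier (Sp n)" using N.coset_carrier[OF x] y by (simp add: bar_proj_eq)
    then show ?thesis using tmQ[of y] tmQ[OF x] hy[OF y] by (simp add: h_def Xb.tensor_class_eq_iff)
  qed
  moreover have "x \<in> pj n x" using N.self_in_coset[OF x] by (simp add: bar_proj_eq)
  ultimately have "(\<lambda>y. tensor_map Xb pj (coprod C n y)) ` pj n x = {Xb.cl (?f (Q n x))}" by blast
  then show "bar_coprod C n (pj n x) = Xb.cl (?f (Q n x))" by (simp add: bar_coprod_def)
  show "supp (?f (Q n x)) \<subseteq> lists (letters Xb)" by (rule tmQ(2)[OF x])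
qed

lemma nform_bl [simp]: "nform V (bl l) = bl l"
  by (simp add: bar_letter_def V.nform_letter_nform)

lemma supp_bl: "supp (bl l) \<subseteq> lists (letters V)"
  by (simp add: bar_letter_def V.supp_letter_nform)

lemma homogeneous_bl: "homogeneous (fst l - 1) (bl l)"
  using homogeneous_letter_nform[of "(fst l - 1, bar_proj C (fst l) (snd l))" V] by (simp add: bar_letter_def)

abbreviation "sq \<equiv> lin_ext scl (bar_square C)"

text \<open>The formula \<open>d(s x) = - s(bd x) + sum of (-1)^i (s x')(s x'')\<close>, with
  \<open>s\<close> the desuspension and \<open>i\<close> the degree of \<open>x'\<close>, once for
  the coset and once for its normal form. Later computations with generators start from the second
  version.\<close>

lemma cobar_bd_gen_pj:
  assumes x: "x \<in> carrier (Sp n)"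
  shows "cobar_bd_gen C (n - 1) (pj n x) = V.cl (- bl (n - 1, bd C n x) + sq (Q n x))"
    and "dgc_letter_bd C (n - 1, pj n x) = - bl (n - 1, bd C n x) + sq (Q n x)"
proof -
  let ?q = "lin_ext scl (\<lambda>w. single1 (map (\<lambda>(n, x). (n, pj n x)) w)) (Q n x)"
  let ?\<psi> = "\<lambda>i S j T. scl (koszul_sign i) (single1 [(i - 1, S), (j - 1, T)])"
  note bc = bar_coprod_pj[OF x]
  have S1: "supp (?\<psi> i S j T) \<subseteq> lists (letters V)" if "S \<in> carrier (Xb i)" "T \<in> carrier (Xb j)" for i S j T
    using that by (intro order.trans[OF supp_scl]) (auto simp: cobar_gens_def)
  have nf: "nform V (?\<psi> i S j T) = scl (koszul_sign i) (letter_nform V (i - 1, S) * letter_nform V (j - 1, T))" for i S j T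
    by (simp add: nform_scl nform_word del: scl_single)
  have linV: "linear_on (Xb i) scl (\<lambda>S. letter_nform V (i - 1, S))" for i
    using V.letter_nform_linear_on[of "i - 1"] by (simp add: cobar_gens_def)
  have lin: "linear_on (Xb i) scl (\<lambda>S. nform V (?\<psi> i S j T))" "linear_on (Xb j) scl (\<lambda>T. nform V (?\<psi> i S j T))" for i j S T
    unfolding nf using linV[of i] linV[of j] unfolding linear_on_def
    by (simp_all add: distrib_left distrib_right poly.scale_right_distrib poly.scale_mult_left poly.scale_mult_right
        mult.commute)
  have mq: "lin_ext scl (on_pair (\<lambda>i S j T. nform V (?\<psi> i S j T))) ?q
      = lin_ext scl (\<lambda>w. on_pair (\<lambda>i S j T. nform V (?\<psi> i S j T)) (map (\<lambda>(n, x). (n, pj n x)) w)) (Q n x)"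
    by (simp add: poly.lin_ext_comp[OF poly.lin_ext_k_linear] poly.lin_ext_single)
  have nq: "nform V (lin_ext scl (on_pair ?\<psi>) ?q) = sq (Q n x)"
  proof -
    have "nform V (on_pair ?\<psi> w) = on_pair (\<lambda>i S j T. nform V (?\<psi> i S j T)) w" for w
      by (auto simp: on_pair_def split: list.split prod.split)
    moreover have "on_pair (\<lambda>i S j T. nform V (?\<psi> i S j T)) (map (\<lambda>(n, x). (n, pj n x)) w) = bar_square C w" for w
      unfolding nf by (auto simp: on_pair_def bar_square_def bar_letter_def split: list.split prod.split)
    ultimately show ?thesis by (simp add: poly.lin_ext_comp[OF nform_k_linear] mq del: scl_single)
  qed
  have "on_tensor_square V (\<lambda>i x j y. koszul_sign i \<odot>\<^bsub>cobar_algebra C\<^esub> tensor_word V [(i - 1, x), (j - 1, y)])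
      (bar_coprod C n (pj n x)) = V.cl (lin_ext scl (on_pair ?\<psi>) ?q)"
    unfolding bc(1) cobar_algebra_def tensor_word_def
    by (rule on_tensor_square_class[OF Xb.graded_space_axioms V.graded_space_axioms _ lin bc(2)])
      (intro conjI S1 V.tensor_smult, auto simp: cobar_gens_def)
  moreover have supp: "supp (lin_ext scl (on_pair ?\<psi>) ?q) \<subseteq> lists (letters V)"
  proof -
    have "supp (on_pair ?\<psi> w) \<subseteq> lists (letters V)" if "w \<in> lists (letters Xb)" for w
    proof (cases "\<exists>i S j T. w = [(i, S), (j, T)]")
      case True
      then obtain i S j T where "w = [(i, S), (j, T)]" by blast
      with that S1[of S i T j] show ?thesis by simp
    next
      case False
      then show ?thesis by (auto simp: on_pair_def split: list.split prod.split)
    qed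
    with supp_lin_ext[of "on_pair ?\<psi>" ?q] bc(2) show ?thesis by blast
  qed
  moreover have "tensor_word V [(n - 1 - 1, bar_bd C n (pj n x))] = V.cl (single1 [(n - 1 - 1, pj (n - 1) (bd C n x))])"
    by (simp add: tensor_word_def bar_bd_pj[OF x])
  moreover have b: "supp (single1 [(n - 1 - 1, pj (n - 1) (bd C n x))] :: _ \<Rightarrow>\<^sub>0 'k) \<subseteq> lists (letters V)"
    using bd_closed[OF x] by (auto simp: gens_carrier)
  ultimately have g: "cobar_bd_gen C (n - 1) (pj n x)
      = V.cl (- single1 [(n - 1 - 1, pj (n - 1) (bd C n x))] + lin_ext scl (on_pair ?\<psi>) ?q)"
    unfolding cobar_bd_gen_def by (simp add: cobar_algebra_def V.tensor_uminus V.tensor_add del: scl_single)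
  let ?r = "- single1 [(n - 1 - 1, pj (n - 1) (bd C n x))] + lin_ext scl (on_pair ?\<psi>) ?q"
  have r: "supp ?r \<subseteq> lists (letters V)"
    using b supp by (intro V.supp_add_lists) (simp_all del: scl_single)
  have nr: "nform V ?r = - bl (n - 1, bd C n x) + sq (Q n x)"
    by (simp add: nform_add nform_diff nform_uminus nq nform_letter bar_letter_def del: scl_single)
  show "cobar_bd_gen C (n - 1) (pj n x) = V.cl (- bl (n - 1, bd C n x) + sq (Q n x))"
    unfolding g using V.tensor_class_nform[OF r] nr by simp
  have "(SOME p. p \<in> cobar_bd_gen C (n - 1) (pj n x)) \<in> V.cl ?r"
    unfolding g by (rule someI[where P = "\<lambda>p. p \<in> V.cl ?r"]) (rule V.in_tensor_class[OF r])
  then have A: "nform V (SOME p. p \<in> cobar_bd_gen C (n - 1) (pj n x)) = nform V ?r"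
    unfolding V.tensor_class_eq[OF r] by blast
  have B: "dgc_letter_bd C (n - 1, pj n x) = nform V (SOME p. p \<in> cobar_bd_gen C (n - 1) (pj n x))"
    using x by (simp add: dgc_letter_bd_def gens_carrier)
  show "dgc_letter_bd C (n - 1, pj n x) = - bl (n - 1, bd C n x) + sq (Q n x)"
    by (rule trans[OF B trans[OF A nr]])
qed

lemma gens_cases:
  assumes "l \<in> letters V"
  obtains n x where "l = (n - 1, pj n x)" "x \<in> carrier (Sp n)"
proof -
  obtain m S where l: "l = (m, S)" by (cases l)
  with assms obtain x where "x \<in> carrier (Sp (m + 1))" "S = pj (m + 1) x" by (auto simp: gens_carrier)
  then show thesis using that[of "m + 1" x] l by simp
qed

lemma supp_sq: "supp (sq q) \<subseteq> lists (letters V)"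
proof -
  have "supp (bar_square C w) \<subseteq> lists (letters V)" for w
  proof (cases "\<exists>i S j T. w = [(i, S), (j, T)]")
    case True
    then obtain i S j T where w: "w = [(i, S), (j, T)]" by blast
    have "supp (bl (i, S) * bl (j, T)) \<subseteq> lists (letters V)"
      by (intro supp_mult_lists supp_bl)
    then show ?thesis
      using supp_scl[of "koszul_sign i" "bl (i, S) * bl (j, T)"] unfolding w bar_square_def on_pair_simps(1) by blast
  next
    case False
    then show ?thesis by (auto simp: bar_square_def on_pair_def split: list.split prod.split)
  qed
  then show ?thesis using supp_lin_ext[of "bar_square C" q] by blast
qed

lemma letter_bd_class:
  assumes "l \<in> letters V"
  shows "cobar_bd_gen C (fst l) (snd l) = V.cl (dgc_letter_bd C l)" "supp (dgc_letter_bd C l) \<subseteq> lists (letters V)"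
proof -
  obtain n x where x: "l = (n - 1, pj n x)" "x \<in> carrier (Sp n)" by (rule gens_cases[OF assms])
  show "cobar_bd_gen C (fst l) (snd l) = V.cl (dgc_letter_bd C l)" using cobar_bd_gen_pj[OF x(2)] by (simp add: x(1))
  show "supp (dgc_letter_bd C l) \<subseteq> lists (letters V)"
    unfolding x(1) cobar_bd_gen_pj(2)[OF x(2)] by (intro V.supp_add_lists supp_sq) (simp add: supp_bl)
qed

lemma nform_letter_bd [simp]: "nform V (dgc_letter_bd C l) = dgc_letter_bd C l"
  by (simp add: dgc_letter_bd_def)

lemma bar_square_homogeneous: "homogeneous (word_degree w - 2) (bar_square C w)"
proof (cases "\<exists>i S j T. w = [(i, S), (j, T)]")
  case True
  then obtain i S j T where w: "w = [(i, S), (j, T)]" by blast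
  have "homogeneous ((i - 1) + (j - 1)) (bl (i, S) * bl (j, T))"
    using homogeneous_bl[of "(i, S)"] homogeneous_bl[of "(j, T)"] by (intro homogeneous_mult) simp_all
  then show ?thesis unfolding w bar_square_def on_pair_simps by (intro homogeneous_scl) (simp add: algebra_simps)
next
  case False
  then show ?thesis by (auto simp: bar_square_def on_pair_def split: list.split prod.split)
qed

lemma homogeneous_letter_bd: "homogeneous (fst l - 1) (dgc_letter_bd C l)"
proof (cases "l \<in> letters V")
  case True
  obtain n x where x: "l = (n - 1, pj n x)" "x \<in> carrier (Sp n)" by (rule gens_cases[OF True])
  have "homogeneous (n - 2) (sq (Q n x))"
  proof (rule homogeneous_lin_ext)
    fix w assume "w \<in> supp (Q n x)"
    then have "word_degree w = n" using coprod_class(3)[OF x(2)] by (auto simp: homogeneous_def)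
    then show "homogeneous (n - 2) (bar_square C w)" using bar_square_homogeneous[of w] by simp
  qed
  then show ?thesis
    using homogeneous_bl[of "(n - 1, bd C n (x))"] unfolding x(1) cobar_bd_gen_pj(2)[OF x(2)]
    by (intro homogeneous_add homogeneous_uminus) simp_all
qed (simp add: dgc_letter_bd_def)

lemma linear_on_bl_bd: "linear_on (Sp n) scl (\<lambda>x. bl (n - 1, bd C n x))"
  using lin_bd[of n] linear_on_bl[of "n - 1"] bd_closed by (auto simp: linear_on_def lin_map_def)

lemma linear_on_letter_bd: "linear_on (V n) scl (\<lambda>S. dgc_letter_bd C (n, S))"
proof -
  have "linear_on (Sp (n + 1)) scl (\<lambda>x. - bl (n, bd C (n + 1) x) + sq (Q (n + 1) x))"
    using linear_on_bl_bd[of "n + 1"] linear_on_Q[of "n + 1"] unfolding linear_on_def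
    by (simp add: poly.lin_ext_add poly.lin_ext_scl poly.scale_right_diff_distrib)
  then have "linear_on (Sp (n + 1)) scl (\<lambda>x. dgc_letter_bd C (n, pj (n + 1) x))"
    using cobar_bd_gen_pj(2)[where n = "n + 1"] unfolding linear_on_def
    by (simp add: closed_opsD[OF Sp.closed])
  from bar_linear_on[OF this] show ?thesis by (simp add: cobar_gens_def)
qed

lemma cobar_bd_word_class:
  assumes "w \<in> lists (letters V)"
  shows "cobar_bd_word C w = V.cl (der_word (dgc_letter_bd C) w) \<and>
    supp (der_word (dgc_letter_bd C) w) \<subseteq> lists (letters V)"
  using assms
proof (induction w rule: list.induct)
  case Nil
  then show ?case by (simp add: cobar_algebra_def V.tensor_zero)
next
  case (Cons l w)
  then have l: "l \<in> letters V" and w: "w \<in> lists (letters V)" by auto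
  note d = letter_bd_class[OF l] and IH = Cons.IH[OF w]
  have s1: "supp (dgc_letter_bd C l * single1 w) \<subseteq> lists (letters V)"
    using w by (intro supp_mult_lists d) simp
  have s2: "supp (single1 [l] * der_word (dgc_letter_bd C) w) \<subseteq> lists (letters V)"
    using l IH by (intro supp_mult_lists) simp_all
  then have s3: "supp (scl (koszul_sign (fst l)) (single1 [l] * der_word (dgc_letter_bd C) w)) \<subseteq> lists (letters V)"
    using supp_scl by (rule order.trans[rotated])
  have "cobar_bd_word C (l # w) = V.cl (dgc_letter_bd C l * single1 w) \<oplus>\<^bsub>V.TV\<^esub>
      V.cl (scl (koszul_sign (fst l)) (single1 [l] * der_word (dgc_letter_bd C) w))"
    using d IH l w s2 by (simp add: cobar_algebra_def tensor_word_def V.tensor_mult V.tensor_smult)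
  then show ?case using V.tensor_add[OF s1 s3] V.supp_add_lists[OF s1 s3] by simp
qed

lemma cobar_bd_class:
  assumes "supp p \<subseteq> lists (letters V)"
  shows "cobar_bd C n (V.cl p) = V.cl (dC p)"
  unfolding cobar_bd_def cobar_algebra_def der_def
proof (rule coset_extend_tensor[OF V.graded_space_axioms V.graded_space_axioms cobar_bd_word_class _ assms])
  show "multilinear V scl (\<lambda>w. nform V (der_word (dgc_letter_bd C) w))"
    unfolding multilinear_def
  proof (intro ballI allI)
    fix u w n
    \<comment> \<open>The letter \<open>(n, x)\<close> is isolated: it is differentiated in one term
      and kept in the two others, and each term is visibly linear in it.\<close>
    have "nform V (der_word (dgc_letter_bd C) (u @ (n, x) # w)) =
       nform V (der_word (dgc_letter_bd C) u) * (letter_nform V (n, x) * nform V (single1 w)) +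
       scl (koszul_sign (word_degree u)) (nform V (single1 u) * (dgc_letter_bd C (n, x) * nform V (single1 w) +
         scl (koszul_sign n) (letter_nform V (n, x) * nform V (der_word (dgc_letter_bd C) w))))" for x
    proof -
      have "nform V (single1 ((n, x) # w)) = letter_nform V (n, x) * nform V (single1 w)" by (simp add: nform_word)
      then show ?thesis
        by (simp add: der_word_append nform_add nform_mult nform_scl nform_letter)
    qed
    then show "linear_on (V n) scl (\<lambda>x. nform V (der_word (dgc_letter_bd C) (u @ (n, x) # w)))"
      using linear_on_letter_bd[of n] V.letter_nform_linear_on[of n] unfolding linear_on_def
      by (simp add: distrib_left distrib_right poly.scale_right_distrib poly.scale_mult_left
          poly.scale_mult_right mult.commute)
  qed
qed

text \<open>The differential is linear in the letter, so it takes the same value on a letter and on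
  the combination of letters that is its normal form.\<close>

lemma der_letter_nform: "dC (letter_nform V l) = dgc_letter_bd C l"
proof (cases "l \<in> letters V")
  case True
  obtain n S where l: "l = (n, S)" by (cases l)
  have S: "S \<in> carrier (V n)" using True l by simp
  have "dC (letter_nform V l) = lin_ext scl (\<lambda>t. dgc_letter_bd C (n, t)) (normal_form (V n) (single1 S))"
    using S by (simp add: letter_nform_def l poly.lin_ext_comp[OF der_k_linear])
  also have "\<dots> = dgc_letter_bd C l"
    using S by (simp add: poly.lin_ext_normal_form[OF V.closed linear_on_letter_bd] poly.lin_ext_single l)
  finally show ?thesis .
next
  case False
  then show ?thesis by (simp add: letter_nform_def dgc_letter_bd_def der_zero)
qed

text \<open>The fixed points of \<open>nform\<close> thus form a subcomplex of the free algebra,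
  which serves as the model of the cobar construction.\<close>

lemma nform_der: "nform V (dC p) = dC (nform V p)"
  unfolding nform_def
  by (rule alg_ext_der[of p UNIV])
    (simp_all add: homogeneous_letter_nform der_letter_nform flip: nform_def)

lemma der_bl:
  assumes "x \<in> carrier (Sp n)"
  shows "dC (bl (n, x)) = - bl (n - 1, bd C n x) + sq (Q n x)"
  using cobar_bd_gen_pj(2)[OF assms] by (simp add: bar_letter_def der_letter_nform)

end


section \<open>Characters of the homology of cobar constructions\<close>

text \<open>A model of the degree \<open>n\<close> part of the cobar construction whose elements are
  polynomials instead of cosets.\<close>

definition cobar_part :: "('k::field, 'v) dgc \<Rightarrow> int \<Rightarrow> ((int \<times> 'v set) list \<Rightarrow>\<^sub>0 'k) set" where
  "cobar_part C n = {p. nform (cobar_gens C) p = p \<and> homogeneous n p}"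

definition cobar_cycles :: "('k::field, 'v) dgc \<Rightarrow> int \<Rightarrow> ((int \<times> 'v set) list \<Rightarrow>\<^sub>0 'k) set" where
  "cobar_cycles C n = {p \<in> cobar_part C n. der (dgc_letter_bd C) p = 0}"

text \<open>An algebra map from the homology to the field placed in degree 0, written as a function
  on cycles that is unchanged by adding boundaries. Only its values on homogeneous cycles in normal
  form are constrained.\<close>

definition homology_character ::
  "('k::field, 'v) dgc \<Rightarrow> (((int \<times> 'v set) list \<Rightarrow>\<^sub>0 'k) \<Rightarrow> 'k) \<Rightarrow> bool" where
  "homology_character C \<kappa> \<longleftrightarrow>
     (\<forall>n. \<forall>p\<in>cobar_cycles C n. \<forall>q\<in>cobar_cycles C n. \<kappa> (p + q) = \<kappa> p + \<kappa> q) \<and>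
     (\<forall>n c. \<forall>p\<in>cobar_cycles C n. \<kappa> (scl c p) = c * \<kappa> p) \<and>
     \<kappa> 1 = 1 \<and>
     (\<forall>n m. \<forall>p\<in>cobar_cycles C n. \<forall>q\<in>cobar_cycles C m. \<kappa> (p * q) = \<kappa> p * \<kappa> q) \<and>
     (\<forall>n. \<forall>p\<in>cobar_cycles C n. \<forall>q\<in>cobar_cycles C n. \<forall>w\<in>cobar_part C (n + 1).
        p = q + der (dgc_letter_bd C) w \<longrightarrow> \<kappa> p = \<kappa> q) \<and>
     (\<forall>n. \<forall>p\<in>cobar_cycles C n. n \<noteq> 0 \<longrightarrow> \<kappa> p = 0)"

text \<open>The property \<open>P\<close> of the overview: \<open>v\<close> is a right inverse of
  \<open>u\<close> up to the boundary of \<open>w\<close>.\<close>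

definition separated_unit :: "('k::field, 'v) dgc \<Rightarrow> bool" where
  "separated_unit C \<longleftrightarrow> (\<exists>u\<in>cobar_cycles C 0. \<exists>v\<in>cobar_cycles C 0. \<exists>w\<in>cobar_part C 1. \<exists>\<kappa> \<kappa>'.
     u * v = 1 + der (dgc_letter_bd C) w \<and> homology_character C \<kappa> \<and> homology_character C \<kappa>' \<and> \<kappa> u \<noteq> \<kappa>' u)"

lemma cobar_part_closed:
  shows "p \<in> cobar_part C n \<Longrightarrow> q \<in> cobar_part C n \<Longrightarrow> p + q \<in> cobar_part C n"
    and "p \<in> cobar_part C n \<Longrightarrow> q \<in> cobar_part C n \<Longrightarrow> p - q \<in> cobar_part C n"
    and "p \<in> cobar_part C n \<Longrightarrow> - p \<in> cobar_part C n"
    and "p \<in> cobar_part C n \<Longrightarrow> scl c p \<in> cobar_part C n"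
    and "p \<in> cobar_part C n \<Longrightarrow> r \<in> cobar_part C m \<Longrightarrow> p * r \<in> cobar_part C (n + m)"
    and "0 \<in> cobar_part C n" "1 \<in> cobar_part C 0"
  by (auto simp: cobar_part_def nform_add nform_diff nform_uminus nform_scl nform_mult homogeneous_add
      homogeneous_diff homogeneous_uminus homogeneous_scl homogeneous_mult homogeneous_one)

lemma cobar_cycles_closed:
  shows "p \<in> cobar_cycles C n \<Longrightarrow> q \<in> cobar_cycles C n \<Longrightarrow> p + q \<in> cobar_cycles C n"
    and "p \<in> cobar_cycles C n \<Longrightarrow> q \<in> cobar_cycles C n \<Longrightarrow> p - q \<in> cobar_cycles C n"
    and "p \<in> cobar_cycles C n \<Longrightarrow> scl c p \<in> cobar_cycles C n"
    and "p \<in> cobar_cycles C n \<Longrightarrow> r \<in> cobar_cycles C m \<Longrightarrow> p * r \<in> cobar_cycles C (n + m)"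
    and "0 \<in> cobar_cycles C n" "1 \<in> cobar_cycles C 0"
  by (auto simp: cobar_cycles_def cobar_part_closed der_add der_diff der_scl der_mult der_zero)

lemma homology_characterD:
  assumes "homology_character C \<kappa>"
  shows "p \<in> cobar_cycles C n \<Longrightarrow> q \<in> cobar_cycles C n \<Longrightarrow> \<kappa> (p + q) = \<kappa> p + \<kappa> q"
    and "p \<in> cobar_cycles C n \<Longrightarrow> \<kappa> (scl c p) = c * \<kappa> p"
    and "\<kappa> 1 = 1"
    and "p \<in> cobar_cycles C n \<Longrightarrow> r \<in> cobar_cycles C m \<Longrightarrow> \<kappa> (p * r) = \<kappa> p * \<kappa> r"
    and "p \<in> cobar_cycles C n \<Longrightarrow> q \<in> cobar_cycles C n \<Longrightarrow> w \<in> cobar_part C (n + 1) \<Longrightarrow>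
      p = q + der (dgc_letter_bd C) w \<Longrightarrow> \<kappa> p = \<kappa> q"
    and "p \<in> cobar_cycles C n \<Longrightarrow> n \<noteq> 0 \<Longrightarrow> \<kappa> p = 0"
proof -
  note a = assms[unfolded homology_character_def]
  note a2 = a[THEN conjunct2] note a3 = a2[THEN conjunct2] note a4 = a3[THEN conjunct2]
  note a5 = a4[THEN conjunct2] note a6 = a5[THEN conjunct2]
  show "p \<in> cobar_cycles C n \<Longrightarrow> q \<in> cobar_cycles C n \<Longrightarrow> \<kappa> (p + q) = \<kappa> p + \<kappa> q"
    using a[THEN conjunct1] by blast
  show "p \<in> cobar_cycles C n \<Longrightarrow> \<kappa> (scl c p) = c * \<kappa> p" using a2[THEN conjunct1] by blast
  show "\<kappa> 1 = 1" using a3[THEN conjunct1] .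
  show "p \<in> cobar_cycles C n \<Longrightarrow> r \<in> cobar_cycles C m \<Longrightarrow> \<kappa> (p * r) = \<kappa> p * \<kappa> r"
    using a4[THEN conjunct1] by blast
  show "p \<in> cobar_cycles C n \<Longrightarrow> q \<in> cobar_cycles C n \<Longrightarrow> w \<in> cobar_part C (n + 1) \<Longrightarrow>
      p = q + der (dgc_letter_bd C) w \<Longrightarrow> \<kappa> p = \<kappa> q"
    using a5[THEN conjunct1] by blast
  show "p \<in> cobar_cycles C n \<Longrightarrow> n \<noteq> 0 \<Longrightarrow> \<kappa> p = 0" using a6 by blast
qed

lemma homology_character_zero:
  assumes "homology_character C \<kappa>" shows "\<kappa> 0 = 0"
proof -
  have "\<kappa> (scl 0 0) = 0 * \<kappa> 0" by (rule homology_characterD(2)[OF assms cobar_cycles_closed(5)])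
  then show ?thesis by simp
qed

lemma homogeneous_two_degrees:
  assumes "homogeneous n p" "homogeneous m p" "n \<noteq> m" shows "p = 0"
proof -
  have "supp p = {}" using assms unfolding homogeneous_def by fastforce
  then show ?thesis by simp
qed

text \<open>What a quasi-isomorphism of cobar constructions provides in terms of polynomials. The
  assumptions \<open>surj\<close> and \<open>inj\<close> are the two halves of bijectivity on
  homology, stated for cycles.\<close>

locale cobar_quasi_iso =
  fixes C :: "('k::field, 'v) dgc" and C' :: "('k, 'w) dgc"
    and f :: "((int \<times> 'v set) list \<Rightarrow>\<^sub>0 'k) \<Rightarrow> ((int \<times> 'w set) list \<Rightarrow>\<^sub>0 'k)"
  assumes f_linear: "k_linear scl f" and f_mult: "f (p * q) = f p * f q" and f_one: "f 1 = 1"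
    and f_part: "p \<in> cobar_part C n \<Longrightarrow> f p \<in> cobar_part C' n"
    and f_der: "p \<in> cobar_part C n \<Longrightarrow> f (der (dgc_letter_bd C) p) = der (dgc_letter_bd C') (f p)"
    and surj: "z' \<in> cobar_cycles C' n \<Longrightarrow>
      \<exists>z\<in>cobar_cycles C n. \<exists>w\<in>cobar_part C' (n + 1). z' = f z + der (dgc_letter_bd C') w"
    and inj: "z \<in> cobar_cycles C n \<Longrightarrow> w \<in> cobar_part C' (n + 1) \<Longrightarrow> f z = der (dgc_letter_bd C') w \<Longrightarrow>
      \<exists>w\<in>cobar_part C (n + 1). z = der (dgc_letter_bd C) w"
begin

abbreviation "d \<equiv> der (dgc_letter_bd C)"
abbreviation "d' \<equiv> der (dgc_letter_bd C')"
abbreviation "A \<equiv> cobar_part C"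
abbreviation "A' \<equiv> cobar_part C'"
abbreviation "Z \<equiv> cobar_cycles C"
abbreviation "Z' \<equiv> cobar_cycles C'"

lemma f_cycle: "z \<in> Z n \<Longrightarrow> f z \<in> Z' n"
  using f_der[of z n] f_part[of z n] by (auto simp: cobar_cycles_def k_linear_zero[OF f_linear])

text \<open>An explicit correction term for the product of two lifts. The factor \<open>f z1\<close>
  is a cycle of degree \<open>n\<close>, so the sign \<open>(-1)^n\<close> turns the differential of
  \<open>f z1 * b\<close> into \<open>f z1 * d' b\<close>; since \<open>z2'\<close> is a cycle as
  well, \<open>a * z2'\<close> accounts for \<open>d' a * z2'\<close>.\<close>

lemma mult_boundary:
  assumes "z1 \<in> Z n" "z2' \<in> Z' m" "z2 \<in> Z m" "a \<in> A' (n + 1)" "b \<in> A' (m + 1)" "z1' = f z1 + d' a" "z2' = f z2 + d' b"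
  shows "z1' * z2' = f (z1 * z2) + d' (scl (koszul_sign n) (f z1 * b) + a * z2')"
    and "scl (koszul_sign n) (f z1 * b) + a * z2' \<in> A' (n + m + 1)"
proof -
  have fz: "f z1 \<in> A' n" "d' (f z1) = 0" "homogeneous n (f z1)"
    using f_cycle[OF assms(1)] by (auto simp: cobar_cycles_def cobar_part_def)
  have z2: "d' z2' = 0" "z2' \<in> A' m" using assms(2) by (auto simp: cobar_cycles_def)
  have "d' (scl (koszul_sign n) (f z1 * b)) = f z1 * d' b"
    using fz by (simp add: der_scl der_mult_homogeneous poly.scale_scale)
  moreover have "d' (a * z2') = d' a * z2'" using z2 by (simp add: der_mult)
  ultimately show "z1' * z2' = f (z1 * z2) + d' (scl (koszul_sign n) (f z1 * b) + a * z2')"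
    by (simp add: der_add f_mult assms(6,7) algebra_simps)
  have "f z1 * b \<in> A' (n + (m + 1))" "a * z2' \<in> A' (n + 1 + m)"
    using fz z2 assms(4,5) by (auto intro: cobar_part_closed)
  then show "scl (koszul_sign n) (f z1 * b) + a * z2' \<in> A' (n + m + 1)"
    by (intro cobar_part_closed(1,4)) (simp_all add: ac_simps)
qed

text \<open>The two classes are lifted along the surjection on homology. The lift satisfies the unit
  equation up to a boundary because the difference \<open>u * v - 1\<close> becomes a boundary under
  \<open>f\<close> and injectivity applies. Characters are pulled back by composition.\<close>

lemma separated_unit_pull:
  assumes "separated_unit C'" shows "separated_unit C"
proof -
  obtain u' v' w' \<kappa> \<psi> where *: "u' \<in> Z' 0" "v' \<in> Z' 0" "w' \<in> A' 1" "u' * v' = 1 + d' w'"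
    "homology_character C' \<kappa>" "homology_character C' \<psi>" "\<kappa> u' \<noteq> \<psi> u'"
    using assms unfolding separated_unit_def by blast
  obtain u a where u: "u \<in> Z 0" "a \<in> A' (0 + 1)" "u' = f u + d' a" using surj[OF *(1)] by blast
  obtain v b where v: "v \<in> Z 0" "b \<in> A' (0 + 1)" "v' = f v + d' b" using surj[OF *(2)] by blast
  note mb = mult_boundary[OF u(1) *(2) v(1) u(2) v(2) u(3) v(3)]
  let ?s = "scl (koszul_sign 0) (f u * b) + a * v'"
  have "f (u * v - 1) = d' (w' - ?s)"
    using mb(1) *(4) by (simp add: k_linear_diff[OF f_linear] f_one der_diff algebra_simps)
  moreover have "w' - ?s \<in> A' (0 + 1)" using cobar_part_closed(2)[of w' C' 1 ?s] mb(2) *(3) by simp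
  moreover have "u * v - 1 \<in> Z 0"
    using cobar_cycles_closed(2)[OF _ cobar_cycles_closed(6)] cobar_cycles_closed(4)[OF u(1) v(1)] by simp
  ultimately obtain w where w: "w \<in> A (0 + 1)" "u * v - 1 = d w" using inj by blast
  have char: "homology_character C (\<lambda>p. \<theta> (f p))" if \<theta>: "homology_character C' \<theta>" for \<theta>
  proof -
    note t = homology_characterD[OF \<theta>]
    have 5: "\<theta> (f p) = \<theta> (f q)" if "p \<in> Z n" "q \<in> Z n" "w \<in> A (n + 1)" "p = q + d w" for n p q w
      using t(5)[OF f_cycle[OF that(1)] f_cycle[OF that(2)] f_part[OF that(3)]] f_der[OF that(3)] that(4)
      by (simp add: k_linear_add[OF f_linear])
    have 1: "\<theta> (f (p + q)) = \<theta> (f p) + \<theta> (f q)" if "p \<in> Z n" "q \<in> Z n" for n p q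
      using t(1)[OF f_cycle[OF that(1)] f_cycle[OF that(2)]] by (simp add: k_linear_add[OF f_linear])
    have 2: "\<theta> (f (scl c p)) = c * \<theta> (f p)" if "p \<in> Z n" for n c p
      using t(2)[OF f_cycle[OF that]] by (simp add: k_linear_scl[OF f_linear])
    have 4: "\<theta> (f (p * q)) = \<theta> (f p) * \<theta> (f q)" if "p \<in> Z n" "q \<in> Z m" for n m p q
      using t(4)[OF f_cycle[OF that(1)] f_cycle[OF that(2)]] by (simp add: f_mult)
    have 6: "\<theta> (f p) = 0" if "p \<in> Z n" "n \<noteq> 0" for n p
      using t(6)[OF f_cycle[OF that(1)] that(2)] .
    show ?thesis
      unfolding homology_character_def f_one using 1 2 t(3) 4 5 6 by blast
  qed
  have eq: "\<theta> (f u) = \<theta> u'" if "homology_character C' \<theta>" for \<theta>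
    using homology_characterD(5)[OF that *(1) f_cycle[OF u(1)] u(2,3)] by simp
  show ?thesis
    unfolding separated_unit_def
  proof (intro bexI exI conjI)
    show "u * v = 1 + d w" using w(2) by (simp add: algebra_simps)
    show "\<kappa> (f u) \<noteq> \<psi> (f u)" using eq[OF *(5)] eq[OF *(6)] *(7) by simp
  qed (use u v w char * in simp_all)
qed

text \<open>A character is evaluated on a lift of the cycle. Two lifts of the same degree differ by
  a cycle whose image is a boundary; it is then a boundary itself, and the character vanishes on
  it.\<close>

lemma character_push:
  assumes \<kappa>: "homology_character C \<kappa>"
  shows "\<exists>\<kappa>'. homology_character C' \<kappa>' \<and> (\<forall>n. \<forall>z\<in>Z n. \<kappa>' (f z) = \<kappa> z)"
proof -
  note c = homology_characterD[OF \<kappa>]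
  define R where "R z' z \<longleftrightarrow> (\<exists>n. \<exists>w\<in>A' (n + 1). z' \<in> Z' n \<and> z \<in> Z n \<and> z' = f z + d' w)" for z' z
  define \<kappa>' where "\<kappa>' z' = \<kappa> (SOME z. R z' z)" for z'
  have bd: "\<kappa> z = 0" if z: "z \<in> Z n" and w: "w \<in> A' (n + 1)" "f z = d' w" for z n w
  proof -
    obtain w where "w \<in> A (n + 1)" "z = d w" using inj[OF z w] by blast
    then show ?thesis
      using c(5)[OF z cobar_cycles_closed(5), of w] homology_character_zero[OF \<kappa>] by simp
  qed
  have eq: "\<kappa>' z' = \<kappa> z" if z': "z' \<in> Z' n" and z: "z \<in> Z n" and w: "w \<in> A' (n + 1)" "z' = f z + d' w" for z' z n w
  proof -
    have "R z' z" using that unfolding R_def by blast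
    then have "R z' (SOME z. R z' z)" by (rule someI)
    then obtain m w1 z1 where 1: "z1 = (SOME z. R z' z)" "w1 \<in> A' (m + 1)" "z' \<in> Z' m" "z1 \<in> Z m" "z' = f z1 + d' w1"
      unfolding R_def by blast
    have "\<kappa> z = \<kappa> z1"
    proof (cases "n = m")
      case True
      have "f (z - z1) = d' (w1 - w)"
        using 1(5) w(2) by (simp add: k_linear_diff[OF f_linear] der_diff algebra_simps)
      moreover have "z - z1 \<in> Z n" "w1 - w \<in> A' (n + 1)"
        using True 1 z w by (auto intro: cobar_cycles_closed cobar_part_closed)
      ultimately have "\<kappa> (z - z1) = 0" using bd by blast
      then show ?thesis using c(1)[OF \<open>z - z1 \<in> Z n\<close>, of z1] 1(4) True by simp
    next
      case False
      \<comment> \<open>The chosen lift may have a degree other than that of \<open>z\<close>. This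
        is possible only if the cycle is zero, and then both lifts have bounding images and both
        values vanish.\<close>
      then have "z' = 0"
        using homogeneous_two_degrees[of n z' m] z' 1(3) by (simp add: cobar_cycles_def cobar_part_def)
      then have "f z = d' (- w)" "f z1 = d' (- w1)" using w(2) 1(5) by (simp_all add: der_uminus eq_neg_iff_add_eq_0)
      then have "\<kappa> z = 0" "\<kappa> z1 = 0"
        using bd[OF z cobar_part_closed(3)[OF w(1)]] bd[OF 1(4) cobar_part_closed(3)[OF 1(2)]] by auto
      then show ?thesis by simp
    qed
    then show ?thesis by (simp add: \<kappa>'_def 1(1))
  qed
  have fz: "\<kappa>' (f z) = \<kappa> z" if "z \<in> Z n" for n z
    using eq[OF f_cycle[OF that] that cobar_part_closed(6)] by (simp add: der_zero)
  have "homology_character C' \<kappa>'"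
    unfolding homology_character_def
  proof (intro conjI allI ballI impI)
    show "\<kappa>' 1 = 1" using fz[OF cobar_cycles_closed(6)] c(3) f_one by simp
    fix n p assume p: "p \<in> Z' n"
    obtain z w where z: "z \<in> Z n" "w \<in> A' (n + 1)" "p = f z + d' w" using surj[OF p] by blast
    have pz: "\<kappa>' p = \<kappa> z" by (rule eq[OF p z])
    show "\<kappa>' (scl c p) = c * \<kappa>' p" for c
    proof -
      have "scl c p = f (scl c z) + d' (scl c w)"
        by (simp add: z(3) k_linear_scl[OF f_linear] der_scl poly.scale_right_distrib)
      from eq[OF cobar_cycles_closed(3)[OF p] cobar_cycles_closed(3)[OF z(1)] cobar_part_closed(4)[OF z(2)] this]
      show ?thesis by (simp add: pz c(2)[OF z(1)])
    qed
    show "\<kappa>' p = 0" if "n \<noteq> 0" using c(6)[OF z(1) that] pz by simp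
    {
      fix q assume q: "q \<in> Z' n"
      obtain y v where y: "y \<in> Z n" "v \<in> A' (n + 1)" "q = f y + d' v" using surj[OF q] by blast
      have qy: "\<kappa>' q = \<kappa> y" by (rule eq[OF q y])
      have "p + q = f (z + y) + d' (w + v)"
        using z y by (simp add: k_linear_add[OF f_linear] der_add)
      from eq[OF cobar_cycles_closed(1)[OF p q] cobar_cycles_closed(1)[OF z(1) y(1)] cobar_part_closed(1)[OF z(2) y(2)] this]
      show "\<kappa>' (p + q) = \<kappa>' p + \<kappa>' q" by (simp add: pz qy c(1)[OF z(1) y(1)])
      fix x assume x: "x \<in> A' (n + 1)" "p = q + d' x"
      then have "p = f y + d' (v + x)" using y by (simp add: der_add)
      from eq[OF p y(1) cobar_part_closed(1)[OF y(2) x(1)] this] show "\<kappa>' p = \<kappa>' q" by (simp add: qy)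
    next
      fix m q assume q: "q \<in> Z' m"
      obtain y v where y: "y \<in> Z m" "v \<in> A' (m + 1)" "q = f y + d' v" using surj[OF q] by blast
      have qy: "\<kappa>' q = \<kappa> y" by (rule eq[OF q y])
      note mb = mult_boundary[OF z(1) q y(1) z(2) y(2) z(3) y(3)]
      from eq[OF cobar_cycles_closed(4)[OF p q] cobar_cycles_closed(4)[OF z(1) y(1)] mb(2) mb(1)]
      show "\<kappa>' (p * q) = \<kappa>' p * \<kappa>' q" by (simp add: pz qy c(4)[OF z(1) y(1)])
    }
  qed
  then show ?thesis using fz by blast
qed

lemma separated_unit_push:
  assumes "separated_unit C" shows "separated_unit C'"
proof -
  obtain u v w \<kappa> \<psi> where *: "u \<in> Z 0" "v \<in> Z 0" "w \<in> A 1" "u * v = 1 + d w"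
    "homology_character C \<kappa>" "homology_character C \<psi>" "\<kappa> u \<noteq> \<psi> u"
    using assms unfolding separated_unit_def by blast
  obtain \<kappa>' where \<kappa>': "homology_character C' \<kappa>'" "\<kappa>' (f u) = \<kappa> u" using character_push[OF *(5)] *(1) by blast
  obtain \<psi>' where \<psi>': "homology_character C' \<psi>'" "\<psi>' (f u) = \<psi> u" using character_push[OF *(6)] *(1) by blast
  have "f u * f v = 1 + d' (f w)"
    using f_mult[of u v] f_der[OF *(3)] *(4) by (simp add: k_linear_add[OF f_linear] f_one)
  then show ?thesis
    unfolding separated_unit_def using * \<kappa>' \<psi>' f_cycle f_part by metis
qed

end


section \<open>Invariance under quasi-isomorphisms of cobar constructions\<close>

locale dgc_morphism = C: augmented_dgc C + C': augmented_dgc C'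
  for C :: "('k::field, 'v) dgc" and C' :: "('k, 'w) dgc" +
  fixes g :: "int \<Rightarrow> 'v \<Rightarrow> 'w"
  assumes hom: "dgc_hom C C' g"
begin

lemma g_lin: "lin_map (space C n) (space C' n) (g n)"
  and g_coaug: "g 0 (coaug C) = coaug C'"
  using hom by (auto simp: dgc_hom_def)

lemma g_N: "g n ` coaug_image C n \<subseteq> coaug_image C' n"
proof (cases "n = 0")
  case True
  then show ?thesis
    using g_lin[of 0] g_coaug C.coaug_closed by (auto simp: coaug_image_def lin_map_def)
next
  case False
  have z: "\<zero>\<^bsub>space C n\<^esub> \<in> carrier (space C n)" by simp
  then have "g n (0 \<odot>\<^bsub>space C n\<^esub> \<zero>\<^bsub>space C n\<^esub>) = 0 \<odot>\<^bsub>space C' n\<^esub> g n \<zero>\<^bsub>space C n\<^esub>"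
    using g_lin[of n] by (simp add: lin_map_def)
  moreover have "g n \<zero>\<^bsub>space C n\<^esub> \<in> carrier (space C' n)" using g_lin[of n] z by (auto simp: lin_map_def)
  ultimately have "g n \<zero>\<^bsub>space C n\<^esub> = \<zero>\<^bsub>space C' n\<^esub>"
    using k_moduleD(6)[OF C.module_Sp z] k_moduleD(6)[OF C'.module_Sp] by simp
  then show ?thesis using False by (simp add: coaug_image_def)
qed

lemma bar_map_pj: "x \<in> carrier (space C n) \<Longrightarrow> bar_map C' g n (bar_proj C n x) = bar_proj C' n (g n x)"
  unfolding bar_map_def bar_proj_def by (rule C'.N.quotient_map_coset[OF C.k_subspace_N g_lin g_N])

text \<open>The map of cobar constructions on polynomials; sending each letter to a normal form
  makes all its values normal forms.\<close>

definition f :: "((int \<times> 'v set) list \<Rightarrow>\<^sub>0 'k) \<Rightarrow> ((int \<times> 'w set) list \<Rightarrow>\<^sub>0 'k)" where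
  "f = alg_ext scl (\<lambda>l. letter_nform (cobar_gens C') (fst l, bar_map C' g (fst l + 1) (snd l)))"

lemma bar_map_closed: "bar_map C' g (n + 1) \<in> carrier (cobar_gens C n) \<rightarrow> carrier (cobar_gens C' n)"
  using g_lin[of "n + 1"] by (auto simp: C.gens_carrier C'.gens_carrier bar_map_pj lin_map_def)

lemma bar_map_linear_on:
  "linear_on (cobar_gens C n) scl (\<lambda>S. letter_nform (cobar_gens C') (n, bar_map C' g (n + 1) S))"
proof -
  have "linear_on (space C (n + 1)) scl (\<lambda>x. bar_letter C' (n + 1, g (n + 1) x))"
    using C'.linear_on_bl[of "n + 1"] g_lin[of "n + 1"] unfolding linear_on_def lin_map_def by (auto simp: Pi_iff)
  moreover have "closed_ops (space C (n + 1))" by (rule C.Sp.closed)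
  ultimately have "linear_on (space C (n + 1)) scl
      (\<lambda>x. letter_nform (cobar_gens C') (n, bar_map C' g (n + 1) (bar_proj C (n + 1) x)))"
    unfolding linear_on_def by (simp add: bar_map_pj closed_opsD bar_letter_def)
  from C.bar_linear_on[OF this] show ?thesis by (simp add: cobar_gens_def[of C])
qed

lemma cobar_map_class:
  assumes p: "supp p \<subseteq> lists (letters (cobar_gens C))"
  shows "cobar_map C' g n (C.V.cl p) = C'.V.cl (f p)"
proof -
  let ?h = "\<lambda>n. bar_map C' g (n + 1)"
  let ?q = "lin_ext scl (\<lambda>w. single1 (map (\<lambda>(n, x). (n, ?h n x)) w)) p"
  note tm = tensor_map_class[OF C.V.graded_space_axioms C'.V.graded_space_axioms bar_map_closed bar_map_linear_on p]
  have "nform (cobar_gens C') ?q = f p"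
    unfolding poly.lin_ext_comp[OF nform_k_linear] nform_map f_def alg_ext_def
    by (simp add: case_prod_unfold)
  then show ?thesis
    using tm C'.V.tensor_class_nform[OF tm(2)] by (simp add: cobar_map_def)
qed

lemma f_linear: "k_linear scl f"
  unfolding f_def by (rule poly.alg_ext_k_linear)

lemma f_nform: "nform (cobar_gens C') (f p) = f p"
  unfolding f_def nform_def poly.alg_ext_comp by (simp add: C'.V.nform_letter_nform flip: nform_def)

lemma f_part: "p \<in> cobar_part C n \<Longrightarrow> f p \<in> cobar_part C' n"
proof -
  have h: "homogeneous (fst l) (letter_nform (cobar_gens C') (fst l, S))" for l :: "int \<times> 'v set" and S
    using homogeneous_letter_nform[of "(fst l, S)"] by simp
  assume "p \<in> cobar_part C n"
  then show ?thesis using homogeneous_alg_ext[OF _ h, of n p] by (simp add: cobar_part_def f_nform) (simp add: f_def)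
qed

lemma part_supp: "p \<in> cobar_part C n \<Longrightarrow> supp p \<subseteq> lists (letters (cobar_gens C))"
  using C.V.supp_nform[of p] by (simp add: cobar_part_def)

end

section \<open>The homology of the cobar construction by representatives\<close>

context augmented_dgc
begin

lemma part_supp: "p \<in> cobar_part C n \<Longrightarrow> supp p \<subseteq> lists (letters V)"
  using V.supp_nform[of p] by (simp add: cobar_part_def)

lemma part_der: "p \<in> cobar_part C n \<Longrightarrow> dC p \<in> cobar_part C (n - 1)"
  using homogeneous_der[of UNIV "dgc_letter_bd C" n p] homogeneous_letter_bd
  by (simp add: cobar_part_def nform_der)

lemma part_class_inj: "p \<in> cobar_part C n \<Longrightarrow> q \<in> cobar_part C m \<Longrightarrow> V.cl p = V.cl q \<Longrightarrow> p = q"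
  using V.tensor_class_eq_iff[OF part_supp part_supp, of p n q m] by (simp add: cobar_part_def)

lemma cobar_space_carrier: "carrier (cobar_space C n) = V.cl ` cobar_part C n"
proof -
  have "V.cl p \<in> V.cl ` cobar_part C n" if "supp p \<subseteq> {w \<in> lists (letters V). word_degree w = n}" for p
  proof -
    have s: "supp p \<subseteq> lists (letters V)" "homogeneous n p" using that by (auto simp: homogeneous_def)
    then have "nform V p \<in> cobar_part C n" by (simp add: cobar_part_def homogeneous_nform)
    then show ?thesis using V.tensor_class_nform[OF s(1)] by (metis imageI)
  qed
  moreover have "V.cl p \<in> V.cl ` {p. supp p \<subseteq> {w \<in> lists (letters V). word_degree w = n}}" if "p \<in> cobar_part C n" for p
    using that part_supp[OF that] by (auto simp: cobar_part_def homogeneous_def)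
  ultimately show ?thesis by (auto simp: cobar_space_def tensor_degree_part_def)
qed

lemma cobar_space_ops:
  "add (cobar_space C n) = add V.TV" "\<zero>\<^bsub>cobar_space C n\<^esub> = V.cl 0"
  by (simp_all add: cobar_space_def tensor_degree_part_def V.tensor_zero)

lemma cobar_bd_image: "cobar_bd C n ` carrier (cobar_space C n) = (\<lambda>w. V.cl (dC w)) ` cobar_part C n"
  by (auto simp: cobar_space_carrier cobar_bd_class[OF part_supp] image_iff)

lemma cobar_coset:
  assumes "z \<in> cobar_part C n"
  shows "(cobar_bd C (n + 1) ` carrier (cobar_space C (n + 1))) +>\<^bsub>cobar_space C n\<^esub> V.cl z
    = (\<lambda>w. V.cl (dC w + z)) ` cobar_part C (n + 1)"
proof -
  have "V.cl (dC w) \<oplus>\<^bsub>cobar_space C n\<^esub> V.cl z = V.cl (dC w + z)" if "w \<in> cobar_part C (n + 1)" for w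
    using V.tensor_add[OF part_supp[OF part_der[OF that]] part_supp[OF assms]] by (simp add: cobar_space_ops)
  then show ?thesis
    unfolding a_r_coset_def' cobar_bd_image by (auto simp: image_iff)
qed

text \<open>Elements of the homology are cosets of cosets. Listing each one as the classes of all
  \<open>dC w + z\<close> allows it to be compared through polynomials.\<close>

lemma homology_carrier:
  "carrier (homology (cobar_space C) (cobar_bd C) n) =
    (\<lambda>z. (\<lambda>w. V.cl (dC w + z)) ` cobar_part C (n + 1)) ` cobar_cycles C n"
proof -
  have cyc: "{z \<in> carrier (cobar_space C n). cobar_bd C n z = \<zero>\<^bsub>cobar_space C (n - 1)\<^esub>} = V.cl ` cobar_cycles C n"
    using part_class_inj[OF part_der cobar_part_closed(6)]
    by (auto simp: cobar_space_carrier cobar_bd_class[OF part_supp] cobar_space_ops cobar_cycles_def image_iff)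
  show ?thesis
    unfolding homology_def quotient_module_def A_RCOSETS_def' cyc
    using cobar_coset by (auto simp: a_r_coset_def' cobar_cycles_def image_iff)
qed

end

context dgc_morphism
begin

lemma quotient_map_cobar:
  assumes z: "z \<in> cobar_part C n" and fd: "\<And>p n. p \<in> cobar_part C n \<Longrightarrow> f (C.dC p) = C'.dC (f p)"
  shows "quotient_map (cobar_space C' n) (cobar_bd C' (n + 1) ` carrier (cobar_space C' (n + 1))) (cobar_map C' g n)
      ((\<lambda>w. C.V.cl (C.dC w + z)) ` cobar_part C (n + 1))
    = (\<lambda>w. C'.V.cl (C'.dC w + f z)) ` cobar_part C' (n + 1)" (is "?L = ?R")
proof -
  have cm: "cobar_map C' g n (C.V.cl (C.dC w + z)) = C'.V.cl (C'.dC (f w) + f z)" if "w \<in> cobar_part C (n + 1)" for w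
  proof -
    have "C.dC w + z \<in> cobar_part C n" using C.part_der[OF that] z by (intro cobar_part_closed) simp_all
    then show ?thesis
      by (simp add: cobar_map_class[OF part_supp] k_linear_add[OF f_linear] fd[OF that])
  qed
  have add: "C'.V.cl (C'.dC w') \<oplus>\<^bsub>cobar_space C' n\<^esub> C'.V.cl (C'.dC (f w) + f z) = C'.V.cl (C'.dC (w' + f w) + f z)"
    if "w' \<in> cobar_part C' (n + 1)" "w \<in> cobar_part C (n + 1)" for w w'
  proof -
    have "C'.dC w' \<in> cobar_part C' n" "C'.dC (f w) + f z \<in> cobar_part C' n"
      using C'.part_der[OF that(1)] C'.part_der[OF f_part[OF that(2)]] f_part[OF z]
      by (auto intro: cobar_part_closed)
    then show ?thesis
      using C'.V.tensor_add[OF C'.part_supp C'.part_supp] by (simp add: C'.cobar_space_ops der_add add.assoc)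
  qed
  have "?L = {C'.V.cl (C'.dC (w' + f w) + f z) | w' w. w' \<in> cobar_part C' (n + 1) \<and> w \<in> cobar_part C (n + 1)}"
    unfolding quotient_map_def set_add_def' C'.cobar_bd_image using cm add by (auto simp: image_iff)
  also have "\<dots> = ?R"
  proof
    show "{C'.V.cl (C'.dC (w' + f w) + f z) | w' w. w' \<in> cobar_part C' (n + 1) \<and> w \<in> cobar_part C (n + 1)} \<subseteq> ?R"
      using cobar_part_closed(1) f_part by fastforce
    show "?R \<subseteq> {C'.V.cl (C'.dC (w' + f w) + f z) | w' w. w' \<in> cobar_part C' (n + 1) \<and> w \<in> cobar_part C (n + 1)}"
    proof
      fix y assume "y \<in> ?R"
      then obtain w' where w': "w' \<in> cobar_part C' (n + 1)" "y = C'.V.cl (C'.dC (w' + f 0) + f z)"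
        by (auto simp: k_linear_zero[OF f_linear])
      then show "y \<in> {C'.V.cl (C'.dC (w' + f w) + f z) | w' w. w' \<in> cobar_part C' (n + 1) \<and> w \<in> cobar_part C (n + 1)}"
        using cobar_part_closed(6)[of C "n + 1"] by blast
    qed
  qed
  finally show ?thesis .
qed

text \<open>Equations between cosets become equations between polynomials by
  \<open>part_class_inj\<close>. Compatibility with the differentials is read off from the chain map
  condition, and \<open>surj\<close> and \<open>inj\<close> come from the bijection on the carriers
  of homology.\<close>

lemma cobar_quasi_isoI:
  assumes "quasi_iso (cobar_space C) (cobar_bd C) (cobar_space C') (cobar_bd C') (cobar_map C' g)"
  shows "cobar_quasi_iso C C' f"
proof
  show "k_linear scl f" by (rule f_linear)
  show "f (p * q) = f p * f q" for p q by (simp add: f_def poly.alg_ext_mult)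
  show "f 1 = 1" by (simp add: f_def poly.alg_ext_one)
  show "f p \<in> cobar_part C' n" if "p \<in> cobar_part C n" for p n by (rule f_part[OF that])
  show fd: "f (C.dC p) = C'.dC (f p)" if p: "p \<in> cobar_part C n" for p n
  proof -
    have "cobar_bd C' n (cobar_map C' g n (C.V.cl p)) = cobar_map C' g (n - 1) (cobar_bd C n (C.V.cl p))"
      using assms p by (simp add: quasi_iso_def C.cobar_space_carrier)
    then have "C'.V.cl (C'.dC (f p)) = C'.V.cl (f (C.dC p))"
      by (simp add: cobar_map_class part_supp[OF p] part_supp[OF C.part_der[OF p]] C.cobar_bd_class
          C'.cobar_bd_class C'.part_supp[OF f_part[OF p]])
    from C'.part_class_inj[OF C'.part_der[OF f_part[OF p]] f_part[OF C.part_der[OF p]] this] show ?thesis ..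
  qed
  let ?K = "\<lambda>n z. (\<lambda>w. C.V.cl (C.dC w + z)) ` cobar_part C (n + 1)"
  let ?K' = "\<lambda>n z. (\<lambda>w. C'.V.cl (C'.dC w + z)) ` cobar_part C' (n + 1)"
  define h where "h n = quotient_map (cobar_space C' n) (cobar_bd C' (n + 1) ` carrier (cobar_space C' (n + 1))) (cobar_map C' g n)" for n
  have hK: "h n (?K n z) = ?K' n (f z)" if "z \<in> cobar_cycles C n" for n z
    unfolding h_def using quotient_map_cobar[OF _ fd] that by (simp add: cobar_cycles_def)
  have bij: "bij_betw (h n) (?K n ` cobar_cycles C n) (?K' n ` cobar_cycles C' n)" for n
    using assms unfolding quasi_iso_def Let_def C.homology_carrier C'.homology_carrier h_def by blast
  show "\<exists>z\<in>cobar_cycles C n. \<exists>w\<in>cobar_part C' (n + 1). z' = f z + C'.dC w" if z': "z' \<in> cobar_cycles C' n" for n z'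
  proof -
    have "?K' n z' \<in> h n ` (?K n ` cobar_cycles C n)" using bij[of n] z' by (auto simp: bij_betw_def)
    then obtain z where z: "z \<in> cobar_cycles C n" "?K' n z' = ?K' n (f z)" using hK by auto
    \<comment> \<open>With \<open>w = 0\<close>, the class of \<open>z'\<close> belongs to its own
      homology class; read in the other description of that class, it exhibits the boundary.\<close>
    have "C'.V.cl (C'.dC 0 + z') \<in> ?K' n z'" by (rule imageI[OF cobar_part_closed(6)])
    then obtain w where w: "w \<in> cobar_part C' (n + 1)" "C'.V.cl z' = C'.V.cl (C'.dC w + f z)"
      unfolding z(2) by (auto simp: der_zero)
    have "C'.dC w + f z \<in> cobar_part C' n"
      using C'.part_der[OF w(1)] f_part[of z n] z(1) by (intro cobar_part_closed) (auto simp: cobar_cycles_def)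
    from C'.part_class_inj[OF _ this w(2), of n] have "z' = C'.dC w + f z" using z' by (auto simp: cobar_cycles_def)
    then show ?thesis using z w by (auto simp: add.commute)
  qed
  show "\<exists>w\<in>cobar_part C (n + 1). z = C.dC w"
    if z: "z \<in> cobar_cycles C n" and w: "w \<in> cobar_part C' (n + 1)" "f z = C'.dC w" for n z w
  proof -
    \<comment> \<open>The hypothesis \<open>f z = d w\<close> makes the two families agree after
      translation of the parameter by \<open>w\<close>.\<close>
    have "?K' n (f z) = ?K' n (f 0)"
    proof
      show "?K' n (f z) \<subseteq> ?K' n (f 0)"
        using w cobar_part_closed(1)[OF _ w(1)] by (auto simp: k_linear_zero[OF f_linear] simp flip: der_add)
      have "C'.dC x + f 0 = C'.dC (x - w) + f z" for x
        using w by (simp add: der_diff k_linear_zero[OF f_linear])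
      then show "?K' n (f 0) \<subseteq> ?K' n (f z)"
        using cobar_part_closed(2)[OF _ w(1)] by auto
    qed
    then have "h n (?K n z) = h n (?K n 0)" by (simp only: hK[OF z] hK[OF cobar_cycles_closed(5)])
    then have "?K n z = ?K n 0"
      by (rule inj_onD[OF bij_betw_imp_inj_on[OF bij] _ imageI[OF z] imageI[OF cobar_cycles_closed(5)]])
    moreover have "C.V.cl (C.dC 0 + z) \<in> ?K n z" by (rule imageI[OF cobar_part_closed(6)])
    ultimately obtain x where x: "x \<in> cobar_part C (n + 1)" "C.V.cl z = C.V.cl (C.dC x)"
      by (auto simp: der_zero)
    from C.part_class_inj[OF _ C.part_der[OF x(1)] x(2), of n] have "z = C.dC x" using z by (auto simp: cobar_cycles_def)
    then show ?thesis using x by blast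
  qed
qed

end

lemma dg_coalgebra_augmented: "dg_coalgebra C \<Longrightarrow> augmented_dgc C"
  by (simp add: dg_coalgebra_def augmented_dgc_def)

lemma separated_unit_omega_quasi_iso:
  assumes "omega_quasi_iso A B g" shows "separated_unit A \<longleftrightarrow> separated_unit B"
proof -
  have "dgc_morphism A B g"
    using assms by (simp add: omega_quasi_iso_def dgc_morphism_def dgc_morphism_axioms_def dg_coalgebra_augmented)
  then interpret dgc_morphism A B g .
  interpret cobar_quasi_iso A B f
    by (rule cobar_quasi_isoI) (use assms in \<open>simp add: omega_quasi_iso_def\<close>)
  show ?thesis using separated_unit_pull separated_unit_push by blast
qed

lemma separated_unit_omega_leg: "omega_leg C C' \<Longrightarrow> separated_unit C \<longleftrightarrow> separated_unit C'"
  unfolding omega_leg_def by (auto dest: separated_unit_omega_quasi_iso)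

lemma separated_unit_omega_zigzag:
  assumes "omega_zigzag A Ds B" shows "separated_unit A \<longleftrightarrow> separated_unit B"
proof -
  have "separated_unit (hd Ds) \<longleftrightarrow> separated_unit (last Ds)" if "successively omega_leg Ds" "Ds \<noteq> []"
    using that
  proof (induction Ds)
    case (Cons D Ds)
    show ?case
    proof (cases Ds)
      case (Cons E Es)
      then have "separated_unit D \<longleftrightarrow> separated_unit E"
        using Cons.prems by (intro separated_unit_omega_leg) simp
      then show ?thesis using Cons.IH Cons.prems \<open>Ds = E # Es\<close> by simp
    qed simp
  qed simp
  moreover have "separated_unit A \<longleftrightarrow> separated_unit (hd Ds)" "separated_unit (last Ds) \<longleftrightarrow> separated_unit B"
    by (rule separated_unit_omega_leg, use assms in \<open>simp add: omega_zigzag_def\<close>)+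
  ultimately show ?thesis using assms by (simp add: omega_zigzag_def)
qed


section \<open>Polynomial sequences\<close>

definition polynomial_seq :: "(nat \<Rightarrow> 'k::field_char_0) \<Rightarrow> bool" where
  "polynomial_seq f \<longleftrightarrow> (\<exists>P. \<forall>n. f n = poly P (of_nat n))"

text \<open>The binomial expansion of \<open>(x + 1)^(m + 1) - x^(m + 1)\<close> has the leading
  term \<open>(m + 1) x^m\<close>; the lower powers are differences by induction. Dividing by
  \<open>m + 1\<close> uses characteristic zero.\<close>

lemma power_is_difference:
  "\<exists>Q. \<forall>x::'k::field_char_0. poly Q (x + 1) - poly Q x = x ^ m"
proof (induction m rule: less_induct)
  case (less m)
  then have "\<forall>k. \<exists>Q. k < m \<longrightarrow> (\<forall>x::'k. poly Q (x + 1) - poly Q x = x ^ k)" by blast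
  then obtain Q where Q: "\<And>k x. k < m \<Longrightarrow> poly (Q k) (x + 1) - poly (Q k) x = (x::'k) ^ k" by metis
  let ?R = "monom 1 (Suc m) - (\<Sum>k<m. smult (of_nat (Suc m choose k)) (Q k))"
  have "poly ?R (x + 1) - poly ?R x = of_nat (Suc m) * x ^ m" for x :: 'k
  proof -
    have "(x + 1) ^ Suc m = (\<Sum>k\<le>Suc m. of_nat (Suc m choose k) * x ^ k)"
      using binomial_ring[of x 1 "Suc m"] by simp
    also have "\<dots> = (\<Sum>k<m. of_nat (Suc m choose k) * x ^ k) + of_nat (Suc m) * x ^ m + x ^ Suc m"
      by (simp add: lessThan_Suc_atMost[symmetric] del: power_Suc binomial_Suc_Suc)
    finally have "(x + 1) ^ Suc m - x ^ Suc m = (\<Sum>k<m. of_nat (Suc m choose k) * x ^ k) + of_nat (Suc m) * x ^ m"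
      by simp
    moreover have "(\<Sum>k<m. of_nat (Suc m choose k) * poly (Q k) (x + 1)) - (\<Sum>k<m. of_nat (Suc m choose k) * poly (Q k) x)
        = (\<Sum>k<m. of_nat (Suc m choose k) * x ^ k)"
      unfolding sum_subtractf[symmetric] by (rule sum.cong) (simp_all add: Q flip: right_diff_distrib)
    ultimately show ?thesis
      by (simp add: poly_monom poly_sum algebra_simps del: power_Suc binomial_Suc_Suc)
  qed
  then have "poly (smult (1 / of_nat (Suc m)) ?R) (x + 1) - poly (smult (1 / of_nat (Suc m)) ?R) x = x ^ m" for x :: 'k
    unfolding poly_smult right_diff_distrib[symmetric] by (simp del: of_nat_Suc)
  then show ?case by blast
qed

text \<open>\<open>R\<close> is a discrete antiderivative of \<open>P\<close>, assembled from those
  of the powers; the sequence differs from it by a constant.\<close>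

lemma polynomial_seq_diff:
  assumes "polynomial_seq (\<lambda>n. f (Suc n) - f n)"
  shows "polynomial_seq f"
proof -
  obtain P where P: "\<And>n. f (Suc n) - f n = poly P (of_nat n)" using assms by (auto simp: polynomial_seq_def)
  have "\<forall>m. \<exists>Q. \<forall>x::'a. poly Q (x + 1) - poly Q x = x ^ m" using power_is_difference by blast
  then obtain Q where Q: "\<And>m x. poly (Q m) (x + 1) - poly (Q m) x = (x::'a) ^ m" by metis
  define R where "R = (\<Sum>i\<le>degree P. smult (coeff P i) (Q i))"
  have R: "poly R (x + 1) - poly R x = poly P x" for x
    unfolding R_def poly_altdef[of P] poly_sum sum_subtractf[symmetric]
    by (rule sum.cong) (simp_all add: Q flip: right_diff_distrib)
  have "f n = poly (R + [:f 0 - poly R 0:]) (of_nat n)" for n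
  proof (induction n)
    case (Suc n)
    then show ?case using P[of n] R[of "of_nat n"] by (simp add: algebra_simps)
  qed simp
  then show ?thesis unfolding polynomial_seq_def by blast
qed

lemma polynomial_seq_cmult: "polynomial_seq f \<Longrightarrow> polynomial_seq (\<lambda>n. c * f n)"
  unfolding polynomial_seq_def by (metis poly_smult)

lemma polynomial_seq_sum: "(\<And>i. i \<in> I \<Longrightarrow> polynomial_seq (f i)) \<Longrightarrow> polynomial_seq (\<lambda>n. \<Sum>i\<in>I. f i n)"
proof (induction I rule: infinite_finite_induct)
  case (insert i I)
  obtain P where "\<forall>n. f i n = poly P (of_nat n)"
    using insert.prems by (auto simp: polynomial_seq_def)
  moreover obtain Q where "\<forall>n. (\<Sum>i\<in>I. f i n) = poly Q (of_nat n)"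
    using insert.IH insert.prems by (auto simp: polynomial_seq_def)
  ultimately have "\<forall>n. (\<Sum>i\<in>insert i I. f i n) = poly (P + Q) (of_nat n)" using insert.hyps by simp
  then show ?case unfolding polynomial_seq_def by blast
qed (auto simp: polynomial_seq_def intro: exI[of _ 0])

text \<open>The polynomial \<open>P * Q - 1\<close> vanishes at all natural numbers, which are
  infinitely many elements of a field of characteristic zero. So \<open>P\<close> is a unit among
  polynomials, hence constant.\<close>

lemma polynomial_seq_unit:
  assumes "polynomial_seq f" "polynomial_seq g" "\<And>n. f n * g n = 1"
  shows "f n = f m"
proof -
  obtain P Q where P: "\<And>n. f n = poly P (of_nat n)" and Q: "\<And>n. g n = poly Q (of_nat n)"
    using assms by (auto simp: polynomial_seq_def)
  have "P * Q - 1 = 0"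
  proof (rule ccontr)
    assume "P * Q - 1 \<noteq> 0"
    then have "finite {x. poly (P * Q - 1) x = 0}" by (rule poly_roots_finite)
    moreover have "range of_nat \<subseteq> {x. poly (P * Q - 1) x = 0}" using assms(3) P Q by auto
    ultimately have "finite (range (of_nat :: nat \<Rightarrow> 'a))" by (rule finite_subset[rotated])
    then show False using finite_imageD[OF _ inj_of_nat] by blast
  qed
  then have PQ: "P * Q = 1" by simp
  then have "P \<noteq> 0" "Q \<noteq> 0" by auto
  then have "degree P = 0" using degree_mult_eq[of P Q] PQ by simp
  then obtain c where "P = [:c:]" by (rule degree_eq_zeroE)
  then show ?thesis by (simp add: P)
qed


section \<open>The shuffle coproduct\<close>

definition lin_ext2 ::
  "('k::field \<Rightarrow> 'b::ab_group_add \<Rightarrow> 'b) \<Rightarrow> ('a \<Rightarrow> 'c \<Rightarrow> 'b) \<Rightarrow> ('a \<Rightarrow>\<^sub>0 'k) \<Rightarrow> ('c \<Rightarrow>\<^sub>0 'k) \<Rightarrow> 'b" where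
  "lin_ext2 s \<phi> p q = lin_ext s (\<lambda>u. lin_ext s (\<phi> u) q) p"

context vector_space
begin

lemma lin_ext2_left: "k_linear scale (\<lambda>p. lin_ext2 scale \<phi> p q)"
  unfolding lin_ext2_def by (rule lin_ext_k_linear)

lemma lin_ext2_right: "k_linear scale (lin_ext2 scale \<phi> p)"
  unfolding lin_ext2_def lin_ext_def[of _ _ p]
  by (intro k_linearI) (simp_all add: lin_ext_add lin_ext_scl scale_right_distrib sum.distrib scale_sum_right mult.commute)

lemma lin_ext2_single: "lin_ext2 scale \<phi> (single1 u) (single1 v) = \<phi> u v"
  by (simp add: lin_ext2_def lin_ext_single)

end

text \<open>The tensor square of the free algebra, as the free space on pairs of words.\<close>

type_synonym ('x, 'k) words2 = "((int \<times> 'x) list \<times> (int \<times> 'x) list) \<Rightarrow>\<^sub>0 'k"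

definition tens :: "((int \<times> 'x) list \<Rightarrow>\<^sub>0 'k::field) \<Rightarrow> ((int \<times> 'x) list \<Rightarrow>\<^sub>0 'k) \<Rightarrow> ('x, 'k) words2" where
  "tens = lin_ext2 scl (\<lambda>u v. single1 (u, v))"

text \<open>The product of a tensor square of graded algebras: moving the inner factors past each
  other costs a Koszul sign.\<close>

definition tmul :: "('x, 'k::field) words2 \<Rightarrow> ('x, 'k) words2 \<Rightarrow> ('x, 'k) words2" where
  "tmul = lin_ext2 scl (\<lambda>u v. scl (koszul_sign (word_degree (snd u) * word_degree (fst v)))
     (single1 (fst u @ fst v, snd u @ snd v)))"

text \<open>The grading involution by total degree, which plays the part of
  \<open>sign_twist\<close> on the tensor square.\<close>

definition tsgn :: "('x, 'k::field) words2 \<Rightarrow> ('x, 'k) words2" where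
  "tsgn = lin_ext scl (\<lambda>u. scl (koszul_sign (word_degree (fst u) + word_degree (snd u))) (single1 u))"

lemma tens_left: "k_linear scl (\<lambda>p. tens p q)" and tens_right: "k_linear scl (tens p)"
  unfolding tens_def by (rule poly.lin_ext2_left poly.lin_ext2_right)+

lemma tmul_left: "k_linear scl (\<lambda>p. tmul p q)" and tmul_right: "k_linear scl (tmul p)"
  unfolding tmul_def by (rule poly.lin_ext2_left poly.lin_ext2_right)+

lemmas tens_simps =
  k_linear_add[OF tens_left] k_linear_scl[OF tens_left] k_linear_zero[OF tens_left] k_linear_diff[OF tens_left] k_linear_uminus[OF tens_left]
  k_linear_add[OF tens_right] k_linear_scl[OF tens_right] k_linear_zero[OF tens_right] k_linear_diff[OF tens_right] k_linear_uminus[OF tens_right]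

lemmas tmul_simps =
  k_linear_add[OF tmul_left] k_linear_scl[OF tmul_left] k_linear_zero[OF tmul_left] k_linear_diff[OF tmul_left] k_linear_uminus[OF tmul_left]
  k_linear_add[OF tmul_right] k_linear_scl[OF tmul_right] k_linear_zero[OF tmul_right] k_linear_diff[OF tmul_right] k_linear_uminus[OF tmul_right]

lemma tsgn_k_linear: "k_linear scl tsgn"
  unfolding tsgn_def by (rule poly.lin_ext_k_linear)

lemma tens_single: "tens (single1 u) (single1 v) = single1 (u, v)"
  by (simp add: tens_def poly.lin_ext2_single)

lemma tmul_single: "tmul (single1 (u1, u2)) (single1 (v1, v2)) =
    scl (koszul_sign (word_degree u2 * word_degree v1)) (single1 (u1 @ v1, u2 @ v2))"
  by (simp add: tmul_def poly.lin_ext2_single)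

lemma k_linear_eqI:
  assumes "k_linear s f" "k_linear s g" "\<And>w. f (single1 w) = g (single1 w)" shows "f p = g p"
  by (rule k_linear_eq_on[OF assms(1,2) subset_UNIV assms(3)])

text \<open>On basis elements the two signs agree because the exponent is additive in each of the
  two degrees; the rest is linear extension in one argument after the other.\<close>

lemma tmul_assoc: "tmul (tmul P Q) R = tmul P (tmul Q R)"
proof -
  have single: "tmul (tmul (single1 u) (single1 v)) (single1 w) = tmul (single1 u) (tmul (single1 v) (single1 w))"
    for u v w :: "(int \<times> 'a) list \<times> (int \<times> 'a) list"
    by (cases u; cases v; cases w)
      (simp add: tmul_single tmul_simps koszul_sign_add distrib_left distrib_right ac_simps del: scl_single)
  have "tmul (tmul (single1 u) (single1 v)) R = tmul (single1 u) (tmul (single1 v) R)" for u v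
    by (rule k_linear_eqI[OF tmul_right _ single]) (rule poly.k_linear_fun_comp[OF tmul_right tmul_right])
  then have "tmul (tmul (single1 u) Q) R = tmul (single1 u) (tmul Q R)" for u
    by (rule k_linear_eqI[rotated 2]) (rule poly.k_linear_fun_comp[OF tmul_left tmul_right]
        poly.k_linear_fun_comp[OF tmul_right tmul_left])+
  then show ?thesis
    by (rule k_linear_eqI[rotated 2]) (rule poly.k_linear_fun_comp[OF tmul_left tmul_left] tmul_left)+
qed

lemma tmul_one: "tmul (single1 ([], [])) Y = Y"
  by (rule k_linear_eqI[OF tmul_right, of "\<lambda>Y. Y"]) (auto simp: tmul_def poly.lin_ext2_single k_linear_def)

lemma tmul_tens:
  assumes q: "homogeneous n q" and r: "homogeneous m r"
  shows "tmul (tens p q) (tens r s) = scl (koszul_sign (n * m)) (tens (p * r) (q * s))"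
proof -
  have 1: "tmul (tens (single1 u1) (single1 u2)) (tens (single1 v1) (single1 v2)) =
      scl (koszul_sign (n * m)) (tens (single1 u1 * single1 v1) (single1 u2 * single1 v2))"
    if "word_degree u2 = n" "word_degree v1 = m" for u1 u2 v1 v2
    using that by (simp add: tens_single tmul_single single1_mult)
  have 2: "tmul (tens (single1 u1) (single1 u2)) (tens (single1 v1) s) =
      scl (koszul_sign (n * m)) (tens (single1 u1 * single1 v1) (single1 u2 * s))"
    if "word_degree u2 = n" "word_degree v1 = m" for u1 u2 v1
    by (induction s rule: poly_induct)
      (simp_all add: 1 that tens_simps tmul_simps distrib_left poly.scale_right_distrib poly.scale_mult_right mult.commute
        del: scl_single)
  have 3: "tmul (tens (single1 u1) (single1 u2)) (tens r s) =
      scl (koszul_sign (n * m)) (tens (single1 u1 * r) (single1 u2 * s))"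
    if "word_degree u2 = n" for u1 u2
    using r unfolding homogeneous_def
    by (induction r rule: poly_induct_on)
      (simp_all add: 2 that tens_simps tmul_simps distrib_left poly.scale_right_distrib poly.scale_mult_right mult.commute
        del: scl_single)
  have 4: "tmul (tens (single1 u1) q) (tens r s) = scl (koszul_sign (n * m)) (tens (single1 u1 * r) (q * s))" for u1
    using q unfolding homogeneous_def
    by (induction q rule: poly_induct_on)
      (simp_all add: 3 tens_simps tmul_simps distrib_right poly.scale_right_distrib poly.scale_mult_left mult.commute
        del: scl_single)
  show ?thesis
    by (induction p rule: poly_induct)
      (simp_all add: 4 tens_simps tmul_simps distrib_right poly.scale_right_distrib poly.scale_mult_left mult.commute
        del: scl_single)
qed

text \<open>The multiplicative extension of \<open>l |-> l \<otimes> 1 + 1 \<otimes> l\<close>. On a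
  word it yields all splittings into a subword and its complement, with Koszul signs.\<close>

primrec shuffle_word :: "(int \<times> 'x) list \<Rightarrow> ('x, 'k::field) words2" where
  "shuffle_word [] = single1 ([], [])"
| "shuffle_word (l # w) = tmul (single1 ([l], []) + single1 ([], [l])) (shuffle_word w)"

definition shuffle :: "((int \<times> 'x) list \<Rightarrow>\<^sub>0 'k::field) \<Rightarrow> ('x, 'k) words2" where
  "shuffle = lin_ext scl shuffle_word"

lemma shuffle_k_linear: "k_linear scl shuffle"
  unfolding shuffle_def by (rule poly.lin_ext_k_linear)

lemmas shuffle_simps = k_linear_add[OF shuffle_k_linear] k_linear_scl[OF shuffle_k_linear]
  k_linear_zero[OF shuffle_k_linear] k_linear_diff[OF shuffle_k_linear] k_linear_uminus[OF shuffle_k_linear]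

lemma shuffle_single: "shuffle (single1 w) = shuffle_word w"
  by (simp add: shuffle_def poly.lin_ext_single)

lemma shuffle_mult: "shuffle (p * q) = tmul (shuffle p) (shuffle q)"
proof -
  have w: "shuffle_word (u @ v) = tmul (shuffle_word u) (shuffle_word v)" for u v :: "(int \<times> 'a) list"
    by (induction u) (simp_all add: tmul_one tmul_assoc)
  have "shuffle (single1 u * q) = tmul (shuffle (single1 u)) (shuffle q)" for u
    by (induction q rule: poly_induct)
      (simp_all add: shuffle_simps tmul_simps distrib_left poly.scale_mult_right single1_mult shuffle_single w
        del: scl_single)
  then show ?thesis
    by (induction p rule: poly_induct)
      (simp_all add: shuffle_simps tmul_simps distrib_right poly.scale_mult_left del: scl_single)
qed

lemma shuffle_one: "shuffle 1 = single1 ([], [])"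
  by (simp add: shuffle_single flip: single1_Nil)

lemma supp_tmul_single:
  "supp (tmul (single1 a) Y :: ('x, 'k::field) words2) \<subseteq> (\<lambda>v. (fst a @ fst v, snd a @ snd v)) ` supp Y"
proof -
  let ?f = "\<lambda>v. scl (koszul_sign (word_degree (snd a) * word_degree (fst v))) (single1 (fst a @ fst v, snd a @ snd v))
    :: ('x, 'k) words2"
  have "tmul (single1 a) Y = lin_ext scl ?f Y"
    unfolding tmul_def lin_ext2_def by (simp add: poly.lin_ext_single)
  then show ?thesis using supp_lin_ext[of ?f Y] by (auto split: if_splits)
qed

lemma shuffle_word_degree:
  "supp (shuffle_word w :: ('x, 'k::field) words2) \<subseteq> {(u, v). word_degree u + word_degree v = word_degree w}"
proof (induction w)
  case (Cons l w)
  have "supp (shuffle_word (l # w) :: ('x, 'k) words2) \<subseteq>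
      supp (tmul (single1 ([l], [])) (shuffle_word w) :: ('x, 'k) words2) \<union> supp (tmul (single1 ([], [l])) (shuffle_word w) :: ('x, 'k) words2)"
    using Poly_Mapping.keys_add by (simp add: tmul_simps)
  with supp_tmul_single[of "([l], [])" "shuffle_word w"] supp_tmul_single[of "([], [l])" "shuffle_word w"] Cons show ?case by fastforce
qed simp

text \<open>The term with full right factor occurs with coefficient 1, and all other terms have
  shorter right factors. This triangular shape is the form in which conilpotence is used.\<close>

lemma shuffle_word_leading:
  "supp (shuffle_word w - single1 ([], w) :: ('x, 'k::field) words2) \<subseteq> {(u, v). length v < length w}"
proof (induction w)
  case (Cons l w)
  define R :: "('x, 'k) words2" where "R = shuffle_word w - single1 ([], w)"
  have sw: "shuffle_word w = single1 ([], w) + R" by (simp add: R_def)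
  have "shuffle_word (l # w) - single1 ([], l # w) =
      single1 ([l], w) + (tmul (single1 ([l], [])) R + tmul (single1 ([], [l])) R)"
    by (simp add: sw tmul_simps tmul_single)
  also have "supp \<dots> \<subseteq> {([l], w)} \<union> (supp (tmul (single1 ([l], [])) R) \<union> supp (tmul (single1 ([], [l])) R))"
    using Poly_Mapping.keys_add[of "single1 ([l], w)" "tmul (single1 ([l], [])) R + tmul (single1 ([], [l])) R"]
      Poly_Mapping.keys_add[of "tmul (single1 ([l], [])) R" "tmul (single1 ([], [l])) R"] by auto
  finally show ?case
    using supp_tmul_single[of "([l], [])" R] supp_tmul_single[of "([], [l])" R] Cons[folded R_def] by fastforce
qed simp

text \<open>A letter put into the right factor stays there, so only the term in which every letter
  went to the left survives.\<close>

lemma shuffle_word_right_counit: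
  "lin_ext scl (\<lambda>(u, v). if v = [] then single1 u else 0) (shuffle_word w) = (single1 w :: (int \<times> 'x) list \<Rightarrow>\<^sub>0 'k::field)"
proof (induction w)
  case (Cons l w)
  let ?E = "lin_ext scl (\<lambda>(u, v). if v = [] then single1 u else 0) :: ('x, 'k) words2 \<Rightarrow> _"
  have 1: "?E (tmul (single1 ([l], [])) Y) = single1 [l] * ?E Y" for Y
    by (induction Y rule: poly_induct)
      (auto simp: tmul_simps poly.lin_ext_zero poly.lin_ext_add poly.lin_ext_scl poly.lin_ext_single distrib_left
        poly.scale_mult_right tmul_single single1_mult simp del: scl_single)
  have 2: "?E (tmul (single1 ([], [l])) Y) = 0" for Y
    by (induction Y rule: poly_induct)
      (auto simp: tmul_simps poly.lin_ext_zero poly.lin_ext_add poly.lin_ext_scl poly.lin_ext_single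
        tmul_single simp del: scl_single)
  show ?case using Cons by (simp add: tmul_simps poly.lin_ext_add 1 2 single1_mult)
qed (simp add: poly.lin_ext_single)

section \<open>Functionals on the tensor square and their convolution\<close>

definition tfun :: "(((int \<times> 'x) list \<Rightarrow>\<^sub>0 'k::field) \<Rightarrow> 'k) \<Rightarrow> (((int \<times> 'x) list \<Rightarrow>\<^sub>0 'k) \<Rightarrow> 'k) \<Rightarrow>
    ('x, 'k) words2 \<Rightarrow> 'k" where
  "tfun \<phi> \<psi> = lin_ext (*) (\<lambda>(u, v). \<phi> (single1 u) * \<psi> (single1 v))"

definition conv :: "(((int \<times> 'x) list \<Rightarrow>\<^sub>0 'k::field) \<Rightarrow> 'k) \<Rightarrow> (((int \<times> 'x) list \<Rightarrow>\<^sub>0 'k) \<Rightarrow> 'k) \<Rightarrow>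
    ((int \<times> 'x) list \<Rightarrow>\<^sub>0 'k) \<Rightarrow> 'k" where
  "conv \<phi> \<psi> p = tfun \<phi> \<psi> (shuffle p)"

definition degree_comp :: "int \<Rightarrow> ((int \<times> 'x) list \<Rightarrow>\<^sub>0 'k::field) \<Rightarrow> ((int \<times> 'x) list \<Rightarrow>\<^sub>0 'k)" where
  "degree_comp n = lin_ext scl (\<lambda>w. if word_degree w = n then single1 w else 0)"

lemma degree_comp_k_linear: "k_linear scl (degree_comp n)"
  unfolding degree_comp_def by (rule poly.lin_ext_k_linear)

lemma homogeneous_degree_comp: "homogeneous n (degree_comp n p)"
  unfolding degree_comp_def by (rule homogeneous_lin_ext) (simp add: homogeneous_single)

lemma degree_comp_homogeneous: "homogeneous m p \<Longrightarrow> degree_comp n p = (if m = n then p else 0)"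
proof -
  assume "homogeneous m p"
  then have "degree_comp n p = lin_ext scl (\<lambda>w. if m = n then single1 w else 0) p"
    unfolding degree_comp_def by (intro poly.lin_ext_cong_on) (auto simp: homogeneous_def)
  then show ?thesis by (cases "m = n") (simp_all add: lin_ext_single1_id, simp add: lin_ext_def)
qed

lemma tfun_k_linear: "k_linear (*) (tfun \<phi> \<psi>)"
  unfolding tfun_def by (rule vector_space_over_itself.lin_ext_k_linear)

lemmas tfun_simps = k_linear_add[OF tfun_k_linear] k_linear_scl[OF tfun_k_linear]
  k_linear_zero[OF tfun_k_linear] k_linear_diff[OF tfun_k_linear] k_linear_uminus[OF tfun_k_linear]

lemma tfun_single: "tfun \<phi> \<psi> (single1 (u, v)) = \<phi> (single1 u) * \<psi> (single1 v)"
  by (simp add: tfun_def vector_space_over_itself.lin_ext_single)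

lemma tfun_tens:
  assumes "k_linear (*) \<phi>" "k_linear (*) \<psi>"
  shows "tfun \<phi> \<psi> (tens p q) = \<phi> p * \<psi> q"
proof -
  note lin = k_linear_add[OF assms(1)] k_linear_add[OF assms(2)] k_linear_scl[OF assms(1)] k_linear_scl[OF assms(2)]
    k_linear_zero[OF assms(1)] k_linear_zero[OF assms(2)]
  have "tfun \<phi> \<psi> (tens (single1 u) q) = \<phi> (single1 u) * \<psi> q" for u
    by (induction q rule: poly_induct)
      (simp_all add: lin tens_simps tfun_simps tens_single tfun_single distrib_left del: scl_single)
  then show ?thesis
    by (induction p rule: poly_induct) (simp_all add: lin tens_simps tfun_simps distrib_right del: scl_single)
qed

lemma tsgn_single: "tsgn (single1 (u, v)) = scl (koszul_sign (word_degree u + word_degree v)) (single1 (u, v))"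
  by (simp add: tsgn_def poly.lin_ext_single)

lemma tsgn_tens:
  assumes "homogeneous n p" "homogeneous m q"
  shows "tsgn (tens p q) = scl (koszul_sign (n + m)) (tens p q)"
proof -
  have *: "tsgn (tens (single1 u) q) = scl (koszul_sign (n + m)) (tens (single1 u) q)" if "word_degree u = n" for u
    using assms(2) unfolding homogeneous_def
    by (induction q rule: poly_induct_on)
      (simp_all add: that tens_simps k_linear_add[OF tsgn_k_linear] k_linear_scl[OF tsgn_k_linear]
        k_linear_zero[OF tsgn_k_linear] tens_single tsgn_single poly.scale_right_distrib mult.commute del: scl_single)
  from assms(1) show ?thesis
    unfolding homogeneous_def
    by (induction p rule: poly_induct_on)
      (simp_all add: * tens_simps k_linear_add[OF tsgn_k_linear] k_linear_scl[OF tsgn_k_linear]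
        k_linear_zero[OF tsgn_k_linear] poly.scale_right_distrib mult.commute del: scl_single)
qed

lemma homogeneous_word: "homogeneous (word_degree w) (single1 w)"
  by (simp add: homogeneous_single)

abbreviation augmentation :: "('l list \<Rightarrow>\<^sub>0 'k::field) \<Rightarrow> 'k" where
  "augmentation \<equiv> alg_ext (*) (\<lambda>_. 0)"

lemma augmentation_word: "augmentation (single1 w) = (if w = [] then 1 else 0)"
  by (cases w) (simp_all add: field_scale.alg_ext_single)

lemma augmentation_eq: "augmentation p = coeff_of p []"
  by (rule k_linear_eqI[OF field_scale.alg_ext_k_linear]) (auto simp: augmentation_word k_linear_def lookup_add lookup_single when_def)

text \<open>A differential on the free algebra whose values on letters are primitive: together with
  the shuffle coproduct this is a dg Hopf algebra. The last assumption makes the augmentation a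
  chain map.\<close>

locale primitive_dga =
  fixes \<delta> :: "int \<times> 'x \<Rightarrow> ((int \<times> 'x) list \<Rightarrow>\<^sub>0 'k::field_char_0)"
  assumes homogeneous_\<delta>: "homogeneous (fst l - 1) (\<delta> l)" and der_\<delta>: "der \<delta> (\<delta> l) = 0"
    and primitive: "shuffle (\<delta> l) = tens (\<delta> l) 1 + tens 1 (\<delta> l)" and augmented: "coeff_of (\<delta> l) [] = 0"
begin

abbreviation "d \<equiv> der \<delta>"

lemma homogeneous_d: "homogeneous n p \<Longrightarrow> homogeneous (n - 1) (d p)"
  by (rule homogeneous_der[of UNIV]) (simp_all add: homogeneous_\<delta>)

lemma homogeneous_d_word: "homogeneous (word_degree w - 1) (d (single1 w))"
  by (rule homogeneous_d[OF homogeneous_word])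

text \<open>In the induction over words the two mixed terms carry the signs
  \<open>(-1)^(n - 1)\<close> and \<open>(-1)^n\<close>, where \<open>n\<close> is the degree of the
  first letter, and cancel.\<close>

lemma d_d: "d (d p) = 0"
proof -
  have "d (der_word \<delta> w) = 0" for w
  proof (induction w)
    case (Cons l w)
    have "d (\<delta> l * single1 w) = scl (koszul_sign (fst l - 1)) (\<delta> l * d (single1 w))"
      by (simp add: der_mult_homogeneous[OF homogeneous_\<delta>] der_\<delta>)
    moreover have "d (single1 [l] * der_word \<delta> w) = \<delta> l * d (single1 w)"
      using Cons by (simp add: der_mult_homogeneous[OF homogeneous_word] der_single single1_Nil)
    ultimately show ?case
      by (simp add: der_add der_scl koszul_sign_diff poly.scale_minus_left flip: poly.scale_left_distrib)
  qed (simp add: der_zero)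
  then have "d (d (single1 w)) = 0" for w by (simp add: der_single)
  then show ?thesis
    by (induction p rule: poly_induct) (simp_all add: der_add der_scl der_zero del: scl_single)
qed

definition td :: "('x, 'k) words2 \<Rightarrow> ('x, 'k) words2" where
  "td = lin_ext scl (\<lambda>(u, v). tens (d (single1 u)) (single1 v) +
     scl (koszul_sign (word_degree u)) (tens (single1 u) (d (single1 v))))"

lemma td_k_linear: "k_linear scl td"
  unfolding td_def by (rule poly.lin_ext_k_linear)

lemmas td_simps = k_linear_add[OF td_k_linear] k_linear_scl[OF td_k_linear]
  k_linear_zero[OF td_k_linear] k_linear_diff[OF td_k_linear] k_linear_uminus[OF td_k_linear]

lemma td_tens:
  assumes "homogeneous n p"
  shows "td (tens p q) = tens (d p) q + scl (koszul_sign n) (tens p (d q))"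
proof -
  have *: "td (tens (single1 u) q) = tens (d (single1 u)) q + scl (koszul_sign n) (tens (single1 u) (d q))"
    if "word_degree u = n" for u
    by (induction q rule: poly_induct)
      (simp_all add: that tens_simps td_simps tens_single der_add der_scl der_zero poly.scale_right_distrib
        mult.commute td_def[THEN fun_cong, of "single1 (u, v)" for v] poly.lin_ext_single del: scl_single)
  from assms show ?thesis
    unfolding homogeneous_def
    by (induction p rule: poly_induct_on)
      (simp_all add: * tens_simps td_simps der_add der_scl der_zero poly.scale_right_distrib mult.commute
        del: scl_single)
qed

text \<open>The tensor square of a dg algebra is a dg algebra. On pure tensors of words this is a
  comparison of four terms and their Koszul signs.\<close>

lemma td_tmul: "td (tmul P Q) = tmul (td P) Q + tmul (tsgn P) (td Q)"
proof -
  note ts = k_linear_add[OF tsgn_k_linear] k_linear_scl[OF tsgn_k_linear] k_linear_zero[OF tsgn_k_linear]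
  have 1: "td (tmul (single1 (u1, u2)) (single1 (v1, v2))) =
      tmul (td (single1 (u1, u2))) (single1 (v1, v2)) + tmul (tsgn (single1 (u1, u2))) (td (single1 (v1, v2)))"
    for u1 u2 v1 v2
  proof -
    note h = homogeneous_word homogeneous_d_word
    let ?a = "word_degree u1" and ?b = "word_degree u2" and ?c = "word_degree v1"
    have "tmul (td (tens (single1 u1) (single1 u2))) (tens (single1 v1) (single1 v2))
      = scl (koszul_sign (?b * ?c)) (tens (d (single1 u1) * single1 v1) (single1 u2 * single1 v2)) +
        scl (koszul_sign ?a * koszul_sign ((?b - 1) * ?c)) (tens (single1 u1 * single1 v1) (d (single1 u2) * single1 v2))"
      by (simp add: td_tens[OF homogeneous_word] tmul_simps tmul_tens[OF h(1) h(1)] tmul_tens[OF h(2) h(1)])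
    moreover have "tmul (tsgn (tens (single1 u1) (single1 u2))) (td (tens (single1 v1) (single1 v2)))
      = scl (koszul_sign (?a + ?b)) (scl (koszul_sign (?b * (?c - 1))) (tens (single1 u1 * d (single1 v1)) (single1 u2 * single1 v2)) +
         scl (koszul_sign ?c * koszul_sign (?b * ?c)) (tens (single1 u1 * single1 v1) (single1 u2 * d (single1 v2))))"
      by (simp add: td_tens[OF homogeneous_word] tsgn_tens[OF homogeneous_word homogeneous_word] tmul_simps
          tmul_tens[OF h(1) h(1)] tmul_tens[OF h(1) h(2)] poly.scale_right_distrib ac_simps)
    moreover have "td (tmul (tens (single1 u1) (single1 u2)) (tens (single1 v1) (single1 v2)))
      = scl (koszul_sign (?b * ?c)) (tens (d (single1 u1 * single1 v1)) (single1 u2 * single1 v2) +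
         scl (koszul_sign (?a + ?c)) (tens (single1 u1 * single1 v1) (d (single1 u2 * single1 v2))))"
      using td_tens[OF homogeneous_mult[OF homogeneous_word[of u1] homogeneous_word[of v1]], of "single1 u2 * single1 v2"]
      by (simp add: tmul_tens[OF h(1) h(1)] td_simps del: single1_mult)
    ultimately show ?thesis
      unfolding tens_single[symmetric] der_mult_homogeneous[OF homogeneous_word] tens_simps
      by (simp add: poly.scale_right_distrib left_diff_distrib right_diff_distrib koszul_sign_diff koszul_sign_add
          ac_simps)
  qed
  have 2: "td (tmul (single1 u) Q) = tmul (td (single1 u)) Q + tmul (tsgn (single1 u)) (td Q)" for u
  proof (induction Q rule: poly_induct)
    case (single w)
    then show ?case using 1[of "fst u" "snd u" "fst w" "snd w"] by simp
  qed (simp_all add: td_simps tmul_simps poly.scale_right_distrib del: scl_single)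
  show ?thesis
    by (induction P rule: poly_induct)
      (simp_all add: 2 td_simps tmul_simps ts poly.scale_right_distrib del: scl_single)
qed

text \<open>Both sides obey the same Leibniz rule along the algebra map \<open>shuffle\<close>, so
  comparison on letters suffices; there it is the assumption \<open>primitive\<close>.\<close>

lemma td_shuffle: "td (shuffle p) = shuffle (d p)"
proof -
  have "td (shuffle_word w) = shuffle (der_word \<delta> w)" for w
  proof (induction w)
    case Nil
    have "td (tens 1 1) = 0" by (simp add: td_tens[OF homogeneous_one] tens_simps)
    then show ?case by (simp add: shuffle_simps tens_single flip: single1_Nil)
  next
    case (Cons l w)
    define P :: "('x, 'k) words2" where "P = single1 ([l], []) + single1 ([], [l])"
    have "td (tens (single1 [l]) 1) = tens (\<delta> l) 1" "td (tens 1 (single1 [l])) = tens 1 (\<delta> l)"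
      by (simp_all add: td_tens[OF homogeneous_one] td_tens[OF homogeneous_word] tens_simps)
    then have 1: "td P = shuffle (\<delta> l)"
      unfolding primitive P_def by (simp add: td_simps flip: single1_Nil tens_single)
    have 2: "tsgn P = scl (koszul_sign (fst l)) P"
      unfolding P_def
      by (simp add: k_linear_add[OF tsgn_k_linear] tsgn_single poly.scale_right_distrib del: scl_single)
    have 3: "shuffle (single1 [l]) = P" by (simp add: P_def shuffle_single tmul_simps tmul_single)
    have "td (shuffle_word (l # w)) = tmul (shuffle (\<delta> l)) (shuffle_word w) +
        scl (koszul_sign (fst l)) (tmul P (shuffle (der_word \<delta> w)))"
      unfolding shuffle_word.simps P_def[symmetric] td_tmul 1 2 Cons by (simp add: tmul_simps)
    then show ?case by (simp add: shuffle_simps shuffle_mult shuffle_single[of w] 3 del: shuffle_word.simps)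
  qed
  then show ?thesis
    by (induction p rule: poly_induct)
      (simp_all add: shuffle_simps td_simps der_add der_scl der_zero shuffle_single der_single del: scl_single)
qed


section \<open>Characters and convolution\<close>

text \<open>A functional on all polynomials that induces an algebra map on homology: it kills
  boundaries, while multiplicativity is demanded of homogeneous cycles only.\<close>

definition character :: "(((int \<times> 'x) list \<Rightarrow>\<^sub>0 'k) \<Rightarrow> 'k) \<Rightarrow> bool" where
  "character \<phi> \<longleftrightarrow> k_linear (*) \<phi> \<and> (\<forall>p. \<phi> (d p) = 0) \<and> \<phi> 1 = 1 \<and>
     (\<forall>n p. homogeneous n p \<longrightarrow> n \<noteq> 0 \<longrightarrow> \<phi> p = 0) \<and>
     (\<forall>n m p q. homogeneous n p \<longrightarrow> homogeneous m q \<longrightarrow> d p = 0 \<longrightarrow> d q = 0 \<longrightarrow> \<phi> (p * q) = \<phi> p * \<phi> q)"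

lemma characterD:
  assumes "character \<phi>"
  shows "k_linear (*) \<phi>" "\<phi> (d p) = 0" "\<phi> 1 = 1" "homogeneous n p \<Longrightarrow> n \<noteq> 0 \<Longrightarrow> \<phi> p = 0"
    "homogeneous n p \<Longrightarrow> homogeneous m q \<Longrightarrow> d p = 0 \<Longrightarrow> d q = 0 \<Longrightarrow> \<phi> (p * q) = \<phi> p * \<phi> q"
  using assms by (simp_all add: character_def)

text \<open>Over a field, \<open>d\<close> has a linear section \<open>g\<close> on its image. Since
  \<open>d\<close> is homogeneous, cutting \<open>g\<close> down to its component of degree one
  higher preserves the section property.\<close>

lemma exists_homotopy:
  "\<exists>h. k_linear scl h \<and> (\<forall>n p. homogeneous n p \<longrightarrow> homogeneous (n + 1) (h p)) \<and> (\<forall>p. d (h (d p)) = d p)"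
proof -
  interpret vector_space_pair "scl :: 'k \<Rightarrow> ((int \<times> 'x) list \<Rightarrow>\<^sub>0 'k) \<Rightarrow> _" "scl :: 'k \<Rightarrow> ((int \<times> 'x) list \<Rightarrow>\<^sub>0 'k) \<Rightarrow> _" ..
  have "Vector_Spaces.linear scl scl d"
    unfolding Vector_Spaces.linear_iff by (simp add: der_add der_scl poly.vector_space_axioms)
  from linear_exists_right_inverse_on[OF this poly.subspace_UNIV]
  obtain g where g: "Vector_Spaces.linear scl scl g" "\<And>p. d (g (d p)) = d p" by auto
  have gl: "k_linear scl g"
    using g(1) unfolding Vector_Spaces.linear_iff by (intro k_linearI) auto
  \<comment> \<open>The correction is made on words, whose degree is known; on homogeneous elements
    of degree \<open>n\<close> it amounts to taking the component of degree \<open>n + 1\<close> of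
    \<open>g\<close>.\<close>
  define h where "h = lin_ext scl (\<lambda>w. degree_comp (word_degree w + 1) (g (single1 w)))"
  have hl: "k_linear scl h" unfolding h_def by (rule poly.lin_ext_k_linear)
  have h: "h p = degree_comp (n + 1) (g p)" if "homogeneous n p" for n p
  proof -
    have "h p = lin_ext scl (\<lambda>w. degree_comp (n + 1) (g (single1 w))) p"
      unfolding h_def using that by (intro poly.lin_ext_cong_on) (auto simp: homogeneous_def)
    also have "\<dots> = degree_comp (n + 1) (g p)"
      by (rule poly.k_linear_lin_ext[OF poly.k_linear_fun_comp[OF degree_comp_k_linear gl], symmetric])
    finally show ?thesis .
  qed
  have comp_d: "d (degree_comp n p) = degree_comp (n - 1) (d p)" for n p
  proof (rule k_linear_eqI[OF poly.k_linear_fun_comp[OF der_k_linear degree_comp_k_linear]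
        poly.k_linear_fun_comp[OF degree_comp_k_linear der_k_linear]])
    show "d (degree_comp n (single1 w)) = degree_comp (n - 1) (d (single1 w))" for w :: "(int \<times> 'x) list"
      by (simp add: degree_comp_homogeneous[OF homogeneous_word] degree_comp_homogeneous[OF homogeneous_d_word] der_zero)
  qed
  have "d (h (d p)) = d p" for p
  proof (rule k_linear_eqI[OF poly.k_linear_fun_comp[OF der_k_linear poly.k_linear_fun_comp[OF hl der_k_linear]] der_k_linear])
    fix w :: "(int \<times> 'x) list"
    let ?n = "word_degree w"
    have "d (h (d (single1 w))) = degree_comp (?n - 1) (d (g (d (single1 w))))"
      using h[OF homogeneous_d_word[of w]] comp_d[of ?n] by simp
    then show "d (h (d (single1 w))) = d (single1 w)"
      using degree_comp_homogeneous[OF homogeneous_d_word[of w], of "?n - 1"] by (simp add: g(2))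
  qed
  then show ?thesis using hl h homogeneous_degree_comp by metis
qed

definition h :: "((int \<times> 'x) list \<Rightarrow>\<^sub>0 'k) \<Rightarrow> ((int \<times> 'x) list \<Rightarrow>\<^sub>0 'k)" where
  "h = (SOME h. k_linear scl h \<and> (\<forall>n p. homogeneous n p \<longrightarrow> homogeneous (n + 1) (h p)) \<and> (\<forall>p. d (h (d p)) = d p))"

lemma h_k_linear: "k_linear scl h" and homogeneous_h: "homogeneous n p \<Longrightarrow> homogeneous (n + 1) (h p)"
  and d_h_d: "d (h (d p)) = d p"
  using someI_ex[OF exists_homotopy] unfolding h_def[symmetric] by auto

text \<open>A map homotopic to the identity that has values in cycles and kills boundaries, so it
  passes from arbitrary elements to representatives of homology.\<close>

definition cycle_proj :: "((int \<times> 'x) list \<Rightarrow>\<^sub>0 'k) \<Rightarrow> ((int \<times> 'x) list \<Rightarrow>\<^sub>0 'k)" where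
  "cycle_proj p = p - d (h p) - h (d p)"

lemma cycle_proj_k_linear: "k_linear scl cycle_proj"
  by (intro k_linearI) (simp_all add: cycle_proj_def k_linear_add[OF h_k_linear] k_linear_scl[OF h_k_linear] der_add der_scl
      poly.scale_right_diff_distrib algebra_simps)

lemma d_cycle_proj: "d (cycle_proj p) = 0" and cycle_proj_d: "cycle_proj (d p) = 0"
  by (simp_all add: cycle_proj_def der_diff d_d d_h_d k_linear_zero[OF h_k_linear])

lemma homogeneous_cycle_proj: "homogeneous n p \<Longrightarrow> homogeneous n (cycle_proj p)"
  using homogeneous_d[OF homogeneous_h, of n p] homogeneous_h[OF homogeneous_d, of n p]
  by (simp add: cycle_proj_def homogeneous_diff)

lemma cycle_proj_word: "homogeneous (word_degree w) (cycle_proj (single1 w))"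
  by (rule homogeneous_cycle_proj[OF homogeneous_word])

definition tproj :: "('x, 'k) words2 \<Rightarrow> ('x, 'k) words2" where
  "tproj = lin_ext scl (\<lambda>(u, v). tens (cycle_proj (single1 u)) (cycle_proj (single1 v)))"

text \<open>With \<open>q\<close> for \<open>cycle_proj\<close>, this is the homotopy
  \<open>h \<otimes> 1 + q \<otimes> h\<close> from the identity to \<open>q \<otimes> q\<close>,
  including the Koszul sign for moving \<open>h\<close> past the first factor.\<close>

definition th :: "('x, 'k) words2 \<Rightarrow> ('x, 'k) words2" where
  "th = lin_ext scl (\<lambda>(u, v). tens (h (single1 u)) (single1 v) +
     scl (koszul_sign (word_degree u)) (tens (cycle_proj (single1 u)) (h (single1 v))))"

lemma tproj_k_linear: "k_linear scl tproj" and th_k_linear: "k_linear scl th"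
  unfolding tproj_def th_def by (rule poly.lin_ext_k_linear)+

lemma tproj_single: "tproj (single1 (u, v)) = tens (cycle_proj (single1 u)) (cycle_proj (single1 v))"
  by (simp add: tproj_def poly.lin_ext_single)

lemma th_tens:
  assumes "homogeneous n p"
  shows "th (tens p q) = tens (h p) q + scl (koszul_sign n) (tens (cycle_proj p) (h q))"
proof -
  note lin = k_linear_add[OF h_k_linear] k_linear_scl[OF h_k_linear] k_linear_zero[OF h_k_linear]
    k_linear_add[OF cycle_proj_k_linear] k_linear_scl[OF cycle_proj_k_linear] k_linear_zero[OF cycle_proj_k_linear]
    k_linear_add[OF th_k_linear] k_linear_scl[OF th_k_linear] k_linear_zero[OF th_k_linear]
  have *: "th (tens (single1 u) q) = tens (h (single1 u)) q + scl (koszul_sign n) (tens (cycle_proj (single1 u)) (h q))"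
    if "word_degree u = n" for u
    by (induction q rule: poly_induct)
      (simp_all add: that tens_simps lin tens_single poly.scale_right_distrib
        mult.commute th_def[THEN fun_cong, of "single1 (u, v)" for v] poly.lin_ext_single del: scl_single)
  from assms show ?thesis
    unfolding homogeneous_def
    by (induction p rule: poly_induct_on)
      (simp_all add: * tens_simps lin poly.scale_right_distrib mult.commute del: scl_single)
qed

text \<open>This is the Kuenneth formula at chain level.\<close>
lemma tproj_homotopy: "P = tproj P + td (th P) + th (td P)"
proof -
  note lin = k_linear_add[OF tproj_k_linear] k_linear_scl[OF tproj_k_linear] k_linear_zero[OF tproj_k_linear]
    k_linear_add[OF th_k_linear] k_linear_scl[OF th_k_linear] k_linear_zero[OF th_k_linear] td_simps
  have "single1 (u, v) = tproj (single1 (u, v)) + td (th (single1 (u, v))) + th (td (single1 (u, v)))" for u v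
  proof -
    let ?u = "single1 u :: (int \<times> 'x) list \<Rightarrow>\<^sub>0 'k" and ?v = "single1 v :: (int \<times> 'x) list \<Rightarrow>\<^sub>0 'k"
    let ?s = "koszul_sign (word_degree u) :: 'k"
    have 1: "td (th (tens ?u ?v)) = tens (d (h ?u)) ?v - scl ?s (tens (h ?u) (d ?v)) + tens (cycle_proj ?u) (d (h ?v))"
      by (simp add: th_tens[OF homogeneous_word] td_simps td_tens[OF homogeneous_h[OF homogeneous_word]]
          td_tens[OF cycle_proj_word] d_cycle_proj tens_simps koszul_sign_add)
    have 2: "th (td (tens ?u ?v)) = tens (h (d ?u)) ?v + scl ?s (tens (h ?u) (d ?v)) + tens (cycle_proj ?u) (h (d ?v))"
      by (simp add: td_tens[OF homogeneous_word] lin th_tens[OF homogeneous_d_word] th_tens[OF homogeneous_word]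
          cycle_proj_d tens_simps poly.scale_right_distrib)
    \<comment> \<open>With \<open>q\<close> for \<open>cycle_proj\<close>, the right side
      telescopes: \<open>(1 - q) \<otimes> 1 + q \<otimes> (1 - q) = 1 - q \<otimes>
      q\<close>.\<close>
    have "tens (d (h ?u) + h (d ?u)) ?v + tens (cycle_proj ?u) (d (h ?v) + h (d ?v))
        = tens (?u - cycle_proj ?u) ?v + tens (cycle_proj ?u) (?v - cycle_proj ?v)"
      by (simp add: cycle_proj_def add.commute)
    then have "tens (d (h ?u)) ?v + tens (h (d ?u)) ?v + (tens (cycle_proj ?u) (d (h ?v)) + tens (cycle_proj ?u) (h (d ?v)))
        = tens ?u ?v - tens (cycle_proj ?u) (cycle_proj ?v)"
      by (simp only: tens_simps) simp
    then show ?thesis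
      unfolding tproj_single unfolding tens_single[symmetric] 1 2 by (simp add: algebra_simps)
  qed
  then have *: "single1 w = tproj (single1 w) + td (th (single1 w)) + th (td (single1 w))" for w
    by (cases w) blast
  show ?thesis
  proof (induction P rule: poly_induct)
    case (single w)
    show ?case by (rule *)
  next
    case (add p q)
    have "p + q = (tproj p + td (th p) + th (td p)) + (tproj q + td (th q) + th (td q))"
      by (rule arg_cong2[OF add, where f = "(+)"])
    also have "\<dots> = tproj (p + q) + td (th (p + q)) + th (td (p + q))"
      by (simp only: lin ac_simps)
    finally show ?case .
  next
    case (scl c p)
    then show ?case by (metis lin poly.scale_right_distrib)
  qed (simp add: lin)
qed

context
  fixes \<phi> \<psi> assumes \<phi>: "character \<phi>" and \<psi>: "character \<psi>"
begin

lemma tfun_td: "tfun \<phi> \<psi> (td P) = 0"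
proof (induction P rule: poly_induct)
  case (single w)
  obtain u v where "w = (u, v)" by (cases w)
  then show ?case
    using characterD(2)[OF \<phi>] characterD(2)[OF \<psi>] td_tens[OF homogeneous_word, of u "single1 v"]
    by (simp add: tens_single tfun_simps tfun_tens[OF characterD(1)[OF \<phi>] characterD(1)[OF \<psi>]])
qed (simp_all add: td_simps tfun_simps del: scl_single)

text \<open>The values of \<open>tproj\<close> are sums of tensors of homogeneous cycles, where
  multiplicativity of each character applies factor by factor.\<close>

lemma tfun_tmul_tproj:
  "tfun \<phi> \<psi> (tmul (tproj P) (tproj Q)) = tfun \<phi> \<psi> (tproj P) * tfun \<phi> \<psi> (tproj Q)"
proof -
  note tt = tfun_tens[OF characterD(1)[OF \<phi>] characterD(1)[OF \<psi>]]
  note lin = k_linear_add[OF tproj_k_linear] k_linear_scl[OF tproj_k_linear] k_linear_zero[OF tproj_k_linear] tfun_simps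
  have s: "tfun \<phi> \<psi> (tmul (tproj (single1 (u1, u2))) (tproj (single1 (v1, v2)))) =
      tfun \<phi> \<psi> (tproj (single1 (u1, u2))) * tfun \<phi> \<psi> (tproj (single1 (v1, v2)))" for u1 u2 v1 v2
  proof -
    have "\<phi> (cycle_proj (single1 u1) * cycle_proj (single1 v1)) = \<phi> (cycle_proj (single1 u1)) * \<phi> (cycle_proj (single1 v1))"
      "\<psi> (cycle_proj (single1 u2) * cycle_proj (single1 v2)) = \<psi> (cycle_proj (single1 u2)) * \<psi> (cycle_proj (single1 v2))"
      by (rule characterD(5)[OF \<phi> cycle_proj_word cycle_proj_word d_cycle_proj d_cycle_proj]
          characterD(5)[OF \<psi> cycle_proj_word cycle_proj_word d_cycle_proj d_cycle_proj])+
    \<comment> \<open>The sign of \<open>tmul\<close> depends on the degree of \<open>u2\<close>. If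
      it is nonzero both sides vanish; if it is zero the sign is 1.\<close>
    moreover have "\<psi> (cycle_proj (single1 u2)) = 0" if "word_degree u2 \<noteq> 0"
      by (rule characterD(4)[OF \<psi> cycle_proj_word that])
    ultimately show ?thesis
      by (cases "word_degree u2 = 0")
        (simp_all add: tproj_single tmul_tens[OF cycle_proj_word cycle_proj_word] tt tfun_simps)
  qed
  have "tfun \<phi> \<psi> (tmul (tproj (single1 u)) (tproj Q)) = tfun \<phi> \<psi> (tproj (single1 u)) * tfun \<phi> \<psi> (tproj Q)" for u
  proof (induction Q rule: poly_induct)
    case (single w)
    then show ?case using s[of "fst u" "snd u" "fst w" "snd w"] by simp
  qed (simp_all add: lin tmul_simps distrib_left del: scl_single)
  then show ?thesis
    by (induction P rule: poly_induct) (simp_all add: lin tmul_simps distrib_right del: scl_single)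
qed

text \<open>Values of \<open>tproj\<close> on basis elements are homogeneous cycles, so their
  product with a boundary is, up to sign, the boundary of a product.\<close>

lemma tfun_tmul_tproj_td: "tfun \<phi> \<psi> (tmul (tproj P) (td Q)) = 0"
proof -
  note lin = k_linear_add[OF tproj_k_linear] k_linear_scl[OF tproj_k_linear] k_linear_zero[OF tproj_k_linear] tfun_simps
  have "tfun \<phi> \<psi> (tmul (tproj (single1 (u, v))) (td Q)) = 0" for u v
  proof -
    let ?s = "koszul_sign (word_degree u + word_degree v) :: 'k"
    have "td (tproj (single1 (u, v))) = 0"
      by (simp add: tproj_single td_tens[OF cycle_proj_word] d_cycle_proj tens_simps)
    moreover have "tsgn (tproj (single1 (u, v))) = scl ?s (tproj (single1 (u, v)))"
      unfolding tproj_single by (rule tsgn_tens[OF cycle_proj_word cycle_proj_word])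
    ultimately have "td (tmul (tproj (single1 (u, v))) Q) = scl ?s (tmul (tproj (single1 (u, v))) (td Q))"
      by (simp add: td_tmul tmul_simps)
    then have "?s * tfun \<phi> \<psi> (tmul (tproj (single1 (u, v))) (td Q)) = 0"
      using tfun_td by (metis k_linear_scl[OF tfun_k_linear])
    then show ?thesis by (simp add: koszul_sign_def split: if_splits)
  qed
  then have "tfun \<phi> \<psi> (tmul (tproj (single1 w)) (td Q)) = 0" for w by (cases w) blast
  then show ?thesis
    by (induction P rule: poly_induct) (simp_all add: lin tmul_simps del: scl_single)
qed

text \<open>Cycles of the tensor square need not be sums of tensors of cycles. The Kuenneth homotopy
  replaces each of the two cycles by its \<open>tproj\<close> at the cost of a boundary, and
  boundaries do not affect the values.\<close>

lemma tfun_tmul: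
  assumes P: "td P = 0" and Q: "td Q = 0"
  shows "tfun \<phi> \<psi> (tmul P Q) = tfun \<phi> \<psi> P * tfun \<phi> \<psi> Q"
proof -
  have z: "th 0 = 0" by (rule k_linear_zero[OF th_k_linear])
  have P': "P = tproj P + td (th P)" and Q': "Q = tproj Q + td (th Q)"
    using tproj_homotopy[of P] tproj_homotopy[of Q] P Q z by simp_all
  have "tmul (td (th P)) Q = td (tmul (th P) Q)"
    using Q by (simp add: td_tmul tmul_simps)
  then have "tfun \<phi> \<psi> (tmul (td (th P)) Q) = 0" using tfun_td by simp
  then have "tfun \<phi> \<psi> (tmul P Q) = tfun \<phi> \<psi> (tmul (tproj P) Q)"
    by (subst P') (simp add: tmul_simps tfun_simps)
  also have "\<dots> = tfun \<phi> \<psi> (tmul (tproj P) (tproj Q))"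
    by (subst Q') (simp add: tmul_simps tfun_simps tfun_tmul_tproj_td)
  also have "\<dots> = tfun \<phi> \<psi> (tproj P) * tfun \<phi> \<psi> (tproj Q)" by (rule tfun_tmul_tproj)
  also have "tfun \<phi> \<psi> (tproj P) = tfun \<phi> \<psi> P"
    by (subst (2) P') (simp add: tfun_simps tfun_td)
  also have "tfun \<phi> \<psi> (tproj Q) = tfun \<phi> \<psi> Q"
    by (subst (2) Q') (simp add: tfun_simps tfun_td)
  finally show ?thesis .
qed

lemma conv_k_linear: "k_linear (*) (conv \<phi> \<psi>)"
  unfolding conv_def by (rule vector_space_over_itself.k_linear_fun_comp[OF tfun_k_linear shuffle_k_linear])

text \<open>Multiplicativity reduces to \<open>tfun_tmul\<close>, as the shuffle coproduct is an
  algebra map that takes cycles to cycles. It also preserves the total degree, so off degree 0 every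
  term has a factor of nonzero degree, on which a character vanishes.\<close>

lemma character_conv: "character (conv \<phi> \<psi>)"
  unfolding character_def
proof (intro conjI allI impI)
  show "k_linear (*) (conv \<phi> \<psi>)" by (rule conv_k_linear)
  show "conv \<phi> \<psi> (d p) = 0" for p by (simp add: conv_def tfun_td flip: td_shuffle)
  show "conv \<phi> \<psi> 1 = 1"
    using characterD(3)[OF \<phi>] characterD(3)[OF \<psi>] by (simp add: conv_def shuffle_one tfun_single single1_Nil)
  show "conv \<phi> \<psi> (p * q) = conv \<phi> \<psi> p * conv \<phi> \<psi> q" if "d p = 0" "d q = 0" for p q
    unfolding conv_def shuffle_mult using that by (intro tfun_tmul) (simp_all add: td_shuffle shuffle_simps)
  fix n :: int and p :: "(int \<times> 'x) list \<Rightarrow>\<^sub>0 'k" assume p: "homogeneous n p" "n \<noteq> 0"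
  show "conv \<phi> \<psi> p = 0"
    using p(1) unfolding homogeneous_def
  proof (induction p rule: poly_induct_on)
    case (single w)
    then have w: "word_degree w = n" by simp
    have "\<phi> (single1 u) * \<psi> (single1 v) = 0" if "(u, v) \<in> supp (shuffle_word w :: ('x, 'k) words2)" for u v
    proof -
      have "word_degree u \<noteq> 0 \<or> word_degree v \<noteq> 0" using shuffle_word_degree[of w] that w p(2) by fastforce
      then show ?thesis
        using characterD(4)[OF \<phi> homogeneous_word] characterD(4)[OF \<psi> homogeneous_word] by auto
    qed
    then show ?case
      unfolding conv_def shuffle_single tfun_def lin_ext_def by (intro sum.neutral) auto
  qed (simp_all add: k_linear_zero[OF conv_k_linear] k_linear_add[OF conv_k_linear] k_linear_scl[OF conv_k_linear])
qed

end

text \<open>The differential of a word has no constant term, because by \<open>augmented\<close> the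
  differential of a letter has none.\<close>

lemma character_augmentation: "character augmentation"
  unfolding character_def
proof (intro conjI allI impI)
  show "k_linear (*) augmentation" by (rule field_scale.alg_ext_k_linear)
  have "augmentation (d (single1 w)) = 0" for w
  proof (cases w)
    case (Cons l w)
    then show ?thesis
      by (simp add: der_single field_scale.alg_ext_add field_scale.alg_ext_mult field_scale.alg_ext_scl
          augmentation_word augmentation_eq[of "\<delta> l"] augmented)
  qed (simp add: der_single field_scale.alg_ext_zero)
  then show "augmentation (d p) = 0" for p
    by (induction p rule: poly_induct)
      (simp_all add: der_add der_scl der_zero field_scale.alg_ext_add field_scale.alg_ext_scl field_scale.alg_ext_zero del: scl_single)
  show "augmentation p = 0" if "homogeneous n p" "n \<noteq> 0" for n p
    using that by (auto simp: augmentation_eq homogeneous_def in_keys_iff)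
qed (simp_all add: field_scale.alg_ext_one field_scale.alg_ext_mult)

primrec conv_power :: "(((int \<times> 'x) list \<Rightarrow>\<^sub>0 'k) \<Rightarrow> 'k) \<Rightarrow> nat \<Rightarrow> ((int \<times> 'x) list \<Rightarrow>\<^sub>0 'k) \<Rightarrow> 'k" where
  "conv_power \<phi> 0 = augmentation"
| "conv_power \<phi> (Suc n) = conv \<phi> (conv_power \<phi> n)"

lemma character_conv_power: "character \<phi> \<Longrightarrow> character (conv_power \<phi> n)"
  by (induction n) (simp_all add: character_augmentation character_conv)

text \<open>The augmentation is a right unit for convolution, by the counit property of the shuffle
  coproduct.\<close>

lemma conv_power_one:
  assumes "character \<phi>" shows "conv_power \<phi> (Suc 0) p = \<phi> p"
proof -
  note lin = characterD(1)[OF assms]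
  have "tfun \<phi> augmentation (single1 a) = \<phi> (lin_ext scl (\<lambda>(u, v). if v = [] then single1 u else 0) (single1 a))" for a
    by (cases a) (auto simp: tfun_single augmentation_word poly.lin_ext_single k_linear_zero[OF lin])
  then have "tfun \<phi> augmentation P = \<phi> (lin_ext scl (\<lambda>(u, v). if v = [] then single1 u else 0) P)" for P
    by (rule k_linear_eqI[OF tfun_k_linear vector_space_over_itself.k_linear_fun_comp[OF lin poly.lin_ext_k_linear]])
  then have "conv_power \<phi> (Suc 0) (single1 w) = \<phi> (single1 w)" for w
    by (simp add: conv_def shuffle_single shuffle_word_right_counit)
  then show ?thesis
    using k_linear_eqI[OF characterD(1)[OF character_conv_power[OF assms, of "Suc 0"]] lin] by simp
qed

text \<open>By induction on the length of the word, consecutive powers differ by a combination of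
  the sequences of shorter words, with coefficients that do not depend on \<open>n\<close>.\<close>

lemma polynomial_seq_conv_power:
  assumes \<phi>: "character \<phi>" shows "polynomial_seq (\<lambda>n. conv_power \<phi> n p)"
proof -
  have word: "polynomial_seq (\<lambda>n. conv_power \<phi> n (single1 w))" for w
  proof (induction w rule: measure_induct_rule[of length])
    case (less w)
    define R :: "('x, 'k) words2" where "R = shuffle_word w - single1 ([], w)"
    have sw: "shuffle_word w = single1 ([], w) + R" by (simp add: R_def)
    \<comment> \<open>The leading term \<open>1 \<otimes> w\<close> contributes
      \<open>\<phi> 1\<close> times the \<open>n\<close>-th value at \<open>w\<close>, which is the
      term subtracted.\<close>
    have "conv_power \<phi> (Suc n) (single1 w) - conv_power \<phi> n (single1 w) =
        (\<Sum>(u, v)\<in>supp R. (coeff_of R (u, v) * \<phi> (single1 u)) * conv_power \<phi> n (single1 v))" for n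
      using characterD(3)[OF \<phi>]
      by (simp add: conv_def shuffle_single sw tfun_simps tfun_single single1_Nil)
        (simp add: tfun_def lin_ext_def case_prod_unfold mult.assoc)
    moreover have "polynomial_seq (\<lambda>n. \<Sum>(u, v)\<in>supp R. (coeff_of R (u, v) * \<phi> (single1 u)) * conv_power \<phi> n (single1 v))"
      unfolding case_prod_unfold
    proof (intro polynomial_seq_sum polynomial_seq_cmult less.IH)
      fix a assume "a \<in> supp R"
      moreover have "supp R \<subseteq> {(u, v). length v < length w}" unfolding R_def by (rule shuffle_word_leading)
      ultimately show "length (snd a) < length w" by auto
    qed
    ultimately have "polynomial_seq (\<lambda>n. conv_power \<phi> (Suc n) (single1 w) - conv_power \<phi> n (single1 w))"
      by (simp only:)
    then show ?case by (rule polynomial_seq_diff)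
  qed
  have "conv_power \<phi> n p = (\<Sum>w\<in>supp p. coeff_of p w * conv_power \<phi> n (single1 w))" for n
    using vector_space_over_itself.k_linear_lin_ext[OF characterD(1)[OF character_conv_power[OF \<phi>]], of n p] by (simp add: lin_ext_def)
  then show ?thesis using polynomial_seq_sum[OF polynomial_seq_cmult[OF word]] by simp
qed

lemma character_of_unit:
  assumes \<phi>: "character \<phi>" and uv: "homogeneous 0 u" "homogeneous 0 v" "d u = 0" "d v = 0" "u * v = 1 + d w"
  shows "\<phi> u = augmentation u"
proof -
  have "conv_power \<phi> n u * conv_power \<phi> n v = 1" for n
  proof -
    note c = characterD[OF character_conv_power[OF \<phi>, of n]]
    have "conv_power \<phi> n u * conv_power \<phi> n v = conv_power \<phi> n (1 + d w)"
      using c(5)[OF uv(1-4)] uv(5) by simp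
    then show ?thesis using c(2,3) by (simp add: k_linear_add[OF c(1)])
  qed
  \<comment> \<open>The exponents 1 and 0 are compared: the first power is the character itself, the
    zeroth the augmentation.\<close>
  from polynomial_seq_unit[OF polynomial_seq_conv_power[OF \<phi>] polynomial_seq_conv_power[OF \<phi>] this, of "Suc 0" 0]
  show ?thesis using conv_power_one[OF \<phi>] by simp
qed

text \<open>A functional known on cycles is extended to all polynomials by taking the component of
  degree 0 and applying \<open>cycle_proj\<close>. On a cycle of degree 0 this changes the argument
  by the boundary of \<open>h p\<close> only, so the value remains.\<close>

lemma character_extension:
  assumes add: "\<And>p q. homogeneous 0 p \<Longrightarrow> homogeneous 0 q \<Longrightarrow> d p = 0 \<Longrightarrow> d q = 0 \<Longrightarrow> \<kappa> (p + q) = \<kappa> p + \<kappa> q"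
    and scl: "\<And>c p. homogeneous 0 p \<Longrightarrow> d p = 0 \<Longrightarrow> \<kappa> (scl c p) = c * \<kappa> p" and one: "\<kappa> 1 = 1"
    and mult: "\<And>n m p q. homogeneous n p \<Longrightarrow> homogeneous m q \<Longrightarrow> d p = 0 \<Longrightarrow> d q = 0 \<Longrightarrow> \<kappa> (p * q) = \<kappa> p * \<kappa> q"
    and bd: "\<And>p. homogeneous 1 p \<Longrightarrow> \<kappa> (d p) = 0"
    and deg: "\<And>n p. homogeneous n p \<Longrightarrow> d p = 0 \<Longrightarrow> n \<noteq> 0 \<Longrightarrow> \<kappa> p = 0"
  shows "\<exists>\<phi>. character \<phi> \<and> (\<forall>p. homogeneous 0 p \<longrightarrow> d p = 0 \<longrightarrow> \<phi> p = \<kappa> p)"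
proof -
  define \<phi> where "\<phi> p = \<kappa> (cycle_proj (degree_comp 0 p))" for p
  have hc: "homogeneous 0 (cycle_proj (degree_comp 0 p))" for p
    by (rule homogeneous_cycle_proj[OF homogeneous_degree_comp])
  have z: "\<kappa> 0 = 0" using scl[of 0 0] by (simp add: der_zero)
  have lin: "k_linear (*) \<phi>"
    by (intro k_linearI) (simp_all add: \<phi>_def k_linear_add[OF degree_comp_k_linear] k_linear_scl[OF degree_comp_k_linear]
        k_linear_add[OF cycle_proj_k_linear] k_linear_scl[OF cycle_proj_k_linear] add scl hc d_cycle_proj)
  have deg0: "\<phi> p = 0" if "homogeneous n p" "n \<noteq> 0" for n p
    using that by (simp add: \<phi>_def degree_comp_homogeneous k_linear_zero[OF cycle_proj_k_linear] z)
  have eq: "\<phi> p = \<kappa> p" if p: "homogeneous 0 p" "d p = 0" for p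
  proof -
    have "cycle_proj p + d (h p) = p" by (simp add: cycle_proj_def p k_linear_zero[OF h_k_linear])
    moreover have "\<kappa> (cycle_proj p + d (h p)) = \<kappa> (cycle_proj p) + \<kappa> (d (h p))"
      using homogeneous_cycle_proj[OF p(1)] homogeneous_d[OF homogeneous_h[OF p(1)]]
      by (intro add) (simp_all add: d_cycle_proj d_d)
    ultimately show ?thesis
      using bd[of "h p"] homogeneous_h[OF p(1)] degree_comp_homogeneous[OF p(1), of 0] by (simp add: \<phi>_def)
  qed
  have "\<phi> (d (single1 w)) = 0" for w
  proof (cases "word_degree w = 1")
    case True
    then show ?thesis using eq[of "d (single1 w)"] bd[OF homogeneous_single[OF True]] homogeneous_d_word[of w]
      by (simp add: d_d)
  next
    case False
    then show ?thesis using deg0[OF homogeneous_d_word[of w]] by simp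
  qed
  then have "\<phi> (d p) = 0" for p
    by (induction p rule: poly_induct)
      (simp_all add: der_add der_scl der_zero k_linear_add[OF lin] k_linear_scl[OF lin] k_linear_zero[OF lin] del: scl_single)
  moreover have "\<phi> (p * q) = \<phi> p * \<phi> q"
    if "homogeneous n p" "homogeneous m q" "d p = 0" "d q = 0" for n m p q
  proof (cases "n = 0 \<and> m = 0")
    case True
    then show ?thesis
      using that mult[OF that] eq[of p] eq[of q] eq[of "p * q"] homogeneous_mult[OF that(1,2)]
      by (simp add: der_mult)
  next
    case False
    then have z: "\<phi> p * \<phi> q = 0" "\<kappa> p * \<kappa> q = 0"
      using deg0[OF that(1)] deg0[OF that(2)] deg[OF that(1,3)] deg[OF that(2,4)] by auto
    \<comment> \<open>Two factors of opposite nonzero degrees still have a product of degree 0; its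
      value is that of \<kappa>, which vanishes by multiplicativity of \<kappa>.\<close>
    show ?thesis
    proof (cases "n + m = 0")
      case True
      then have "\<phi> (p * q) = \<kappa> (p * q)"
        using eq[of "p * q"] homogeneous_mult[OF that(1,2)] that by (simp add: der_mult)
      then show ?thesis using z mult[OF that] by (simp only:)
    next
      case False
      then show ?thesis using deg0[OF homogeneous_mult[OF that(1,2)]] z by simp
    qed
  qed
  moreover have "\<phi> 1 = 1" using eq[OF homogeneous_one] one by simp
  ultimately have "character \<phi>" unfolding character_def using lin deg0 by blast
  then show ?thesis using eq by blast
qed

end


section \<open>Cocommutative coalgebras\<close>

lemma lin_ext_on_pair_cong:
  assumes "supp q \<subseteq> lists (letters V)"
    "\<And>i x j y. x \<in> carrier (V i) \<Longrightarrow> y \<in> carrier (V j) \<Longrightarrow> \<psi> i x j y = \<psi>' i x j y"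
  shows "lin_ext s (on_pair \<psi>) q = lin_ext s (on_pair \<psi>') q"
proof -
  have "on_pair \<psi> w = on_pair \<psi>' w" if "w \<in> supp q" for w
  proof (cases "\<exists>i x j y. w = [(i, x), (j, y)]")
    case True
    then obtain i x j y where w: "w = [(i, x), (j, y)]" by blast
    have "w \<in> lists (letters V)" using that assms(1) by blast
    then show ?thesis using assms(2)[of x i y j] by (simp add: w)
  next
    case False
    then show ?thesis by (auto simp: on_pair_def split: list.split prod.split)
  qed
  then show ?thesis by (simp add: lin_ext_def)
qed

lemma supp_lin_ext_on_pair:
  assumes "supp q \<subseteq> lists (letters V)"
    "\<And>i x j y. x \<in> carrier (V i) \<Longrightarrow> y \<in> carrier (V j) \<Longrightarrow> supp (\<psi> i x j y) \<subseteq> S"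
  shows "supp (lin_ext scl (on_pair \<psi>) q) \<subseteq> S"
proof -
  have "supp (on_pair \<psi> w) \<subseteq> S" if w: "w \<in> lists (letters V)" for w
  proof (cases "\<exists>i x j y. w = [(i, x), (j, y)]")
    case True
    then obtain i x j y where "w = [(i, x), (j, y)]" by blast
    then show ?thesis using assms(2)[of x i y j] w by simp
  next
    case False
    then show ?thesis by (auto simp: on_pair_def split: list.split prod.split)
  qed
  then show ?thesis using supp_lin_ext[of "on_pair \<psi>" q] assms(1) by blast
qed

lemma comp_on_pair:
  "f 0 = 0 \<Longrightarrow> f (on_pair \<psi> w) = on_pair (\<lambda>i x j y. f (\<psi> i x j y)) w"
  by (auto simp: on_pair_def split: list.split prod.split)

lemma (in vector_space) lin_ext_comp_on_pair:
  assumes "k_linear scale f"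
  shows "f (lin_ext scl (on_pair \<psi>) q) = lin_ext scale (on_pair (\<lambda>i x j y. f (\<psi> i x j y))) q"
  by (simp add: lin_ext_comp[OF assms] comp_on_pair[of f, OF k_linear_zero[OF assms]])

lemma lin_ext_on_pair_add:
  "lin_ext scl (on_pair (\<lambda>i x j y. \<phi> i x j y + \<psi> i x j y)) q = lin_ext scl (on_pair \<phi>) q + lin_ext scl (on_pair \<psi>) q"
proof -
  have "on_pair (\<lambda>i x j y. \<phi> i x j y + \<psi> i x j y) w = on_pair \<phi> w + on_pair \<psi> w" for w
    by (auto simp: on_pair_def split: list.split prod.split)
  then show ?thesis by (simp add: lin_ext_def poly.scale_right_distrib sum.distrib)
qed

lemma lin_ext_on_pair_uminus:
  "lin_ext scl (on_pair (\<lambda>i x j y. - \<psi> i x j y)) q = - lin_ext scl (on_pair \<psi>) q"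
proof -
  have "on_pair (\<lambda>i x j y. - \<psi> i x j y) w = - on_pair \<psi> w" for w
    by (auto simp: on_pair_def split: list.split prod.split)
  then show ?thesis by (simp add: lin_ext_def sum_negf)
qed

lemma shuffle_letters:
  assumes "supp p \<subseteq> {w. length w = 1}"
  shows "shuffle p = tens p 1 + tens 1 p"
  using assms
proof (induction p rule: poly_induct_on)
  case (single w)
  then obtain l where "w = [l]" by (cases w) auto
  then show ?case
    by (simp add: shuffle_single tmul_simps tmul_single tens_single flip: single1_Nil)
qed (simp_all add: shuffle_simps tens_simps poly.scale_right_distrib del: scl_single)

section \<open>The coalgebra axioms in terms of cobar generators\<close>

context augmented_dgc
begin

lemma bl_supp_length: "supp (bl l) \<subseteq> {w. length w = 1}"
proof (cases "(fst l - 1, pj (fst l) (snd l)) \<in> letters V")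
  case True
  then show ?thesis
    using supp_lin_ext[of "\<lambda>t. single1 [(fst l - 1, t)]" "normal_form (V (fst l - 1)) (single1 (pj (fst l) (snd l)))"]
    by (auto simp: bar_letter_def letter_nform_def)
qed (simp add: bar_letter_def letter_nform_def)

lemma multilinear_bar_square: "multilinear Sp scl (bar_square C)"
  unfolding bar_square_def using linear_on_bl unfolding linear_on_def
  by (intro poly.multilinear_on_pair linear_onI)
    (auto simp: distrib_left distrib_right poly.scale_right_distrib poly.scale_mult_left poly.scale_mult_right mult.commute)

lemma sq_nform: "supp p \<subseteq> lists (letters Sp) \<Longrightarrow> sq (nform Sp p) = sq p"
  by (rule poly.multilinear_nform[OF Sp.graded_space_axioms multilinear_bar_square])

lemma bl_zero: "bl (n, \<zero>\<^bsub>Sp n\<^esub>) = 0"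
  using linear_on_zero[OF module_Sp linear_on_bl] .

lemma linear_on_word2:
  "linear_on (Sp i) scl (\<lambda>x. nform Sp (single1 [(i, x), l]))" "linear_on (Sp j) scl (\<lambda>y. nform Sp (single1 [l, (j, y)]))"
  using Sp.letter_nform_linear_on unfolding linear_on_def
  by (simp_all add: nform_word distrib_left distrib_right poly.scale_mult_left poly.scale_mult_right)

lemma linear_on_compose_bd:
  "linear_on (Sp (i - 1)) s f \<Longrightarrow> linear_on (Sp i) s (\<lambda>x. f (bd C i x))"
  using lin_bd[of i] bd_closed[of _ i] by (auto simp: linear_on_def lin_map_def)

lemma linear_on_add: "linear_on M scl f \<Longrightarrow> linear_on M scl g \<Longrightarrow> linear_on M scl (\<lambda>x. f x + g x)"
  by (simp add: linear_on_def poly.scale_right_distrib)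

lemma linear_on_scl: "linear_on M scl f \<Longrightarrow> linear_on M scl (\<lambda>x. scl c (f x))"
  by (simp add: linear_on_def poly.scale_right_distrib mult.commute)

text \<open>The co-Leibniz rule after desuspension. The term with \<open>bd x\<close> gets the
  weight of degree \<open>i - 1\<close>, hence the minus sign; in the other term the weight cancels
  the Koszul sign of the rule.\<close>

lemma coprod_bd:
  assumes x: "x \<in> carrier (Sp n)"
  shows "sq (Q (n - 1) (bd C n x)) = lin_ext scl (on_pair (\<lambda>i x j y.
    - scl (koszul_sign i) (bl (i - 1, bd C i x) * bl (j, y)) + bl (i, x) * bl (j - 1, bd C j y))) (Q n x)"
proof -
  let ?\<psi> = "\<lambda>i x j y. single1 [(i - 1, bd C i x), (j, y)] + scl (koszul_sign i :: 'k) (single1 [(i, x), (j - 1, bd C j y)])"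
  have s1: "supp (single1 [(i - 1, bd C i x), (j, y)] :: _ \<Rightarrow>\<^sub>0 'k) \<subseteq> lists (letters Sp)"
    "supp (single1 [(i, x), (j - 1, bd C j y)] :: _ \<Rightarrow>\<^sub>0 'k) \<subseteq> lists (letters Sp)"
    if "x \<in> carrier (Sp i)" "y \<in> carrier (Sp j)" for i x j y
    using that by (simp_all add: bd_closed)
  have s: "supp (?\<psi> i x j y) \<subseteq> lists (letters Sp)" if "x \<in> carrier (Sp i)" "y \<in> carrier (Sp j)" for i x j y
    using s1[OF that] by (intro Sp.supp_add_lists order.trans[OF supp_scl])
  have ax: "coprod C (n - 1) (bd C n x) = on_tensor_square Sp (\<lambda>i x j y. tensor_word Sp [(i - 1, bd C i x), (j, y)]
      \<oplus>\<^bsub>Sp.TV\<^esub> koszul_sign i \<odot>\<^bsub>Sp.TV\<^esub> tensor_word Sp [(i, x), (j - 1, bd C j y)]) (coprod C n x)"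
    using counital x unfolding counital_dg_coalgebra_def Let_def by blast
  also have "\<dots> = Sp.cl (lin_ext scl (on_pair ?\<psi>) (Q n x))"
    unfolding coprod_class(1)[OF x]
  proof (rule on_tensor_square_class[OF Sp.graded_space_axioms Sp.graded_space_axioms _ _ _ coprod_class(2)[OF x]])
    fix i x j y assume xy: "x \<in> carrier (Sp i)" "y \<in> carrier (Sp j)"
    have "supp (scl (koszul_sign i :: 'k) (single1 [(i, x), (j - 1, bd C j y)])) \<subseteq> lists (letters Sp)"
      by (rule order.trans[OF supp_scl s1(2)[OF xy]])
    then show "tensor_word Sp [(i - 1, bd C i x), (j, y)] \<oplus>\<^bsub>Sp.TV\<^esub>
        koszul_sign i \<odot>\<^bsub>Sp.TV\<^esub> tensor_word Sp [(i, x), (j - 1, bd C j y)] = Sp.cl (?\<psi> i x j y) \<and>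
        supp (?\<psi> i x j y) \<subseteq> lists (letters Sp)"
      using s[OF xy] s1[OF xy] by (simp add: tensor_word_def Sp.tensor_smult Sp.tensor_add del: scl_single)
  next
    fix i j y assume "y \<in> carrier (Sp j)"
    then show "linear_on (Sp i) scl (\<lambda>x. nform Sp (?\<psi> i x j y))"
      unfolding nform_add nform_scl
      by (intro linear_on_add linear_on_scl linear_on_word2 linear_on_compose_bd)
  next
    fix i j x assume "x \<in> carrier (Sp i)"
    then show "linear_on (Sp j) scl (\<lambda>y. nform Sp (?\<psi> i x j y))"
      unfolding nform_add nform_scl
      by (intro linear_on_add linear_on_scl linear_on_word2 linear_on_compose_bd)
  qed
  finally have eq: "coprod C (n - 1) (bd C n x) = Sp.cl (lin_ext scl (on_pair ?\<psi>) (Q n x))" .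
  have supp: "supp (lin_ext scl (on_pair ?\<psi>) (Q n x)) \<subseteq> lists (letters Sp)"
    by (rule supp_lin_ext_on_pair[OF coprod_class(2)[OF x] s])
  have "sq (Q (n - 1) (bd C n x)) = sq (lin_ext scl (on_pair ?\<psi>) (Q n x))"
    using coprod_class(4)[OF bd_closed[OF x] supp eq] sq_nform[OF supp] by simp
  also have "\<dots> = lin_ext scl (on_pair (\<lambda>i x j y. sq (?\<psi> i x j y))) (Q n x)"
    by (rule poly.lin_ext_comp_on_pair[OF poly.lin_ext_k_linear])
  also have "(\<lambda>i x j y. sq (?\<psi> i x j y)) = (\<lambda>i x j y.
    - scl (koszul_sign i) (bl (i - 1, bd C i x) * bl (j, y)) + bl (i, x) * bl (j - 1, bd C j y))"
    by (simp add: fun_eq_iff poly.lin_ext_add poly.lin_ext_scl poly.lin_ext_single bar_square_def koszul_sign_diff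
        del: scl_single)
  finally show ?thesis .
qed

text \<open>The sign by the degree of the middle factor is what both bracketings of the iterated
  coproduct produce: directly when the last two factors come from one coproduct, and up to the sign
  of their total degree when the first two do.\<close>

definition cubic_weight :: "int list \<Rightarrow> 'k" where
  "cubic_weight ds = (case ds of [i, j, k] \<Rightarrow> koszul_sign j | _ \<Rightarrow> 0)"

abbreviation "cub \<equiv> lin_ext scl (\<lambda>w. scl (cubic_weight (map fst w)) (prod_list (map bl w)))"

lemma cub_nform: "supp p \<subseteq> lists (letters Sp) \<Longrightarrow> cub (nform Sp p) = cub p"
  by (rule poly.multilinear_nform[OF Sp.graded_space_axioms
        multilinear_weighted[OF poly.multilinear_prod_list[OF linear_on_bl]]])

lemma cub_left: "cub (single1 [l] * p) = bl l * sq p"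
proof (induction p rule: poly_induct)
  case (single w)
  show ?case
  proof (cases "length w = 2")
    case True
    then obtain l1 l2 where "w = [l1, l2]" by (auto simp: length_Suc_conv numeral_2_eq_2)
    then show ?thesis
      by (simp add: single1_mult poly.lin_ext_single cubic_weight_def bar_square_def poly.scale_mult_right mult.assoc)
  next
    case False
    then have "bar_square C w = 0" by (simp add: bar_square_def on_pair_other)
    moreover have "cubic_weight (map fst (l # w)) = 0"
      using False by (auto simp: cubic_weight_def split: list.split)
    ultimately show ?thesis by (simp add: single1_mult poly.lin_ext_single)
  qed
qed (simp_all add: distrib_left poly.lin_ext_add poly.lin_ext_scl poly.lin_ext_zero poly.scale_mult_right del: scl_single)

lemma cub_right:
  assumes "homogeneous i p"
  shows "cub (p * single1 [l]) = scl (koszul_sign i) (sq p * bl l)"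
  using assms unfolding homogeneous_def
proof (induction p rule: poly_induct_on)
  case (single w)
  show ?case
  proof (cases "length w = 2")
    case True
    then obtain l1 l2 where w: "w = [l1, l2]" by (auto simp: length_Suc_conv numeral_2_eq_2)
    then have "i = fst l1 + fst l2" using single by simp
    then show ?thesis
      by (simp add: w single1_mult poly.lin_ext_single cubic_weight_def bar_square_def poly.scale_mult_left mult.assoc
          koszul_sign_add)
  next
    case False
    then have "bar_square C w = 0" by (simp add: bar_square_def on_pair_other)
    moreover have "cubic_weight (map fst (w @ [l])) = 0"
      using False by (auto simp: cubic_weight_def split: list.split)
    ultimately show ?thesis by (simp add: single1_mult poly.lin_ext_single)
  qed
qed (simp_all add: distrib_right poly.lin_ext_add poly.lin_ext_scl poly.lin_ext_zero poly.scale_mult_left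
    poly.scale_right_distrib mult.commute del: scl_single)

text \<open>Both sides are values of the multilinear map \<open>cub\<close> on the two iterated
  coproducts, which are equal as tensors.\<close>

lemma coassociative:
  assumes x: "x \<in> carrier (Sp n)"
  shows "lin_ext scl (on_pair (\<lambda>i x j y. scl (koszul_sign i) (sq (Q i x) * bl (j, y)))) (Q n x) =
    lin_ext scl (on_pair (\<lambda>i x j y. bl (i, x) * sq (Q j y))) (Q n x)"
proof -
  let ?\<phi> = "\<lambda>i x j y. Q i x * single1 [(j, y)]" and ?\<psi> = "\<lambda>i x j y. single1 [(i, x)] * Q j y"
  note q = coprod_class(2)[OF x]
  have s: "supp (?\<phi> i x j y) \<subseteq> lists (letters Sp)" "supp (?\<psi> i x j y) \<subseteq> lists (letters Sp)"
    if "x \<in> carrier (Sp i)" "y \<in> carrier (Sp j)" for i x j y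
    by (intro supp_mult_lists coprod_class(2); use that in simp)+
  have lin: "linear_on (Sp i) scl (\<lambda>x. nform Sp (Q i x))" for i
    using linear_on_Q[of i] unfolding linear_on_def by (simp add: nform_add nform_scl)
  have ax: "on_tensor_square Sp (\<lambda>i x j y. coprod C i x \<otimes>\<^bsub>Sp.TV\<^esub> tensor_word Sp [(j, y)]) (coprod C n x) =
      on_tensor_square Sp (\<lambda>i x j y. tensor_word Sp [(i, x)] \<otimes>\<^bsub>Sp.TV\<^esub> coprod C j y) (coprod C n x)"
    using counital x unfolding counital_dg_coalgebra_def Let_def by blast
  have 1: "on_tensor_square Sp (\<lambda>i x j y. coprod C i x \<otimes>\<^bsub>Sp.TV\<^esub> tensor_word Sp [(j, y)]) (coprod C n x) =
      Sp.cl (lin_ext scl (on_pair ?\<phi>) (Q n x))"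
    unfolding coprod_class(1)[OF x]
  proof (rule on_tensor_square_class[OF Sp.graded_space_axioms Sp.graded_space_axioms _ _ _ q])
    fix i x j y assume xy: "x \<in> carrier (Sp i)" "y \<in> carrier (Sp j)"
    then show "coprod C i x \<otimes>\<^bsub>Sp.TV\<^esub> tensor_word Sp [(j, y)] = Sp.cl (?\<phi> i x j y) \<and> supp (?\<phi> i x j y) \<subseteq> lists (letters Sp)"
      using s[OF xy] coprod_class(1,2)[OF xy(1)] by (simp add: tensor_word_def Sp.tensor_mult)
  next
    show "linear_on (Sp i) scl (\<lambda>x. nform Sp (?\<phi> i x j y))" "linear_on (Sp j) scl (\<lambda>y. nform Sp (?\<phi> i x j y))" for i j x y
      using lin[of i] Sp.letter_nform_linear_on[of j] unfolding linear_on_def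
      by (simp_all add: nform_mult nform_letter distrib_left distrib_right poly.scale_mult_left poly.scale_mult_right)
  qed
  have 2: "on_tensor_square Sp (\<lambda>i x j y. tensor_word Sp [(i, x)] \<otimes>\<^bsub>Sp.TV\<^esub> coprod C j y) (coprod C n x) =
      Sp.cl (lin_ext scl (on_pair ?\<psi>) (Q n x))"
    unfolding coprod_class(1)[OF x]
  proof (rule on_tensor_square_class[OF Sp.graded_space_axioms Sp.graded_space_axioms _ _ _ q])
    fix i x j y assume xy: "x \<in> carrier (Sp i)" "y \<in> carrier (Sp j)"
    then show "tensor_word Sp [(i, x)] \<otimes>\<^bsub>Sp.TV\<^esub> coprod C j y = Sp.cl (?\<psi> i x j y) \<and> supp (?\<psi> i x j y) \<subseteq> lists (letters Sp)"
      using s[OF xy] coprod_class(1,2)[OF xy(2)] by (simp add: tensor_word_def Sp.tensor_mult)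
  next
    show "linear_on (Sp i) scl (\<lambda>x. nform Sp (?\<psi> i x j y))" "linear_on (Sp j) scl (\<lambda>y. nform Sp (?\<psi> i x j y))" for i j x y
      using lin[of j] Sp.letter_nform_linear_on[of i] unfolding linear_on_def
      by (simp_all add: nform_mult nform_letter distrib_left distrib_right poly.scale_mult_left poly.scale_mult_right)
  qed
  have s1: "supp (lin_ext scl (on_pair ?\<phi>) (Q n x)) \<subseteq> lists (letters Sp)"
    by (rule supp_lin_ext_on_pair[OF q]) (rule s(1))
  have s2: "supp (lin_ext scl (on_pair ?\<psi>) (Q n x)) \<subseteq> lists (letters Sp)"
    by (rule supp_lin_ext_on_pair[OF q]) (rule s(2))
  have "nform Sp (lin_ext scl (on_pair ?\<phi>) (Q n x)) = nform Sp (lin_ext scl (on_pair ?\<psi>) (Q n x))"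
    using ax 1 2 Sp.tensor_class_eq_iff[OF s1 s2] by simp
  then have "cub (lin_ext scl (on_pair ?\<phi>) (Q n x)) = cub (lin_ext scl (on_pair ?\<psi>) (Q n x))"
    using cub_nform[OF s1] cub_nform[OF s2] by simp
  then have "lin_ext scl (on_pair (\<lambda>i x j y. cub (?\<phi> i x j y))) (Q n x) = lin_ext scl (on_pair (\<lambda>i x j y. cub (?\<psi> i x j y))) (Q n x)"
    by (simp add: poly.lin_ext_comp_on_pair[OF poly.lin_ext_k_linear])
  moreover have "lin_ext scl (on_pair (\<lambda>i x j y. cub (?\<phi> i x j y))) (Q n x) =
      lin_ext scl (on_pair (\<lambda>i x j y. scl (koszul_sign i) (sq (Q i x) * bl (j, y)))) (Q n x)"
    by (rule lin_ext_on_pair_cong[OF q]) (rule cub_right[OF coprod_class(3)])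
  ultimately show ?thesis by (simp add: cub_left)
qed

text \<open>The square of the cobar differential on a generator has three parts: the linear one
  vanishes since \<open>bd\<close> squares to zero, the quadratic one by the co-Leibniz rule and the
  cubic one by coassociativity.\<close>

lemma der_letter_bd: "dC (dgc_letter_bd C l) = 0"
proof (cases "l \<in> letters V")
  case True
  obtain n x where l: "l = (n - 1, pj n x)" and x: "x \<in> carrier (Sp n)" by (rule gens_cases[OF True])
  let ?R1 = "\<lambda>i x j y. - scl (koszul_sign i) (bl (i - 1, bd C i x) * bl (j, y)) + bl (i, x) * bl (j - 1, bd C j y)"
  let ?R2 = "\<lambda>i x j y. scl (koszul_sign i) (sq (Q i x) * bl (j, y))"
  let ?R3 = "\<lambda>i x j y. bl (i, x) * sq (Q j y)"
  have "dC (sq (Q n x)) = lin_ext scl (on_pair (\<lambda>i x j y. dC (scl (koszul_sign i) (bl (i, x) * bl (j, y))))) (Q n x)"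
    unfolding bar_square_def by (rule poly.lin_ext_comp_on_pair[OF der_k_linear])
  also have "\<dots> = lin_ext scl (on_pair (\<lambda>i x j y. (?R1 i x j y + ?R2 i x j y) + - ?R3 i x j y)) (Q n x)"
  proof (rule lin_ext_on_pair_cong[OF coprod_class(2)[OF x]])
    fix i x j y assume xy: "x \<in> carrier (Sp i)" "y \<in> carrier (Sp j)"
    have "homogeneous (i - 1) (bl (i, x))" using homogeneous_bl[of "(i, x)"] by simp
    then show "dC (scl (koszul_sign i) (bl (i, x) * bl (j, y))) = ?R1 i x j y + ?R2 i x j y + - ?R3 i x j y"
      by (simp add: der_scl der_mult_homogeneous der_bl[OF xy(1)] der_bl[OF xy(2)] koszul_sign_diff
          poly.scale_right_distrib poly.scale_right_diff_distrib left_diff_distrib right_diff_distrib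
          distrib_left distrib_right)
  qed
  also have "\<dots> = sq (Q (n - 1) (bd C n x))"
    by (simp only: lin_ext_on_pair_add lin_ext_on_pair_uminus coassociative[OF x] coprod_bd[OF x]) simp
  finally have "dC (sq (Q n x)) = sq (Q (n - 1) (bd C n x))" .
  then have "dC (dgc_letter_bd C l) = bl (n - 1 - 1, bd C (n - 1) (bd C n x))"
    by (simp only: l cobar_bd_gen_pj(2)[OF x] der_add der_uminus der_bl[OF bd_closed[OF x]]) simp
  also have "\<dots> = 0" by (simp only: bd_bd[OF x] bl_zero)
  finally show ?thesis .
qed (simp add: dgc_letter_bd_def der_zero)

text \<open>Cocommutativity is transported by the multilinear map that sends \<open>x, y\<close> to
  the weighted tensor of their generators. The weight is taken on the new first factor after the
  flip, whence \<open>koszul_sign j\<close>.\<close>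

lemma coproduct_symmetric:
  assumes "cocommutative C" and x: "x \<in> carrier (Sp n)"
  shows "lin_ext scl (on_pair (\<lambda>i x j y. scl (koszul_sign i) (tens (bl (i, x)) (bl (j, y))))) (Q n x) =
    lin_ext scl (on_pair (\<lambda>i x j y. scl (koszul_sign (i * j) * koszul_sign j) (tens (bl (j, y)) (bl (i, x))))) (Q n x)"
proof -
  let ?\<psi> = "\<lambda>i x j y. scl (koszul_sign (i * j) :: 'k) (single1 [(j, y), (i, x)])"
  let ?G = "on_pair (\<lambda>i x j y. scl (koszul_sign i) (tens (bl (i, x)) (bl (j, y))))"
  note q = coprod_class(2)[OF x]
  have s1: "supp (single1 [(j, y), (i, x)] :: _ \<Rightarrow>\<^sub>0 'k) \<subseteq> lists (letters Sp)"
    if "x \<in> carrier (Sp i)" "y \<in> carrier (Sp j)" for i x j y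
    using that by simp
  have s: "supp (?\<psi> i x j y) \<subseteq> lists (letters Sp)" if "x \<in> carrier (Sp i)" "y \<in> carrier (Sp j)" for i x j y
    by (rule order.trans[OF supp_scl s1[OF that]])
  have "coprod C n x = on_tensor_square Sp (\<lambda>i x j y. koszul_sign (i * j) \<odot>\<^bsub>Sp.TV\<^esub> tensor_word Sp [(j, y), (i, x)]) (coprod C n x)"
    using assms by (simp add: cocommutative_def)
  also have "\<dots> = Sp.cl (lin_ext scl (on_pair ?\<psi>) (Q n x))"
    unfolding coprod_class(1)[OF x]
  proof (rule on_tensor_square_class[OF Sp.graded_space_axioms Sp.graded_space_axioms _ _ _ q])
    fix i x j y assume xy: "x \<in> carrier (Sp i)" "y \<in> carrier (Sp j)"
    then show "koszul_sign (i * j) \<odot>\<^bsub>Sp.TV\<^esub> tensor_word Sp [(j, y), (i, x)] = Sp.cl (?\<psi> i x j y) \<and>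
        supp (?\<psi> i x j y) \<subseteq> lists (letters Sp)"
      using s[OF xy] s1[OF xy] by (simp add: tensor_word_def Sp.tensor_smult del: scl_single)
  next
    show "linear_on (Sp i) scl (\<lambda>x. nform Sp (?\<psi> i x j y))" "linear_on (Sp j) scl (\<lambda>y. nform Sp (?\<psi> i x j y))" for i j x y
      unfolding nform_scl by (intro linear_on_scl linear_on_word2)+
  qed
  finally have eq: "coprod C n x = Sp.cl (lin_ext scl (on_pair ?\<psi>) (Q n x))" .
  have s2: "supp (lin_ext scl (on_pair ?\<psi>) (Q n x)) \<subseteq> lists (letters Sp)"
    by (rule supp_lin_ext_on_pair[OF q]) (rule s)
  have "multilinear Sp scl ?G"
    using linear_on_bl unfolding linear_on_def
    by (intro poly.multilinear_on_pair linear_onI)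
      (auto simp: tens_simps poly.scale_right_distrib mult.commute)
  then have "lin_ext scl ?G (nform Sp (lin_ext scl (on_pair ?\<psi>) (Q n x))) = lin_ext scl ?G (lin_ext scl (on_pair ?\<psi>) (Q n x))"
    by (rule poly.multilinear_nform[OF Sp.graded_space_axioms _ s2])
  then have "lin_ext scl ?G (Q n x) = lin_ext scl ?G (lin_ext scl (on_pair ?\<psi>) (Q n x))"
    by (rule trans[OF arg_cong[OF coprod_class(4)[OF x s2 eq], of "lin_ext scl ?G"]])
  also have "\<dots> = lin_ext scl (on_pair (\<lambda>i x j y. lin_ext scl ?G (?\<psi> i x j y))) (Q n x)"
    by (rule poly.lin_ext_comp_on_pair[OF poly.lin_ext_k_linear])
  also have "(\<lambda>i x j y. lin_ext scl ?G (?\<psi> i x j y)) =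
      (\<lambda>i x j y. scl (koszul_sign (i * j) * koszul_sign j) (tens (bl (j, y)) (bl (i, x))))"
    by (simp add: fun_eq_iff poly.lin_ext_scl poly.lin_ext_single del: scl_single)
  finally show ?thesis .
qed

lemma shuffle_bl_bl:
  "shuffle (bl (i, x) * bl (j, y)) = tens (bl (i, x) * bl (j, y)) 1 + tens 1 (bl (i, x) * bl (j, y)) +
    (tens (bl (i, x)) (bl (j, y)) + scl (koszul_sign ((i - 1) * (j - 1))) (tens (bl (j, y)) (bl (i, x))))"
proof -
  have h: "homogeneous (i - 1) (bl (i, x))" "homogeneous (j - 1) (bl (j, y))"
    using homogeneous_bl[of "(i, x)"] homogeneous_bl[of "(j, y)"] by simp_all
  show ?thesis
    by (simp add: shuffle_mult shuffle_letters[OF bl_supp_length] tmul_simps tmul_tens[OF homogeneous_one homogeneous_one]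
        tmul_tens[OF homogeneous_one h(2)] tmul_tens[OF h(1) homogeneous_one] tmul_tens[OF h] algebra_simps)
qed

text \<open>The shuffle coproduct of a product of two generators has two cross terms. Summed over a
  symmetric coproduct they cancel, because the desuspension shifts degrees by one and so reverses
  the sign of the flip.\<close>

lemma shuffle_sq:
  assumes "cocommutative C" and x: "x \<in> carrier (Sp n)"
  shows "shuffle (sq (Q n x)) = tens (sq (Q n x)) 1 + tens 1 (sq (Q n x))"
proof -
  let ?b = "\<lambda>i x j y. scl (koszul_sign i) (bl (i, x) * bl (j, y))"
  let ?G = "\<lambda>i x j y. scl (koszul_sign i) (tens (bl (i, x)) (bl (j, y)))"
  let ?H = "\<lambda>i x j y. scl (koszul_sign (i * j) * koszul_sign j) (tens (bl (j, y)) (bl (i, x)))"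
  \<comment> \<open>The exponents agree modulo 2: \<open>(i - 1)(j - 1) + i = i j - j + 1\<close>;
    the summand 1 is the sign that makes the cross terms cancel.\<close>
  have sgn: "koszul_sign i * koszul_sign ((i - 1) * (j - 1)) = - (koszul_sign (i * j) * koszul_sign j :: 'k)" for i j
    by (auto simp: koszul_sign_def)
  have "shuffle (?b i x j y) = tens (?b i x j y) 1 + tens 1 (?b i x j y) + (?G i x j y + - ?H i x j y)" for i x j y
    by (simp add: shuffle_simps shuffle_bl_bl tens_simps poly.scale_right_distrib sgn)
  then have "shuffle (sq (Q n x)) = lin_ext scl (on_pair (\<lambda>i x j y.
      tens (?b i x j y) 1 + tens 1 (?b i x j y) + (?G i x j y + - ?H i x j y))) (Q n x)"
    unfolding bar_square_def by (simp add: poly.lin_ext_comp_on_pair[OF shuffle_k_linear])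
  also have "\<dots> = lin_ext scl (on_pair (\<lambda>i x j y. tens (?b i x j y) 1)) (Q n x) +
      lin_ext scl (on_pair (\<lambda>i x j y. tens 1 (?b i x j y))) (Q n x)"
    by (simp only: lin_ext_on_pair_add lin_ext_on_pair_uminus coproduct_symmetric[OF assms]) simp
  finally show ?thesis
    unfolding bar_square_def
    by (simp add: poly.lin_ext_comp_on_pair[OF tens_left] poly.lin_ext_comp_on_pair[OF tens_right])
qed

lemma augmentation_bl: "augmentation (bl l) = 0"
  using bl_supp_length[of l] by (auto simp: augmentation_eq in_keys_iff)

lemma augmentation_sq: "augmentation (sq q) = 0"
proof -
  have "augmentation (sq q) = lin_ext (*) (\<lambda>w. augmentation (bar_square C w)) q"
    by (rule vector_space_over_itself.lin_ext_comp[OF field_scale.alg_ext_k_linear])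
  moreover have "augmentation (bar_square C w) = 0" for w
    unfolding bar_square_def comp_on_pair[of augmentation, OF field_scale.alg_ext_zero]
    by (auto simp: field_scale.alg_ext_scl field_scale.alg_ext_mult augmentation_bl on_pair_def split: list.split prod.split)
  ultimately show ?thesis by (simp add: lin_ext_def)
qed

end

lemma cocommutative_primitive_dga:
  fixes C :: "('k::field_char_0, 'v) dgc"
  assumes "augmented_dgc C" "cocommutative C"
  shows "primitive_dga (dgc_letter_bd C)"
proof
  interpret augmented_dgc C by fact
  fix l :: "int \<times> 'v set"
  show "homogeneous (fst l - 1) (dgc_letter_bd C l)" by (rule homogeneous_letter_bd)
  show "dC (dgc_letter_bd C l) = 0" by (rule der_letter_bd)
  show "shuffle (dgc_letter_bd C l) = tens (dgc_letter_bd C l) 1 + tens 1 (dgc_letter_bd C l)"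
  proof (cases "l \<in> letters V")
    case True
    then obtain n x where l: "l = (n - 1, pj n x)" and x: "x \<in> carrier (Sp n)" by (rule gens_cases)
    show ?thesis
      unfolding l cobar_bd_gen_pj(2)[OF x]
      by (simp add: shuffle_simps tens_simps shuffle_sq[OF assms(2) x] shuffle_letters[OF bl_supp_length])
  qed (simp add: dgc_letter_bd_def shuffle_simps tens_simps)
  show "coeff_of (dgc_letter_bd C l) [] = 0"
  proof (cases "l \<in> letters V")
    case True
    then obtain n x where l: "l = (n - 1, pj n x)" and x: "x \<in> carrier (Sp n)" by (rule gens_cases)
    show ?thesis
      unfolding l cobar_bd_gen_pj(2)[OF x] augmentation_eq[symmetric]
      by (simp add: field_scale.alg_ext_diff augmentation_bl augmentation_sq)
  qed (simp add: dgc_letter_bd_def)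
qed

text \<open>The Hopf algebra argument runs in the whole free algebra, whereas a homology character
  is constrained on normal forms only; precomposition with \<open>nform\<close>, a dg algebra map,
  bridges the two.\<close>

lemma cocommutative_no_separated_unit:
  fixes C :: "('k::field_char_0, 'v) dgc"
  assumes C: "augmented_dgc C" and cocomm: "cocommutative C"
  shows "\<not> separated_unit C"
proof
  interpret augmented_dgc C by fact
  interpret primitive_dga "dgc_letter_bd C" by (rule cocommutative_primitive_dga[OF C cocomm])
  assume "separated_unit C"
  then obtain u v w \<kappa> \<kappa>' where *: "u \<in> cobar_cycles C 0" "v \<in> cobar_cycles C 0" "u * v = 1 + dC w"
    "homology_character C \<kappa>" "homology_character C \<kappa>'" "\<kappa> u \<noteq> \<kappa>' u"
    unfolding separated_unit_def by blast
  have u: "homogeneous 0 u" "dC u = 0" "nform V u = u" and v: "homogeneous 0 v" "dC v = 0"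
    using *(1,2) by (simp_all add: cobar_cycles_def cobar_part_def)
  have "\<theta> u = augmentation u" if \<theta>: "homology_character C \<theta>" for \<theta>
  proof -
    note c = homology_characterD[OF \<theta>]
    have cyc: "nform V p \<in> cobar_cycles C n" if "homogeneous n p" "dC p = 0" for n p
      using that by (simp add: cobar_cycles_def cobar_part_def homogeneous_nform flip: nform_der)
    have "\<exists>\<phi>. character \<phi> \<and> (\<forall>p. homogeneous 0 p \<longrightarrow> dC p = 0 \<longrightarrow> \<phi> p = \<theta> (nform V p))"
    proof (rule character_extension)
      show "\<theta> (nform V (p + q)) = \<theta> (nform V p) + \<theta> (nform V q)"
        if "homogeneous 0 p" "homogeneous 0 q" "dC p = 0" "dC q = 0" for p q
        using c(1)[OF cyc[OF that(1,3)] cyc[OF that(2,4)]] by (simp add: nform_add)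
      show "\<theta> (nform V (scl a p)) = a * \<theta> (nform V p)" if "homogeneous 0 p" "dC p = 0" for a p
        using c(2)[OF cyc[OF that]] by (simp add: nform_scl)
      show "\<theta> (nform V 1) = 1" using c(3) by simp
      show "\<theta> (nform V (p * q)) = \<theta> (nform V p) * \<theta> (nform V q)"
        if "homogeneous n p" "homogeneous m q" "dC p = 0" "dC q = 0" for n m p q
        using c(4)[OF cyc[OF that(1,3)] cyc[OF that(2,4)]] by (simp add: nform_mult)
      show "\<theta> (nform V (dC p)) = 0" if p: "homogeneous 1 p" for p
      proof -
        have "nform V p \<in> cobar_part C (0 + 1)" using p by (simp add: cobar_part_def homogeneous_nform)
        moreover have "nform V (dC p) \<in> cobar_cycles C 0" using homogeneous_d[OF p] by (intro cyc) (simp_all add: d_d)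
        ultimately show ?thesis
          using c(5)[of "nform V (dC p)" 0 0 "nform V p"] cobar_cycles_closed(5)[of C 0] homology_character_zero[OF \<theta>]
          by (simp add: nform_der)
      qed
      show "\<theta> (nform V p) = 0" if "homogeneous n p" "dC p = 0" "n \<noteq> 0" for n p
        by (rule c(6)[OF cyc[OF that(1,2)] that(3)])
    qed
    then obtain \<phi> where \<phi>: "character \<phi>" "\<phi> u = \<theta> u" using u by auto
    then show ?thesis using character_of_unit[OF \<phi>(1) u(1) v(1) u(2) v(2) *(3)] by simp
  qed
  then show False using *(4-6) by metis
qed


section \<open>A unit from a multiplicative function on loops\<close>

lemma free_module_simps [simp]:
  "carrier (free_module S) = {p. supp p \<subseteq> S}" "\<zero>\<^bsub>free_module S\<^esub> = 0" "p \<oplus>\<^bsub>free_module S\<^esub> q = p + q"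
  "c \<odot>\<^bsub>free_module S\<^esub> p = scl c p"
  by (simp_all add: free_module_def scl_def)

lemma k_module_free_module: "k_module (free_module S :: ('k::field, 's \<Rightarrow>\<^sub>0 'k) module)"
proof (rule moduleI)
  show "cring (ring_of_type_algebra :: 'k ring)" by (rule cring_from_type_algebra)
  show "abelian_group (free_module S :: ('k, 's \<Rightarrow>\<^sub>0 'k) module)"
  proof (rule abelian_groupI)
    fix p q :: "'s \<Rightarrow>\<^sub>0 'k" assume "p \<in> carrier (free_module S)" "q \<in> carrier (free_module S)"
    then show "p \<oplus>\<^bsub>free_module S\<^esub> q \<in> carrier (free_module S)"
      using Poly_Mapping.keys_add[of p q] by auto
  next
    fix p :: "'s \<Rightarrow>\<^sub>0 'k" assume "p \<in> carrier (free_module S)"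
    then show "\<exists>q\<in>carrier (free_module S). q \<oplus>\<^bsub>free_module S\<^esub> p = \<zero>\<^bsub>free_module S\<^esub>"
      by (intro bexI[of _ "- p"]) auto
  qed (auto simp: algebra_simps)
  show "a \<odot>\<^bsub>free_module S\<^esub> p \<in> carrier (free_module S)"
    if "p \<in> carrier (free_module S)" for a and p :: "'s \<Rightarrow>\<^sub>0 'k"
    using that supp_scl[of a p] by auto
qed (auto simp: ring_of_type_algebra_def poly.scale_left_distrib poly.scale_right_distrib)

lemma degenerate_subset: "degenerate_simplices S b n \<subseteq> based_simplices S b n"
  by (auto simp: degenerate_simplices_def)

lemma degenerate_chains_eq: "degenerate_chains S b n = {p. supp p \<subseteq> degenerate_simplices S b n}"
  by (simp add: degenerate_chains_def)

lemma k_subspace_degenerate: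
  "k_subspace (free_module (based_simplices S b n) :: ('k::field, _) module) (degenerate_chains S b n)"
proof (rule k_subspace.intro)
  show "k_module (free_module (based_simplices S b n) :: ('k, _) module)" by (rule k_module_free_module)
  show "degenerate_chains S b n \<subseteq> carrier (free_module (based_simplices S b n) :: ('k, _) module)"
    using degenerate_subset[of S b n] by (auto simp: degenerate_chains_eq)
  fix p q :: "((nat \<Rightarrow> real) \<Rightarrow> 'a) \<Rightarrow>\<^sub>0 'k" assume p: "p \<in> degenerate_chains S b n"
  show "p \<oplus>\<^bsub>free_module (based_simplices S b n)\<^esub> q \<in> degenerate_chains S b n" if "q \<in> degenerate_chains S b n"
    using p that Poly_Mapping.keys_add[of p q] by (auto simp: degenerate_chains_eq)
  show "c \<odot>\<^bsub>free_module (based_simplices S b n)\<^esub> p \<in> degenerate_chains S b n" for c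
    using p supp_scl[of c p] by (auto simp: degenerate_chains_eq)
qed (simp add: degenerate_chains_eq)

text \<open>The augmented coalgebra structure is a hypothesis here; in the application it is
  contained in the given zig-zag.\<close>

locale based_chains = augmented_dgc "singular_chains S b :: ('k::field, _) dgc"
  for S :: "'a topology" and b :: 'a
begin

abbreviation "C \<equiv> singular_chains S b :: ('k, _) dgc"
abbreviation "BS \<equiv> based_simplices S b"
abbreviation "DG \<equiv> degenerate_simplices S b"

sublocale F: k_subspace "free_module (BS n) :: ('k, _) module" "degenerate_chains S b n" for n
  by (rule k_subspace_degenerate)

definition cls :: "int \<Rightarrow> (((nat \<Rightarrow> real) \<Rightarrow> 'a) \<Rightarrow>\<^sub>0 'k) \<Rightarrow> (((nat \<Rightarrow> real) \<Rightarrow> 'a) \<Rightarrow>\<^sub>0 'k) set" where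
  "cls n p = degenerate_chains S b n +>\<^bsub>free_module (BS n)\<^esub> p"

lemma Sp_eq: "Sp n = chain_space S b n" and bd_eq: "bd C n = chain_bd S b n"
  and coprod_eq: "coprod C n = chain_coprod S b n" and coaug_eq: "coaug C = simplex_class S b 0 (base_simplex b)"
  by (simp_all add: singular_chains_def)

lemma Sp_carrier: "carrier (Sp n) = cls n ` {p. supp p \<subseteq> BS n}"
  unfolding Sp_eq chain_space_def F.quotient_carrier by (simp add: cls_def)

lemma cls_carrier: "supp p \<subseteq> BS n \<Longrightarrow> cls n p \<in> carrier (Sp n)"
  by (simp add: Sp_carrier)

lemma cls_add: "supp p \<subseteq> BS n \<Longrightarrow> supp q \<subseteq> BS n \<Longrightarrow> cls n p \<oplus>\<^bsub>Sp n\<^esub> cls n q = cls n (p + q)"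
  unfolding Sp_eq chain_space_def cls_def using F.quotient_add[of p n q] by simp

lemma cls_smult: "supp p \<subseteq> BS n \<Longrightarrow> c \<odot>\<^bsub>Sp n\<^esub> cls n p = cls n (scl c p)"
  unfolding Sp_eq chain_space_def cls_def using F.quotient_smult[of p n c] by simp

lemma cls_zero: "\<zero>\<^bsub>Sp n\<^esub> = cls n 0"
  unfolding Sp_eq chain_space_def cls_def using F.quotient_zero[of n] by simp

lemma in_cls_iff:
  assumes "supp p \<subseteq> BS n"
  shows "q \<in> cls n p \<longleftrightarrow> supp (q - p) \<subseteq> DG n"
proof
  assume "q \<in> cls n p"
  then obtain r where "supp r \<subseteq> DG n" "q = r + p" unfolding cls_def F.coset_iff by (auto simp: degenerate_chains_eq)
  then show "supp (q - p) \<subseteq> DG n" by simp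
next
  assume "supp (q - p) \<subseteq> DG n"
  then show "q \<in> cls n p"
    unfolding cls_def F.coset_iff by (intro bexI[of _ "q - p"]) (simp_all add: degenerate_chains_eq)
qed

lemma cls_eqI: "supp p \<subseteq> BS n \<Longrightarrow> supp (q - p) \<subseteq> DG n \<Longrightarrow> cls n q = cls n p"
  using F.coset_eqI[of p n q] in_cls_iff[of p n q] by (simp add: cls_def)

lemma cls_eqD:
  assumes "supp q \<subseteq> BS n" "supp p \<subseteq> BS n" "cls n q = cls n p"
  shows "supp (q - p) \<subseteq> DG n"
  using in_cls_iff[OF assms(2), of q] in_cls_iff[OF assms(1), of q] assms(3) by simp

lemma simplex_class_eq: "simplex_class S b n \<sigma> = cls n (single1 \<sigma>)"
  by (simp add: simplex_class_def cls_def)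

lemma abelian_monoid_Sp: "abelian_monoid (Sp n)"
  using module_Sp[of n] by (simp add: module_def abelian_group_def)

lemma cls_finsum:
  assumes "finite I" "\<And>i. i \<in> I \<Longrightarrow> supp (f i) \<subseteq> BS n"
  shows "(\<Oplus>\<^bsub>Sp n\<^esub>i\<in>I. cls n (f i)) = cls n (\<Sum>i\<in>I. f i) \<and> supp (\<Sum>i\<in>I. f i) \<subseteq> BS n"
proof -
  show ?thesis
    using assms
  proof (induction I)
    case empty
    then show ?case by (simp add: cls_zero)
  next
    case (insert i I)
    have "(\<Oplus>\<^bsub>Sp n\<^esub>i\<in>insert i I. cls n (f i)) = cls n (f i) \<oplus>\<^bsub>Sp n\<^esub> (\<Oplus>\<^bsub>Sp n\<^esub>i\<in>I. cls n (f i))"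
      using insert by (intro abelian_monoid.finsum_insert[OF abelian_monoid_Sp]) (auto simp: cls_carrier)
    moreover have "supp (f i + (\<Sum>i\<in>I. f i)) \<subseteq> BS n" using insert by (intro Sp.supp_add_lists) auto
    ultimately show ?case using insert by (simp add: cls_add)
  qed
qed

text \<open>A map on simplices passes to normalized chains when it takes degenerate simplices to
  combinations of degenerate ones, so that all representatives of a class have congruent
  images.\<close>

lemma coset_extend_chains:
  assumes \<phi>: "\<And>\<sigma>. \<sigma> \<in> BS m \<Longrightarrow> \<phi> \<sigma> = cls n (\<psi> \<sigma>) \<and> supp (\<psi> \<sigma>) \<subseteq> BS n"
    and deg: "\<And>\<sigma>. \<sigma> \<in> DG m \<Longrightarrow> supp (\<psi> \<sigma>) \<subseteq> DG n" and p: "supp p \<subseteq> BS m"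
  shows "coset_extend (Sp n) \<phi> (cls m p) = cls n (lin_ext scl \<psi> p)" "supp (lin_ext scl \<psi> p) \<subseteq> BS n"
proof -
  have L: "lin_extend (Sp n) \<phi> q = cls n (lin_ext scl \<psi> q) \<and> supp (lin_ext scl \<psi> q) \<subseteq> BS n" if q: "supp q \<subseteq> BS m" for q
  proof -
    have s: "supp (scl (coeff_of q \<sigma>) (\<psi> \<sigma>)) \<subseteq> BS n" if "\<sigma> \<in> supp q" for \<sigma>
      using \<phi>[of \<sigma>] that q supp_scl[of "coeff_of q \<sigma>" "\<psi> \<sigma>"] by blast
    have t: "coeff_of q \<sigma> \<odot>\<^bsub>Sp n\<^esub> \<phi> \<sigma> = cls n (scl (coeff_of q \<sigma>) (\<psi> \<sigma>))" if "\<sigma> \<in> supp q" for \<sigma>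
    proof -
      have "\<sigma> \<in> BS m" using that q by blast
      from \<phi>[OF this] show ?thesis by (simp add: cls_smult)
    qed
    have "lin_extend (Sp n) \<phi> q = (\<Oplus>\<^bsub>Sp n\<^esub>\<sigma>\<in>supp q. cls n (scl (coeff_of q \<sigma>) (\<psi> \<sigma>)))"
      unfolding lin_extend_def using s t by (intro abelian_monoid.finsum_cong'[OF abelian_monoid_Sp]) (auto simp: cls_carrier)
    then show ?thesis
      using cls_finsum[of "supp q" "\<lambda>\<sigma>. scl (coeff_of q \<sigma>) (\<psi> \<sigma>)" n] s by (simp add: lin_ext_def)
  qed
  show "supp (lin_ext scl \<psi> p) \<subseteq> BS n" using L[OF p] by blast
  show "coset_extend (Sp n) \<phi> (cls m p) = cls n (lin_ext scl \<psi> p)"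
  proof (rule coset_extend_eqI)
    show "cls m p \<noteq> {}" using in_cls_iff[OF p, of p] by auto
    fix q assume "q \<in> cls m p"
    then have d: "supp (q - p) \<subseteq> DG m" using in_cls_iff[OF p] by blast
    have "q = (q - p) + p" by simp
    then have q: "supp q \<subseteq> BS m"
      using Poly_Mapping.keys_add[of "q - p" p] d p degenerate_subset[of S b m] by (metis (no_types) Un_subset_iff order.trans)
    have "supp (lin_ext scl \<psi> (q - p)) \<subseteq> DG n"
      using supp_lin_ext[of \<psi> "q - p"] deg d by blast
    then have "cls n (lin_ext scl \<psi> q) = cls n (lin_ext scl \<psi> p)"
      using L[OF p] by (intro cls_eqI) (simp_all add: poly.lin_ext_diff)
    then show "lin_extend (Sp n) \<phi> q = cls n (lin_ext scl \<psi> p)" using L[OF q] by simp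
  qed
qed

lemma based_negative: "n < 0 \<Longrightarrow> BS n = {}"
  by (auto simp: based_simplices_def)

lemma based_zero: "BS 0 \<subseteq> {base_simplex b}"
proof
  fix \<sigma> assume "\<sigma> \<in> BS 0"
  then have s: "singular_simplex 0 S \<sigma>" "\<sigma> (\<lambda>j. if j = 0 then 1 else 0) = b"
    by (auto simp: based_simplices_def)
  have v: "x = (\<lambda>j. if j = 0 then 1 else 0)" if "x \<in> standard_simplex 0" for x :: "nat \<Rightarrow> real"
    using that by (auto simp: standard_simplex_def fun_eq_iff)
  have "\<sigma> x = base_simplex b x" for x
  proof (cases "x \<in> standard_simplex 0")
    case True
    then show ?thesis using v[OF True] s(2) by (simp add: base_simplex_def)
  next
    case False
    then show ?thesis using s(1) by (simp add: singular_simplex_def base_simplex_def extensional_def)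
  qed
  then show "\<sigma> \<in> {base_simplex b}" by auto
qed

text \<open>There are no chains of negative degree, and the base simplex spans degree 0, where it is
  divided out as the coaugmentation. So the generators of the cobar construction start in degree
  0.\<close>

lemma bl_nonpos:
  assumes "n \<le> 0" and x: "x \<in> carrier (Sp n)"
  shows "bl (n, x) = 0"
proof -
  obtain p where p: "supp p \<subseteq> BS n" "x = cls n p" using x by (auto simp: Sp_carrier)
  have "x \<in> N n"
  proof (cases "n = 0")
    case True
    then have "supp p \<subseteq> {base_simplex b}" using p based_zero by auto
    then have "p = scl (coeff_of p (base_simplex b)) (single1 (base_simplex b))"
      by (intro poly_mapping_eqI) (auto simp: lookup_single when_def in_keys_iff)
    \<comment> \<open>That the base simplex is a based simplex is extracted from the coaugmentation:
      there are no degenerate 0-simplices, so its class, which is a class of chains, determines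
      it.\<close>
    moreover have "supp (single1 (base_simplex b) :: _ \<Rightarrow>\<^sub>0 'k) \<subseteq> BS 0"
      using coaug_closed cls_eqD[of 0 0] True p
    proof -
      have "coaug C \<in> cls 0 ` {p. supp p \<subseteq> BS 0}" using coaug_closed by (simp add: Sp_carrier)
      then obtain r where r: "supp r \<subseteq> BS 0" "cls 0 (single1 (base_simplex b)) = cls 0 r"
        by (auto simp: coaug_eq simplex_class_eq)
      have "single1 (base_simplex b) \<in> cls 0 (single1 (base_simplex b))"
        unfolding cls_def F.coset_iff by (intro bexI[of _ 0]) (simp_all add: degenerate_chains_eq)
      then have "supp (single1 (base_simplex b) - r) \<subseteq> DG 0" using in_cls_iff[OF r(1)] r(2) by simp
      moreover have "DG 0 = {}" by (auto simp: degenerate_simplices_def)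
      ultimately have "single1 (base_simplex b) = r" by simp
      then show ?thesis using r(1) by blast
    qed
    ultimately have "x = coeff_of p (base_simplex b) \<odot>\<^bsub>Sp 0\<^esub> coaug C"
      unfolding p(2) True coaug_eq simplex_class_eq by (subst cls_smult) auto
    then show ?thesis using True by (simp add: coaug_image_def)
  next
    case False
    then have "p = 0" using assms p based_negative[of n] by simp
    then show ?thesis using p(2) N.zero[of n] by (simp add: cls_zero)
  qed
  then have "pj n x = pj n \<zero>\<^bsub>Sp n\<^esub>" by (simp add: bar_proj_eq N.coset_of_subspace N.zero)
  then show ?thesis using bl_zero[of n] by (simp add: bar_letter_def)
qed

text \<open>In positive degrees the image of the coaugmentation is zero, so nothing is divided
  out.\<close>

lemma bar_proj_pos:
  assumes "n > 0" "x \<in> carrier (Sp n)" "y \<in> carrier (Sp n)" "pj n x = pj n y"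
  shows "x = y"
proof -
  have "x \<in> pj n y" using N.self_in_coset[OF assms(2)] assms(4) by (simp add: bar_proj_eq)
  then obtain m where "m \<in> N n" "x = m \<oplus>\<^bsub>Sp n\<^esub> y" unfolding bar_proj_eq N.coset_iff by blast
  then show ?thesis using assms(1,3) by (simp add: coaug_image_def)
qed

end

section \<open>Based simplices of dimensions one and two\<close>

abbreviation simplex_vertex :: "nat \<Rightarrow> nat \<Rightarrow> real" where
  "simplex_vertex i \<equiv> (\<lambda>j. if j = i then 1 else 0)"

lemma standard_simplex_1: "x \<in> standard_simplex (Suc 0) \<longleftrightarrow> 0 \<le> x 0 \<and> 0 \<le> x 1 \<and> x 0 + x 1 = 1 \<and> (\<forall>j>1. x j = 0)"
proof -
  have "0 \<le> x i \<and> x i \<le> 1" if x: "0 \<le> x 0" "0 \<le> x 1" "x 0 + x 1 = 1" "\<forall>j>1. x j = 0" for i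
  proof -
    consider "i = 0" | "i = 1" | "i > 1" by linarith
    then show ?thesis using x by cases auto
  qed
  then show ?thesis by (auto simp: standard_simplex_def)
qed

lemma standard_simplex_2:
  "x \<in> standard_simplex (Suc (Suc 0)) \<longleftrightarrow>
    0 \<le> x 0 \<and> 0 \<le> x 1 \<and> 0 \<le> x 2 \<and> x 0 + x 1 + x 2 = 1 \<and> (\<forall>j>2. x j = 0)"
proof -
  have "0 \<le> x i \<and> x i \<le> 1" if x: "0 \<le> x 0" "0 \<le> x 1" "0 \<le> x 2" "x 0 + x 1 + x 2 = 1" "\<forall>j>2. x j = 0" for i
  proof -
    consider "i = 0" | "i = 1" | "i = 2" | "i > 2" by linarith
    then show ?thesis using x by cases auto
  qed
  then show ?thesis by (auto simp: standard_simplex_def numeral_2_eq_2)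
qed

lemma singular_simplex_restrict:
  assumes \<sigma>: "singular_simplex n S \<sigma>"
    and f: "\<And>x. x \<in> standard_simplex m \<Longrightarrow> f x \<in> standard_simplex n"
    and c: "\<And>j. continuous_map (powertop_real UNIV) euclideanreal (\<lambda>x. f x j)"
  shows "singular_simplex m S (restrict (\<lambda>x. \<sigma> (f x)) (standard_simplex m))"
proof -
  have "continuous_map (subtopology (powertop_real UNIV) (standard_simplex m)) (subtopology (powertop_real UNIV) (standard_simplex n)) f"
    unfolding continuous_map_in_subtopology
    by (auto simp: f continuous_map_componentwise_UNIV intro!: continuous_map_from_subtopology c)
  then have "continuous_map (subtopology (powertop_real UNIV) (standard_simplex m)) S (\<sigma> \<circ> f)"
    using \<sigma> unfolding singular_simplex_def by (blast intro: continuous_map_compose)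
  then have "continuous_map (subtopology (powertop_real UNIV) (standard_simplex m)) S
      (restrict (\<lambda>x. \<sigma> (f x)) (standard_simplex m))"
    by (rule continuous_map_eq) simp
  then show ?thesis by (simp add: singular_simplex_def)
qed

lemma continuous_map_coord: "continuous_map (powertop_real UNIV) euclideanreal (\<lambda>x. x j)"
  by (rule continuous_map_product_projection) simp

definition edge01 :: "((nat \<Rightarrow> real) \<Rightarrow> 'a) \<Rightarrow> (nat \<Rightarrow> real) \<Rightarrow> 'a" where
  "edge01 \<tau> = restrict \<tau> (standard_simplex 1)"
definition edge12 :: "((nat \<Rightarrow> real) \<Rightarrow> 'a) \<Rightarrow> (nat \<Rightarrow> real) \<Rightarrow> 'a" where
  "edge12 \<tau> = restrict (\<lambda>x. \<tau> (\<lambda>j. if j = 0 then 0 else x (j - Suc 0))) (standard_simplex 1)"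
definition edge02 :: "((nat \<Rightarrow> real) \<Rightarrow> 'a) \<Rightarrow> (nat \<Rightarrow> real) \<Rightarrow> 'a" where
  "edge02 \<tau> = restrict (\<lambda>x. \<tau> (\<lambda>j. if j = 0 then x 0 else if j = 2 then x (Suc 0) else 0)) (standard_simplex 1)"

text \<open>The boundary uses singular faces and the coproduct front and back faces. Expressing both
  by the three edges makes the two comparable.\<close>

lemma faces_2:
  "singular_face 2 0 \<tau> = edge12 \<tau>" "singular_face 2 1 \<tau> = edge02 \<tau>" "singular_face 2 2 \<tau> = edge01 \<tau>"
  "front_face 1 \<tau> = edge01 \<tau>" "back_face 2 1 \<tau> = edge12 \<tau>"
proof -
  have "restrict (\<tau> \<circ> simplical_face 2) (standard_simplex (Suc 0)) = restrict \<tau> (standard_simplex (Suc 0))"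
  proof (rule restrict_ext)
    fix x :: "nat \<Rightarrow> real" assume "x \<in> standard_simplex (Suc 0)"
    then have "simplical_face 2 x = x" by (auto simp: simplical_face_def standard_simplex_1 fun_eq_iff)
    then show "(\<tau> \<circ> simplical_face 2) x = \<tau> x" by simp
  qed
  then show "singular_face 2 2 \<tau> = edge01 \<tau>" by (simp add: singular_face_def edge01_def)
  have "restrict (\<tau> \<circ> simplical_face 1) (standard_simplex (Suc 0)) =
      restrict (\<lambda>x. \<tau> (\<lambda>j. if j = 0 then x 0 else if j = 2 then x (Suc 0) else 0)) (standard_simplex (Suc 0))"
  proof (rule restrict_ext)
    fix x :: "nat \<Rightarrow> real" assume "x \<in> standard_simplex (Suc 0)"
    then have "simplical_face 1 x = (\<lambda>j. if j = 0 then x 0 else if j = 2 then x (Suc 0) else 0)"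
      by (auto simp: simplical_face_def standard_simplex_1 fun_eq_iff)
    then show "(\<tau> \<circ> simplical_face 1) x = \<tau> (\<lambda>j. if j = 0 then x 0 else if j = 2 then x (Suc 0) else 0)" by simp
  qed
  then show "singular_face 2 1 \<tau> = edge02 \<tau>" by (simp add: singular_face_def edge02_def)
  have "simplical_face 0 x = (\<lambda>j. if j = 0 then 0 else x (j - Suc 0))" for x :: "nat \<Rightarrow> real"
    by (auto simp: simplical_face_def)
  then show "singular_face 2 0 \<tau> = edge12 \<tau>" by (simp add: singular_face_def edge12_def comp_def)
qed (auto simp: front_face_def back_face_def edge01_def edge12_def)

lemma based_simplices_nat:
  "based_simplices S b (int n) = {\<sigma>. singular_simplex n S \<sigma> \<and> (\<forall>i\<le>n. \<sigma> (simplex_vertex i) = b)}"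
  by (simp add: based_simplices_def)

lemma based_1: "\<sigma> \<in> based_simplices S b 1 \<longleftrightarrow>
    singular_simplex 1 S \<sigma> \<and> \<sigma> (simplex_vertex 0) = b \<and> \<sigma> (simplex_vertex 1) = b"
  using based_simplices_nat[of S b 1] by (auto simp: le_Suc_eq)

lemma based_2: "\<tau> \<in> based_simplices S b 2 \<longleftrightarrow> singular_simplex 2 S \<tau> \<and>
    \<tau> (simplex_vertex 0) = b \<and> \<tau> (simplex_vertex 1) = b \<and> \<tau> (simplex_vertex 2) = b"
  using based_simplices_nat[of S b 2] by (auto simp: le_Suc_eq numeral_2_eq_2)

lemma based_edges:
  assumes "\<tau> \<in> based_simplices S b 2"
  shows "edge01 \<tau> \<in> based_simplices S b 1" "edge12 \<tau> \<in> based_simplices S b 1" "edge02 \<tau> \<in> based_simplices S b 1"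
proof -
  note \<tau> = assms[unfolded based_2]
  have v: "simplex_vertex 0 \<in> standard_simplex (Suc 0)" "simplex_vertex 1 \<in> standard_simplex (Suc 0)"
    by (auto simp: standard_simplex_1)
  have e: "(\<lambda>j. if j = 0 then 0 else simplex_vertex 0 (j - Suc 0)) = simplex_vertex 1"
    "(\<lambda>j. if j = 0 then 0 else simplex_vertex (Suc 0) (j - Suc 0)) = simplex_vertex 2"
    "(\<lambda>j. if j = 0 then simplex_vertex 0 0 else if j = 2 then simplex_vertex 0 (Suc 0) else 0) = simplex_vertex 0"
    "(\<lambda>j. if j = 0 then 0 else if j = 2 then 1 else 0) = simplex_vertex 2"
    by (auto simp: fun_eq_iff)
  have "singular_simplex 1 S (edge01 \<tau>)"
    unfolding edge01_def using \<tau>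
    by (intro singular_simplex_restrict[where f = "\<lambda>x. x" and n = 2] continuous_map_coord)
      (auto simp: standard_simplex_1 standard_simplex_2 numeral_2_eq_2)
  moreover have "singular_simplex 1 S (edge12 \<tau>)"
    unfolding edge12_def using \<tau>
    by (intro singular_simplex_restrict[where n = 2])
      (auto simp: standard_simplex_1 standard_simplex_2 numeral_2_eq_2 continuous_map_coord intro: continuous_map_coord)
  moreover have "singular_simplex 1 S (edge02 \<tau>)"
    unfolding edge02_def using \<tau>
    by (intro singular_simplex_restrict[where n = 2])
      (auto simp: standard_simplex_1 standard_simplex_2 numeral_2_eq_2 continuous_map_coord)
  ultimately show "edge01 \<tau> \<in> based_simplices S b 1" "edge12 \<tau> \<in> based_simplices S b 1" "edge02 \<tau> \<in> based_simplices S b 1"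
    using \<tau> v e by (simp_all add: based_1 edge01_def edge12_def edge02_def)
qed

lemma based_topspace: "\<sigma> \<in> based_simplices S b 1 \<Longrightarrow> b \<in> topspace S"
proof -
  assume "\<sigma> \<in> based_simplices S b 1"
  then have "\<sigma> (simplex_vertex 0) = b" "\<sigma> ` standard_simplex 1 \<subseteq> topspace S"
    unfolding based_1 singular_simplex_def
    using continuous_map_image_subset_topspace[of "subtopology (powertop_real UNIV) (standard_simplex 1)" S \<sigma>]
    by (simp_all add: topspace_standard_simplex)
  moreover have "simplex_vertex 0 \<in> standard_simplex (Suc 0)" by (auto simp: standard_simplex_1)
  ultimately show ?thesis by auto
qed

lemma singular_simplex_base: "b \<in> topspace S \<Longrightarrow> singular_simplex 0 S (base_simplex b)"
proof -
  assume "b \<in> topspace S"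
  then have "continuous_map (subtopology (powertop_real UNIV) (standard_simplex 0)) S (\<lambda>_. b)" by simp
  then have "continuous_map (subtopology (powertop_real UNIV) (standard_simplex 0)) S (base_simplex b)"
    by (rule continuous_map_eq) (auto simp: base_simplex_def)
  then show ?thesis by (simp add: singular_simplex_def base_simplex_def)
qed

lemma degenerate_1: "\<sigma> \<in> degenerate_simplices S b 1 \<longleftrightarrow>
    \<sigma> \<in> based_simplices S b 1 \<and> (\<forall>x\<in>standard_simplex 1. \<sigma> x = b)"
proof
  assume "\<sigma> \<in> degenerate_simplices S b 1"
  then obtain \<tau> where \<sigma>: "\<sigma> \<in> based_simplices S b 1"
    "\<sigma> = restrict (\<tau> \<circ> simplex_collapse 0) (standard_simplex 1)"
    by (auto simp: degenerate_simplices_def)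
  have c: "simplex_collapse 0 x = simplex_vertex 0" if "x \<in> standard_simplex (Suc 0)" for x :: "nat \<Rightarrow> real"
    using that by (auto simp: simplex_collapse_def standard_simplex_1 fun_eq_iff)
  have v: "simplex_vertex 0 \<in> standard_simplex (Suc 0)" by (auto simp: standard_simplex_1)
  have "\<tau> (simplex_vertex 0) = \<sigma> (simplex_vertex 0)" by (subst \<sigma>(2)) (simp add: v c[OF v])
  also have "\<dots> = b" using \<sigma>(1) by (simp add: based_1)
  finally have "\<sigma> x = b" if "x \<in> standard_simplex 1" for x
    by (subst \<sigma>(2)) (use that c[of x] in simp)
  then show "\<sigma> \<in> based_simplices S b 1 \<and> (\<forall>x\<in>standard_simplex 1. \<sigma> x = b)" using \<sigma>(1) by blast
next
  assume \<sigma>: "\<sigma> \<in> based_simplices S b 1 \<and> (\<forall>x\<in>standard_simplex 1. \<sigma> x = b)"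
  have e: "\<sigma> \<in> extensional (standard_simplex 1)" using \<sigma> by (simp add: based_1 singular_simplex_def)
  have c: "simplex_collapse 0 x \<in> standard_simplex 0" if "x \<in> standard_simplex (Suc 0)" for x :: "nat \<Rightarrow> real"
    using that by (auto simp: simplex_collapse_def standard_simplex_1 standard_simplex_def)
  have "\<sigma> = restrict (base_simplex b \<circ> simplex_collapse 0) (standard_simplex 1)"
    using \<sigma> c by (intro extensionalityI[OF e]) (auto simp: base_simplex_def)
  then show "\<sigma> \<in> degenerate_simplices S b 1"
    using \<sigma> singular_simplex_base[OF based_topspace] unfolding degenerate_simplices_def by (auto intro!: exI[of _ "base_simplex b"])
qed

text \<open>A degenerate triangle factors through a collapse of its first or its last edge: that
  edge is constant and the remaining two coincide. Boundary and coproduct are well defined on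
  normalized 2-chains for this reason.\<close>

lemma degenerate_2_edges:
  assumes "\<sigma> \<in> degenerate_simplices S b 2"
  shows "edge12 \<sigma> = edge02 \<sigma> \<and> edge01 \<sigma> \<in> degenerate_simplices S b 1 \<or>
    edge01 \<sigma> = edge02 \<sigma> \<and> edge12 \<sigma> \<in> degenerate_simplices S b 1"
proof -
  obtain i \<tau> where \<sigma>: "\<sigma> \<in> based_simplices S b 2" "i < 2"
    "\<sigma> = restrict (\<tau> \<circ> simplex_collapse i) (standard_simplex 2)"
    using assms by (auto simp: degenerate_simplices_def)
  have in2: "x \<in> standard_simplex 2" "(\<lambda>j. if j = 0 then 0 else x (j - Suc 0)) \<in> standard_simplex 2"
    "(\<lambda>j. if j = 0 then x 0 else if j = 2 then x (Suc 0) else 0) \<in> standard_simplex 2"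
    if "x \<in> standard_simplex (Suc 0)" for x :: "nat \<Rightarrow> real"
    using that by (auto simp: standard_simplex_1 standard_simplex_2 numeral_2_eq_2)
  have s: "\<sigma> y = \<tau> (simplex_collapse i y)" if "y \<in> standard_simplex 2" for y
    by (subst \<sigma>(3)) (use that in simp)
  note e = based_edges[OF \<sigma>(1)]
  have v: "simplex_vertex 0 \<in> standard_simplex (Suc 0)" "simplex_vertex 1 \<in> standard_simplex (Suc 0)"
    by (auto simp: standard_simplex_1)
  consider "i = 0" | "i = 1" using \<sigma>(2) by linarith
  then show ?thesis
  proof cases
    case 1
    have c: "simplex_collapse 0 (\<lambda>j. if j = 0 then 0 else x (j - Suc 0)) = x"
      "simplex_collapse 0 (\<lambda>j. if j = 0 then x 0 else if j = 2 then x (Suc 0) else 0) = x"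
      "simplex_collapse 0 x = simplex_vertex 0"
      if "x \<in> standard_simplex (Suc 0)" for x :: "nat \<Rightarrow> real"
      using that by (auto simp: simplex_collapse_def standard_simplex_1 fun_eq_iff)
    have "edge12 \<sigma> = edge02 \<sigma>"
      unfolding edge12_def edge02_def
      using s[OF in2(2)] s[OF in2(3)] c 1 by (intro restrict_ext) simp
    moreover have "edge01 \<sigma> x = b" if "x \<in> standard_simplex (Suc 0)" for x
      using that s[OF in2(1)[OF that]] s[OF in2(1)[OF v(1)]] c(3)[OF that] c(3)[OF v(1)] v 1 e(1) by (simp add: edge01_def based_1)
    ultimately show ?thesis using e(1) by (simp add: degenerate_1)
  next
    case 2
    have c: "simplex_collapse 1 x = x"
      "simplex_collapse 1 (\<lambda>j. if j = 0 then x 0 else if j = 2 then x (Suc 0) else 0) = x"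
      "simplex_collapse 1 (\<lambda>j. if j = 0 then 0 else x (j - Suc 0)) = simplex_vertex 1"
      if "x \<in> standard_simplex (Suc 0)" for x :: "nat \<Rightarrow> real"
      using that by (auto simp: simplex_collapse_def standard_simplex_1 fun_eq_iff)
    have "edge01 \<sigma> = edge02 \<sigma>"
      unfolding edge01_def edge02_def
      using s[OF in2(1)] s[OF in2(3)] c 2 by (intro restrict_ext) simp
    moreover have "edge12 \<sigma> x = b" if "x \<in> standard_simplex (Suc 0)" for x
      using that s[OF in2(2)[OF that]] s[OF in2(2)[OF v(1)]] c(3)[OF that] c(3)[OF v(1)] v 2 e(2) by (simp add: edge12_def based_1)
    ultimately show ?thesis using e(2) by (simp add: degenerate_1)
  qed
qed

lemma based_end_faces:
  assumes "\<tau> \<in> based_simplices S b 2"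
  shows "front_face 0 \<tau> \<in> based_simplices S b 0" "back_face 2 2 \<tau> \<in> based_simplices S b 0"
    "front_face 2 \<tau> = \<tau>" "back_face 2 0 \<tau> = \<tau>"
proof -
  note \<tau> = assms[unfolded based_2]
  have v: "x \<in> standard_simplex 0 \<longleftrightarrow> x = simplex_vertex 0" for x :: "nat \<Rightarrow> real"
  proof
    show "x \<in> standard_simplex 0 \<Longrightarrow> x = simplex_vertex 0"
      by (auto simp: standard_simplex_def fun_eq_iff)
  qed (simp add: standard_simplex_def)
  have e: "(\<lambda>j. if j < 2 then 0 else simplex_vertex 0 (j - 2)) = simplex_vertex 2"
    by (auto simp: fun_eq_iff)
  have "singular_simplex 0 S (front_face 0 \<tau>)"
    unfolding front_face_def using \<tau>
    by (intro singular_simplex_restrict[where f = "\<lambda>x. x" and n = 2] continuous_map_coord)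
      (auto simp: v standard_simplex_2 numeral_2_eq_2)
  moreover have "front_face 0 \<tau> (simplex_vertex 0) = b"
    using \<tau> by (simp add: front_face_def v)
  ultimately show "front_face 0 \<tau> \<in> based_simplices S b 0"
    using based_simplices_nat[of S b 0] by simp
  have "singular_simplex 0 S (back_face 2 2 \<tau>)"
    unfolding back_face_def diff_self_eq_0 using \<tau>
    by (intro singular_simplex_restrict[where n = 2])
      (auto simp: v standard_simplex_2 numeral_2_eq_2 continuous_map_coord)
  moreover have "back_face 2 2 \<tau> (simplex_vertex 0) = b"
    using \<tau> e by (simp add: back_face_def v)
  ultimately show "back_face 2 2 \<tau> \<in> based_simplices S b 0"
    using based_simplices_nat[of S b 0] by simp
  have "\<tau> \<in> extensional (standard_simplex 2)" using \<tau> by (simp add: singular_simplex_def)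
  then show "front_face 2 \<tau> = \<tau>" "back_face 2 0 \<tau> = \<tau>"
    by (simp_all add: front_face_def back_face_def extensional_restrict)
qed

lemma atMost_2: "{..2::nat} = {0, 1, 2}"
  by auto

section \<open>Characters of the cobar construction from functions on loops\<close>

context based_chains
begin

abbreviation "cls1 \<sigma> \<equiv> cls 1 (single1 \<sigma>)"

lemma cls_degenerate: "supp p \<subseteq> DG n \<Longrightarrow> cls n p = cls n 0"
  by (rule cls_eqI) simp_all

lemma bd_2:
  assumes p: "supp p \<subseteq> BS 2"
  shows "bd C 2 (cls 2 p) = cls 1 (lin_ext scl (\<lambda>\<tau>. single1 (edge12 \<tau>) - single1 (edge02 \<tau>) + single1 (edge01 \<tau>)) p)"
    and "supp (lin_ext scl (\<lambda>\<tau>. single1 (edge12 \<tau>) - single1 (edge02 \<tau>) + single1 (edge01 \<tau>)) p :: _ \<Rightarrow>\<^sub>0 'k) \<subseteq> BS 1"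
proof -
  let ?\<psi> = "\<lambda>\<tau>. single1 (edge12 \<tau>) - single1 (edge02 \<tau>) + single1 (edge01 \<tau>) :: _ \<Rightarrow>\<^sub>0 'k"
  have bs: "supp (?\<psi> \<tau>) \<subseteq> BS 1" if "\<tau> \<in> BS 2" for \<tau>
    using based_edges[OF that] by (intro Sp.supp_add_lists Sp.supp_diff_lists) simp_all
  have \<phi>: "(if (2::int) \<le> 0 then \<zero>\<^bsub>chain_space S b (2 - 1)\<^esub> else
          (\<Oplus>\<^bsub>chain_space S b (2 - 1)\<^esub>k\<in>{..nat 2}.
             koszul_sign (int k) \<odot>\<^bsub>chain_space S b (2 - 1)\<^esub>
               simplex_class S b (2 - 1) (singular_face (nat 2) k \<tau>))) = cls 1 (?\<psi> \<tau>)" if \<tau>: "\<tau> \<in> BS 2" for \<tau>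
  proof -
    let ?f = "\<lambda>k. scl (koszul_sign (int k)) (single1 (singular_face 2 k \<tau>)) :: _ \<Rightarrow>\<^sub>0 'k"
    have face: "singular_face 2 k \<tau> \<in> BS 1" if "k \<in> {..2}" for k
      using that based_edges[OF \<tau>] faces_2(1-3)[of \<tau>] unfolding atMost_2 by auto
    have f: "koszul_sign (int k) \<odot>\<^bsub>Sp 1\<^esub> cls1 (singular_face 2 k \<tau>) = cls 1 (?f k)" "supp (?f k) \<subseteq> BS 1"
      if "k \<in> {..2}" for k
      using face[OF that] order.trans[OF supp_scl, of "single1 (singular_face 2 k \<tau>)" "BS 1" "koszul_sign (int k)"]
      by (simp_all add: cls_smult del: scl_single)
    have "(\<Oplus>\<^bsub>Sp 1\<^esub>k\<in>{..2}. koszul_sign (int k) \<odot>\<^bsub>Sp 1\<^esub> cls1 (singular_face 2 k \<tau>)) = (\<Oplus>\<^bsub>Sp 1\<^esub>k\<in>{..2}. cls 1 (?f k))"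
      using f by (intro abelian_monoid.finsum_cong'[OF abelian_monoid_Sp]) (auto simp: cls_carrier simp del: scl_single)
    also have "\<dots> = cls 1 (\<Sum>k\<in>{..2}. ?f k)" using cls_finsum[of "{..2::nat}" ?f 1] f(2) by blast
    also have "(\<Sum>k\<in>{..2}. ?f k) = ?\<psi> \<tau>"
      unfolding atMost_2 by (simp add: faces_2(1-3)[unfolded One_nat_def] koszul_sign_def single_uminus)
    finally show ?thesis by (simp add: simplex_class_eq flip: Sp_eq)
  qed
  have deg: "supp (?\<psi> \<tau>) \<subseteq> DG 1" if "\<tau> \<in> DG 2" for \<tau>
    using degenerate_2_edges[OF that] by auto
  have "bd C 2 (cls 2 p) = coset_extend (Sp 1) (\<lambda>\<sigma>. if (2::int) \<le> 0 then \<zero>\<^bsub>chain_space S b (2 - 1)\<^esub> else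
          (\<Oplus>\<^bsub>chain_space S b (2 - 1)\<^esub>k\<in>{..nat 2}.
             koszul_sign (int k) \<odot>\<^bsub>chain_space S b (2 - 1)\<^esub>
               simplex_class S b (2 - 1) (singular_face (nat 2) k \<sigma>))) (cls 2 p)"
    by (simp add: bd_eq chain_bd_def Sp_eq)
  also have "\<dots> = cls 1 (lin_ext scl ?\<psi> p)"
    by (rule coset_extend_chains(1)[OF conjI[OF \<phi> bs] deg p])
  finally show "bd C 2 (cls 2 p) = cls 1 (lin_ext scl ?\<psi> p)" .
  show "supp (lin_ext scl ?\<psi> p) \<subseteq> BS 1"
    using supp_lin_ext[of ?\<psi> p] bs p by blast
qed

text \<open>Of the three Alexander-Whitney terms, the outer two contain a factor of degree 0, which
  is zero among the generators. The middle one has weight -1, its first factor being of degree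
  1.\<close>

lemma sq_coprod_2:
  assumes p: "supp p \<subseteq> BS 2"
  shows "sq (Q 2 (cls 2 p)) = lin_ext scl (\<lambda>\<tau>. - (bl (1, cls1 (edge01 \<tau>)) * bl (1, cls1 (edge12 \<tau>)))) p"
proof -
  let ?w = "\<lambda>i \<tau>. [(int i, cls (int i) (single1 (front_face i \<tau>))), (2 - int i, cls (2 - int i) (single1 (back_face 2 i \<tau>)))]"
  let ?\<psi> = "\<lambda>\<tau>. \<Sum>i\<in>{..2}. single1 (?w i \<tau>) :: _ \<Rightarrow>\<^sub>0 'k"
  have w: "?w i \<tau> \<in> lists (letters Sp)" if "\<tau> \<in> BS 2" "i \<in> {..2}" for i \<tau>
    using that(2) based_end_faces[OF that(1)] based_edges[OF that(1)] faces_2(4,5)[of \<tau>] that(1) unfolding atMost_2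
    by (auto intro!: cls_carrier)
  have \<phi>: "(\<Oplus>\<^bsub>Sp.TV\<^esub>i\<in>{..nat 2}. tensor_word Sp
            [(int i, simplex_class S b (int i) (front_face i \<tau>)),
             (2 - int i, simplex_class S b (2 - int i) (back_face (nat 2) i \<tau>))]) = Sp.cl (?\<psi> \<tau>) \<and>
      supp (?\<psi> \<tau>) \<subseteq> lists (letters Sp)" if "\<tau> \<in> BS 2" for \<tau>
    using Sp.tensor_finsum[of "{..2::nat}" "\<lambda>i. single1 (?w i \<tau>)"] w[OF that]
    by (simp add: tensor_word_def simplex_class_eq)
  \<comment> \<open>For a degenerate triangle each summand has a degenerate factor: the triangle
    itself in the outer terms, one of the two edges in the middle term.\<close>
  have deg: "nform Sp (?\<psi> \<tau>) = 0" if \<tau>: "\<tau> \<in> DG 2" for \<tau>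
  proof -
    have z: "letter_nform Sp (n, cls n q) = 0" if "supp q \<subseteq> DG n" for n q
      using linear_on_zero[OF module_Sp Sp.letter_nform_linear_on, of n] cls_degenerate[OF that] by (simp add: cls_zero)
    have \<tau>2: "\<tau> \<in> BS 2" using \<tau> degenerate_subset[of S b 2] by blast
    have "nform Sp (single1 (?w i \<tau>)) = 0" if i: "i \<in> {..2}" for i
    proof -
      consider "i = 0" | "i = 1" | "i = 2" using i unfolding atMost_2 by blast
      then show ?thesis
      proof cases
        case 2
        have "edge01 \<tau> \<in> DG 1 \<or> edge12 \<tau> \<in> DG 1" using degenerate_2_edges[OF \<tau>] by blast
        then show ?thesis
          using z[of "single1 (edge01 \<tau>)" 1] z[of "single1 (edge12 \<tau>)" 1] faces_2(4,5)[of \<tau>] 2 by (auto simp: nform_word)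
      qed (use based_end_faces[OF \<tau>2] z[of "single1 \<tau>" 2] \<tau> in \<open>simp_all add: nform_word\<close>)
    qed
    then show ?thesis by (simp add: nform_sum)
  qed
  have L: "lin_extend Sp.TV (\<lambda>\<sigma>. \<Oplus>\<^bsub>Sp.TV\<^esub>i\<in>{..nat 2}. tensor_word Sp
            [(int i, simplex_class S b (int i) (front_face i \<sigma>)),
             (2 - int i, simplex_class S b (2 - int i) (back_face (nat 2) i \<sigma>))]) q
      = Sp.cl (lin_ext scl ?\<psi> q) \<and> supp (lin_ext scl ?\<psi> q) \<subseteq> lists (letters Sp)" if q: "supp q \<subseteq> BS 2" for q
    using Sp.lin_extend_tensor[of q _ ?\<psi>, OF \<phi>] q by blast
  have "coprod C 2 (cls 2 p) = Sp.cl (lin_ext scl ?\<psi> p)"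
    unfolding coprod_eq chain_coprod_def Sp_eq[symmetric]
  proof (rule coset_extend_eqI)
    show "cls 2 p \<noteq> {}" using in_cls_iff[OF p, of p] by auto
    fix q assume "q \<in> cls 2 p"
    then have d: "supp (q - p) \<subseteq> DG 2" using in_cls_iff[OF p] by blast
    have "supp ((q - p) + p) \<subseteq> BS 2"
      using d p degenerate_subset[of S b 2] by (intro Sp.supp_add_lists) auto
    then have q: "supp q \<subseteq> BS 2" by simp
    have "nform Sp (lin_ext scl ?\<psi> (q - p)) = lin_ext scl (\<lambda>\<tau>. nform Sp (?\<psi> \<tau>)) (q - p)"
      by (rule poly.lin_ext_comp[OF nform_k_linear])
    also have "\<dots> = lin_ext scl (\<lambda>\<tau>. 0) (q - p)"
      using deg d by (intro poly.lin_ext_cong_on) blast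
    finally have "nform Sp (lin_ext scl ?\<psi> q) = nform Sp (lin_ext scl ?\<psi> p)"
      by (simp add: poly.lin_ext_diff nform_diff) (simp add: lin_ext_def)
    then show "lin_extend Sp.TV (\<lambda>\<sigma>. \<Oplus>\<^bsub>Sp.TV\<^esub>i\<in>{..nat 2}. tensor_word Sp
            [(int i, simplex_class S b (int i) (front_face i \<sigma>)),
             (2 - int i, simplex_class S b (2 - int i) (back_face (nat 2) i \<sigma>))]) q = Sp.cl (lin_ext scl ?\<psi> p)"
      using L[OF q] L[OF p] by (simp add: Sp.tensor_class_eq_iff)
  qed
  then have "Q 2 (cls 2 p) = nform Sp (lin_ext scl ?\<psi> p)"
    using L[OF p] by (intro coprod_class(4)[OF cls_carrier[OF p]]) simp_all
  then have "sq (Q 2 (cls 2 p)) = sq (lin_ext scl ?\<psi> p)" using sq_nform L[OF p] by simp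
  also have "\<dots> = lin_ext scl (\<lambda>\<tau>. sq (?\<psi> \<tau>)) p"
    by (rule poly.lin_ext_comp[OF poly.lin_ext_k_linear])
  also have "\<dots> = lin_ext scl (\<lambda>\<tau>. - (bl (1, cls1 (edge01 \<tau>)) * bl (1, cls1 (edge12 \<tau>)))) p"
  proof (rule poly.lin_ext_cong_on)
    fix \<tau> assume "\<tau> \<in> supp p"
    then have \<tau>: "\<tau> \<in> BS 2" using p by blast
    have z: "bl (0, cls 0 (single1 (front_face 0 \<tau>))) = 0" "bl (0, cls 0 (single1 (back_face 2 2 \<tau>))) = 0"
      using based_end_faces[OF \<tau>] by (auto intro!: bl_nonpos cls_carrier)
    have "sq (?\<psi> \<tau>) = (\<Sum>i\<in>{..2}. bar_square C (?w i \<tau>))"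
      by (simp add: poly.lin_ext_sum poly.lin_ext_single)
    also have "\<dots> = - (bl (1, cls1 (edge01 \<tau>)) * bl (1, cls1 (edge12 \<tau>)))"
      unfolding atMost_2 using z faces_2(4,5)[of \<tau>] by (simp add: bar_square_def koszul_sign_def)
    finally show "sq (?\<psi> \<tau>) = - (bl (1, cls1 (edge01 \<tau>)) * bl (1, cls1 (edge12 \<tau>)))" .
  qed
  finally show ?thesis .
qed

text \<open>Under the identification of the homology in degree 0 with the group ring of the
  fundamental group, the generator of a loop \<open>g\<close> is \<open>g - 1\<close>; this explains
  the value \<open>c \<sigma> - 1\<close>.\<close>

definition loop_sum :: "(((nat \<Rightarrow> real) \<Rightarrow> 'a) \<Rightarrow> 'k) \<Rightarrow> (((nat \<Rightarrow> real) \<Rightarrow> 'a) \<Rightarrow>\<^sub>0 'k) \<Rightarrow> 'k" where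
  "loop_sum c = lin_ext (*) (\<lambda>\<sigma>. c \<sigma> - 1)"

text \<open>Generators of degree 0 are classes of 1-chains; a chain is chosen and summed. All other
  letters get zero, as the field sits in degree 0.\<close>

definition loop_letter :: "(((nat \<Rightarrow> real) \<Rightarrow> 'a) \<Rightarrow> 'k) \<Rightarrow> int \<times> (((nat \<Rightarrow> real) \<Rightarrow> 'a) \<Rightarrow>\<^sub>0 'k) set set \<Rightarrow> 'k" where
  "loop_letter c l = (if fst l = 0 \<and> snd l \<in> carrier (V 0)
     then loop_sum c (SOME p. supp p \<subseteq> BS 1 \<and> snd l = pj 1 (cls 1 p)) else 0)"

definition loop_character :: "(((nat \<Rightarrow> real) \<Rightarrow> 'a) \<Rightarrow> 'k) \<Rightarrow> ((int \<times> (((nat \<Rightarrow> real) \<Rightarrow> 'a) \<Rightarrow>\<^sub>0 'k) set set) list \<Rightarrow>\<^sub>0 'k) \<Rightarrow> 'k" where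
  "loop_character c = alg_ext (*) (loop_letter c)"

lemma loop_sum_linear: "k_linear (*) (loop_sum c)"
  unfolding loop_sum_def by (rule vector_space_over_itself.lin_ext_k_linear)

text \<open>The conditions say that \<open>c\<close> sends constant loops to 1 and is multiplicative
  whenever a based triangle relates three loops, as a character of the fundamental group
  does.\<close>

context
  fixes c :: "((nat \<Rightarrow> real) \<Rightarrow> 'a) \<Rightarrow> 'k"
  assumes cocycle: "\<And>\<tau>. \<tau> \<in> BS 2 \<Longrightarrow> c (edge02 \<tau>) = c (edge01 \<tau>) * c (edge12 \<tau>)"
    and degenerate: "\<And>\<sigma>. \<sigma> \<in> DG 1 \<Longrightarrow> c \<sigma> = 1"
begin

lemma loop_sum_degenerate: "supp p \<subseteq> DG 1 \<Longrightarrow> loop_sum c p = 0"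
  unfolding loop_sum_def lin_ext_def by (rule sum.neutral) (auto simp: degenerate)

text \<open>In degree 1 the coaugmentation divides out nothing, so two chains of the same generator
  differ by degenerate simplices, on which \<open>c \<sigma> - 1\<close> vanishes.\<close>

lemma loop_letter_pj:
  assumes p: "supp p \<subseteq> BS 1"
  shows "loop_letter c (0, pj 1 (cls 1 p)) = loop_sum c p"
proof -
  let ?q = "SOME q. supp q \<subseteq> BS 1 \<and> pj 1 (cls 1 p) = pj 1 (cls 1 q)"
  have q: "supp ?q \<subseteq> BS 1 \<and> pj 1 (cls 1 p) = pj 1 (cls 1 ?q)"
    by (rule someI[where P = "\<lambda>q. supp q \<subseteq> BS 1 \<and> pj 1 (cls 1 p) = pj 1 (cls 1 q)"]) (use p in simp)
  then have "cls 1 p = cls 1 ?q" using p by (intro bar_proj_pos[of 1] cls_carrier) simp_all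
  then have "supp (p - ?q) \<subseteq> DG 1" using q p by (intro cls_eqD) simp_all
  then have "loop_sum c p = loop_sum c ?q"
    using loop_sum_degenerate[of "p - ?q"] by (simp add: k_linear_diff[OF loop_sum_linear])
  moreover have "pj 1 (cls 1 p) \<in> carrier (V 0)" using cls_carrier[OF p] by (simp add: gens_carrier)
  ultimately show ?thesis by (simp add: loop_letter_def)
qed

lemma loop_letter_linear_on: "linear_on (V n) (*) (\<lambda>S. loop_letter c (n, S))"
proof (cases "n = 0")
  case True
  have "linear_on (Sp 1) (*) (\<lambda>x. loop_letter c (0, pj 1 x))"
  proof (rule linear_onI)
    fix x y assume "x \<in> carrier (Sp 1)" "y \<in> carrier (Sp 1)"
    then obtain p q where p: "supp p \<subseteq> BS 1" "x = cls 1 p" and q: "supp q \<subseteq> BS 1" "y = cls 1 q"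
      by (auto simp: Sp_carrier)
    then show "loop_letter c (0, pj 1 (x \<oplus>\<^bsub>Sp 1\<^esub> y)) = loop_letter c (0, pj 1 x) + loop_letter c (0, pj 1 y)"
      by (simp add: cls_add loop_letter_pj Sp.supp_add_lists k_linear_add[OF loop_sum_linear])
  next
    fix a x assume "x \<in> carrier (Sp 1)"
    then obtain p where p: "supp p \<subseteq> BS 1" "x = cls 1 p" by (auto simp: Sp_carrier)
    then show "loop_letter c (0, pj 1 (a \<odot>\<^bsub>Sp 1\<^esub> x)) = a * loop_letter c (0, pj 1 x)"
      by (simp add: cls_smult loop_letter_pj order.trans[OF supp_scl] k_linear_scl[OF loop_sum_linear])
  qed
  from bar_linear_on[OF this] show ?thesis using True by (simp add: cobar_gens_def)
qed (simp add: loop_letter_def linear_on_def)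

lemma loop_character_letter_nform: "l \<in> letters V \<Longrightarrow> loop_character c (letter_nform V l) = loop_letter c l"
  using field_scale.alg_ext_nform[OF V.graded_space_axioms loop_letter_linear_on, of "single1 [l]"]
  by (simp add: loop_character_def nform_letter field_scale.alg_ext_single)

lemma loop_character_bl:
  "x \<in> carrier (Sp n) \<Longrightarrow> loop_character c (bl (n, x)) = loop_letter c (n - 1, pj n x)"
  unfolding bar_letter_def by (simp add: loop_character_letter_nform gens_carrier)

lemma loop_character_bl1: "supp p \<subseteq> BS 1 \<Longrightarrow> loop_character c (bl (1, cls 1 p)) = loop_sum c p"
  using loop_character_bl[of "cls 1 p" 1] loop_letter_pj[of p] by (simp add: cls_carrier)

lemmas loop_character_simps =
  field_scale.alg_ext_add[of "loop_letter c", folded loop_character_def]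
  field_scale.alg_ext_diff[of "loop_letter c", folded loop_character_def]
  field_scale.alg_ext_uminus[of "loop_letter c", folded loop_character_def]
  field_scale.alg_ext_scl[of "loop_letter c", folded loop_character_def]
  field_scale.alg_ext_mult[of "loop_letter c", folded loop_character_def]
  field_scale.alg_ext_one[of "loop_letter c", folded loop_character_def]
  field_scale.alg_ext_zero[of "loop_letter c", folded loop_character_def]

lemma loop_character_k_linear: "k_linear (*) (loop_character c)"
  unfolding loop_character_def by (rule field_scale.alg_ext_k_linear)

text \<open>A word of nonzero degree contains a letter of nonzero degree, which contributes the
  factor zero.\<close>

lemma loop_character_degree:
  assumes "homogeneous n p" "n \<noteq> 0" shows "loop_character c p = 0"
  using assms(1) unfolding homogeneous_def
proof (induction p rule: poly_induct_on)
  case (single w)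
  then have "word_degree w \<noteq> 0" using assms(2) by simp
  then have "prod_list (map (loop_letter c) w) = 0"
    by (induction w) (auto simp: loop_letter_def)
  then show ?case by (simp add: loop_character_def field_scale.alg_ext_single)
qed (simp_all add: loop_character_simps)

text \<open>For degree reasons only generators from 2-chains matter. With \<open>c1\<close>,
  \<open>c2\<close>, \<open>c3\<close> for the values on the edges 01, 12, 02, a triangle
  contributes \<open>-(c2 - c3 + c1 - 1) - (c1 - 1)(c2 - 1) = c3 - c1 c2\<close>, which is zero by
  the cocycle condition.\<close>

lemma loop_character_letter_bd: "loop_character c (dgc_letter_bd C l) = 0"
proof (cases "l \<in> letters V \<and> fst l = 1")
  case True
  then obtain n x where l: "l = (n - 1, pj n x)" and x: "x \<in> carrier (Sp n)" using gens_cases by metis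
  then have n: "n = 2" using True by simp
  then obtain p where p: "supp p \<subseteq> BS 2" "x = cls 2 p" using x by (auto simp: Sp_carrier)
  have "loop_character c (dgc_letter_bd C l) = - loop_character c (bl (1, bd C 2 (cls 2 p))) + loop_character c (sq (Q 2 (cls 2 p)))"
    unfolding l cobar_bd_gen_pj(2)[OF x] unfolding n p(2) by (simp add: loop_character_simps)
  also have "loop_character c (bl (1, bd C 2 (cls 2 p))) = lin_ext (*) (\<lambda>\<tau>. c (edge12 \<tau>) - c (edge02 \<tau>) + c (edge01 \<tau>) - 1) p"
    unfolding bd_2(1)[OF p(1)] loop_character_bl1[OF bd_2(2)[OF p(1)]]
      vector_space_over_itself.lin_ext_comp[OF loop_sum_linear]
    by (simp add: k_linear_add[OF loop_sum_linear] k_linear_diff[OF loop_sum_linear])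
      (simp add: loop_sum_def vector_space_over_itself.lin_ext_single add_diff_eq)
  also have "loop_character c (sq (Q 2 (cls 2 p))) = lin_ext (*) (\<lambda>\<tau>. - ((c (edge01 \<tau>) - 1) * (c (edge12 \<tau>) - 1))) p"
    unfolding sq_coprod_2[OF p(1)] vector_space_over_itself.lin_ext_comp[OF loop_character_k_linear]
  proof (rule vector_space_over_itself.lin_ext_cong_on)
    fix \<tau> assume "\<tau> \<in> supp p"
    then have "\<tau> \<in> BS 2" using p by blast
    then show "loop_character c (- (bl (1, cls1 (edge01 \<tau>)) * bl (1, cls1 (edge12 \<tau>)))) = - ((c (edge01 \<tau>) - 1) * (c (edge12 \<tau>) - 1))"
      using based_edges[of \<tau> S b]
      by (simp add: loop_character_simps loop_character_bl1 loop_sum_def vector_space_over_itself.lin_ext_single)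
  qed
  also have "- lin_ext (*) (\<lambda>\<tau>. c (edge12 \<tau>) - c (edge02 \<tau>) + c (edge01 \<tau>) - 1) p +
      lin_ext (*) (\<lambda>\<tau>. - ((c (edge01 \<tau>) - 1) * (c (edge12 \<tau>) - 1))) p = 0"
    unfolding lin_ext_def sum_negf[symmetric] sum.distrib[symmetric]
    using p(1) cocycle by (intro sum.neutral) (auto simp: algebra_simps)
  finally show ?thesis .
next
  case False
  then have "dgc_letter_bd C l = 0 \<or> fst l - 1 \<noteq> 0" by (auto simp: dgc_letter_bd_def)
  then show ?thesis using loop_character_degree[OF homogeneous_letter_bd[of l]] by (auto simp: loop_character_simps)
qed

lemma loop_character_der: "loop_character c (dC p) = 0"
proof -
  have "loop_character c (der_word (dgc_letter_bd C) w) = 0" for w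
    by (induction w) (simp_all add: loop_character_simps loop_character_letter_bd)
  then show ?thesis
    by (induction p rule: poly_induct) (simp_all add: der_add der_scl der_zero der_single loop_character_simps del: scl_single)
qed

lemma homology_character_loop: "homology_character C (loop_character c)"
  unfolding homology_character_def
  by (auto simp: loop_character_simps loop_character_der cobar_cycles_def cobar_part_def intro: loop_character_degree)

end

text \<open>In total degree 1 one factor of each coproduct term has degree at most 0, and the
  boundary lies in degree 0; both vanish among the generators. Adding 1 passes from
  \<open>g - 1\<close> to the group element \<open>g\<close>.\<close>

lemma bar_loop_cycle:
  assumes "x \<in> carrier (Sp 1)" shows "1 + bl (1, x) \<in> cobar_cycles C 0"
proof -
  have "bar_square C w = 0" if "w \<in> supp (Q 1 x)" for w
  proof (cases "\<exists>i y j z. w = [(i, y), (j, z)]")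
    case True
    then obtain i y j z where w: "w = [(i, y), (j, z)]" by blast
    have "w \<in> lists (letters Sp)" "word_degree w = 1"
      using coprod_class(2,3)[OF assms] that by (auto simp: homogeneous_def)
    then have "y \<in> carrier (Sp i)" "z \<in> carrier (Sp j)" "i \<le> 0 \<or> j \<le> 0" by (auto simp: w)
    then have "bl (i, y) = 0 \<or> bl (j, z) = 0" using bl_nonpos by blast
    then show ?thesis by (auto simp: w bar_square_def)
  qed (auto simp: bar_square_def on_pair_def split: list.split prod.split)
  then have "sq (Q 1 x) = 0" by (simp add: lin_ext_def)
  moreover have "bl (0, bd C 1 x) = 0" using bd_closed[OF assms] by (intro bl_nonpos) simp_all
  ultimately have "dC (bl (1, x)) = 0" using der_bl[OF assms] by simp
  then show ?thesis
    using homogeneous_bl[of "(1, x)"]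
    by (simp add: cobar_cycles_def cobar_part_def nform_add der_add homogeneous_add homogeneous_one)
qed

text \<open>
  The 2-simplex \<open>\<tau>\<close> is a homotopy from the composite of \<open>edge01 \<tau>\<close> and \<open>edge12 \<tau>\<close> to the
  constant loop, and \<open>c\<close> is a character of the fundamental group.
\<close>
lemma separated_unit_loop:
  assumes c: "\<And>\<tau>. \<tau> \<in> BS 2 \<Longrightarrow> c (edge02 \<tau>) = c (edge01 \<tau>) * c (edge12 \<tau>)" "\<And>\<sigma>. \<sigma> \<in> DG 1 \<Longrightarrow> c \<sigma> = (1::'k)"
    and \<tau>: "\<tau> \<in> BS 2" "edge02 \<tau> \<in> DG 1" "c (edge01 \<tau>) \<noteq> 1"
  shows "separated_unit C"
proof -
  note e = based_edges[OF \<tau>(1)]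
  have s: "supp (single1 \<tau> :: _ \<Rightarrow>\<^sub>0 'k) \<subseteq> BS 2" using \<tau> by simp
  \<comment> \<open>These represent the loop, its inverse and the homotopy between their product and
    the constant loop; the sign of \<open>?w\<close> comes from the minus sign in front of the
    linear part of the cobar differential.\<close>
  let ?u = "1 + bl (1, cls1 (edge01 \<tau>))" and ?v = "1 + bl (1, cls1 (edge12 \<tau>))" and ?w = "- bl (2, cls 2 (single1 \<tau>))"
  have "bd C 2 (cls 2 (single1 \<tau>)) = cls 1 (single1 (edge12 \<tau>) - single1 (edge02 \<tau>) + single1 (edge01 \<tau>))"
    by (simp add: bd_2[OF s] poly.lin_ext_single)
  also have "\<dots> = cls 1 (single1 (edge12 \<tau>) + single1 (edge01 \<tau>))"
    using e \<tau>(2) by (intro cls_eqI Sp.supp_add_lists) (simp_all add: algebra_simps)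
  also have "\<dots> = cls1 (edge12 \<tau>) \<oplus>\<^bsub>Sp 1\<^esub> cls1 (edge01 \<tau>)"
    using e by (simp add: cls_add)
  finally have "bl (1, bd C 2 (cls 2 (single1 \<tau>))) = bl (1, cls1 (edge12 \<tau>)) + bl (1, cls1 (edge01 \<tau>))"
    using linear_onD(1)[OF linear_on_bl, of "cls1 (edge12 \<tau>)" 1 "cls1 (edge01 \<tau>)"] e by (simp add: cls_carrier)
  then have "?u * ?v = 1 + dC ?w"
    using der_bl[OF cls_carrier[OF s]]
    by (simp add: der_uminus sq_coprod_2[OF s] poly.lin_ext_single algebra_simps)
  moreover have "?u \<in> cobar_cycles C 0" "?v \<in> cobar_cycles C 0" using e by (auto intro!: bar_loop_cycle cls_carrier)
  moreover have "?w \<in> cobar_part C 1"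
    using homogeneous_bl[of "(2, cls 2 (single1 \<tau>))"] by (simp add: cobar_part_def nform_uminus homogeneous_uminus)
  moreover have "homology_character C (loop_character c)" by (rule homology_character_loop[OF c])
  moreover have "homology_character C (loop_character (\<lambda>_. 1))" by (rule homology_character_loop) simp_all
  moreover have "loop_character c ?u = c (edge01 \<tau>)"
    using e(1) by (simp add: loop_character_simps[OF c] loop_character_bl1[OF c] loop_sum_def vector_space_over_itself.lin_ext_single)
  moreover have "loop_character (\<lambda>_. 1) ?u = 1"
    using e(1) loop_character_bl1[of "\<lambda>_. 1" "single1 (edge01 \<tau>)"] loop_character_simps(1,6)[of "\<lambda>_. 1"]
    by (simp add: loop_sum_def lin_ext_def)
  ultimately show ?thesis unfolding separated_unit_def using \<tau>(3) by metis
qed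

end


section \<open>The circle\<close>

text \<open>The functor sees only spaces with points in \<open>'a\<close>. A copy of
  \<open>T\<close> on the image of the injection arises by pulling the topology back along its
  inverse.\<close>

lemma homeomorphic_copy:
  assumes "inj_on r (topspace T)"
  obtains S e where "homeomorphic_maps S T e r"
proof
  let ?A = "r ` topspace T" and ?e = "inv_into (topspace T) r"
  have e: "?e (r y) = y" if "y \<in> topspace T" for y using that assms by (rule inv_into_f_f[rotated])
  have "continuous_map (pullback_topology ?A ?e T) T (id \<circ> ?e)"
    by (rule continuous_map_pullback) simp
  moreover have "continuous_map T (pullback_topology ?A ?e T) r"
  proof (rule continuous_map_pullback')
    show "continuous_map T T (?e \<circ> r)" by (rule continuous_map_eq[OF continuous_map_id]) (simp add: e)
  qed auto
  ultimately show "homeomorphic_maps (pullback_topology ?A ?e T) T ?e r"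
    using e by (auto simp: homeomorphic_maps_def topspace_pullback_topology)
qed

abbreviation circle :: "complex topology" where
  "circle \<equiv> top_of_set (sphere 0 1)"

lemma path_connected_circle: "path_connected_space circle"
  using path_connected_sphere[of "0::complex" 1] by simp

lemma locally_path_connected_circle: "locally_path_connected_space circle"
  using locally_path_connected_sphere[of "0::complex" 1]
  unfolding locally_def locally_path_connected_space_def neighbourhood_base_of path_connectedin_subtopology
    path_connectedin_euclidean
  by (meson openin_imp_subset order.trans)

definition square_root_path :: "(real \<Rightarrow> complex) \<Rightarrow> (real \<Rightarrow> complex) \<Rightarrow> bool" where
  "square_root_path p q \<longleftrightarrow> continuous_on {0..1} q \<and> (\<forall>t\<in>{0..1}. (q t)\<^sup>2 = p t)"

text \<open>For a closed path, this is \<open>(-1)\<^sup>n\<close> where \<open>n\<close> is the winding number around \<open>0\<close>.\<close>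
definition winding_sign :: "(real \<Rightarrow> complex) \<Rightarrow> 'k::field" where
  "winding_sign p = (if \<exists>q. square_root_path p q \<and> q 0 = 1 \<and> q 1 = 1 then 1 else -1)"

text \<open>The quotient of two continuous square roots of a nonvanishing path takes only the values
  1 and -1, hence is constant on the connected interval. So the product of the end values does not
  depend on the root; multiplying by \<open>q 0\<close> normalises the root to start at 1.\<close>

lemma winding_sign_eq:
  assumes q: "square_root_path p q" and p: "p 0 = 1" "\<And>t. t \<in> {0..1} \<Longrightarrow> p t \<noteq> 0"
  shows "winding_sign p = (if q 0 * q 1 = 1 then 1 else -1)"
proof -
  have q0: "(q 0)\<^sup>2 = 1" using q p by (simp add: square_root_path_def)
  have q': "square_root_path p (\<lambda>t. q 0 * q t)"
    using q q0 by (auto simp: square_root_path_def power_mult_distrib intro!: continuous_intros)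
  have "q 0 * q 1 = 1" if f: "square_root_path p f" "f 0 = 1" "f 1 = 1" for f
  proof -
    let ?h = "\<lambda>t. f t / (q 0 * q t)"
    have nz: "q 0 * q t \<noteq> 0" if "t \<in> {0..1}" for t
      using q' p(2)[OF that] that unfolding square_root_path_def by (metis zero_power2)
    have "continuous_on {0..1} ?h"
      using f(1) q' nz unfolding square_root_path_def by (intro continuous_on_divide) auto
    moreover have "?h t \<in> {1, -1}" if "t \<in> {0..1}" for t
    proof -
      have "(?h t)\<^sup>2 = p t / p t" using f(1) q' that unfolding square_root_path_def by (simp only: power_divide)
      then have "(?h t)\<^sup>2 = 1" using p(2)[OF that] by simp
      then show ?thesis using power2_eq_1_iff by blast
    qed
    then have "?h ` {0..1} \<subseteq> {1, -1}" by blast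
    then have "finite (?h ` {0..1})" by (rule finite_subset) simp
    ultimately have "?h constant_on {0..1}" by (rule continuous_finite_range_constant[OF connected_Icc])
    then obtain y where "\<And>t. t \<in> {0..1} \<Longrightarrow> ?h t = y" unfolding constant_on_def by blast
    then have "?h 1 = ?h 0" by simp
    then have "1 / (q 0 * q 1) = 1" unfolding f using q0 by (simp only: power2_eq_square div_by_1)
    then show ?thesis by (simp only: divide_eq_1_iff)
  qed
  moreover have "\<exists>f. square_root_path p f \<and> f 0 = 1 \<and> f 1 = 1" if "q 0 * q 1 = 1"
    using q' q0 that by (intro exI[of _ "\<lambda>t. q 0 * q t"]) (simp add: power2_eq_square)
  ultimately show ?thesis unfolding winding_sign_def by (intro if_cong refl) blast
qed

locale circle_space =
  fixes S :: "'a topology" and e :: "'a \<Rightarrow> complex" and r :: "complex \<Rightarrow> 'a"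
  assumes homeomorphic: "homeomorphic_maps S circle e r"
begin

lemma cont_e: "continuous_map S circle e" and cont_r: "continuous_map circle S r"
  and r_e: "x \<in> topspace S \<Longrightarrow> r (e x) = x" and e_r: "norm z = 1 \<Longrightarrow> e (r z) = z"
  using homeomorphic by (auto simp: homeomorphic_maps_def)

lemma norm_e: "x \<in> topspace S \<Longrightarrow> norm (e x) = 1"
  using cont_e continuous_map_image_subset_topspace by fastforce

lemma r_in: "norm z = 1 \<Longrightarrow> r z \<in> topspace S"
  using cont_r continuous_map_image_subset_topspace by fastforce

lemma cont_e_euclidean: "continuous_map S euclidean e"
  using cont_e continuous_map_in_subtopology by blast

lemma continuous_map_r:
  assumes "continuous_on A f" "\<And>x. x \<in> A \<Longrightarrow> norm (f x) = 1"
  shows "continuous_map (top_of_set A) S (\<lambda>x. r (f x))"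
  using continuous_map_compose[OF _ cont_r, of "top_of_set A" f] assms
  by (auto simp: comp_def continuous_map_in_subtopology)

text \<open>Around \<open>x\<close> the open half circle centred at \<open>x\<close> is taken. Loops
  in it contract along straight segments in the plane, projected back to the circle by
  \<open>sgn\<close>.\<close>

lemma semilocally_simply_connected: "semilocally_simply_connected_space S"
  unfolding semilocally_simply_connected_space_def
proof
  fix x assume x: "x \<in> topspace S"
  define f where "f y = Re (e y * cnj (e x))" for y
  have f1: "f x = 1" using norm_e[OF x] by (simp add: f_def complex_norm_square[symmetric])
  have "continuous_map S euclideanreal ((\<lambda>z. Re (z * cnj (e x))) \<circ> e)"
    by (rule continuous_map_compose[OF cont_e_euclidean]) (auto intro!: continuous_intros)
  moreover have "(\<lambda>z. Re (z * cnj (e x))) \<circ> e = f" by (simp add: f_def fun_eq_iff)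
  ultimately have "continuous_map S euclideanreal f" by simp
  moreover have "openin euclideanreal {0<..}" by (rule open_openin[THEN iffD1, OF open_greaterThan])
  ultimately have U: "openin S {y \<in> topspace S. f y \<in> {0<..}}" by (rule openin_continuous_map_preimage)
  moreover have "homotopic_with (\<lambda>h. h 0 = x \<and> h 1 = x) (top_of_set {0..1}) S g (\<lambda>_. x)"
    if g: "pathin (subtopology S {y \<in> topspace S. f y \<in> {0<..}}) g" "g 0 = x" "g 1 = x" for g
  proof -
    have gc: "continuous_map (top_of_set {0..1}) S g"
      and "g ` {0..1} \<subseteq> {y \<in> topspace S. f y \<in> {0<..}}"
      using g(1) unfolding pathin_def continuous_map_in_subtopology by (simp_all add: image_subset_iff_funcset)
    then have gU: "g t \<in> topspace S" "f (g t) > 0" if "t \<in> {0..1}" for t using that by (simp_all add: image_subset_iff)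
    have "continuous_map (top_of_set {0..1::real}) euclidean (e \<circ> g)"
      by (rule continuous_map_compose[OF gc cont_e_euclidean])
    then have ec: "continuous_on {0..1} (\<lambda>t. e (g t))" by (simp add: comp_def)
    \<comment> \<open>The segment stays in the open half plane in direction \<open>e x\<close>, so
      it misses the origin and \<open>sgn\<close> is continuous along it.\<close>
    define k where "k u = (1 - fst u) *\<^sub>R e (g (snd u)) + fst u *\<^sub>R e x" for u :: "real \<times> real"
    have k: "k u \<noteq> 0" if u: "u \<in> {0..1} \<times> {0..1}" for u
    proof -
      have "Re (k u * cnj (e x)) = (1 - fst u) * f (g (snd u)) + fst u * f x"
        by (simp add: k_def f_def algebra_simps)
      also have "\<dots> > 0"
      proof (cases "fst u = 1")
        case False
        then have "(1 - fst u) * f (g (snd u)) > 0" using u gU[of "snd u"] by (intro mult_pos_pos) auto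
        then show ?thesis using u f1 by (intro add_pos_nonneg) auto
      qed (simp add: f1)
      finally show ?thesis by auto
    qed
    have "continuous_on ({0..1} \<times> {0..1}) (\<lambda>u. e (g (snd u)))"
      by (rule continuous_on_compose2[OF ec]) (auto intro!: continuous_intros)
    then have "continuous_on ({0..1} \<times> {0..1}) k"
      unfolding k_def by (intro continuous_intros)
    then have "continuous_map (top_of_set ({0..1} \<times> {0..1})) S (\<lambda>u. r (sgn (k u)))"
      using k by (intro continuous_map_r continuous_on_sgn) (auto simp: norm_sgn)
    moreover have "r (sgn (k (0, t))) = g t" "r (sgn (k (1, t))) = x" if "t \<in> {0..1}" for t
      using gU[OF that] x norm_e by (simp_all add: k_def sgn_div_norm r_e)
    moreover have "r (sgn (k (s, t))) = x" if "t \<in> {0, 1}" for s t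
    proof -
      have "k (s, t) = e x" using that g by (auto simp: k_def algebra_simps simp flip: scaleR_left.add)
      then show ?thesis using x norm_e by (simp add: sgn_div_norm r_e)
    qed
    ultimately show ?thesis
      by (subst homotopic_with) (auto intro!: exI[of _ "\<lambda>u. r (sgn (k u))"])
  qed
  ultimately show "\<exists>U. openin S U \<and> x \<in> U \<and> (\<forall>g. pathin (subtopology S U) g \<and> g 0 = x \<and> g 1 = x \<longrightarrow>
      homotopic_with (\<lambda>h. h 0 = x \<and> h 1 = x) (top_of_set {0..1}) S g (\<lambda>_. x))"
    using x f1 by (intro exI[of _ "{y \<in> topspace S. f y \<in> {0<..}}"]) auto
qed

abbreviation "b \<equiv> r 1"

lemma top_obj_circle: "top_obj S b"
proof -
  have "S homeomorphic_space circle" using homeomorphic by (auto simp: homeomorphic_space_def)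
  then show ?thesis
    using path_connected_circle locally_path_connected_circle semilocally_simply_connected r_in[of 1]
    by (simp add: top_obj_def homeomorphic_path_connected_space homeomorphic_locally_path_connected_space)
qed

definition segment :: "real \<Rightarrow> nat \<Rightarrow> real" where
  "segment t = (\<lambda>j. if j = 0 then 1 - t else if j = Suc 0 then t else 0)"

definition triangle :: "real \<times> real \<Rightarrow> nat \<Rightarrow> real" where
  "triangle u = (\<lambda>j. if j = 0 then 1 - fst u - snd u else if j = 1 then fst u else if j = 2 then snd u else 0)"

definition loop_sign :: "((nat \<Rightarrow> real) \<Rightarrow> 'a) \<Rightarrow> 'k::field" where
  "loop_sign \<sigma> = winding_sign (\<lambda>t. e (\<sigma> (segment t)))"

lemma segment_in: "t \<in> {0..1} \<Longrightarrow> segment t \<in> standard_simplex (Suc 0)"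
  by (auto simp: segment_def standard_simplex_1)

lemma simplex_pullback:
  assumes \<sigma>: "singular_simplex n S \<sigma>" and f: "\<And>x. x \<in> A \<Longrightarrow> f x \<in> standard_simplex n"
    and c: "\<And>j. continuous_on A (\<lambda>x. f x j)"
  shows "continuous_on A (\<lambda>x. e (\<sigma> (f x)))" "x \<in> A \<Longrightarrow> norm (e (\<sigma> (f x))) = 1"
proof -
  have "continuous_map (top_of_set A) (subtopology (powertop_real UNIV) (standard_simplex n)) f"
    using f c by (auto simp: continuous_map_in_subtopology continuous_map_componentwise_UNIV)
  moreover have s: "continuous_map (subtopology (powertop_real UNIV) (standard_simplex n)) S \<sigma>"
    using \<sigma> by (simp add: singular_simplex_def)
  ultimately have "continuous_map (top_of_set A) euclidean (e \<circ> (\<sigma> \<circ> f))"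
    using cont_e_euclidean by (intro continuous_map_compose)
  then show "continuous_on A (\<lambda>x. e (\<sigma> (f x)))" by (simp add: comp_def)
  show "norm (e (\<sigma> (f x))) = 1" if "x \<in> A"
    using f[OF that] continuous_map_image_subset_topspace[OF s] by (intro norm_e) (auto simp: topspace_standard_simplex)
qed

lemma e_b: "e b = 1"
  by (simp add: e_r)

lemma loop_sign_eq:
  assumes "\<sigma> \<in> based_simplices S b 1" "square_root_path (\<lambda>t. e (\<sigma> (segment t))) q"
  shows "loop_sign \<sigma> = (if q 0 * q 1 = 1 then 1 else -1)"
  unfolding loop_sign_def
proof (rule winding_sign_eq[OF assms(2)])
  have "segment 0 = simplex_vertex 0" by (auto simp: segment_def fun_eq_iff)
  then show "e (\<sigma> (segment 0)) = 1" using assms(1) e_b by (simp add: based_1)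
  have "continuous_on {0..1} (\<lambda>t. segment t j)" for j
    by (cases "j = 0"; cases "j = 1") (auto simp: segment_def intro!: continuous_intros)
  then have "norm (e (\<sigma> (segment t))) = 1" if "t \<in> {0..1}" for t
    using assms(1) that segment_in by (intro simplex_pullback(2)[where n = 1 and A = "{0..1}"]) (auto simp: based_1)
  then show "e (\<sigma> (segment t)) \<noteq> 0" if "t \<in> {0..1}" for t using that by force
qed

lemma loop_sign_degenerate: "\<sigma> \<in> degenerate_simplices S b 1 \<Longrightarrow> loop_sign \<sigma> = 1"
  using loop_sign_eq[of \<sigma> "\<lambda>_. 1"] segment_in e_b by (auto simp: degenerate_1 square_root_path_def)

text \<open>The triangle is contractible, so one continuous square root \<open>g\<close> exists on
  all of it and restricts to the edges. At the vertices \<open>g\<close> is 1 or -1, and the middle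
  vertex enters the product of the two signs twice.\<close>

lemma loop_sign_cocycle:
  assumes "\<tau> \<in> based_simplices S b 2"
  shows "loop_sign (edge02 \<tau>) = loop_sign (edge01 \<tau>) * loop_sign (edge12 \<tau>)"
proof -
  note \<tau> = assms[unfolded based_2]
  define T where "T = {u::real \<times> real. 0 \<le> fst u \<and> 0 \<le> snd u \<and> fst u + snd u \<le> 1}"
  have T: "triangle u \<in> standard_simplex 2" if "u \<in> T" for u
    using that by (auto simp: triangle_def standard_simplex_2 T_def numeral_2_eq_2)
  have "continuous_on T (\<lambda>u. triangle u j)" for j
    by (cases "j = 0"; cases "j = 1"; cases "j = 2") (auto simp: triangle_def intro!: continuous_intros)
  note F = simplex_pullback[OF conjunct1[OF \<tau>] T this]
  have "convex T"
  proof (rule convexI)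
    fix x y and u v :: real assume "x \<in> T" "y \<in> T" "0 \<le> u" "0 \<le> v" "u + v = 1"
    moreover from this have "u * (fst x + snd x) + v * (fst y + snd y) \<le> 1"
      by (intro convex_bound_le) (auto simp: T_def)
    ultimately show "u *\<^sub>R x + v *\<^sub>R y \<in> T" by (simp add: T_def algebra_simps)
  qed
  then have "contractible T" by (rule convex_imp_contractible)
  moreover have "e (\<tau> (triangle u)) \<noteq> 0" if "u \<in> T" for u using F(2)[OF _ that] by force
  ultimately obtain g where g: "continuous_on T g" "\<And>u. u \<in> T \<Longrightarrow> e (\<tau> (triangle u)) = (g u)\<^sup>2"
    using continuous_sqrt_on_contractible[OF F(1)] by blast
  have root: "square_root_path (\<lambda>t. e (\<sigma> (segment t))) (\<lambda>t. g (f t))"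
    if "continuous_on {0..1} f" "\<And>t. t \<in> {0..1} \<Longrightarrow> f t \<in> T \<and> \<sigma> (segment t) = \<tau> (triangle (f t))" for f \<sigma>
    using that g(2) continuous_on_compose2[OF g(1) that(1)] by (auto simp: square_root_path_def image_subset_iff)
  have "square_root_path (\<lambda>t. e (edge01 \<tau> (segment t))) (\<lambda>t. g (t, 0))"
  proof (rule root)
    fix t :: real assume t: "t \<in> {0..1}"
    have "segment t = triangle (t, 0)" by (auto simp: segment_def triangle_def)
    then show "(t, 0) \<in> T \<and> edge01 \<tau> (segment t) = \<tau> (triangle (t, 0))"
      using t segment_in[OF t] by (auto simp: edge01_def T_def)
  qed (auto intro!: continuous_intros)
  moreover have "square_root_path (\<lambda>t. e (edge12 \<tau> (segment t))) (\<lambda>t. g (1 - t, t))"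
  proof (rule root)
    fix t :: real assume t: "t \<in> {0..1}"
    have "(\<lambda>j. if j = 0 then 0 else segment t (j - Suc 0)) = triangle (1 - t, t)"
      by (auto simp: segment_def triangle_def fun_eq_iff)
    then show "(1 - t, t) \<in> T \<and> edge12 \<tau> (segment t) = \<tau> (triangle (1 - t, t))"
      using t segment_in[OF t] by (auto simp: edge12_def T_def)
  qed (auto intro!: continuous_intros)
  moreover have "square_root_path (\<lambda>t. e (edge02 \<tau> (segment t))) (\<lambda>t. g (0, t))"
  proof (rule root)
    fix t :: real assume t: "t \<in> {0..1}"
    have "(\<lambda>j. if j = 0 then segment t 0 else if j = 2 then segment t (Suc 0) else 0) = triangle (0, t)"
      by (auto simp: segment_def triangle_def fun_eq_iff)
    then show "(0, t) \<in> T \<and> edge02 \<tau> (segment t) = \<tau> (triangle (0, t))"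
      using t segment_in[OF t] by (auto simp: edge02_def T_def)
  qed (auto intro!: continuous_intros)
  ultimately have signs: "loop_sign (edge01 \<tau>) = (if g (0, 0) * g (1, 0) = 1 then 1 else -1)"
    "loop_sign (edge12 \<tau>) = (if g (1, 0) * g (0, 1) = 1 then 1 else -1)"
    "loop_sign (edge02 \<tau>) = (if g (0, 0) * g (0, 1) = 1 then 1 else -1)"
    using based_edges[OF assms] loop_sign_eq by fastforce+
  have "triangle (0, 0) = simplex_vertex 0" "triangle (1, 0) = simplex_vertex 1" "triangle (0, 1) = simplex_vertex 2"
    by (auto simp: triangle_def fun_eq_iff)
  moreover have "(0, 0) \<in> T" "(1, 0) \<in> T" "(0, 1) \<in> T" by (simp_all add: T_def)
  ultimately have "(g (0, 0))\<^sup>2 = 1" "(g (1, 0))\<^sup>2 = 1" "(g (0, 1))\<^sup>2 = 1"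
    using \<tau> e_b g(2) by metis+
  then show ?thesis unfolding signs by (auto simp: power2_eq_1_iff)
qed

text \<open>The map depends only on the middle barycentric coordinate. It runs once around the
  circle along edge 01, back along edge 12, and is constant along edge 02.\<close>

definition generator_homotopy :: "(nat \<Rightarrow> real) \<Rightarrow> 'a" where
  "generator_homotopy = restrict (\<lambda>x. r (cis (2 * pi * x 1))) (standard_simplex 2)"

lemma generator_homotopy_based: "generator_homotopy \<in> based_simplices S b 2"
proof -
  have "continuous_map (powertop_real UNIV) euclidean ((\<lambda>t. cis (2 * pi * t)) \<circ> (\<lambda>x. x 1))"
    by (rule continuous_map_compose[OF continuous_map_coord]) (auto intro!: continuous_intros)
  then have "continuous_map (subtopology (powertop_real UNIV) (standard_simplex 2)) circle (\<lambda>x. cis (2 * pi * x 1))"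
    unfolding continuous_map_in_subtopology comp_def by (auto intro: continuous_map_from_subtopology simp del: One_nat_def)
  from continuous_map_compose[OF this cont_r]
  have "continuous_map (subtopology (powertop_real UNIV) (standard_simplex 2)) S generator_homotopy"
    by (rule continuous_map_eq) (auto simp: generator_homotopy_def)
  moreover have "simplex_vertex 0 \<in> standard_simplex 2" "simplex_vertex 1 \<in> standard_simplex 2" "simplex_vertex 2 \<in> standard_simplex 2"
    by (auto simp: standard_simplex_2 numeral_2_eq_2)
  ultimately show ?thesis
    by (simp add: based_2 singular_simplex_def) (simp add: generator_homotopy_def)
qed

lemma edge02_generator: "edge02 generator_homotopy \<in> degenerate_simplices S b 1"
proof -
  have "(\<lambda>j. if j = 0 then x 0 else if j = 2 then x (Suc 0) else 0) \<in> standard_simplex 2"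
    if "x \<in> standard_simplex (Suc 0)" for x :: "nat \<Rightarrow> real"
    using that by (auto simp: standard_simplex_1 standard_simplex_2 numeral_2_eq_2)
  then show ?thesis
    using based_edges(3)[OF generator_homotopy_based] by (auto simp: degenerate_1 edge02_def generator_homotopy_def)
qed

text \<open>Halving the angle gives the root \<open>cis (pi * t)\<close>, which starts at 1 and ends
  at -1.\<close>

lemma loop_sign_generator: "loop_sign (edge01 generator_homotopy) = -1"
proof -
  have "square_root_path (\<lambda>t. e (edge01 generator_homotopy (segment t))) (\<lambda>t. cis (pi * t))"
    unfolding square_root_path_def
  proof (intro conjI ballI)
    fix t :: real assume t: "t \<in> {0..1}"
    have "segment t \<in> standard_simplex 2"
      using t by (auto simp: segment_def standard_simplex_2 numeral_2_eq_2)
    then have "edge01 generator_homotopy (segment t) = r (cis (2 * pi * t))"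
      using segment_in[OF t] by (simp add: edge01_def generator_homotopy_def) (simp add: segment_def)
    then show "(cis (pi * t))\<^sup>2 = e (edge01 generator_homotopy (segment t))"
      by (simp add: e_r power2_eq_square cis_mult mult.assoc)
  qed (auto intro!: continuous_intros)
  from loop_sign_eq[OF based_edges(1)[OF generator_homotopy_based] this] show ?thesis by simp
qed

lemma separated_unit_circle:
  assumes "dg_coalgebra (singular_chains S b :: ('k::field_char_0, _) dgc)"
  shows "separated_unit (singular_chains S b :: ('k, _) dgc)"
proof -
  have "based_chains TYPE('k) S b" using assms by (simp add: based_chains_def dg_coalgebra_augmented)
  then show ?thesis
  proof (rule based_chains.separated_unit_loop)
    show "loop_sign (edge01 generator_homotopy) \<noteq> (1::'k)" by (simp add: loop_sign_generator)
  qed (simp_all add: loop_sign_cocycle loop_sign_degenerate generator_homotopy_based edge02_generator)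
qed

end

text \<open>An injection of the reals into \<open>'a\<close> supplies enough points for a copy of
  the circle, and the contradiction arises at this one object.\<close>

theorem theorem22:
  fixes embed :: "real \<Rightarrow> 'a"
  assumes "inj embed"
  shows "\<not> (\<exists>(F :: 'a topology \<Rightarrow> 'a \<Rightarrow> ('k::field_char_0, 'v) dgc) Fm.
            top_cdgc_functor F Fm \<and>
            (\<forall>S b. top_obj S b \<longrightarrow>
              (\<exists>Ds :: ('k, 'w) dgc list. omega_zigzag (F S b) Ds (singular_chains S b))))"
proof
  assume "\<exists>(F :: 'a topology \<Rightarrow> 'a \<Rightarrow> ('k, 'v) dgc) Fm.
            top_cdgc_functor F Fm \<and>
            (\<forall>S b. top_obj S b \<longrightarrow>
              (\<exists>Ds :: ('k, 'w) dgc list. omega_zigzag (F S b) Ds (singular_chains S b)))"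
  then obtain F :: "'a topology \<Rightarrow> 'a \<Rightarrow> ('k, 'v) dgc" and Fm where F: "top_cdgc_functor F Fm"
    and z: "\<And>S b. top_obj S b \<Longrightarrow> \<exists>Ds :: ('k, 'w) dgc list. omega_zigzag (F S b) Ds (singular_chains S b)"
    by blast
  \<comment> \<open>A point of the unit circle is encoded by its angle in the half-open interval
    from 0 to \<open>2 * pi\<close>.\<close>
  have "inj_on (embed \<circ> Arg2pi) (sphere 0 1)"
  proof (rule comp_inj_on[OF inj_onI])
    fix z w assume "z \<in> sphere 0 1" "w \<in> sphere 0 1" "Arg2pi z = Arg2pi w"
    then show "z = w" using Arg2pi_eq[of z] Arg2pi_eq[of w] by simp
  qed (use assms in \<open>auto intro: inj_on_subset\<close>)
  then have "inj_on (embed \<circ> Arg2pi) (topspace circle)" by simp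
  then obtain S e where "homeomorphic_maps S circle e (embed \<circ> Arg2pi)" by (rule homeomorphic_copy)
  then interpret circle_space S e "embed \<circ> Arg2pi" by unfold_locales
  let ?b = "(embed \<circ> Arg2pi) 1"
  obtain Ds :: "('k, 'w) dgc list" where Ds: "omega_zigzag (F S ?b) Ds (singular_chains S ?b)"
    using z[OF top_obj_circle] by blast
  \<comment> \<open>The last leg of the zig-zag ends at the singular chains, and an
    \<Omega>-quasi-isomorphism has dg coalgebras as source and target.\<close>
  then have "dg_coalgebra (singular_chains S ?b :: ('k, _) dgc)"
    by (auto simp: omega_zigzag_def omega_leg_def omega_quasi_iso_def)
  then have "separated_unit (singular_chains S ?b :: ('k, _) dgc)" by (rule separated_unit_circle)
  then have "separated_unit (F S ?b)" using separated_unit_omega_zigzag[OF Ds] by simp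
  moreover have "augmented_dgc (F S ?b)" "cocommutative (F S ?b)"
    using F top_obj_circle by (auto simp: top_cdgc_functor_def dg_coalgebra_augmented)
  ultimately show False using cocommutative_no_separated_unit by blast
qed

end
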